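(* For every integer $n\ge 2$, the remainder polynomial $R_{(n,2)}(x)$ is irreducible in $\mathbb{Z}[x]$.
   Context: $\mathrm{He}_k(x)$ denotes the monic probabilists' Hermite polynomial of degree $k$ (solution of $y''-xy'+ky=0$). A partition $\lambda=(\lambda_1\ge\dots\ge\lambda_r\ge 0)$ may have zero parts; its degree sequence is $n_\lambda=(\lambda_r,\lambda_{r-1}+1,\dots,\lambda_1+r-1)$, and $\Delta(x_1,\dots,x_r)=\prod_{i<j}(x_j-x_i)$. The Wronskian Hermite polynomial is $\mathrm{He}_\lambda(x)=\mathrm{Wr}[\mathrm{He}_{n_1},\dots,\mathrm{He}_{n_r}]/\Delta(n_\lambda)$ with $n_\lambda=(n_1,\dots,n_r)$; it is monic of degree $|\lambda|$ with integer coefficients. Removing a $2$-hook means replacing an entry $a$ of $n_\lambda$ by $a-2\ge 0$ with $a-2\notin n_\lambda$; removing $2$-hooks until impossible yields the $2$-core $\bar\lambda$, a staircase $(m,m-1,\dots,1)$ padded with zeros, with $|\bar\lambda|=\binom{m+1}2$. Then $\mathrm{He}_\lambda(x)=x^{|\bar\lambda|}R_\lambda(x)$ with $R_\lambda\in\mathbb{Z}[x]$, $R_\lambda(0)\neq0$ (the remainder polynomial). *)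

theory Defs
  imports "HOL-Computational_Algebra.Polynomial" "HOL-Computational_Algebra.Factorial_Ring"
    "Jordan_Normal_Form.Determinant"
begin

fun hermite :: "nat \<Rightarrow> int poly" where
  "hermite 0 = 1"
| "hermite (Suc 0) = [:0, 1:]"
| "hermite (Suc (Suc k)) = [:0, 1:] * hermite (Suc k) - smult (int (Suc k)) (hermite k)"

definition wronskian :: "int poly list \<Rightarrow> int poly" where
  "wronskian fs = det (mat (length fs) (length fs) (\<lambda>(i, j). (pderiv ^^ i) (fs ! j)))"

(* A partition is a list lam = [lam_1, ..., lam_r], weakly decreasing (zero parts allowed).
   Degree sequence n_lam = (lam_r, lam_{r-1}+1, ..., lam_1 + r - 1). *)
definition degseq :: "nat list \<Rightarrow> nat list" where
  "degseq lam = map (\<lambda>i. lam ! (length lam - 1 - i) + i) [0..<length lam]"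

definition vandermonde :: "nat list \<Rightarrow> int" where
  "vandermonde ns = (\<Prod>j<length ns. \<Prod>i<j. int (ns ! j) - int (ns ! i))"

(* Wronskian Hermite polynomial He_lam = Wr[He_{n_1},...,He_{n_r}] / Delta(n_lam)
   (the division is exact; it is performed coefficientwise) *)
definition wronskian_hermite :: "nat list \<Rightarrow> int poly" where
  "wronskian_hermite lam =
     map_poly (\<lambda>c. c div vandermonde (degseq lam)) (wronskian (map hermite (degseq lam)))"

(* Removing a 2-hook from a degree sequence (viewed as a finite set of naturals) *)
definition remove_2hook :: "nat set \<Rightarrow> nat set \<Rightarrow> bool" where
  "remove_2hook S T \<longleftrightarrow> (\<exists>a\<in>S. 2 \<le> a \<and> a - 2 \<notin> S \<and> T = insert (a - 2) (S - {a}))"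

(* size |mu| of the partition with degree set T: sum of entries minus binom(r,2) *)
definition size_of_degset :: "nat set \<Rightarrow> nat" where
  "size_of_degset T = \<Sum>T - card T * (card T - 1) div 2"

definition core2_size :: "nat list \<Rightarrow> nat" where
  "core2_size lam = (THE m. \<exists>T. remove_2hook\<^sup>*\<^sup>* (set (degseq lam)) T
                                \<and> \<not> (\<exists>T'. remove_2hook T T') \<and> m = size_of_degset T)"

(* Remainder polynomial: He_lam = x^{|core|} * R_lam *)
definition remainder_poly :: "nat list \<Rightarrow> int poly" where
  "remainder_poly lam = wronskian_hermite lam div monom 1 (core2_size lam)"

end

theory Submission
  imports Defs "HOL-Computational_Algebra.Computational_Algebra" "HOL-Analysis.Complex_Transcendental" "HOL-Analysis.Convex"
begin

text \<open>
  The coefficients of \<open>R\<close> are explicit: up to sign and a small bracket, the coefficient of \<open>x^(2i)\<close> is a quotient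
  of double factorials. For an odd prime \<open>p\<close> Legendre's formula therefore bounds the slopes of the \<open>p\<close>-adic
  Newton polygon of \<open>R\<close> by about \<open>1/p\<close>, so a factor of degree \<open>d \<le> p\<close> has constant term prime to \<open>p\<close>. If moreover
  \<open>p\<close> divides the coefficients of \<open>R\<close> up to degree \<open>deg R - d\<close>, then the cofactor vanishes modulo \<open>p\<close>, which is
  absurd. Such a prime only has to divide \<open>n + 1\<close> or one of the about \<open>d/2\<close> largest odd numbers entering the
  double factorials. A Sylvester type theorem (Erdos' removal argument, sharpened by sieving modulo 210 and by Chebyshev
  bounds) supplies it when \<open>d\<close> is large; for small \<open>d\<close> the absence of such a prime makes all these numbers smooth
  and leads to exponential Diophantine equations, solved by congruences.
  Three families escape: \<open>n + 1\<close> a power of 3 with \<open>d = 4\<close> (\<open>n\<close> even), \<open>n + 1\<close> a power of 2 with \<open>d \<le> 2\<close>,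
  and \<open>n = 15\<close> with \<open>d = 4\<close>. They are excluded by comparing the lower and upper 3-adic slopes, respectively by
  reducing modulo a prime factor of \<open>n - 2\<close>, where \<open>R\<close> becomes a power of \<open>x\<close> times \<open>x^4 + 3\<close>.
\<close>

section \<open>Valuations of double factorials\<close>

text \<open>The parities differ in what the prime must satisfy. For even n the denominator at x^(2i)
  is (2i-1)!!, with valuation below 2i/p, so p \<ge> d is enough; but the Vandermonde factor n - 1
  cancels one number of the list n + 1, n - 1, n - 3, ..., which leaves a gap after the first entry.
  For odd n the denominator is (2i+1)!!, its valuation is only at most 2i/(p-1), and p \<ge> d + 2
  is needed; an odd prime dividing n + 1 may be as small as d + 1, because it also divides most of
  the brackets. The exceptional families are those where the list is too short: for even n and d = 4
  only n + 1 is left, possibly a power of 3; for odd n and d \<le> 2 only n + 1 is left, possibly a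
  power of 2; for n = 15 and d = 4 only 15 and 16 are left, and their primes are too small. Short
  lists are treated by counting: a prime p \<ge> 5 divides at most one of five consecutive odd
  numbers, so smooth terms are nearly prime powers.\<close>

lemma prime_elem_multiplicity_prod:
  fixes f :: "'b \<Rightarrow> nat"
  assumes "prime p" "finite A" "\<And>x. x \<in> A \<Longrightarrow> f x \<noteq> 0"
  shows "multiplicity p (prod f A) = (\<Sum>x\<in>A. multiplicity p (f x))"
  using assms(2,3)
proof (induction A rule: finite_induct)
  case (insert x A)
  then show ?case
    using assms(1) by (simp add: prime_elem_multiplicity_mult_distrib)
qed simp

text \<open>The multiples of \<open>p\<close> up to \<open>n\<close> are \<open>p\<close> times
  \<open>1, ..., n div p\<close>. This one-step recursion is the form of Legendre's formula on which
  the inductions below run.\<close>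

lemma multiplicity_fact_rec:
  fixes p :: nat
  assumes "prime p"
  shows "multiplicity p (fact n) = n div p + multiplicity p (fact (n div p))"
proof (induction n)
  case (Suc n)
  have p: "p > 1" using assms prime_gt_1_nat by blast
  have split: "multiplicity p (fact (Suc n)) = multiplicity p (Suc n) + multiplicity p (fact n)"
    using assms by (simp add: prime_elem_multiplicity_mult_distrib del: mult_Suc)
  show ?case
  proof (cases "p dvd Suc n")
    case False
    then have "Suc n div p = n div p"
      by (simp add: div_Suc dvd_eq_mod_eq_0)
    moreover have "multiplicity p (Suc n) = 0"
      using False by (rule not_dvd_imp_multiplicity_0)
    ultimately show ?thesis using split Suc by simp
  next
    case True
    then obtain m where m: "Suc n = p * m" by blast
    then obtain m' where m': "m = Suc m'" by (cases m) auto
    have "multiplicity p (p * m) = Suc (multiplicity p m)"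
      using p m by (intro multiplicity_times_same) (auto simp: m')
    moreover have "n div p = m'"
    proof -
      have "n = (p - 1) + m' * p" using m m' p by (simp add: algebra_simps)
      then have "n div p = m' + (p - 1) div p" using p by (simp only: div_mult_self1)
      then show ?thesis using p by simp
    qed
    moreover have "multiplicity p (fact m) = multiplicity p m + multiplicity p (fact m')"
      using assms m' by (simp add: prime_elem_multiplicity_mult_distrib del: mult_Suc)
    ultimately show ?thesis using split Suc m m' p by simp
  qed
qed simp

lemma legendre_formula:
  fixes p :: nat
  assumes "prime p" "n < p ^ T"
  shows "multiplicity p (fact n) = (\<Sum>t=1..T. n div p ^ t)"
  using assms(2)
proof (induction T arbitrary: n)
  case (Suc T)
  have p: "p > 0" using assms(1) prime_gt_0_nat by blast
  have "n div p < p ^ T" using Suc.prems p by (simp add: less_mult_imp_div_less mult.commute)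
  then have "multiplicity p (fact n) = n div p + (\<Sum>t=1..T. n div p div p ^ t)"
    using multiplicity_fact_rec[OF assms(1), of n] Suc.IH by simp
  also have "(\<Sum>t=1..T. n div p div p ^ t) = (\<Sum>t=Suc 1..Suc T. n div p ^ t)"
    unfolding sum.atLeast_Suc_atMost_Suc_shift by (simp add: div_mult2_eq)
  also have "n div p + \<dots> = (\<Sum>t=1..Suc T. n div p ^ t)"
    using sum.atLeast_Suc_atMost[of 1 "Suc T" "\<lambda>t. n div p ^ t"] by simp
  finally show ?case .
qed simp

text \<open>By Legendre the left side is \<open>n\<close> minus the digit sum of \<open>n\<close> in
  base \<open>p\<close>, and that sum is at least 1. The induction avoids digits by descending to
  \<open>n div p\<close>.\<close>

lemma multiplicity_fact_le:
  fixes p :: nat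
  assumes "prime p" "n > 0"
  shows "(p - 1) * multiplicity p (fact n) \<le> n - 1"
  using assms(2)
proof (induction n rule: less_induct)
  case (less n)
  have p: "p > 1" using assms prime_gt_1_nat by blast
  show ?case
  proof (cases "n div p = 0")
    case True
    then show ?thesis using multiplicity_fact_rec[OF assms(1), of n] by simp
  next
    case False
    define m where "m = n div p"
    have m: "m > 0" "m < n" using False p less.prems unfolding m_def by auto
    have IH: "(p - 1) * multiplicity p (fact m) \<le> m - 1"
      using less.IH m by auto
    have "(p - 1) * multiplicity p (fact n) = (p - 1) * m + (p - 1) * multiplicity p (fact m)"
      using multiplicity_fact_rec[OF assms(1), of n] by (simp add: m_def algebra_simps)
    also have "\<dots> \<le> (p - 1) * m + (m - 1)" using IH by simp
    also have "\<dots> = p * m - 1" using m p by (cases p) (auto simp: algebra_simps)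
    also have "\<dots> \<le> n - 1" unfolding m_def by (intro diff_le_mono) simp
    finally show ?thesis .
  qed
qed

text \<open>The double factorial \<open>(2i - 1)!!\<close>, indexed by its number of
  factors.\<close>

definition odd_fact :: "nat \<Rightarrow> nat" where
  "odd_fact i = (\<Prod>l<i. 2 * l + 1)"

lemma odd_fact_0 [simp]: "odd_fact 0 = 1" and
  odd_fact_Suc [simp]: "odd_fact (Suc i) = (2 * i + 1) * odd_fact i"
  by (simp_all add: odd_fact_def mult.commute)

lemma odd_fact_pos [simp]: "odd_fact i > 0"
  by (simp add: odd_fact_def)

lemma odd_fact_nonzero [simp]: "odd_fact i \<noteq> 0"
  using odd_fact_pos[of i] by linarith

lemma fact_double: "fact (2 * i) = odd_fact i * 2 ^ i * (fact i :: nat)"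
proof (induction i)
  case (Suc i)
  have "fact (2 * Suc i) = (2 * i + 2) * ((2 * i + 1) * (fact (2 * i) :: nat))"
    by (simp add: algebra_simps)
  then show ?case using Suc by (simp add: algebra_simps)
qed simp

lemma multiplicity_fact_double:
  assumes "prime p" "odd p"
  shows "multiplicity p (fact (2 * i)) = multiplicity p (odd_fact i) + multiplicity p (fact i :: nat)"
proof -
  have "multiplicity p (2 ^ i :: nat) = 0"
    using assms by (intro not_dvd_imp_multiplicity_0) (metis prime_dvd_power primes_dvd_imp_eq two_is_prime_nat dvd_refl)
  then show ?thesis
    unfolding fact_double using assms(1) by (simp add: prime_elem_multiplicity_mult_distrib)
qed

text \<open>The even factors of \<open>(2i + 1)!\<close> multiply to \<open>2^i * i!\<close>.
  Keeping the subtracted \<open>i!\<close> is what later yields a strict bound when \<open>p\<close>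
  divides \<open>i\<close>.\<close>

lemma multiplicity_odd_fact_le_fact:
  assumes "prime p" "odd p"
  shows "multiplicity p (odd_fact (Suc i)) \<le> multiplicity p (fact (2 * i + 1)) - multiplicity p (fact i :: nat)"
proof -
  have "fact (2 * i + 1) = odd_fact (Suc i) * 2 ^ i * (fact i :: nat)"
    using fact_double[of i] by (simp add: algebra_simps)
  moreover have "multiplicity p (2 ^ i :: nat) = 0"
    using assms by (intro not_dvd_imp_multiplicity_0) (metis prime_dvd_power primes_dvd_imp_eq two_is_prime_nat dvd_refl)
  ultimately show ?thesis
    using assms(1) by (simp add: prime_elem_multiplicity_mult_distrib del: fact_Suc odd_fact_Suc)
qed

text \<open>The slope bound for even \<open>n\<close>. The odd multiples of \<open>p\<close> below
  \<open>2i\<close> are \<open>p\<close> times \<open>1, 3, ..., 2m - 1\<close>, so the valuation is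
  \<open>m\<close> plus that of \<open>odd_fact m\<close>, where \<open>p * (2m - 1) < 2i\<close>;
  the second part is zero or controlled by induction.\<close>

lemma multiplicity_odd_fact_less:
  fixes p :: nat
  assumes "prime p" "odd p" "i > 0"
  shows "p * multiplicity p (odd_fact i) < 2 * i"
  using assms(3)
proof (induction i rule: less_induct)
  case (less i)
  have p: "p \<ge> 3" using assms prime_ge_2_nat[of p] by (cases "p = 2") auto
  define w where "w = i div p"
  define u where "u = 2 * i div p"
  have f: "multiplicity p (odd_fact j) + multiplicity p (fact j) = multiplicity p (fact (2 * j))" for j
    using multiplicity_fact_double[OF assms(1,2), of j] by simp
  have r: "multiplicity p (fact j) = j div p + multiplicity p (fact (j div p))" for j
    by (rule multiplicity_fact_rec[OF assms(1)])
  have i_w: "w * p \<le> i" "i < w * p + p"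
    using p div_mult_mod_eq[of i p] mod_less_divisor[of p i] unfolding w_def by linarith+
  have i_u: "u * p \<le> 2 * i" "2 * i < u * p + p"
    using p div_mult_mod_eq[of "2 * i" p] mod_less_divisor[of p "2 * i"] unfolding u_def by linarith+
  have u_cases: "u = 2 * w \<or> u = 2 * w + 1"
  proof -
    have "2 * w * p < (u + 1) * p" using i_w i_u by (simp add: algebra_simps)
    then have "2 * w < u + 1" using p by (metis mult_less_cancel2)
    moreover have "u * p < (2 * w + 2) * p" using i_w i_u by (simp add: algebra_simps)
    then have "u < 2 * w + 2" by (metis mult_less_cancel2)
    ultimately show ?thesis by linarith
  qed
  \<comment> \<open>\<open>m\<close> counts the odd multiples of \<open>p\<close> below
    \<open>2i\<close>: it is \<open>w\<close> if \<open>2i div p = 2w\<close>, and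
    \<open>w + 1\<close> if \<open>2i div p = 2w + 1\<close>.\<close>
  have step: "\<exists>m. multiplicity p (odd_fact i) = m + multiplicity p (odd_fact m) \<and> (m > 0 \<longrightarrow> p * (2 * m - 1) < 2 * i)"
    using u_cases
  proof
    assume u: "u = 2 * w"
    have "multiplicity p (odd_fact i) = w + multiplicity p (odd_fact w)"
      using f[of i] f[of w] r[of i] r[of "2 * i"] u unfolding u_def[symmetric] w_def[symmetric] by simp
    moreover have "w > 0 \<longrightarrow> p * (2 * w - 1) < 2 * i"
    proof
      assume w: "w > 0"
      then have "p * (2 * w - 1) < p * (2 * w)" using p by simp
      then show "p * (2 * w - 1) < 2 * i" using i_w by (simp add: algebra_simps)
    qed
    ultimately show ?thesis by blast
  next
    assume u: "u = 2 * w + 1"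
    have "multiplicity p (fact (2 * Suc w)) = multiplicity p (2 * Suc w) + multiplicity p (fact u)"
    proof -
      have e: "2 * Suc w = Suc u" using u by simp
      show ?thesis unfolding e
        using assms(1) by (simp add: prime_elem_multiplicity_mult_distrib del: mult_Suc)
    qed
    moreover have "multiplicity p (2 * Suc w) = multiplicity p (Suc w)"
    proof -
      have "multiplicity p (2::nat) = 0" using p by (intro not_dvd_imp_multiplicity_0) (auto dest: dvd_imp_le)
      then show ?thesis using assms(1) by (simp add: prime_elem_multiplicity_mult_distrib del: mult_Suc mult_Suc_right)
    qed
    moreover have "multiplicity p (fact (Suc w)) = multiplicity p (Suc w) + multiplicity p (fact w)"
      using assms(1) by (simp add: prime_elem_multiplicity_mult_distrib del: mult_Suc)
    ultimately have "multiplicity p (odd_fact i) = Suc w + multiplicity p (odd_fact (Suc w))"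
      using f[of i] f[of "Suc w"] r[of i] r[of "2 * i"] u unfolding u_def[symmetric] w_def[symmetric] by linarith
    moreover have "p * (2 * Suc w - 1) < 2 * i"
    proof -
      have "p * (2 * Suc w - 1) = u * p" using u by (simp add: algebra_simps)
      moreover have "u * p \<noteq> 2 * i"
        using assms(2) u by (metis even_mult_iff odd_one even_add dvd_triv_left)
      ultimately show ?thesis using i_u by linarith
    qed
    ultimately show ?thesis by blast
  qed
  then obtain m where m: "multiplicity p (odd_fact i) = m + multiplicity p (odd_fact m)"
    "m > 0 \<Longrightarrow> p * (2 * m - 1) < 2 * i" by blast
  show ?case
  proof (cases "m = 0")
    case True
    then show ?thesis using m less.prems by simp
  next
    case False
    have mi: "p * (2 * m - 1) < 2 * i" using m False by blast
    have "p * m \<le> p * (2 * m - 1)" using False by (intro mult_le_mono2) linarith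
    show ?thesis
    proof (cases "multiplicity p (odd_fact m) = 0")
      case True
      then show ?thesis using m(1) order.strict_trans1[OF \<open>p * m \<le> _\<close> mi] by simp
    next
      case nz: False
      have "3 * m \<le> p * m" using p by simp
      then have "m < i" using mi \<open>p * m \<le> _\<close> False by linarith
      then have IH: "p * multiplicity p (odd_fact m) < 2 * m" using less.IH False by blast
      then have "p * 1 < 2 * m" using nz
        by (metis Suc_leI le_less_trans mult_le_mono2 not_gr_zero One_nat_def)
      have "p * multiplicity p (odd_fact i) < p * m + 2 * m"
        using m IH by (simp add: algebra_simps)
      \<comment> \<open>The right side minus the left side is \<open>(p - 2) * (m - 1) - 1\<close>,
        and here \<open>p \<ge> 3\<close> and \<open>m \<ge> 2\<close>.\<close>
      also have "\<dots> \<le> p * (2 * m - 1) + 1"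
      proof -
        have "(p - 2) * (m - 2) \<ge> (p - 2) * 1 \<or> m = 2"
          using \<open>p * 1 < 2 * m\<close> p by (cases "m \<ge> 3") auto
        moreover obtain q where "p = q + 3" using p by (metis add.commute le_iff_add)
        moreover have "2 \<le> m" using \<open>p * 1 < 2 * m\<close> p by linarith
        then obtain l where "m = l + 2" by (metis add.commute le_iff_add)
        ultimately show ?thesis using \<open>p * 1 < 2 * m\<close> by (auto simp: algebra_simps)
      qed
      finally show ?thesis using mi by linarith
    qed
  qed
qed

section \<open>Large prime factors of odd numbers in short progressions\<close>

lemma prod_nat_dvd_fact:
  assumes "A \<subseteq> {1..n}"
  shows "\<Prod>A dvd (fact n :: nat)"
proof -
  have "\<Prod>A dvd \<Prod>{1..n}" using assms by (intro prod_dvd_prod_subset) auto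
  then show ?thesis by (simp add: fact_prod)
qed

text \<open>A power of \<open>p\<close> dividing both terms divides their difference, twice the
  distance of the indices; the factor 2 drops out because \<open>p\<close> is odd.\<close>

lemma multiplicity_term_le:
  fixes p y :: nat
  assumes "prime p" "odd p" "j \<noteq> j0" "y > 0"
    "multiplicity p (y + 2 * j) \<le> multiplicity p (y + 2 * j0)"
  shows "multiplicity p (y + 2 * j) \<le> multiplicity p (if j < j0 then j0 - j else j - j0)"
proof -
  define v where "v = multiplicity p (y + 2 * j)"
  define \<delta> where "\<delta> = (if j < j0 then j0 - j else j - j0)"
  have "p ^ v dvd y + 2 * j" "p ^ v dvd y + 2 * j0"
    unfolding v_def using assms(5) by (auto intro: multiplicity_dvd multiplicity_dvd')
  then have "p ^ v dvd 2 * \<delta>"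
    using dvd_diff_nat[of "p ^ v" "y + 2 * j" "y + 2 * j0"] dvd_diff_nat[of "p ^ v" "y + 2 * j0" "y + 2 * j"]
    by (cases "j < j0") (simp_all add: \<delta>_def diff_mult_distrib2)
  moreover have "coprime (p ^ v) 2"
    using assms(1,2) by (simp add: coprime_power_left_iff)
  ultimately have "p ^ v dvd \<delta>"
    by (simp add: coprime_dvd_mult_right_iff)
  moreover have "\<delta> \<noteq> 0" using assms(3) by (auto simp: \<delta>_def)
  ultimately show ?thesis
    unfolding v_def[symmetric] \<delta>_def[symmetric] using assms(1)
    by (intro multiplicity_geI) (auto simp: prime_gt_1_nat not_prime_unit)
qed

text \<open>The distances to the term \<open>j0\<close> of highest valuation are distinct numbers up
  to \<open>j0\<close> on its left and up to \<open>K - 1 - j0\<close> on its right, and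
  \<open>j0! * (K - 1 - j0)!\<close> divides \<open>(K - 1)!\<close>.\<close>

lemma sum_multiplicity_others_le:
  fixes p y :: nat
  assumes p: "prime p" "odd p" and J: "J \<subseteq> {..<K}" "j0 \<in> J" and y: "y > 0"
    and max: "\<And>j. j \<in> J \<Longrightarrow> multiplicity p (y + 2 * j) \<le> multiplicity p (y + 2 * j0)"
  shows "(\<Sum>j\<in>J - {j0}. multiplicity p (y + 2 * j)) \<le> multiplicity p (fact (K - 1) :: nat)"
proof -
  have fin: "finite J" using J finite_subset by blast
  define L where "L = {j\<in>J. j < j0}"
  define R where "R = {j\<in>J. j0 < j}"
  have split: "J - {j0} = L \<union> R" "L \<inter> R = {}" "finite L" "finite R"
    using fin unfolding L_def R_def by auto
  have imL: "(\<lambda>j. j0 - j) ` L \<subseteq> {1..j0}" and injL: "inj_on (\<lambda>j. j0 - j) L"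
    unfolding L_def by (auto simp: inj_on_def)
  have imR: "(\<lambda>j. j - j0) ` R \<subseteq> {1..K - 1 - j0}" and injR: "inj_on (\<lambda>j. j - j0) R"
  proof -
    have "j - j0 \<in> {1..K - 1 - j0}" if "j \<in> R" for j
    proof -
      have "j < K" "j0 < j" using that J unfolding R_def by auto
      then have "1 \<le> j - j0" "j - j0 \<le> K - 1 - j0" by linarith+
      then show ?thesis by simp
    qed
    then show "(\<lambda>j. j - j0) ` R \<subseteq> {1..K - 1 - j0}" by blast
    show "inj_on (\<lambda>j. j - j0) R" unfolding R_def by (auto simp: inj_on_def)
  qed
  have "(\<Sum>j\<in>L. multiplicity p (y + 2 * j)) \<le> (\<Sum>j\<in>L. multiplicity p (j0 - j))"
  proof (intro sum_mono)
    fix j assume "j \<in> L"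
    then show "multiplicity p (y + 2 * j) \<le> multiplicity p (j0 - j)"
      using multiplicity_term_le[OF p _ y max, of j] unfolding L_def by auto
  qed
  also have "\<dots> = multiplicity p (\<Prod>j\<in>L. j0 - j)"
    using p split by (subst prime_elem_multiplicity_prod) (auto simp: L_def)
  also have "\<dots> \<le> multiplicity p (fact j0)"
    using prod_nat_dvd_fact[OF imL] injL by (intro dvd_imp_multiplicity_le) (auto simp: prod.reindex)
  finally have l: "(\<Sum>j\<in>L. multiplicity p (y + 2 * j)) \<le> multiplicity p (fact j0 :: nat)" .
  have "(\<Sum>j\<in>R. multiplicity p (y + 2 * j)) \<le> (\<Sum>j\<in>R. multiplicity p (j - j0))"
  proof (intro sum_mono)
    fix j assume "j \<in> R"
    then show "multiplicity p (y + 2 * j) \<le> multiplicity p (j - j0)"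
      using multiplicity_term_le[OF p _ y max, of j] unfolding R_def by auto
  qed
  also have "\<dots> = multiplicity p (\<Prod>j\<in>R. j - j0)"
    using p split by (subst prime_elem_multiplicity_prod) (auto simp: R_def)
  also have "\<dots> \<le> multiplicity p (fact (K - 1 - j0))"
    using prod_nat_dvd_fact[OF imR] injR by (intro dvd_imp_multiplicity_le) (auto simp: prod.reindex)
  finally have r: "(\<Sum>j\<in>R. multiplicity p (y + 2 * j)) \<le> multiplicity p (fact (K - 1 - j0) :: nat)" .
  have "fact j0 * fact (K - 1 - j0) dvd (fact (j0 + (K - 1 - j0)) :: nat)"
    using binomial_fact_lemma[of j0 "j0 + (K - 1 - j0)"]
    by (metis add_diff_cancel_left' dvd_triv_left le_add1)
  moreover have "j0 + (K - 1 - j0) = K - 1" using J by auto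
  ultimately have "multiplicity p (fact j0 * fact (K - 1 - j0) :: nat) \<le> multiplicity p (fact (K - 1) :: nat)"
    by (intro dvd_imp_multiplicity_le) auto
  then have "multiplicity p (fact j0 :: nat) + multiplicity p (fact (K - 1 - j0) :: nat) \<le> multiplicity p (fact (K - 1) :: nat)"
    using p by (simp add: prime_elem_multiplicity_mult_distrib)
  then show ?thesis using l r split by (simp add: sum.union_disjoint)
qed

text \<open>Erdos' device: for each prime of \<open>S1\<close> discard a term in which it occurs to the highest
  power; the primes of \<open>S2\<close> occur at most to the first power.\<close>

lemma exists_subset_prod_dvd_fact:
  fixes y :: nat
  assumes J: "J \<subseteq> {..<K}" and y: "odd y" and fin: "finite S1" "finite S2"
    and prm: "\<And>p. p \<in> S1 \<union> S2 \<Longrightarrow> prime p \<and> odd p"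
    and smooth: "\<And>p j. prime p \<Longrightarrow> j \<in> J \<Longrightarrow> p dvd y + 2 * j \<Longrightarrow> p \<in> S1 \<union> S2"
    and S2: "\<And>p j. p \<in> S2 \<Longrightarrow> j \<in> J \<Longrightarrow> y + 2 * j < p ^ 2"
  shows "\<exists>U\<subseteq>J. card (J - U) \<le> card S1 \<and> (\<Prod>j\<in>U. y + 2 * j) dvd fact (K - 1) * \<Prod>S2"
proof (cases "J = {}")
  case True
  then show ?thesis by auto
next
  case ne: False
  have finJ: "finite J" using J finite_subset by blast
  have y0: "y > 0" using y by (auto intro: Nat.gr0I)
  define f where "f = (\<lambda>p::nat. arg_max_on (\<lambda>j. multiplicity p (y + 2 * j)) J)"
  have f: "f p \<in> J" "\<And>j. j \<in> J \<Longrightarrow> multiplicity p (y + 2 * j) \<le> multiplicity p (y + 2 * f p)" for p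
  proof -
    obtain m where m: "m \<in> J" "\<And>j. j \<in> J \<Longrightarrow> multiplicity p (y + 2 * j) \<le> multiplicity p (y + 2 * m)"
    proof -
      have "Max ((\<lambda>j. multiplicity p (y + 2 * j)) ` J) \<in> (\<lambda>j. multiplicity p (y + 2 * j)) ` J"
        using finJ ne by (intro Max_in) auto
      then obtain m where "m \<in> J" "Max ((\<lambda>j. multiplicity p (y + 2 * j)) ` J) = multiplicity p (y + 2 * m)" by blast
      then show thesis using finJ that[of m] by (metis (no_types) Max_ge finite_imageI imageI)
    qed
    have "is_arg_max (\<lambda>j. multiplicity p (y + 2 * j)) (\<lambda>x. x \<in> J) m"
      using m by (auto simp: is_arg_max_linorder)
    then have "is_arg_max (\<lambda>j. multiplicity p (y + 2 * j)) (\<lambda>x. x \<in> J) (f p)"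
      unfolding f_def arg_max_on_def arg_max_def by (rule someI)
    then show "f p \<in> J" "\<And>j. j \<in> J \<Longrightarrow> multiplicity p (y + 2 * j) \<le> multiplicity p (y + 2 * f p)"
      by (auto simp: is_arg_max_linorder)
  qed
  define U where "U = J - f ` S1"
  have U: "U \<subseteq> J" "finite U" using finJ unfolding U_def by auto
  have "card (J - U) \<le> card (f ` S1)"
    using fin unfolding U_def by (intro card_mono) auto
  also have "\<dots> \<le> card S1" using fin by (intro card_image_le)
  finally have cardU: "card (J - U) \<le> card S1" .
  have S2pos: "\<Prod>S2 \<noteq> 0" using fin prm by (auto dest: prime_gt_0_nat)
  have "(\<Prod>j\<in>U. y + 2 * j) dvd fact (K - 1) * \<Prod>S2"
  proof (rule multiplicity_le_imp_dvd)
    show "(\<Prod>j\<in>U. y + 2 * j) \<noteq> 0" using U y0 by auto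
    fix p :: nat assume p: "prime p"
    have eqU: "multiplicity p (\<Prod>j\<in>U. y + 2 * j) = (\<Sum>j\<in>U. multiplicity p (y + 2 * j))"
      using p U y0 by (intro prime_elem_multiplicity_prod) auto
    have eqR: "multiplicity p (fact (K - 1) * \<Prod>S2) = multiplicity p (fact (K - 1) :: nat) + multiplicity p (\<Prod>S2)"
      using p S2pos by (simp add: prime_elem_multiplicity_mult_distrib)
    show "multiplicity p (\<Prod>j\<in>U. y + 2 * j) \<le> multiplicity p (fact (K - 1) * \<Prod>S2)"
    proof (cases "p \<in> S1 \<union> S2")
      case False
      then have "multiplicity p (y + 2 * j) = 0" if "j \<in> U" for j
        using smooth[OF p, of j] that U by (intro not_dvd_imp_multiplicity_0) auto
      then show ?thesis using eqU by simp
    next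
      case True
      have odd: "odd p" using prm True by blast
      have main: "(\<Sum>j\<in>J - {f p}. multiplicity p (y + 2 * j)) \<le> multiplicity p (fact (K - 1) :: nat)"
        using f by (intro sum_multiplicity_others_le[OF p odd J _ y0]) auto
      show ?thesis
      proof (cases "p \<in> S1")
        case True
        have "(\<Sum>j\<in>U. multiplicity p (y + 2 * j)) \<le> (\<Sum>j\<in>J - {f p}. multiplicity p (y + 2 * j))"
          using finJ True unfolding U_def by (intro sum_mono2) auto
        then show ?thesis using main eqU eqR by linarith
      next
        case False
        then have p2: "p \<in> S2" using True by blast
        have "(\<Sum>j\<in>U. multiplicity p (y + 2 * j)) \<le> (\<Sum>j\<in>J. multiplicity p (y + 2 * j))"
          using finJ U by (intro sum_mono2) auto
        also have "\<dots> = multiplicity p (y + 2 * f p) + (\<Sum>j\<in>J - {f p}. multiplicity p (y + 2 * j))"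
          using finJ f by (intro sum.remove) auto
        finally have "(\<Sum>j\<in>U. multiplicity p (y + 2 * j))
          \<le> multiplicity p (y + 2 * f p) + multiplicity p (fact (K - 1) :: nat)" using main by linarith
        moreover have "multiplicity p (y + 2 * f p) < 2"
        proof (rule multiplicity_lessI)
          show "\<not> p ^ 2 dvd y + 2 * f p" using S2[OF p2 f(1)] y0 by (meson add_gr_0 dvd_imp_le not_less)
        qed (use y0 p not_prime_unit in auto)
        moreover have "multiplicity p (\<Prod>S2) \<ge> 1"
          using p p2 fin S2pos by (intro multiplicity_geI) (auto intro: dvd_prodI dest: not_prime_unit)
        ultimately show ?thesis using eqU eqR by linarith
      qed
    qed
  qed
  then show ?thesis using U cardU by blast
qed

text \<open>The terms of the progression are odd, so only the odd part of \<open>(K - 1)!\<close>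
  can meet their product. Dropping the power of 2 gains a factor of about
  \<open>2^(K - 1) / K\<close>.\<close>

definition odd_part_fact :: "nat \<Rightarrow> nat" where
  "odd_part_fact n = fact n div 2 ^ multiplicity 2 (fact n :: nat)"

lemma fact_eq_odd_part: "2 ^ multiplicity 2 (fact n :: nat) * odd_part_fact n = fact n"
  unfolding odd_part_fact_def by (simp add: multiplicity_dvd)

lemma odd_part_fact_pos: "odd_part_fact n > 0"
proof (rule ccontr)
  assume "\<not> odd_part_fact n > 0"
  then have "fact n = (0::nat)" using fact_eq_odd_part[of n] by simp
  then show False by simp
qed

lemma exists_subset_prod_le:
  fixes y :: nat
  assumes J: "J \<subseteq> {..<K}" and y: "odd y" and fin: "finite S1" "finite S2"
    and prm: "\<And>p. p \<in> S1 \<union> S2 \<Longrightarrow> prime p \<and> odd p"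
    and smooth: "\<And>p j. prime p \<Longrightarrow> j \<in> J \<Longrightarrow> p dvd y + 2 * j \<Longrightarrow> p \<in> S1 \<union> S2"
    and S2: "\<And>p j. p \<in> S2 \<Longrightarrow> j \<in> J \<Longrightarrow> y + 2 * j < p ^ 2"
  shows "\<exists>U\<subseteq>J. card (J - U) \<le> card S1 \<and> (\<Prod>j\<in>U. y + 2 * j) \<le> odd_part_fact (K - 1) * \<Prod>S2"
proof -
  have "\<exists>U\<subseteq>J. card (J - U) \<le> card S1 \<and> (\<Prod>j\<in>U. y + 2 * j) dvd fact (K - 1) * \<Prod>S2"
    by (rule exists_subset_prod_dvd_fact[where ?S1.0 = S1 and ?S2.0 = S2 and K = K])
      (fact J, fact y, fact fin(1), fact fin(2), fact prm, fact smooth, fact S2)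
  then obtain U where U: "U \<subseteq> J" "card (J - U) \<le> card S1" "(\<Prod>j\<in>U. y + 2 * j) dvd fact (K - 1) * \<Prod>S2"
    by metis
  have "odd (\<Prod>j\<in>U. y + 2 * j)"
    using y finite_subset[OF U(1) finite_subset[OF J]] by (simp add: even_prod_iff)
  then have "coprime (\<Prod>j\<in>U. y + 2 * j) (2 ^ multiplicity 2 (fact (K - 1) :: nat))"
    by (metis coprime_power_right_iff coprime_right_2_iff_odd)
  moreover have "(\<Prod>j\<in>U. y + 2 * j) dvd 2 ^ multiplicity 2 (fact (K - 1) :: nat) * (odd_part_fact (K - 1) * \<Prod>S2)"
    using U(3) unfolding mult.assoc[symmetric] fact_eq_odd_part .
  ultimately have "(\<Prod>j\<in>U. y + 2 * j) dvd odd_part_fact (K - 1) * \<Prod>S2"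
    using coprime_dvd_mult_right_iff by blast
  moreover have "odd_part_fact (K - 1) * \<Prod>S2 > 0"
    using odd_part_fact_pos[of "K - 1"] prod_pos[of S2 "\<lambda>p. p"] prm prime_gt_0_nat by auto
  ultimately have "(\<Prod>j\<in>U. y + 2 * j) \<le> odd_part_fact (K - 1) * \<Prod>S2"
    by (rule dvd_imp_le)
  with U(1,2) show ?thesis by (intro exI[of _ U] conjI)
qed

text \<open>The valuation is \<open>n\<close> minus the number \<open>b\<close> of binary ones of
  \<open>n\<close>, and a number with \<open>b\<close> ones is at least
  \<open>2^b - 1\<close>.\<close>

lemma two_power_le_multiplicity_fact:
  "2 ^ n \<le> 2 ^ multiplicity 2 (fact n :: nat) * (n + 1)"
proof (induction n rule: less_induct)
  case (less n)
  show ?case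
  proof (cases "n = 0")
    case False
    define q where "q = n div 2"
    have q: "q < n" using False unfolding q_def by simp
    have rec: "multiplicity 2 (fact n :: nat) = q + multiplicity 2 (fact q :: nat)"
      using multiplicity_fact_rec[of 2 n] by (simp add: q_def)
    have IH: "2 ^ q \<le> 2 ^ multiplicity 2 (fact q :: nat) * (q + 1)" using less q by blast
    have "n = 2 * q \<or> n = 2 * q + 1" unfolding q_def by presburger
    then show ?thesis
    proof
      assume n: "n = 2 * q"
      have "(2::nat) ^ n = 2 ^ q * 2 ^ q" using n by (simp add: mult_2 power_add)
      also have "\<dots> \<le> 2 ^ q * (2 ^ multiplicity 2 (fact q :: nat) * (q + 1))" using IH by simp
      also have "\<dots> \<le> 2 ^ q * (2 ^ multiplicity 2 (fact q :: nat) * (n + 1))"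
        using n by (intro mult_le_mono2) simp
      finally show ?thesis unfolding rec by (simp only: power_add mult.assoc)
    next
      assume n: "n = 2 * q + 1"
      have "(2::nat) ^ n = 2 * (2 ^ q * 2 ^ q)" using n by (simp add: mult_2 power_add)
      also have "\<dots> \<le> 2 * (2 ^ q * (2 ^ multiplicity 2 (fact q :: nat) * (q + 1)))" using IH by simp
      also have "\<dots> = 2 ^ q * (2 ^ multiplicity 2 (fact q :: nat) * (n + 1))" using n by (simp add: algebra_simps)
      finally show ?thesis unfolding rec by (simp only: power_add mult.assoc)
    qed
  qed simp
qed

lemma odd_part_fact_upper: "2 ^ n * odd_part_fact n \<le> fact (n + 1)"
proof -
  have "2 ^ n * odd_part_fact n \<le> 2 ^ multiplicity 2 (fact n :: nat) * (n + 1) * odd_part_fact n"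
    using two_power_le_multiplicity_fact by (intro mult_le_mono1)
  also have "\<dots> = fact (n + 1)" using fact_eq_odd_part[of n] by (simp add: algebra_simps)
  finally show ?thesis .
qed

section \<open>Chebyshev's bound for the product of the primes up to n\<close>

definition primorial :: "nat \<Rightarrow> nat" where
  "primorial n = \<Prod>{p. prime p \<and> p \<le> n}"

lemma finite_primes_le [simp]: "finite {p::nat. prime p \<and> p \<le> n}"
  by (rule finite_subset[of _ "{..n}"]) auto

lemma primorial_pos: "primorial n > 0"
  unfolding primorial_def by (intro prod_pos) (auto dest: prime_gt_0_nat)

lemma primorial_dvd: "m \<le> n \<Longrightarrow> primorial m dvd primorial n"
  unfolding primorial_def by (intro prod_dvd_prod_subset) auto

lemma primorial_mono: "m \<le> n \<Longrightarrow> primorial m \<le> primorial n"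
  using primorial_dvd primorial_pos dvd_imp_le by blast

text \<open>With \<open>x = n/q\<close> both sides grow by 7 when \<open>x\<close> grows by 1, so
  only the fractional part of \<open>x\<close> matters; there all floors are determined by
  \<open>u = 6b div q < 6\<close>.\<close>

lemma chebyshev_floor_ineq:
  fixes n q :: nat
  assumes "q > 0"
  shows "3 * n div q + 2 * (2 * n div q) \<le> 6 * n div q + n div q"
proof -
  define a b where "a = n div q" and "b = n mod q"
  have n: "n = a * q + b" and b: "b < q" using assms unfolding a_def b_def by auto
  have e: "c * n div q = c * a + c * b div q" for c
  proof -
    have "c * n = c * b + (c * a) * q" using n by (simp add: algebra_simps)
    then show ?thesis using assms by (simp only: div_mult_self1)
  qed
  define u where "u = 6 * b div q"
  have "6 * b < 6 * q" using b by simp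
  then have "u < 6" unfolding u_def using less_mult_imp_div_less by blast
  moreover have "3 * b div q = u div 2"
  proof -
    have "u div 2 = (3 * b) * 2 div (q * 2)" by (simp add: u_def div_mult2_eq)
    moreover have "(3 * b) * 2 div (q * 2) = 3 * b div q" by (rule div_mult_mult2) simp
    ultimately show ?thesis by simp
  qed
  moreover have "2 * b div q = u div 3"
  proof -
    have "u div 3 = (2 * b) * 3 div (q * 3)" by (simp add: u_def div_mult2_eq)
    moreover have "(2 * b) * 3 div (q * 3) = 2 * b div q" by (rule div_mult_mult2) simp
    ultimately show ?thesis by simp
  qed
  ultimately have "3 * b div q + 2 * (2 * b div q) \<le> 6 * b div q"
    unfolding u_def[symmetric] by (simp only:)
  then show ?thesis using e[of 1] e[of 2] e[of 3] e[of 6] b by simp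
qed

text \<open>Chebyshev's quotient \<open>(6n)! n! / ((3n)! (2n)!\<^sup>2)\<close> is an integer divisible by every
  prime in \<open>(2n, 6n]\<close>.\<close>

lemma primes_dvd_chebyshev_quotient:
  "\<Prod>{p. prime p \<and> 2 * n < p \<and> p \<le> 6 * n} * (fact (3 * n) * (fact (2 * n) * fact (2 * n)))
     dvd (fact (6 * n) * fact n :: nat)"
proof (rule multiplicity_le_imp_dvd)
  define P where "P = {p::nat. prime p \<and> 2 * n < p \<and> p \<le> 6 * n}"
  have finP: "finite P" unfolding P_def by (rule finite_subset[of _ "{..6 * n}"]) auto
  have P0: "\<Prod>P \<noteq> 0" using finP by (auto simp: P_def)
  then show "\<Prod>{p. prime p \<and> 2 * n < p \<and> p \<le> 6 * n} * (fact (3 * n) * (fact (2 * n) * fact (2 * n) :: nat)) \<noteq> 0"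
    by (simp add: P_def)
  fix p :: nat assume p: "prime p"
  define T where "T = Suc (6 * n)"
  have p1: "p > 1" using p prime_gt_1_nat by blast
  have T: "m < p ^ T" if "m \<le> 6 * n" for m
  proof -
    have "T < p ^ T" using p1 by (intro power_gt_expt) simp
    then show ?thesis using that unfolding T_def by linarith
  qed
  have leg: "multiplicity p (fact m) = (\<Sum>t=1..T. m div p ^ t)" if "m \<le> 6 * n" for m
    using legendre_formula[OF p T[OF that]] .
  have mP: "multiplicity p (\<Prod>P) = (if p \<in> P then 1 else 0)"
  proof -
    have "multiplicity p (\<Prod>P) = (\<Sum>q\<in>P. multiplicity p q)"
      using prime_elem_multiplicity_prod[OF p finP, of "\<lambda>x. x"] P0 finP
      by (metis (no_types, lifting) prod_zero_iff)
    also have "\<dots> = (\<Sum>q\<in>P. if q = p then 1 else 0)"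
    proof (intro sum.cong refl)
      fix q assume "q \<in> P"
      then have "prime q" by (simp add: P_def)
      then show "multiplicity p q = (if q = p then 1 else 0)"
        using p by (auto simp: prime_multiplicity_other not_prime_unit intro!: multiplicity_self)
    qed
    finally show ?thesis using finP by (simp add: sum.delta)
  qed
  have "(if p \<in> P then 1 else 0) + (\<Sum>t=1..T. 3 * n div p ^ t + 2 * (2 * n div p ^ t))
      \<le> (\<Sum>t=1..T. 6 * n div p ^ t + n div p ^ t)"
  proof -
    have split: "(\<Sum>t=1..T. g t) = g 1 + (\<Sum>t=2..T. g t)" for g :: "nat \<Rightarrow> nat"
      using sum.atLeast_Suc_atMost[of 1 T g] by (simp add: T_def numeral_2_eq_2)
    have "(\<Sum>t=2..T. 3 * n div p ^ t + 2 * (2 * n div p ^ t)) \<le> (\<Sum>t=2..T. 6 * n div p ^ t + n div p ^ t)"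
      using p1 by (intro sum_mono chebyshev_floor_ineq) auto
    \<comment> \<open>The extra factor \<open>p\<close> comes from the first power alone: for
      \<open>2n < p \<le> 3n\<close> the floors of \<open>3n/p\<close> and \<open>6n/p\<close> are
      at most 1 and at least 2, for \<open>3n < p \<le> 6n\<close> they are 0 and at least
      1.\<close>
    moreover have "(if p \<in> P then 1 else 0) + (3 * n div p ^ 1 + 2 * (2 * n div p ^ 1)) \<le> 6 * n div p ^ 1 + n div p ^ 1"
    proof (cases "p \<in> P")
      case False
      then show ?thesis using chebyshev_floor_ineq[of p n] p1 by simp
    next
      case True
      then have le: "2 * n < p" "p \<le> 6 * n" by (auto simp: P_def)
      then have "2 * n div p = 0" by simp
      show ?thesis
      proof (cases "p \<le> 3 * n")
        case True
        have "3 * n div p < 2" using le by (intro less_mult_imp_div_less) simp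
        moreover have "2 \<le> 6 * n div p" using True p1 by (simp add: less_eq_div_iff_mult_less_eq)
        ultimately show ?thesis using \<open>2 * n div p = 0\<close> by simp
      next
        case False
        then have "3 * n div p = 0" by simp
        moreover have "1 \<le> 6 * n div p" using le p1 by (simp add: less_eq_div_iff_mult_less_eq)
        ultimately show ?thesis using \<open>2 * n div p = 0\<close> by simp
      qed
    qed
    ultimately show ?thesis unfolding split[of "\<lambda>t. 3 * n div p ^ t + 2 * (2 * n div p ^ t)"]
      split[of "\<lambda>t. 6 * n div p ^ t + n div p ^ t"] by linarith
  qed
  then show "multiplicity p (\<Prod>{p. prime p \<and> 2 * n < p \<and> p \<le> 6 * n} * (fact (3 * n) * (fact (2 * n) * fact (2 * n))))
      \<le> multiplicity p (fact (6 * n) * fact n)"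
    unfolding P_def[symmetric] using p P0 mP
    by (simp add: prime_elem_multiplicity_mult_distrib leg sum.distrib sum_distrib_left[symmetric])
qed

text \<open>\<open>108 = 6^6 / (3^3 * 2^2 * 2^2)\<close> is the limit of the ratio of consecutive
  quotients; the polynomial inequality in the induction says that the ratio never exceeds
  it.\<close>

lemma chebyshev_quotient_le:
  "fact (6 * n) * fact n \<le> 108 ^ n * (fact (3 * n) * (fact (2 * n) * fact (2 * n)) :: nat)"
proof (induction n)
  case (Suc n)
  have g1: "fact (m + 1) = (m + 1) * (fact m :: nat)" for m by simp
  have g2: "fact (m + 2) = (m + 2) * (m + 1) * (fact m :: nat)" for m
    using g1[of "m + 1"] g1[of m] by (simp only: add.assoc one_add_one mult.assoc)
  have g3: "fact (m + 3) = (m + 3) * (m + 2) * (m + 1) * (fact m :: nat)" for m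
  proof -
    have "m + 3 = (m + 2) + 1" by simp
    then show ?thesis using g1[of "m + 2"] g2[of m] by (simp only: mult.assoc)
  qed
  have g6: "fact (m + 6) = (m + 6) * (m + 5) * (m + 4) * (m + 3) * (m + 2) * (m + 1) * (fact m :: nat)" for m
  proof -
    have "m + 6 = (m + 3) + 3" "m + 5 = (m + 3) + 2" "m + 4 = (m + 3) + 1" by simp_all
    then show ?thesis using g3[of "m + 3"] g3[of m] by (simp only: mult.assoc)
  qed
  have f6: "fact (6 * Suc n) = (6*n+6)*(6*n+5)*(6*n+4)*(6*n+3)*(6*n+2)*(6*n+1)*(fact (6*n) :: nat)"
    using g6[of "6 * n"] by (simp only: mult_Suc_right add.commute[of 6])
  have f3: "fact (3 * Suc n) = (3*n+3)*(3*n+2)*(3*n+1)*(fact (3*n) :: nat)"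
    using g3[of "3 * n"] by (simp only: mult_Suc_right add.commute[of 3])
  have f2: "fact (2 * Suc n) = (2*n+2)*(2*n+1)*(fact (2*n) :: nat)"
    using g2[of "2 * n"] by (simp only: mult_Suc_right add.commute[of 2])
  have fs: "fact (Suc n) = (n + 1) * (fact n :: nat)" by simp
  have poly: "(6*n+6)*(6*n+5)*(6*n+4)*(6*n+3)*(6*n+2)*(6*n+1)*(n+1)
     \<le> 108 * ((3*n+3)*(3*n+2)*(3*n+1)*((2*n+2)*(2*n+1)*((2*n+2)*(2*n+1))))"
    by (simp add: algebra_simps)
  have "fact (6 * Suc n) * fact (Suc n) =
      (6*n+6)*(6*n+5)*(6*n+4)*(6*n+3)*(6*n+2)*(6*n+1)*(n+1) * (fact (6*n) * fact n :: nat)"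
    unfolding f6 fs by (simp only: mult_ac)
  also have "\<dots> \<le> 108 * ((3*n+3)*(3*n+2)*(3*n+1)*((2*n+2)*(2*n+1)*((2*n+2)*(2*n+1))))
      * (108 ^ n * (fact (3 * n) * (fact (2 * n) * fact (2 * n))))"
    using poly Suc by (rule mult_le_mono)
  also have "\<dots> = 108 ^ Suc n * (fact (3 * Suc n) * (fact (2 * Suc n) * fact (2 * Suc n)))"
    unfolding f3 f2 by (simp only: power_Suc mult_ac)
  finally show ?case .
qed simp

lemma primorial_step: "primorial (6 * n) \<le> primorial (2 * n) * 108 ^ n"
proof -
  define P where "P = {p::nat. prime p \<and> 2 * n < p \<and> p \<le> 6 * n}"
  define F where "F = (fact (3 * n) * (fact (2 * n) * fact (2 * n)) :: nat)"
  have "\<Prod>P * F \<le> fact (6 * n) * fact n"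
    unfolding P_def F_def by (intro dvd_imp_le primes_dvd_chebyshev_quotient) simp
  also have "\<dots> \<le> 108 ^ n * F" unfolding F_def by (rule chebyshev_quotient_le)
  finally have "\<Prod>P \<le> 108 ^ n" by (simp add: F_def)
  moreover have "primorial (6 * n) = primorial (2 * n) * \<Prod>P"
    unfolding primorial_def P_def
    by (subst prod.union_disjoint[symmetric]) (auto intro!: prod.cong intro: finite_subset[of _ "{..6 * n}"])
  ultimately show ?thesis by simp
qed

section \<open>Tables of primes, and the bound (10/3)^n for the primorial\<close>

definition small_primes :: "int list" where
  "small_primes = [2, 3, 5, 7, 11, 13, 17, 19, 23, 29, 31, 37, 41, 43, 47, 53, 59, 61, 67, 71, 73, 79, 83, 89, 97, 101, 103, 107, 109, 113, 127, 131, 137, 139, 149, 151, 157, 163, 167, 173, 179, 181, 191, 193, 197, 199, 211, 223, 227, 229, 233, 239, 241, 251, 257, 263, 269, 271, 277, 281, 283, 293, 307, 311, 313, 317, 331, 337, 347, 349, 353, 359, 367, 373, 379, 383, 389, 397, 401, 409, 419, 421, 431, 433, 439, 443, 449, 457, 461, 463, 467, 479, 487, 491, 499, 503, 509, 521, 523, 541, 547, 557, 563, 569, 571, 577, 587, 593, 599, 601, 607, 613, 617, 619, 631, 641, 643, 647, 653, 659, 661, 673, 677, 683, 691, 701, 709, 719, 727, 733, 739, 743, 751, 757, 761, 769, 773, 787, 797, 809]"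

text \<open>The limit 810 exceeds \<open>2k + 3\<close> for all \<open>k \<le> 400\<close>, the
  range settled by tables. Below 37 all divisors are tried, since a small prime would divide itself;
  above, the primes up to 31 suffice because \<open>31^2 > 810\<close>.\<close>

lemma prime_le_810_in_small_primes:
  assumes "prime p" "p \<le> 810"
  shows "int p \<in> set small_primes"
proof (cases "p < 37")
  case True
  have "list_all (\<lambda>n. n \<in> set small_primes \<or> (\<exists>q\<in>set [2..n - 1]. q dvd n)) [2..36]"
    unfolding small_primes_def by code_simp
  moreover have "int p \<in> {2..36}" using True prime_ge_2_nat[OF assms(1)] by simp
  ultimately have "int p \<in> set small_primes \<or> (\<exists>q\<in>set [2..int p - 1]. q dvd int p)"
    unfolding list_all_iff set_upto by blast
  moreover have "\<not> q dvd int p" if q: "q \<in> set [2..int p - 1]" for q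
  proof
    have that: "2 \<le> q" "q < int p" using q by auto
    assume "q dvd int p"
    then have "nat q dvd p" using that by (simp add: nat_dvd_iff)
    then have "nat q = 1 \<or> nat q = p" using assms(1) by (simp add: prime_nat_iff)
    then show False using that by auto
  qed
  ultimately show ?thesis by blast
next
  case False
  have "list_all (\<lambda>n. (\<exists>q\<in>set [2,3,5,7,11,13,17,19,23,29,31]. q dvd n) \<or> n \<in> set small_primes) [37..810]"
    unfolding small_primes_def by code_simp
  moreover have "int p \<in> {37..810}" using False assms(2) by simp
  ultimately have "(\<exists>q\<in>set [2,3,5,7,11,13,17,19,23,29,31]. q dvd int p) \<or> int p \<in> set small_primes"
    unfolding list_all_iff set_upto by blast
  moreover have "\<not> q dvd int p" if "q \<in> set [2,3,5,7,11,13,17,19,23,29,31]" for q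
  proof
    assume "q dvd int p"
    then have "nat q dvd p" using that by (auto simp: nat_dvd_iff)
    then have "nat q = 1 \<or> nat q = p" using assms(1) by (simp add: prime_nat_iff)
    then show False using that False by auto
  qed
  ultimately show ?thesis by blast
qed

definition odd_primes_le :: "nat \<Rightarrow> nat set" where
  "odd_primes_le n = {p. prime p \<and> odd p \<and> p \<le> n}"

lemma finite_odd_primes_le [simp]: "finite (odd_primes_le n)"
  unfolding odd_primes_le_def by (rule finite_subset[of _ "{..n}"]) auto

lemma odd_primes_le_mono: "m \<le> n \<Longrightarrow> odd_primes_le m \<subseteq> odd_primes_le n"
  unfolding odd_primes_le_def by auto

lemma card_odd_primes_le_small:
  assumes "n \<le> 810"
  shows "card (odd_primes_le n) \<le> length (filter (\<lambda>q. 3 \<le> q \<and> q \<le> int n) small_primes)"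
proof -
  have "int ` odd_primes_le n \<subseteq> set (filter (\<lambda>q. 3 \<le> q \<and> q \<le> int n) small_primes)"
  proof
    fix q assume "q \<in> int ` odd_primes_le n"
    then obtain p where p: "q = int p" "prime p" "odd p" "p \<le> n"
      unfolding odd_primes_le_def by blast
    have "p \<noteq> 2" using p by auto
    then have "3 \<le> p" using prime_ge_2_nat[OF p(2)] by linarith
    then show "q \<in> set (filter (\<lambda>q. 3 \<le> q \<and> q \<le> int n) small_primes)"
      using prime_le_810_in_small_primes[OF p(2)] p assms by simp
  qed
  then have "card (int ` odd_primes_le n) \<le> card (set (filter (\<lambda>q. 3 \<le> q \<and> q \<le> int n) small_primes))"
    by (intro card_mono) auto
  also have "\<dots> \<le> length (filter (\<lambda>q. 3 \<le> q \<and> q \<le> int n) small_primes)" by (rule card_length)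
  finally show ?thesis by (simp add: card_image)
qed

lemma primorial_small:
  assumes "n \<le> 810"
  shows "int (primorial n) \<le> prod_list (filter (\<lambda>q. q \<le> int n) small_primes)"
proof -
  have d: "distinct small_primes" unfolding small_primes_def by code_simp
  have pos: "\<forall>q\<in>set small_primes. 1 \<le> q" unfolding small_primes_def by code_simp
  have "int (primorial n) = \<Prod>(int ` {p. prime p \<and> p \<le> n})"
    unfolding primorial_def by (simp add: prod.reindex)
  also have "\<dots> \<le> \<Prod>(set (filter (\<lambda>q. q \<le> int n) small_primes))"
  proof (rule prod_mono2)
    show "int ` {p. prime p \<and> p \<le> n} \<subseteq> set (filter (\<lambda>q. q \<le> int n) small_primes)"
      using prime_le_810_in_small_primes assms by auto
  qed (use pos in auto)
  also have "\<dots> = prod_list (filter (\<lambda>q. q \<le> int n) small_primes)"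
    using d prod.distinct_set_conv_list[of "filter (\<lambda>q. q \<le> int n) small_primes" "\<lambda>q. q"] by simp
  finally show ?thesis .
qed

text \<open>Blocks \<open>a..b\<close> with \<open>primorial b \<le> (10/3)^a\<close>: both sides
  increase, so one computation settles every \<open>n\<close> in the block.\<close>

lemma primorial_le_power_small:
  assumes "n < 271"
  shows "3 ^ n * primorial n \<le> 10 ^ n"
proof -
  have block: "3 ^ n * primorial n \<le> 10 ^ n"
    if "a \<le> n" "n \<le> b" "b \<le> 810" "3 ^ a * prod_list (filter (\<lambda>q. q \<le> int b) small_primes) \<le> 10 ^ a" for a b
  proof -
    have "int (primorial n) \<le> prod_list (filter (\<lambda>q. q \<le> int b) small_primes)"
      using primorial_mono[OF that(2)] primorial_small[OF that(3)] by linarith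
    then have "3 ^ a * int (primorial n) \<le> 3 ^ a * prod_list (filter (\<lambda>q. q \<le> int b) small_primes)"
      by (rule mult_left_mono) simp
    from order_trans[OF this that(4)] have "int (3 ^ a * primorial n) \<le> int (10 ^ a)" by simp
    then have le: "3 ^ a * primorial n \<le> 10 ^ a" by (simp only: of_nat_le_iff)
    define c where "c = n - a"
    have c: "n = c + a" using that(1) by (simp add: c_def)
    have "3 ^ n * primorial n = 3 ^ c * (3 ^ a * primorial n)"
      by (subst c, simp only: power_add mult.assoc)
    also have "\<dots> \<le> 10 ^ c * 10 ^ a" by (rule mult_le_mono[OF power_mono le]) simp_all
    also have "\<dots> = 10 ^ n" by (simp only: c power_add)
    finally show ?thesis .
  qed
  have b0: "3 ^ 0 * prod_list (filter (\<lambda>q. q \<le> 1) small_primes) \<le> 10 ^ 0"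
    unfolding small_primes_def by code_simp
  have b1: "3 ^ 2 * prod_list (filter (\<lambda>q. q \<le> 4) small_primes) \<le> 10 ^ 2"
    unfolding small_primes_def by code_simp
  have b2: "3 ^ 5 * prod_list (filter (\<lambda>q. q \<le> 10) small_primes) \<le> 10 ^ 5"
    unfolding small_primes_def by code_simp
  have b3: "3 ^ 11 * prod_list (filter (\<lambda>q. q \<le> 18) small_primes) \<le> 10 ^ 11"
    unfolding small_primes_def by code_simp
  have b4: "3 ^ 19 * prod_list (filter (\<lambda>q. q \<le> 30) small_primes) \<le> 10 ^ 19"
    unfolding small_primes_def by code_simp
  have b5: "3 ^ 31 * prod_list (filter (\<lambda>q. q \<le> 46) small_primes) \<le> 10 ^ 31"
    unfolding small_primes_def by code_simp
  have b6: "3 ^ 47 * prod_list (filter (\<lambda>q. q \<le> 66) small_primes) \<le> 10 ^ 47"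
    unfolding small_primes_def by code_simp
  have b7: "3 ^ 67 * prod_list (filter (\<lambda>q. q \<le> 96) small_primes) \<le> 10 ^ 67"
    unfolding small_primes_def by code_simp
  have b8: "3 ^ 97 * prod_list (filter (\<lambda>q. q \<le> 130) small_primes) \<le> 10 ^ 97"
    unfolding small_primes_def by code_simp
  have b9: "3 ^ 131 * prod_list (filter (\<lambda>q. q \<le> 178) small_primes) \<le> 10 ^ 131"
    unfolding small_primes_def by code_simp
  have b10: "3 ^ 179 * prod_list (filter (\<lambda>q. q \<le> 232) small_primes) \<le> 10 ^ 179"
    unfolding small_primes_def by code_simp
  have b11: "3 ^ 233 * prod_list (filter (\<lambda>q. q \<le> 306) small_primes) \<le> 10 ^ 233"
    unfolding small_primes_def by code_simp
  have c0: ?thesis if "0 \<le> n" "n \<le> 1"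
    by (rule block[OF that]) (use b0 in simp_all)
  have c1: ?thesis if "2 \<le> n" "n \<le> 4"
    by (rule block[OF that]) (use b1 in simp_all)
  have c2: ?thesis if "5 \<le> n" "n \<le> 10"
    by (rule block[OF that]) (use b2 in simp_all)
  have c3: ?thesis if "11 \<le> n" "n \<le> 18"
    by (rule block[OF that]) (use b3 in simp_all)
  have c4: ?thesis if "19 \<le> n" "n \<le> 30"
    by (rule block[OF that]) (use b4 in simp_all)
  have c5: ?thesis if "31 \<le> n" "n \<le> 46"
    by (rule block[OF that]) (use b5 in simp_all)
  have c6: ?thesis if "47 \<le> n" "n \<le> 66"
    by (rule block[OF that]) (use b6 in simp_all)
  have c7: ?thesis if "67 \<le> n" "n \<le> 96"
    by (rule block[OF that]) (use b7 in simp_all)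
  have c8: ?thesis if "97 \<le> n" "n \<le> 130"
    by (rule block[OF that]) (use b8 in simp_all)
  have c9: ?thesis if "131 \<le> n" "n \<le> 178"
    by (rule block[OF that]) (use b9 in simp_all)
  have c10: ?thesis if "179 \<le> n" "n \<le> 232"
    by (rule block[OF that]) (use b10 in simp_all)
  have c11: ?thesis if "233 \<le> n" "n \<le> 306"
    by (rule block[OF that]) (use b11 in simp_all)
  show ?thesis
  proof (rule ccontr)
    assume neg: "\<not> ?thesis"
    have h0: "0 \<le> n" by simp
    have "1 < n" using neg c0[OF h0] by (meson not_le)
    then have h1: "2 \<le> n" by simp
    have "4 < n" using neg c1[OF h1] by (meson not_le)
    then have h2: "5 \<le> n" by simp
    have "10 < n" using neg c2[OF h2] by (meson not_le)
    then have h3: "11 \<le> n" by simp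
    have "18 < n" using neg c3[OF h3] by (meson not_le)
    then have h4: "19 \<le> n" by simp
    have "30 < n" using neg c4[OF h4] by (meson not_le)
    then have h5: "31 \<le> n" by simp
    have "46 < n" using neg c5[OF h5] by (meson not_le)
    then have h6: "47 \<le> n" by simp
    have "66 < n" using neg c6[OF h6] by (meson not_le)
    then have h7: "67 \<le> n" by simp
    have "96 < n" using neg c7[OF h7] by (meson not_le)
    then have h8: "97 \<le> n" by simp
    have "130 < n" using neg c8[OF h8] by (meson not_le)
    then have h9: "131 \<le> n" by simp
    have "178 < n" using neg c9[OF h9] by (meson not_le)
    then have h10: "179 \<le> n" by simp
    have "232 < n" using neg c10[OF h10] by (meson not_le)
    then have h11: "233 \<le> n" by simp
    have "306 < n" using neg c11[OF h11] by (meson not_le)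
    then have h12: "307 \<le> n" by simp
    show False using h12 assms by simp
  qed
qed

text \<open>Since \<open>108 < (10/3)^4\<close>, the step from \<open>2m\<close> to
  \<open>6m\<close> leaves room to spare, which pays for rounding \<open>n\<close> up to the
  multiple \<open>6m\<close> of 6.\<close>

lemma primorial_le_power: "3 ^ n * primorial n \<le> 10 ^ n"
proof (induction n rule: less_induct)
  case (less n)
  show ?case
  proof (cases "n < 271")
    case True
    then show ?thesis by (rule primorial_le_power_small)
  next
    case False
    define m where "m = (n + 5) div 6"
    have m: "n \<le> 6 * m" "6 * m \<le> n + 5" "46 \<le> m" "2 * m < n"
      using False unfolding m_def by linarith+
    have step: "(10::nat) ^ (2 * m) * 108 ^ m * 3 ^ (4 * m) * 10 ^ 5 \<le> 10 ^ (6 * m) * 3 ^ 5"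
    proof -
      \<comment> \<open>\<open>874800 = 10^2 * 108 * 3^4\<close> is compared with
        \<open>10^6\<close>: every unit of \<open>m\<close> gains a factor 0.8748, and 46 of them
        outweigh \<open>(10/3)^5\<close>, the price of rounding by at most 5. From
        \<open>n = 271\<close> on, \<open>m\<close> is at least 46.\<close>
      obtain j where j: "m = 46 + j" using m le_iff_add by blast
      have e: "(10::nat) ^ (2 * m) * 108 ^ m * 3 ^ (4 * m) = 874800 ^ m" for m
        by (simp add: power_mult flip: power_mult_distrib)
      have e': "(10::nat) ^ (6 * m) = 1000000 ^ m" for m by (simp add: power_mult)
      have base: "(874800::nat) ^ 46 * 10 ^ 5 \<le> 1000000 ^ 46 * 3 ^ 5" by simp
      have "(874800::nat) ^ m * 10 ^ 5 = 874800 ^ j * (874800 ^ 46 * 10 ^ 5)"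
        unfolding j power_add by (simp only: mult_ac)
      also have "\<dots> \<le> 1000000 ^ j * (1000000 ^ 46 * 3 ^ 5)"
        by (rule mult_le_mono[OF power_mono base]) simp_all
      also have "\<dots> = 1000000 ^ m * 3 ^ 5" unfolding j power_add by (simp only: mult_ac)
      finally show ?thesis unfolding e e' .
    qed
    have IH: "3 ^ (2 * m) * primorial (2 * m) \<le> 10 ^ (2 * m)" using less m by blast
    have "3 ^ (6 * m) * primorial n \<le> 3 ^ (6 * m) * (primorial (2 * m) * 108 ^ m)"
      using primorial_mono[OF m(1)] primorial_step[of m] by (intro mult_le_mono2) linarith
    also have "\<dots> = (3 ^ (2 * m) * primorial (2 * m)) * (108 ^ m * 3 ^ (4 * m))"
      by (simp add: mult.assoc mult.left_commute flip: power_add)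
    also have "\<dots> \<le> 10 ^ (2 * m) * (108 ^ m * 3 ^ (4 * m))" using IH by (rule mult_le_mono1)
    finally have A: "3 ^ (6 * m) * primorial n \<le> 10 ^ (2 * m) * (108 ^ m * 3 ^ (4 * m))" .
    obtain d where d: "6 * m = n + d" "d \<le> 5" using m by (metis le_iff_add nat_add_left_cancel_le)
    have "10 ^ 5 * 3 ^ d * (3 ^ n * primorial n) \<le> 10 ^ (6 * m) * 3 ^ 5"
    proof -
      have "10 ^ 5 * 3 ^ d * (3 ^ n * primorial n) = 10 ^ 5 * (3 ^ (6 * m) * primorial n)"
        unfolding d(1) power_add by (simp only: mult_ac)
      also have "\<dots> \<le> 10 ^ 5 * (10 ^ (2 * m) * (108 ^ m * 3 ^ (4 * m)))" using A by (rule mult_le_mono2)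
      also have "\<dots> = 10 ^ (2 * m) * 108 ^ m * 3 ^ (4 * m) * 10 ^ 5" by (simp only: mult_ac)
      also have "\<dots> \<le> 10 ^ (6 * m) * 3 ^ 5" by (rule step)
      finally show ?thesis .
    qed
    also have "\<dots> = 10 ^ n * (10 ^ d * 3 ^ 5)" unfolding d(1) power_add by (simp only: mult_ac)
    also have "\<dots> \<le> 10 ^ n * (10 ^ 5 * 3 ^ d)"
    proof -
      have "d = 0 \<or> d = 1 \<or> d = 2 \<or> d = 3 \<or> d = 4 \<or> d = 5" using d(2) by linarith
      then have "(10::nat) ^ d * 3 ^ 5 \<le> 10 ^ 5 * 3 ^ d" by auto
      then show ?thesis by (rule mult_le_mono2)
    qed
    finally have "10 ^ 5 * 3 ^ d * (3 ^ n * primorial n) \<le> 10 ^ 5 * 3 ^ d * 10 ^ n"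
      by (simp only: mult_ac)
    then show ?thesis by simp
  qed
qed

text \<open>A certificate for \<open>a\<close> terms of which \<open>r\<close> are discarded: if
  \<open>y \<ge> 6a\<close>, the kept terms together with the gain \<open>2^(a - 1)\<close> from the
  odd part outweigh \<open>a!\<close> with a factor \<open>2^s\<close> in reserve. The reserve hands
  the surplus of one table entry to the next, so that later entries are checked without
  factorials.\<close>

definition slack :: "nat \<Rightarrow> nat \<Rightarrow> nat \<Rightarrow> bool" where
  "slack a r s \<longleftrightarrow> r \<le> a \<and> 2 ^ s * fact a < (6 * a) ^ (a - r) * 2 ^ (a - 1)"

lemma fact_add_le: "fact (a + d) \<le> fact a * ((a + d) ^ d :: nat)"
proof (induction d)
  case (Suc d)
  have "fact (a + Suc d) = (a + Suc d) * (fact (a + d) :: nat)" by simp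
  also have "\<dots> \<le> (a + Suc d) * (fact a * (a + d) ^ d)" using Suc by (rule mult_le_mono2)
  also have "\<dots> \<le> (a + Suc d) * (fact a * (a + Suc d) ^ d)"
    by (intro mult_le_mono2 power_mono) auto
  finally show ?case by (simp only: power_Suc mult_ac)
qed simp

text \<open>Going from \<open>a\<close> to \<open>a'\<close> multiplies the factorial by at most
  \<open>a'^(a' - a)\<close>, while the other side gains a factor 2 for each new term and at least
  \<open>6a\<close> for each new term that is kept; the last hypothesis balances the two.\<close>

lemma slack_step:
  assumes "slack a r s" "0 < a" "a \<le> a'" "r \<le> r'" "r' - r \<le> a' - a"
    and "2 ^ s' * (a' ^ (a' - a) * (6 * a) ^ (r' - r)) \<le> 2 ^ s * (12 * a) ^ (a' - a)"
  shows "slack a' r' s'"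
proof -
  define D E where "D = a' - a" and "E = r' - r"
  have a': "a' = a + D" and r': "r' = r + E" and ED: "E \<le> D" and ra: "r \<le> a"
    using assms unfolding D_def E_def slack_def by auto
  have "fact (a + D) \<le> fact a * ((a + D) ^ D :: nat)"
    by (rule fact_add_le)
  then have "2 ^ s' * fact a' * (6 * a) ^ E \<le> 2 ^ s' * (fact a * a' ^ D) * (6 * a) ^ E"
    unfolding a' by (intro mult_le_mono1 mult_le_mono2)
  also have "\<dots> = (2 ^ s' * (a' ^ D * (6 * a) ^ E)) * fact a" by (simp only: mult_ac)
  also have "\<dots> \<le> (2 ^ s * (12 * a) ^ D) * fact a"
    using assms(6) unfolding D_def E_def by (rule mult_le_mono1)
  also have "\<dots> = (2 ^ s * fact a) * (12 * a) ^ D" by (simp only: mult_ac)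
  also have "\<dots> < (6 * a) ^ (a - r) * 2 ^ (a - 1) * (12 * a) ^ D"
    using assms(1,2) unfolding slack_def by (intro mult_strict_right_mono) auto
  also have "(12 * a) ^ D = (6 * a) ^ D * (2::nat) ^ D"
  proof -
    have "12 * a = 6 * a * 2" by simp
    then show ?thesis by (simp only: power_mult_distrib)
  qed
  also have "(6 * a) ^ (a - r) * 2 ^ (a - 1) * ((6 * a) ^ D * 2 ^ D) = (6 * a) ^ (a' - r') * 2 ^ (a' - 1) * (6 * a) ^ E"
  proof -
    have "a - r + D = a' - r' + E" using a' r' ED ra by linarith
    then have e1: "(6 * a) ^ (a - r) * (6 * a) ^ D = (6 * a) ^ (a' - r') * (6 * a) ^ E"
      by (simp only: power_add[symmetric])
    have "a - 1 + D = a' - 1" using a' assms(2) by linarith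
    then have e2: "(2::nat) ^ (a - 1) * 2 ^ D = 2 ^ (a' - 1)"
      by (simp only: power_add[symmetric])
    have "(6 * a) ^ (a - r) * 2 ^ (a - 1) * ((6 * a) ^ D * 2 ^ D)
        = ((6 * a) ^ (a - r) * (6 * a) ^ D) * (2 ^ (a - 1) * 2 ^ D)" by (simp only: mult_ac)
    also have "\<dots> = (6 * a) ^ (a' - r') * 2 ^ (a' - 1) * (6 * a) ^ E"
      unfolding e1 e2 by (simp only: mult_ac)
    finally show ?thesis .
  qed
  also have "\<dots> \<le> (6 * a') ^ (a' - r') * 2 ^ (a' - 1) * (6 * a) ^ E"
    by (intro mult_le_mono1 power_mono) (use assms(3) in simp_all)
  finally have "2 ^ s' * fact a' < (6 * a') ^ (a' - r') * 2 ^ (a' - 1)"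
    unfolding mult_less_cancel2 by (rule conjunct2)
  then show ?thesis unfolding slack_def using a' r' ED ra by simp
qed

text \<open>With \<open>r\<close> fixed between two table entries, the balance condition reduces to
  \<open>k \<le> 12a\<close>.\<close>

lemma odd_part_fact_less_power:
  assumes "slack a r s" "0 < a" "a \<le> k" "k \<le> 12 * a" "6 * k \<le> y"
  shows "odd_part_fact (k - 1) < y ^ (k - r)"
proof -
  have "slack k r 0"
  proof (rule slack_step[OF assms(1-3)])
    have "k ^ (k - a) \<le> (12 * a) ^ (k - a)" using assms(4) by (rule power_mono) simp
    also have "\<dots> \<le> 2 ^ s * (12 * a) ^ (k - a)" by simp
    finally show "2 ^ 0 * (k ^ (k - a) * (6 * a) ^ (r - r)) \<le> 2 ^ s * (12 * a) ^ (k - a)" by simp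
  qed auto
  then have "fact k < (6 * k) ^ (k - r) * 2 ^ (k - 1)" by (simp add: slack_def)
  also have "\<dots> \<le> y ^ (k - r) * 2 ^ (k - 1)" using assms(5) by (intro mult_le_mono1 power_mono) auto
  finally have "fact k < y ^ (k - r) * 2 ^ (k - 1)" .
  moreover have "2 ^ (k - 1) * odd_part_fact (k - 1) \<le> fact k"
    using odd_part_fact_upper[of "k - 1"] assms(2,3) by simp
  ultimately have "2 ^ (k - 1) * odd_part_fact (k - 1) < 2 ^ (k - 1) * y ^ (k - r)"
    by (metis mult.commute order.strict_trans1)
  then show ?thesis by (metis mult_less_cancel1)
qed

lemma card_odd_primes_le_block:
  assumes "n \<le> N" "N \<le> 810" "length (filter (\<lambda>q. 3 \<le> q \<and> q \<le> int N) small_primes) \<le> r"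
  shows "card (odd_primes_le n) \<le> r"
proof -
  have "card (odd_primes_le n) \<le> card (odd_primes_le N)"
    using odd_primes_le_mono[OF assms(1)] by (intro card_mono) auto
  also have "\<dots> \<le> length (filter (\<lambda>q. 3 \<le> q \<and> q \<le> int N) small_primes)"
    using assms(2) by (rule card_odd_primes_le_small)
  finally show ?thesis using assms(3) by linarith
qed

lemma slack_start:
  shows "slack 6 5 0" and "slack 9 7 0" and "slack 11 8 0" and "slack 13 9 0" and "slack 14 10 0" and "slack 17 12 0" and "slack 20 13 0" and "slack 22 15 0" and "slack 28 18 0" and "slack 34 21 0" and "slack 40 22 22"
  by (simp_all add: slack_def fact_numeral)

text \<open>In \<open>slack a r s\<close>, \<open>a\<close> is the first \<open>k\<close> of a
  block, \<open>r\<close> bounds the number of odd primes up to \<open>2k + 3\<close> throughout the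
  block, and \<open>s\<close> is the power of 2 still in reserve.\<close>

lemma slack_chain:
  shows s40: "slack 40 22 22"
    and s43: "slack 43 25 8"
    and s50: "slack 50 28 7"
    and s55: "slack 55 30 7"
    and s63: "slack 63 33 9"
    and s72: "slack 72 37 5"
    and s82: "slack 82 41 3"
    and s93: "slack 93 45 4"
    and s104: "slack 104 49 5"
    and s115: "slack 115 53 5"
    and s127: "slack 127 57 8"
    and s137: "slack 137 61 4"
    and s152: "slack 152 66 7"
    and s167: "slack 167 71 9"
    and s182: "slack 182 77 1"
    and s199: "slack 199 82 9"
    and s215: "slack 215 88 3"
    and s230: "slack 230 93 3"
    and s248: "slack 248 99 2"
    and s272: "slack 272 106 11"
    and s295: "slack 295 114 5"
    and s319: "slack 319 122 2"
    and s340: "slack 340 128 9"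
    and s365: "slack 365 136 8"
    and s392: "slack 392 138 79"
proof -
  show s40: "slack 40 22 22" by (rule slack_start)
  show s43: "slack 43 25 8" by (rule slack_step[OF s40]) simp_all
  show s50: "slack 50 28 7" by (rule slack_step[OF s43]) simp_all
  show s55: "slack 55 30 7" by (rule slack_step[OF s50]) simp_all
  show s63: "slack 63 33 9" by (rule slack_step[OF s55]) simp_all
  show s72: "slack 72 37 5" by (rule slack_step[OF s63]) simp_all
  show s82: "slack 82 41 3" by (rule slack_step[OF s72]) simp_all
  show s93: "slack 93 45 4" by (rule slack_step[OF s82]) simp_all
  show s104: "slack 104 49 5" by (rule slack_step[OF s93]) simp_all
  show s115: "slack 115 53 5" by (rule slack_step[OF s104]) simp_all
  show s127: "slack 127 57 8" by (rule slack_step[OF s115]) simp_all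
  show s137: "slack 137 61 4" by (rule slack_step[OF s127]) simp_all
  show s152: "slack 152 66 7" by (rule slack_step[OF s137]) simp_all
  show s167: "slack 167 71 9" by (rule slack_step[OF s152]) simp_all
  show s182: "slack 182 77 1" by (rule slack_step[OF s167]) simp_all
  show s199: "slack 199 82 9" by (rule slack_step[OF s182]) simp_all
  show s215: "slack 215 88 3" by (rule slack_step[OF s199]) simp_all
  show s230: "slack 230 93 3" by (rule slack_step[OF s215]) simp_all
  show s248: "slack 248 99 2" by (rule slack_step[OF s230]) simp_all
  show s272: "slack 272 106 11" by (rule slack_step[OF s248]) simp_all
  show s295: "slack 295 114 5" by (rule slack_step[OF s272]) simp_all
  show s319: "slack 319 122 2" by (rule slack_step[OF s295]) simp_all
  show s340: "slack 340 128 9" by (rule slack_step[OF s319]) simp_all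
  show s365: "slack 365 136 8" by (rule slack_step[OF s340]) simp_all
  show s392: "slack 392 138 79" by (rule slack_step[OF s365]) simp_all
qed

lemma prime_count_blocks:
  shows "length (filter (\<lambda>q. 3 \<le> q \<and> q \<le> 15) small_primes) \<le> 5"
    and "length (filter (\<lambda>q. 3 \<le> q \<and> q \<le> 21) small_primes) \<le> 7"
    and "length (filter (\<lambda>q. 3 \<le> q \<and> q \<le> 27) small_primes) \<le> 8"
    and "length (filter (\<lambda>q. 3 \<le> q \<and> q \<le> 29) small_primes) \<le> 9"
    and "length (filter (\<lambda>q. 3 \<le> q \<and> q \<le> 35) small_primes) \<le> 10"
    and "length (filter (\<lambda>q. 3 \<le> q \<and> q \<le> 41) small_primes) \<le> 12"
    and "length (filter (\<lambda>q. 3 \<le> q \<and> q \<le> 45) small_primes) \<le> 13"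
    and "length (filter (\<lambda>q. 3 \<le> q \<and> q \<le> 57) small_primes) \<le> 15"
    and "length (filter (\<lambda>q. 3 \<le> q \<and> q \<le> 69) small_primes) \<le> 18"
    and "length (filter (\<lambda>q. 3 \<le> q \<and> q \<le> 81) small_primes) \<le> 21"
    and "length (filter (\<lambda>q. 3 \<le> q \<and> q \<le> 87) small_primes) \<le> 22"
    and "length (filter (\<lambda>q. 3 \<le> q \<and> q \<le> 101) small_primes) \<le> 25"
    and "length (filter (\<lambda>q. 3 \<le> q \<and> q \<le> 111) small_primes) \<le> 28"
    and "length (filter (\<lambda>q. 3 \<le> q \<and> q \<le> 127) small_primes) \<le> 30"
    and "length (filter (\<lambda>q. 3 \<le> q \<and> q \<le> 145) small_primes) \<le> 33"
    and "length (filter (\<lambda>q. 3 \<le> q \<and> q \<le> 165) small_primes) \<le> 37"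
    and "length (filter (\<lambda>q. 3 \<le> q \<and> q \<le> 187) small_primes) \<le> 41"
    and "length (filter (\<lambda>q. 3 \<le> q \<and> q \<le> 209) small_primes) \<le> 45"
    and "length (filter (\<lambda>q. 3 \<le> q \<and> q \<le> 231) small_primes) \<le> 49"
    and "length (filter (\<lambda>q. 3 \<le> q \<and> q \<le> 255) small_primes) \<le> 53"
    and "length (filter (\<lambda>q. 3 \<le> q \<and> q \<le> 275) small_primes) \<le> 57"
    and "length (filter (\<lambda>q. 3 \<le> q \<and> q \<le> 305) small_primes) \<le> 61"
    and "length (filter (\<lambda>q. 3 \<le> q \<and> q \<le> 335) small_primes) \<le> 66"
    and "length (filter (\<lambda>q. 3 \<le> q \<and> q \<le> 365) small_primes) \<le> 71"
    and "length (filter (\<lambda>q. 3 \<le> q \<and> q \<le> 399) small_primes) \<le> 77"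
    and "length (filter (\<lambda>q. 3 \<le> q \<and> q \<le> 431) small_primes) \<le> 82"
    and "length (filter (\<lambda>q. 3 \<le> q \<and> q \<le> 461) small_primes) \<le> 88"
    and "length (filter (\<lambda>q. 3 \<le> q \<and> q \<le> 497) small_primes) \<le> 93"
    and "length (filter (\<lambda>q. 3 \<le> q \<and> q \<le> 545) small_primes) \<le> 99"
    and "length (filter (\<lambda>q. 3 \<le> q \<and> q \<le> 591) small_primes) \<le> 106"
    and "length (filter (\<lambda>q. 3 \<le> q \<and> q \<le> 639) small_primes) \<le> 114"
    and "length (filter (\<lambda>q. 3 \<le> q \<and> q \<le> 681) small_primes) \<le> 122"
    and "length (filter (\<lambda>q. 3 \<le> q \<and> q \<le> 731) small_primes) \<le> 128"
    and "length (filter (\<lambda>q. 3 \<le> q \<and> q \<le> 785) small_primes) \<le> 136"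
    and "length (filter (\<lambda>q. 3 \<le> q \<and> q \<le> 801) small_primes) \<le> 138"
  unfolding small_primes_def by code_simp+

text \<open>For \<open>k = 7, 8, 10\<close> only 1, 1 and 2 terms survive, and the bound
  \<open>k! / 2^(k - 1)\<close> exceeds the corresponding power of \<open>6k\<close>; these values
  are treated apart.\<close>

lemma odd_part_fact_less_power_medium:
  assumes "6 \<le> k" "k < 400" "k \<noteq> 7" "k \<noteq> 8" "k \<noteq> 10" "6 * k \<le> y"
  shows "odd_part_fact (k - 1) < y ^ (k - card (odd_primes_le (2 * k + 3)))"
proof -
  have block: ?thesis
    if "slack a r s" "length (filter (\<lambda>q. 3 \<le> q \<and> q \<le> int (2 * b + 3)) small_primes) \<le> r"
      "0 < a" "a \<le> k" "k \<le> b" "b \<le> 400" "b \<le> 12 * a" for a b r s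
  proof -
    have "card (odd_primes_le (2 * k + 3)) \<le> r"
      using that by (intro card_odd_primes_le_block[of _ "2 * b + 3"]) auto
    then have "y ^ (k - r) \<le> y ^ (k - card (odd_primes_le (2 * k + 3)))"
      using assms by (intro power_increasing) auto
    moreover have "odd_part_fact (k - 1) < y ^ (k - r)"
      using that assms by (intro odd_part_fact_less_power[OF that(1)]) auto
    ultimately show ?thesis by linarith
  qed
  note pc = prime_count_blocks
  have b0: ?thesis if "6 \<le> k" "k \<le> 6"
    by (rule block[OF slack_start(1), where b = 6]) (use that pc(1) in simp_all)
  have b1: ?thesis if "9 \<le> k" "k \<le> 9"
    by (rule block[OF slack_start(2), where b = 9]) (use that pc(2) in simp_all)
  have b2: ?thesis if "11 \<le> k" "k \<le> 12"
    by (rule block[OF slack_start(3), where b = 12]) (use that pc(3) in simp_all)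
  have b3: ?thesis if "13 \<le> k" "k \<le> 13"
    by (rule block[OF slack_start(4), where b = 13]) (use that pc(4) in simp_all)
  have b4: ?thesis if "14 \<le> k" "k \<le> 16"
    by (rule block[OF slack_start(5), where b = 16]) (use that pc(5) in simp_all)
  have b5: ?thesis if "17 \<le> k" "k \<le> 19"
    by (rule block[OF slack_start(6), where b = 19]) (use that pc(6) in simp_all)
  have b6: ?thesis if "20 \<le> k" "k \<le> 21"
    by (rule block[OF slack_start(7), where b = 21]) (use that pc(7) in simp_all)
  have b7: ?thesis if "22 \<le> k" "k \<le> 27"
    by (rule block[OF slack_start(8), where b = 27]) (use that pc(8) in simp_all)
  have b8: ?thesis if "28 \<le> k" "k \<le> 33"
    by (rule block[OF slack_start(9), where b = 33]) (use that pc(9) in simp_all)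
  have b9: ?thesis if "34 \<le> k" "k \<le> 39"
    by (rule block[OF slack_start(10), where b = 39]) (use that pc(10) in simp_all)
  have b10: ?thesis if "40 \<le> k" "k \<le> 42"
    by (rule block[OF slack_chain(1), where b = 42]) (use that pc(11) in simp_all)
  have b11: ?thesis if "43 \<le> k" "k \<le> 49"
    by (rule block[OF slack_chain(2), where b = 49]) (use that pc(12) in simp_all)
  have b12: ?thesis if "50 \<le> k" "k \<le> 54"
    by (rule block[OF slack_chain(3), where b = 54]) (use that pc(13) in simp_all)
  have b13: ?thesis if "55 \<le> k" "k \<le> 62"
    by (rule block[OF slack_chain(4), where b = 62]) (use that pc(14) in simp_all)
  have b14: ?thesis if "63 \<le> k" "k \<le> 71"
    by (rule block[OF slack_chain(5), where b = 71]) (use that pc(15) in simp_all)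
  have b15: ?thesis if "72 \<le> k" "k \<le> 81"
    by (rule block[OF slack_chain(6), where b = 81]) (use that pc(16) in simp_all)
  have b16: ?thesis if "82 \<le> k" "k \<le> 92"
    by (rule block[OF slack_chain(7), where b = 92]) (use that pc(17) in simp_all)
  have b17: ?thesis if "93 \<le> k" "k \<le> 103"
    by (rule block[OF slack_chain(8), where b = 103]) (use that pc(18) in simp_all)
  have b18: ?thesis if "104 \<le> k" "k \<le> 114"
    by (rule block[OF slack_chain(9), where b = 114]) (use that pc(19) in simp_all)
  have b19: ?thesis if "115 \<le> k" "k \<le> 126"
    by (rule block[OF slack_chain(10), where b = 126]) (use that pc(20) in simp_all)
  have b20: ?thesis if "127 \<le> k" "k \<le> 136"
    by (rule block[OF slack_chain(11), where b = 136]) (use that pc(21) in simp_all)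
  have b21: ?thesis if "137 \<le> k" "k \<le> 151"
    by (rule block[OF slack_chain(12), where b = 151]) (use that pc(22) in simp_all)
  have b22: ?thesis if "152 \<le> k" "k \<le> 166"
    by (rule block[OF slack_chain(13), where b = 166]) (use that pc(23) in simp_all)
  have b23: ?thesis if "167 \<le> k" "k \<le> 181"
    by (rule block[OF slack_chain(14), where b = 181]) (use that pc(24) in simp_all)
  have b24: ?thesis if "182 \<le> k" "k \<le> 198"
    by (rule block[OF slack_chain(15), where b = 198]) (use that pc(25) in simp_all)
  have b25: ?thesis if "199 \<le> k" "k \<le> 214"
    by (rule block[OF slack_chain(16), where b = 214]) (use that pc(26) in simp_all)
  have b26: ?thesis if "215 \<le> k" "k \<le> 229"
    by (rule block[OF slack_chain(17), where b = 229]) (use that pc(27) in simp_all)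
  have b27: ?thesis if "230 \<le> k" "k \<le> 247"
    by (rule block[OF slack_chain(18), where b = 247]) (use that pc(28) in simp_all)
  have b28: ?thesis if "248 \<le> k" "k \<le> 271"
    by (rule block[OF slack_chain(19), where b = 271]) (use that pc(29) in simp_all)
  have b29: ?thesis if "272 \<le> k" "k \<le> 294"
    by (rule block[OF slack_chain(20), where b = 294]) (use that pc(30) in simp_all)
  have b30: ?thesis if "295 \<le> k" "k \<le> 318"
    by (rule block[OF slack_chain(21), where b = 318]) (use that pc(31) in simp_all)
  have b31: ?thesis if "319 \<le> k" "k \<le> 339"
    by (rule block[OF slack_chain(22), where b = 339]) (use that pc(32) in simp_all)
  have b32: ?thesis if "340 \<le> k" "k \<le> 364"
    by (rule block[OF slack_chain(23), where b = 364]) (use that pc(33) in simp_all)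
  have b33: ?thesis if "365 \<le> k" "k \<le> 391"
    by (rule block[OF slack_chain(24), where b = 391]) (use that pc(34) in simp_all)
  have b34: ?thesis if "392 \<le> k" "k \<le> 399"
    by (rule block[OF slack_chain(25), where b = 399]) (use that pc(35) in simp_all)
  show ?thesis
  proof (rule ccontr)
    assume neg: "\<not> ?thesis"
    have h0: "6 \<le> k" by (rule assms)
    have "6 < k" using neg b0[OF h0] by (meson not_le)
    then have h1: "9 \<le> k" using assms by simp
    have "9 < k" using neg b1[OF h1] by (meson not_le)
    then have h2: "11 \<le> k" using assms by simp
    have "12 < k" using neg b2[OF h2] by (meson not_le)
    then have h3: "13 \<le> k" using assms by simp
    have "13 < k" using neg b3[OF h3] by (meson not_le)
    then have h4: "14 \<le> k" using assms by simp
    have "16 < k" using neg b4[OF h4] by (meson not_le)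
    then have h5: "17 \<le> k" using assms by simp
    have "19 < k" using neg b5[OF h5] by (meson not_le)
    then have h6: "20 \<le> k" using assms by simp
    have "21 < k" using neg b6[OF h6] by (meson not_le)
    then have h7: "22 \<le> k" using assms by simp
    have "27 < k" using neg b7[OF h7] by (meson not_le)
    then have h8: "28 \<le> k" using assms by simp
    have "33 < k" using neg b8[OF h8] by (meson not_le)
    then have h9: "34 \<le> k" using assms by simp
    have "39 < k" using neg b9[OF h9] by (meson not_le)
    then have h10: "40 \<le> k" using assms by simp
    have "42 < k" using neg b10[OF h10] by (meson not_le)
    then have h11: "43 \<le> k" using assms by simp
    have "49 < k" using neg b11[OF h11] by (meson not_le)
    then have h12: "50 \<le> k" using assms by simp
    have "54 < k" using neg b12[OF h12] by (meson not_le)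
    then have h13: "55 \<le> k" using assms by simp
    have "62 < k" using neg b13[OF h13] by (meson not_le)
    then have h14: "63 \<le> k" using assms by simp
    have "71 < k" using neg b14[OF h14] by (meson not_le)
    then have h15: "72 \<le> k" using assms by simp
    have "81 < k" using neg b15[OF h15] by (meson not_le)
    then have h16: "82 \<le> k" using assms by simp
    have "92 < k" using neg b16[OF h16] by (meson not_le)
    then have h17: "93 \<le> k" using assms by simp
    have "103 < k" using neg b17[OF h17] by (meson not_le)
    then have h18: "104 \<le> k" using assms by simp
    have "114 < k" using neg b18[OF h18] by (meson not_le)
    then have h19: "115 \<le> k" using assms by simp
    have "126 < k" using neg b19[OF h19] by (meson not_le)
    then have h20: "127 \<le> k" using assms by simp
    have "136 < k" using neg b20[OF h20] by (meson not_le)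
    then have h21: "137 \<le> k" using assms by simp
    have "151 < k" using neg b21[OF h21] by (meson not_le)
    then have h22: "152 \<le> k" using assms by simp
    have "166 < k" using neg b22[OF h22] by (meson not_le)
    then have h23: "167 \<le> k" using assms by simp
    have "181 < k" using neg b23[OF h23] by (meson not_le)
    then have h24: "182 \<le> k" using assms by simp
    have "198 < k" using neg b24[OF h24] by (meson not_le)
    then have h25: "199 \<le> k" using assms by simp
    have "214 < k" using neg b25[OF h25] by (meson not_le)
    then have h26: "215 \<le> k" using assms by simp
    have "229 < k" using neg b26[OF h26] by (meson not_le)
    then have h27: "230 \<le> k" using assms by simp
    have "247 < k" using neg b27[OF h27] by (meson not_le)
    then have h28: "248 \<le> k" using assms by simp
    have "271 < k" using neg b28[OF h28] by (meson not_le)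
    then have h29: "272 \<le> k" using assms by simp
    have "294 < k" using neg b29[OF h29] by (meson not_le)
    then have h30: "295 \<le> k" using assms by simp
    have "318 < k" using neg b30[OF h30] by (meson not_le)
    then have h31: "319 \<le> k" using assms by simp
    have "339 < k" using neg b31[OF h31] by (meson not_le)
    then have h32: "340 \<le> k" using assms by simp
    have "364 < k" using neg b32[OF h32] by (meson not_le)
    then have h33: "365 \<le> k" using assms by simp
    have "391 < k" using neg b33[OF h33] by (meson not_le)
    then have h34: "392 \<le> k" using assms by simp
    have "399 < k" using neg b34[OF h34] by (meson not_le)
    then have h35: "400 \<le> k" using assms by simp
    show False using h35 assms by simp
  qed
qed

text \<open>Trial division: a composite number below \<open>2809 = 53^2\<close> has a proper divisor
  below 53.\<close>

lemma prime_if_no_small_factor: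
  fixes n :: nat
  assumes "1 < n" "n < 2809" "\<forall>q\<in>set [2..<53]. n mod q = 0 \<longrightarrow> n = q"
  shows "prime n"
proof (rule ccontr)
  assume "\<not> prime n"
  then obtain a where a: "a dvd n" "a \<noteq> 1" "a \<noteq> n" using assms(1) by (auto simp: prime_nat_iff)
  then obtain b where b: "n = a * b" by blast
  have "a \<noteq> 0" "b \<noteq> 0" using b assms(1) by (metis mult_0 mult_0_right not_one_less_zero)+
  moreover have "b \<noteq> 1" using a(3) b by (metis mult_1_right)
  ultimately have pos: "a > 0" "b > 0" "b \<noteq> 1" by simp_all
  have no: "d = n" if "d dvd n" "2 \<le> d" "d < 53" for d
  proof -
    have "d \<in> {2..<53}" using that by simp
    with assms(3)[unfolded set_upt] have "n mod d = 0 \<longrightarrow> n = d" by (rule bspec)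
    then show ?thesis using that(1) by (simp add: dvd_eq_mod_eq_0)
  qed
  have "53 \<le> a"
  proof (rule ccontr)
    assume "\<not> 53 \<le> a"
    then have "a = n" using no[of a] a pos by linarith
    then show False using a by simp
  qed
  moreover have "53 \<le> b"
  proof (rule ccontr)
    assume "\<not> 53 \<le> b"
    moreover have "b dvd n" unfolding b by simp
    ultimately have "b = n" using no[of b] pos by linarith
    then have "a * b = 1 * b" using b by (metis mult_1)
    then show False using a(2) pos by (metis mult_cancel2 not_less0)
  qed
  ultimately have "53 * 53 \<le> n" unfolding b by (rule mult_le_mono)
  then show False using assms(2) by simp
qed

lemma chain_primes:
  shows p19: "prime (19::nat)"
    and p23: "prime (23::nat)"
    and p29: "prime (29::nat)"
    and p31: "prime (31::nat)"
    and p37: "prime (37::nat)"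
    and p43: "prime (43::nat)"
    and p47: "prime (47::nat)"
    and p53: "prime (53::nat)"
    and p61: "prime (61::nat)"
    and p73: "prime (73::nat)"
    and p79: "prime (79::nat)"
    and p83: "prime (83::nat)"
    and p89: "prime (89::nat)"
    and p103: "prime (103::nat)"
    and p113: "prime (113::nat)"
    and p127: "prime (127::nat)"
    and p137: "prime (137::nat)"
    and p139: "prime (139::nat)"
    and p151: "prime (151::nat)"
    and p163: "prime (163::nat)"
    and p173: "prime (173::nat)"
    and p181: "prime (181::nat)"
    and p193: "prime (193::nat)"
    and p199: "prime (199::nat)"
    and p211: "prime (211::nat)"
    and p223: "prime (223::nat)"
    and p233: "prime (233::nat)"
    and p241: "prime (241::nat)"
    and p251: "prime (251::nat)"
    and p263: "prime (263::nat)"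
    and p277: "prime (277::nat)"
    and p283: "prime (283::nat)"
    and p293: "prime (293::nat)"
    and p307: "prime (307::nat)"
    and p317: "prime (317::nat)"
    and p331: "prime (331::nat)"
    and p421: "prime (421::nat)"
    and p557: "prime (557::nat)"
    and p739: "prime (739::nat)"
    and p983: "prime (983::nat)"
    and p1307: "prime (1307::nat)"
    and p1741: "prime (1741::nat)"
    and p2311: "prime (2311::nat)"
    and p2411: "prime (2411::nat)"
  by (rule prime_if_no_small_factor; simp)+

text \<open>For \<open>y < 6k\<close> the progression reaches beyond
  \<open>y + 2 * (y div 6)\<close>, roughly \<open>4y/3\<close>, so it contains a prime outright.
  The limit 2400 is \<open>6 * 400\<close>.\<close>

lemma prime_between:
  fixes y :: nat
  assumes "15 \<le> y" "y < 2400"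
  shows "\<exists>p. prime p \<and> y < p \<and> p \<le> y + 2 * (y div 6)"
proof (rule ccontr)
  assume neg: "\<not> ?thesis"
  have step: "b \<le> y" if "prime b" "a \<le> y" "b \<le> a + 2 * (a div 6)" for a b
  proof (rule ccontr)
    assume "\<not> b \<le> y"
    moreover have "a div 6 \<le> y div 6" using that(2) by (rule div_le_mono)
    ultimately have "prime b \<and> y < b \<and> b \<le> y + 2 * (y div 6)" using that by linarith
    then show False using neg by blast
  qed
  have h19: "19 \<le> y" by (rule step[OF p19 assms(1)]) simp
  have h23: "23 \<le> y" by (rule step[OF p23 h19]) simp
  have h29: "29 \<le> y" by (rule step[OF p29 h23]) simp
  have h37: "37 \<le> y" by (rule step[OF p37 h29]) simp
  have h47: "47 \<le> y" by (rule step[OF p47 h37]) simp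
  have h61: "61 \<le> y" by (rule step[OF p61 h47]) simp
  have h79: "79 \<le> y" by (rule step[OF p79 h61]) simp
  have h103: "103 \<le> y" by (rule step[OF p103 h79]) simp
  have h137: "137 \<le> y" by (rule step[OF p137 h103]) simp
  have h181: "181 \<le> y" by (rule step[OF p181 h137]) simp
  have h241: "241 \<le> y" by (rule step[OF p241 h181]) simp
  have h317: "317 \<le> y" by (rule step[OF p317 h241]) simp
  have h421: "421 \<le> y" by (rule step[OF p421 h317]) simp
  have h557: "557 \<le> y" by (rule step[OF p557 h421]) simp
  have h739: "739 \<le> y" by (rule step[OF p739 h557]) simp
  have h983: "983 \<le> y" by (rule step[OF p983 h739]) simp
  have h1307: "1307 \<le> y" by (rule step[OF p1307 h983]) simp
  have h1741: "1741 \<le> y" by (rule step[OF p1741 h1307]) simp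
  have h2311: "2311 \<le> y" by (rule step[OF p2311 h1741]) simp
  have h2411: "2411 \<le> y" by (rule step[OF p2411 h2311]) simp
  show False using h2411 assms by simp
qed

text \<open>Lengths 12 and 14 serve \<open>k = 7\<close> and \<open>k = 8, 10\<close>; from 89 and
  331 on, the size estimate takes over.\<close>

lemma prime_between_small:
  fixes y :: nat
  assumes "15 \<le> y" "y < 331" "g = 14 \<or> g = 12 \<and> y < 89"
  shows "\<exists>p. prime p \<and> y < p \<and> p \<le> y + g"
proof (rule ccontr)
  assume neg: "\<not> ?thesis"
  have step: "b \<le> y" if "prime b" "a \<le> y" "b \<le> a + 14" "b \<le> a + 12 \<or> 89 \<le> a" for a b
  proof (rule ccontr)
    assume "\<not> b \<le> y"
    then have "prime b \<and> y < b \<and> b \<le> y + g" using that assms(3) by linarith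
    then show False using neg by blast
  qed
  have h23: "23 \<le> y" by (rule step[OF p23 assms(1)]) simp_all
  have h31: "31 \<le> y" by (rule step[OF p31 h23]) simp_all
  have h43: "43 \<le> y" by (rule step[OF p43 h31]) simp_all
  have h53: "53 \<le> y" by (rule step[OF p53 h43]) simp_all
  have h61: "61 \<le> y" by (rule step[OF p61 h53]) simp_all
  have h73: "73 \<le> y" by (rule step[OF p73 h61]) simp_all
  have h83: "83 \<le> y" by (rule step[OF p83 h73]) simp_all
  have h89: "89 \<le> y" by (rule step[OF p89 h83]) simp_all
  have h103: "103 \<le> y" by (rule step[OF p103 h89]) simp_all
  have h113: "113 \<le> y" by (rule step[OF p113 h103]) simp_all
  have h127: "127 \<le> y" by (rule step[OF p127 h113]) simp_all
  have h139: "139 \<le> y" by (rule step[OF p139 h127]) simp_all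
  have h151: "151 \<le> y" by (rule step[OF p151 h139]) simp_all
  have h163: "163 \<le> y" by (rule step[OF p163 h151]) simp_all
  have h173: "173 \<le> y" by (rule step[OF p173 h163]) simp_all
  have h181: "181 \<le> y" by (rule step[OF p181 h173]) simp_all
  have h193: "193 \<le> y" by (rule step[OF p193 h181]) simp_all
  have h199: "199 \<le> y" by (rule step[OF p199 h193]) simp_all
  have h211: "211 \<le> y" by (rule step[OF p211 h199]) simp_all
  have h223: "223 \<le> y" by (rule step[OF p223 h211]) simp_all
  have h233: "233 \<le> y" by (rule step[OF p233 h223]) simp_all
  have h241: "241 \<le> y" by (rule step[OF p241 h233]) simp_all
  have h251: "251 \<le> y" by (rule step[OF p251 h241]) simp_all
  have h263: "263 \<le> y" by (rule step[OF p263 h251]) simp_all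
  have h277: "277 \<le> y" by (rule step[OF p277 h263]) simp_all
  have h283: "283 \<le> y" by (rule step[OF p283 h277]) simp_all
  have h293: "293 \<le> y" by (rule step[OF p293 h283]) simp_all
  have h307: "307 \<le> y" by (rule step[OF p307 h293]) simp_all
  have h317: "317 \<le> y" by (rule step[OF p317 h307]) simp_all
  have h331: "331 \<le> y" by (rule step[OF p331 h317]) simp_all
  show False using h331 assms by simp
qed

section \<open>Logarithmic estimates for k at least 400\<close>

lemma e_ge: "2.718 \<le> exp (1::real)"
  using e_approx_32 by (simp add: abs_if field_simps split: if_splits)

lemma ln_le_power:
  fixes x :: real
  assumes "0 < x" "0 < n" "x ^ n \<le> 2.718 ^ m"
  shows "ln x \<le> real m / real n"
proof -
  have "2.718 ^ m \<le> exp (1::real) ^ m" by (rule power_mono[OF e_ge]) simp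
  with assms(3) have "x ^ n \<le> exp 1 ^ m" by linarith
  also have "\<dots> = exp (real m)" by (simp flip: exp_of_nat_mult)
  finally have "ln (x ^ n) \<le> real m" using assms(1) by (metis exp_gt_zero ln_exp ln_le_cancel_iff zero_less_power)
  then show ?thesis using assms by (simp add: ln_realpow field_simps)
qed

lemma ln_ge_power:
  fixes x :: real
  assumes "0 < x" "0 < n" "2.72 ^ m \<le> x ^ n"
  shows "real m / real n \<le> ln x"
proof -
  have "exp 1 ^ m \<le> (2.72::real) ^ m" using e_less_272 by (intro power_mono) auto
  then have "exp (real m) \<le> x ^ n" using assms(3) by (simp flip: exp_of_nat_mult)
  then have "real m \<le> ln (x ^ n)" using assms(1) by (metis exp_gt_zero ln_exp ln_le_cancel_iff zero_less_power)
  then show ?thesis using assms by (simp add: ln_realpow field_simps)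
qed

lemma ln_frac_le:
  fixes a b m n :: nat
  assumes "0 < a" "0 < b" "0 < n" "a ^ n * 1000 ^ m \<le> b ^ n * 2718 ^ m"
  shows "ln (real a / real b) \<le> real m / real n"
proof (rule ln_le_power)
  have "real (a ^ n * 1000 ^ m) \<le> real (b ^ n * 2718 ^ m)" using assms(4) by (rule of_nat_mono)
  then have "real a ^ n * 1000 ^ m \<le> real b ^ n * 2718 ^ m" by simp
  then have "real a ^ n / real b ^ n \<le> 2718 ^ m / 1000 ^ m" using assms(2) by (simp add: divide_simps mult.commute)
  then show "(real a / real b) ^ n \<le> 2.718 ^ m" by (simp flip: power_divide)
qed (use assms in auto)

lemma ln_nat_ge:
  fixes a m n :: nat
  assumes "0 < a" "0 < n" "272 ^ m \<le> a ^ n * 100 ^ m"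
  shows "real m / real n \<le> ln (real a)"
proof (rule ln_ge_power)
  have "real (272 ^ m) \<le> real (a ^ n * 100 ^ m)" using assms(3) by (rule of_nat_mono)
  then have "272 ^ m \<le> real a ^ n * 100 ^ m" by simp
  then have "272 ^ m / 100 ^ m \<le> real a ^ n" by (simp add: divide_simps)
  then show "2.72 ^ m \<le> real a ^ n" by (simp flip: power_divide)
qed (use assms in auto)

lemma ln2_ge: "69 / 100 \<le> ln (2::real)"
  using ln_nat_ge[of 2 13 9] by simp

lemma ln2_le: "ln (2::real) \<le> 7 / 10"
  using ln_frac_le[of 2 1 10 7] by simp

lemma ln_10_3_le: "ln (10 / 3 :: real) \<le> 241 / 200"
  using ln_frac_le[of 10 3 44 53] by simp

lemma ln_20_le: "ln (20::real) \<le> 3"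
  using ln_frac_le[of 20 1 1 3] by simp

lemma ln_400_le: "ln (400::real) \<le> 6"
  using ln_frac_le[of 400 1 1 6] by simp

lemma ln_400_ge: "5 \<le> ln (400::real)"
  using ln_nat_ge[of 400 1 5] by simp

lemma ln_le_tangent:
  fixes x a :: real
  assumes "0 < a" "0 < x"
  shows "ln x \<le> ln a + (x - a) / a"
proof -
  have "ln (x / a) \<le> x / a - 1" using assms by (intro ln_le_minus_one) simp
  then show ?thesis using assms by (simp add: ln_div field_simps)
qed

text \<open>Stirling's estimate in the crude form \<open>k! \<le> e * k^(k + 1) * e^(-k)\<close>.
  The induction step amounts to \<open>ln (1 + 1/k) \<ge> 1/(k + 1)\<close>.\<close>

lemma ln_fact_le:
  assumes "k > 0"
  shows "ln (fact k :: real) \<le> (real k + 1) * ln (real k) - real k + 1"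
  using assms
proof (induction k rule: nat_induct_non_zero)
  case (Suc k)
  have k: "real k > 0" using Suc by simp
  have "ln (real k / (real k + 1)) \<le> real k / (real k + 1) - 1"
    using k by (intro ln_le_minus_one) simp
  then have "ln (real k) - ln (real k + 1) \<le> - 1 / (real k + 1)"
    using k by (simp add: ln_div field_simps)
  then have d: "(real k + 1) * ln (real k) + 1 \<le> (real k + 1) * ln (real k + 1)"
    using k by (simp add: field_simps)
  have "ln (fact (Suc k) :: real) = ln (real k + 1) + ln (fact k)"
    by (simp add: ln_mult add.commute)
  also have "\<dots> \<le> ln (real k + 1) + ((real k + 1) * ln (real k) - real k + 1)"
    using Suc.IH by simp
  also have "\<dots> \<le> (real (Suc k) + 1) * ln (real (Suc k)) - real (Suc k) + 1"
    using d by (simp add: algebra_simps)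
  finally show ?case .
qed simp

lemma ln_odd_part_fact_le:
  assumes "k > 0"
  shows "ln (real (odd_part_fact (k - 1))) \<le> (real k + 1) * ln (real k) - real k + 1 - (real k - 1) * ln 2"
proof -
  have "2 ^ (k - 1) * odd_part_fact (k - 1) \<le> fact k"
    using odd_part_fact_upper[of "k - 1"] assms by simp
  then have "real (2 ^ (k - 1) * odd_part_fact (k - 1)) \<le> real (fact k)"
    by (rule of_nat_mono)
  then have "2 ^ (k - 1) * real (odd_part_fact (k - 1)) \<le> fact k" by simp
  moreover have pos: "real (odd_part_fact (k - 1)) > 0" using odd_part_fact_pos by simp
  ultimately have "ln (2 ^ (k - 1) * real (odd_part_fact (k - 1))) \<le> ln (fact k)"
    by (subst ln_le_cancel_iff) auto
  moreover have "ln (2 ^ (k - 1) * real (odd_part_fact (k - 1))) = (real k - 1) * ln 2 + ln (real (odd_part_fact (k - 1)))"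
    using pos assms by (simp add: ln_mult ln_realpow of_nat_diff)
  ultimately show ?thesis using ln_fact_le[OF assms] by linarith
qed

lemma ln_primorial_le: "ln (real (primorial n)) \<le> 241 / 200 * real n"
proof -
  have pos: "real (primorial n) > 0" using primorial_pos by simp
  have "real (3 ^ n * primorial n) \<le> real (10 ^ n)" using primorial_le_power by (rule of_nat_mono)
  then have "real (primorial n) \<le> (10 / 3) ^ n" by (simp add: power_divide field_simps)
  then have "ln (real (primorial n)) \<le> ln ((10 / 3) ^ n)" using pos by (subst ln_le_cancel_iff) auto
  also have "\<dots> = real n * ln (10 / 3)" by (simp add: ln_realpow)
  also have "\<dots> \<le> real n * (241 / 200)" using ln_10_3_le by (intro mult_left_mono) auto
  finally show ?thesis by simp
qed

text \<open>An odd prime other than 3 is 1 or 5 modulo 6. It serves for the primes up to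
  \<open>sqrt x\<close>, where the additive constant 51 of the finer sieve would be
  expensive.\<close>

lemma card_odd_primes_sieve6:
  assumes "\<And>p. p \<in> S \<Longrightarrow> prime p \<and> odd p \<and> real p \<le> w" "0 \<le> w"
  shows "real (card S) \<le> w / 3 + 1"
proof -
  define n where "n = nat \<lfloor>w\<rfloor>"
  define A where "A = {1..(n - 1) div 6}"
  define B where "B = {1..(n + 1) div 6}"
  have "S \<subseteq> insert 3 ((\<lambda>q. 6 * q + 1) ` A \<union> (\<lambda>q. 6 * q - 1) ` B)"
  proof
    fix p assume "p \<in> S"
    then have p: "prime p" "odd p" "real p \<le> w" using assms by auto
    then have "p \<le> n" unfolding n_def by (simp add: le_nat_floor)
    have "p > 1" using p prime_gt_1_nat by blast
    have "p = 3 \<or> \<not> 3 dvd p" using p(1) by (auto simp: prime_nat_iff)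
    moreover have "\<not> 2 dvd p" using p by simp
    ultimately have "p = 3 \<or> p mod 6 = 1 \<or> p mod 6 = 5" by presburger
    moreover have "p \<in> (\<lambda>q. 6 * q + 1) ` A" if "p mod 6 = 1"
    proof (rule image_eqI[of _ _ "p div 6"])
      show p6: "p = 6 * (p div 6) + 1" using that by presburger
      have "1 \<le> p div 6" using that \<open>p > 1\<close> by presburger
      moreover have "p div 6 \<le> (n - 1) div 6"
        using p6 \<open>p \<le> n\<close> by (subst less_eq_div_iff_mult_less_eq) linarith+
      ultimately show "p div 6 \<in> A" unfolding A_def by simp
    qed
    moreover have "p \<in> (\<lambda>q. 6 * q - 1) ` B" if "p mod 6 = 5"
    proof (rule image_eqI[of _ _ "(p + 1) div 6"])
      show "p = 6 * ((p + 1) div 6) - 1" using that by presburger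
      have "1 \<le> (p + 1) div 6" using that by presburger
      moreover have "(p + 1) div 6 \<le> (n + 1) div 6" using \<open>p \<le> n\<close> by (intro div_le_mono) simp
      ultimately show "(p + 1) div 6 \<in> B" unfolding B_def by simp
    qed
    ultimately show "p \<in> insert 3 ((\<lambda>q. 6 * q + 1) ` A \<union> (\<lambda>q. 6 * q - 1) ` B)" by blast
  qed
  then have "card S \<le> card (insert 3 ((\<lambda>q. 6 * q + 1) ` A \<union> (\<lambda>q. 6 * q - 1) ` B))"
    by (intro card_mono) (auto simp: A_def B_def)
  also have "\<dots> \<le> Suc (card ((\<lambda>q. 6 * q + 1) ` A \<union> (\<lambda>q. 6 * q - 1) ` B))"
    by (rule card_insert_le_m1) (auto simp: A_def B_def)
  also have "\<dots> \<le> Suc (card A + card B)"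
    using card_Un_le[of "(\<lambda>q. 6 * q + 1) ` A" "(\<lambda>q. 6 * q - 1) ` B"] card_image_le[of A "\<lambda>q. 6 * q + 1"]
      card_image_le[of B "\<lambda>q. 6 * q - 1"] by (simp add: A_def B_def)
  finally have "card S \<le> 1 + (n - 1) div 6 + (n + 1) div 6" by (simp add: A_def B_def)
  then have "3 * card S \<le> 3 + n" by linarith
  then have "real (3 * card S) \<le> real (3 + n)" by (rule of_nat_mono)
  then have "3 * real (card S) \<le> 3 + real n" by simp
  moreover have "real n \<le> w" unfolding n_def using assms(2) by simp
  ultimately show ?thesis by linarith
qed

text \<open>48 is Euler's totient of 210; the constant 51 pays for the primes 3, 5, 7 and for one
  incomplete block of residues.\<close>

lemma card_odd_primes_sieve210: "real (card (odd_primes_le n)) \<le> 51 + 48 * real n / 210"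
proof -
  define R where "R = set (filter (\<lambda>r. \<not> 2 dvd r \<and> \<not> 3 dvd r \<and> \<not> 5 dvd r \<and> \<not> 7 dvd r) [0..209::int])"
  have R: "card R \<le> 48"
  proof -
    have "length (filter (\<lambda>r. \<not> 2 dvd r \<and> \<not> 3 dvd r \<and> \<not> 5 dvd r \<and> \<not> 7 dvd r) [0..209::int]) \<le> 48"
      by code_simp
    moreover have "card R \<le> length (filter (\<lambda>r. \<not> 2 dvd r \<and> \<not> 3 dvd r \<and> \<not> 5 dvd r \<and> \<not> 7 dvd r) [0..209::int])"
      unfolding R_def by (rule card_length)
    ultimately show ?thesis by linarith
  qed
  have finR: "finite R" unfolding R_def by (rule finite_set)
  have "int ` odd_primes_le n \<subseteq> {3, 5, 7} \<union> (\<lambda>(q, r). 210 * int q + r) ` ({..n div 210} \<times> R)"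
  proof
    fix x assume "x \<in> int ` odd_primes_le n"
    then obtain p where p: "x = int p" "prime p" "odd p" "p \<le> n" unfolding odd_primes_le_def by blast
    have d: "q = p" if "q dvd p" "q \<noteq> 1" for q using that p(2) by (auto simp: prime_nat_iff)
    show "x \<in> {3, 5, 7} \<union> (\<lambda>(q, r). 210 * int q + r) ` ({..n div 210} \<times> R)"
    proof (cases "p \<in> {3, 5, 7}")
      case True
      then show ?thesis using p by auto
    next
      case False
      then have nd: "\<not> 2 dvd p" "\<not> 3 dvd p" "\<not> 5 dvd p" "\<not> 7 dvd p" using d[of 3] d[of 5] d[of 7] p(3) by auto
      define r where "r = int p mod 210"
      have "r mod 2 \<noteq> 0" "r mod 3 \<noteq> 0" "r mod 5 \<noteq> 0" "r mod 7 \<noteq> 0"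
      proof -
        have "r mod int q \<noteq> 0" if "int q dvd 210" "\<not> q dvd p" for q
          using that unfolding r_def by (simp add: mod_mod_cancel dvd_eq_mod_eq_0 flip: zmod_int)
        from this[of 2] this[of 3] this[of 5] this[of 7] nd
        show "r mod 2 \<noteq> 0" "r mod 3 \<noteq> 0" "r mod 5 \<noteq> 0" "r mod 7 \<noteq> 0" by simp_all
      qed
      moreover have "r \<in> {0..209}" unfolding r_def by simp
      ultimately have "r \<in> R" unfolding R_def set_filter set_upto dvd_eq_mod_eq_0 by blast
      moreover have "x = 210 * int (p div 210) + r" unfolding p(1) r_def by (simp add: zdiv_int)
      moreover have "p div 210 \<in> {..n div 210}" using p(4) by (simp add: div_le_mono)
      ultimately show ?thesis by (intro UnI2 image_eqI[of _ _ "(p div 210, r)"]) auto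
    qed
  qed
  then have "card (int ` odd_primes_le n) \<le> card ({3, 5, 7} \<union> (\<lambda>(q, r). 210 * int q + r) ` ({..n div 210} \<times> R))"
    using finR by (intro card_mono) auto
  also have "\<dots> \<le> card {3, 5, 7 :: int} + card ((\<lambda>(q, r). 210 * int q + r) ` ({..n div 210} \<times> R))"
    by (rule card_Un_le)
  also have "\<dots> \<le> 3 + card ({..n div 210} \<times> R)"
    using finR by (intro add_mono card_image_le) auto
  also have "card ({..n div 210} \<times> R) = (n div 210 + 1) * card R" by (simp add: card_cartesian_product)
  also have "3 + (n div 210 + 1) * card R \<le> 3 + (n div 210 + 1) * 48" using R by (intro add_left_mono mult_le_mono2)
  finally have "card (odd_primes_le n) \<le> 51 + 48 * (n div 210)" by (simp add: card_image)
  then have "real (card (odd_primes_le n)) \<le> real (51 + 48 * (n div 210))" by (rule of_nat_mono)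
  then have "real (card (odd_primes_le n)) \<le> 51 + 48 * real (n div 210)" by simp
  moreover have "real (n div 210) \<le> real n / 210" using of_nat_div_le_of_nat[of n 210, where ?'a = real] by simp
  ultimately show ?thesis by linarith
qed

lemma concave_on_ge_min_endpoints:
  fixes f :: "real \<Rightarrow> real"
  assumes "concave_on {a..b} f" "x \<in> {a..b}" "0 < f a" "0 < f b"
  shows "0 < f x"
proof (cases "a = b")
  case True
  then show ?thesis using assms by auto
next
  case False
  then have ab: "a < b" using assms(2) by simp
  define t where "t = (x - a) / (b - a)"
  have t: "0 \<le> t" "t \<le> 1" using assms(2) ab unfolding t_def by auto
  have "t * (b - a) = x - a" unfolding t_def using ab by simp
  then have x: "(1 - t) *\<^sub>R a + t *\<^sub>R b = x" by (simp add: algebra_simps)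
  have "(1 - t) * f a + t * f b \<le> f x"
    using concave_onD[OF assms(1) t, of a b] x ab by simp
  moreover have "0 < (1 - t) * f a + t * f b"
  proof (cases "t = 0")
    case True
    then show ?thesis using assms(3) by simp
  next
    case False
    then show ?thesis using t assms by (intro add_nonneg_pos mult_pos_pos mult_nonneg_nonneg) auto
  qed
  ultimately show ?thesis by linarith
qed

text \<open>With \<open>w = sqrt x\<close>, where \<open>x\<close> is the largest of the \<open>k\<close> odd numbers, the function below is
  concave in \<open>w\<close>, so its positivity need only be checked at \<open>w = 2 sqrt k\<close> and \<open>w = k\<close>.\<close>

lemma sieve_inequality_left:
  fixes k :: real
  assumes "400 \<le> k"
  shows "0 < (k - 1 - 2 * sqrt k / 3) * (2 * ln (2 * sqrt k)) - ((k + 1) * ln k + (213 / 200) * k + (533 / 100))"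
proof -
  define u where "u = sqrt k"
  have u2: "k = u ^ 2" using assms unfolding u_def by simp
  have u: "20 \<le> u" unfolding u_def using assms by (intro real_le_rsqrt) simp
  have lnk: "ln k = 2 * ln u" unfolding u2 using u by (simp add: ln_realpow)
  have ln2u: "ln (2 * u) = ln 2 + ln u" using u by (simp add: ln_mult)
  have lnu: "ln u \<le> u / 20 + 2" using ln_le_tangent[of 20 u] ln_20_le u by (simp add: field_simps)
  have "(u ^ 2 - 1 - 2 * u / 3) * (2 * (ln 2 + ln u)) - ((u ^ 2 + 1) * (2 * ln u) + (213 / 200) * u ^ 2 + (533 / 100))
      = (u ^ 2 - 1 - 2 * u / 3) * (2 * ln 2) - (4 + 4 * u / 3) * ln u - (213 / 200) * u ^ 2 - (533 / 100)"
    by (simp add: algebra_simps)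
  moreover have "(u ^ 2 - 1 - 2 * u / 3) * (69 / 50) \<le> (u ^ 2 - 1 - 2 * u / 3) * (2 * ln 2)"
  proof (intro mult_left_mono)
    have "20 * u \<le> u ^ 2" using u by (simp add: power2_eq_square)
    then show "0 \<le> u ^ 2 - 1 - 2 * u / 3" using u by linarith
  qed (use ln2_ge in simp)
  moreover have "(4 + 4 * u / 3) * ln u \<le> (4 + 4 * u / 3) * (u / 20 + 2)"
    using lnu u by (intro mult_left_mono) auto
  moreover have "0 < (u ^ 2 - 1 - 2 * u / 3) * (69 / 50) - (4 + 4 * u / 3) * (u / 20 + 2) - (213 / 200) * u ^ 2 - (533 / 100)"
  proof -
    have "20 * u \<le> u ^ 2" using u by (simp add: power2_eq_square)
    moreover have "(u ^ 2 - 1 - 2 * u / 3) * (69 / 50) - (4 + 4 * u / 3) * (u / 20 + 2) - (213 / 200) * u ^ 2 - (533 / 100)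
        = (149 / 600) * u ^ 2 - (284 / 75) * u - (1471 / 100)"
      by (simp add: field_simps power2_eq_square)
    ultimately show ?thesis using u by linarith
  qed
  ultimately have "0 < (u ^ 2 - 1 - 2 * u / 3) * (2 * (ln 2 + ln u)) - ((u ^ 2 + 1) * (2 * ln u) + (213 / 200) * u ^ 2 + (533 / 100))"
    by linarith
  then show ?thesis unfolding u2[symmetric] u_def[symmetric] lnk ln2u .
qed

lemma sieve_inequality_right:
  fixes k :: real
  assumes "400 \<le> k"
  shows "0 < (k - 1 - k / 3) * (2 * ln k) - ((k + 1) * ln k + (213 / 200) * k + (533 / 100))"
proof -
  have "5 \<le> ln k" using ln_400_ge assms by (meson ln_mono order_trans zero_less_numeral)
  then have "(k / 3 - 3) * 5 \<le> (k / 3 - 3) * ln k" using assms by (intro mult_left_mono) auto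
  moreover have "(k - 1 - k / 3) * (2 * ln k) - (k + 1) * ln k = (k / 3 - 3) * ln k"
    by (simp add: algebra_simps)
  ultimately show ?thesis using assms by (simp add: algebra_simps)
qed

text \<open>The constants collect what remains besides \<open>ln x\<close>:
  \<open>1.065 = 2 * 1.205 - 1 - 0.69/2\<close> comes from the primorial up to
  \<open>2k + 3\<close>, Stirling's estimate and the powers of 2, and 5.33 rounds up
  \<open>3 * 1.205 + 1 + 0.7\<close>.\<close>

lemma sieve_inequality:
  fixes k x :: real
  assumes "400 \<le> k" "4 * k \<le> x" "x \<le> k ^ 2"
  shows "(k + 1) * ln k + (213 / 200) * k + (533 / 100) < (k - 1 - sqrt x / 3) * ln x"
proof -
  define C where "C = (k + 1) * ln k + (213 / 200) * k + (533 / 100)"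
  define f where "f = (\<lambda>w::real. (k - 1 - w / 3) * (2 * ln w) - C)"
  define w where "w = sqrt x"
  have x0: "0 < x" using assms by linarith
  have pos: "0 < 2 * sqrt k" using assms by simp
  have w: "w \<in> {2 * sqrt k..k}"
  proof -
    have "2 * sqrt k = sqrt (4 * k)" by (simp add: real_sqrt_mult)
    then have "2 * sqrt k \<le> w" unfolding w_def using assms by simp
    moreover have "w \<le> k" unfolding w_def using assms by (intro real_le_lsqrt) auto
    ultimately show ?thesis by simp
  qed
  have conc: "concave_on {2 * sqrt k..k} f"
  proof (rule f''_le0_imp_concave)
    fix v assume "v \<in> {2 * sqrt k..k}"
    then have v: "0 < v" using pos unfolding atLeastAtMost_iff by linarith
    show "(f has_real_derivative (- 2 / 3 * ln v + (k - 1 - v / 3) * (2 / v))) (at v)"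
      unfolding f_def using v by (auto intro!: derivative_eq_intros simp: field_simps)
    show "((\<lambda>v. - 2 / 3 * ln v + (k - 1 - v / 3) * (2 / v)) has_real_derivative (- 2 / 3 / v - 2 * (k - 1) / v ^ 2)) (at v)"
      using v by (auto intro!: derivative_eq_intros simp: field_simps power2_eq_square)
    have "0 \<le> 2 / 3 / v" "0 \<le> 2 * (k - 1) / v ^ 2" using v assms by simp_all
    then show "- 2 / 3 / v - 2 * (k - 1) / v ^ 2 \<le> 0" by linarith
  qed simp
  have fl: "0 < f (2 * sqrt k)"
    using sieve_inequality_left[OF assms(1)] unfolding f_def C_def by simp
  have fr: "0 < f k"
    using sieve_inequality_right[OF assms(1)] unfolding f_def C_def by simp
  have "0 < f w" by (rule concave_on_ge_min_endpoints[OF conc w fl fr])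
  moreover have "2 * ln w = ln x" unfolding w_def using x0 by (simp add: ln_sqrt)
  ultimately show ?thesis unfolding f_def C_def w_def by simp
qed

text \<open>Pair \<open>j\<close> with \<open>k - 1 - j\<close>: among pairs with the same sum the
  extreme one has the smallest product.\<close>

lemma prod_terms_squared_ge:
  fixes y k :: nat
  assumes "0 < k"
  shows "(y * (y + 2 * (k - 1))) ^ k \<le> (\<Prod>j<k. y + 2 * j) ^ 2"
proof -
  have e: "(\<Prod>j<k. y + 2 * (k - 1 - j)) = (\<Prod>j<k. y + 2 * j)"
    using prod.nat_diff_reindex[of "\<lambda>j. y + 2 * j" k] by simp
  have "(\<Prod>j<k. y + 2 * j) ^ 2 = (\<Prod>j<k. (y + 2 * j) * (y + 2 * (k - 1 - j)))"
    unfolding prod.distrib e power2_eq_square ..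
  moreover have "(\<Prod>j<k. y * (y + 2 * (k - 1))) \<le> (\<Prod>j<k. (y + 2 * j) * (y + 2 * (k - 1 - j)))"
  proof (intro prod_mono conjI)
    fix j assume "j \<in> {..<k}"
    define i where "i = k - 1 - j"
    have "k - 1 = j + i" unfolding i_def using \<open>j \<in> {..<k}\<close> by simp
    then show "y * (y + 2 * (k - 1)) \<le> (y + 2 * j) * (y + 2 * (k - 1 - j))"
      by (simp add: algebra_simps)
  qed simp
  ultimately show ?thesis by simp
qed

text \<open>The removal argument in the variant where a term is sacrificed for every prime, so that
  the second set of primes is empty; the surviving terms are bounded below by
  \<open>y\<close>.\<close>

lemma power_le_odd_part_fact:
  fixes y :: nat
  assumes J: "J \<subseteq> {..<K}" and y: "odd y"
    and smooth: "\<And>p j. prime p \<Longrightarrow> j \<in> J \<Longrightarrow> p dvd y + 2 * j \<Longrightarrow> p \<le> z"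
  shows "y ^ (card J - card (odd_primes_le z)) \<le> odd_part_fact (K - 1)"
proof -
  define S1 where "S1 = odd_primes_le z"
  have y0: "0 < y" using y by (rule odd_pos)
  have "\<exists>U\<subseteq>J. card (J - U) \<le> card S1 \<and> (\<Prod>j\<in>U. y + 2 * j) \<le> odd_part_fact (K - 1) * \<Prod>{}"
  proof (rule exists_subset_prod_le[OF J y])
    show "prime p \<and> odd p" if "p \<in> S1 \<union> {}" for p
      using that unfolding S1_def odd_primes_le_def by auto
    show "p \<in> S1 \<union> {}" if "prime p" "j \<in> J" "p dvd y + 2 * j" for p j
    proof -
      have "odd (y + 2 * j)" using y by simp
      then have "odd p" using that(3) dvd_trans by blast
      then show ?thesis using that(1) smooth[OF that] unfolding S1_def odd_primes_le_def by simp
    qed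
  qed (auto simp: S1_def)
  then obtain U where U: "U \<subseteq> J" "card (J - U) \<le> card S1"
    "(\<Prod>j\<in>U. y + 2 * j) \<le> odd_part_fact (K - 1)" unfolding prod.empty mult_1_right by metis
  have finU: "finite U" by (rule finite_subset[OF U(1) finite_subset[OF J finite_lessThan]])
  have cU: "card J - card S1 \<le> card U"
    using U finU card_Diff_subset[OF finU U(1)] by simp
  have "y ^ (card J - card S1) \<le> y ^ card U" using cU y0 by (intro power_increasing) auto
  also have "\<dots> = (\<Prod>j\<in>U. y)" by simp
  also have "\<dots> \<le> (\<Prod>j\<in>U. y + 2 * j)" by (intro prod_mono) auto
  finally show ?thesis using U(3) unfolding S1_def by linarith
qed

text \<open>Every product with a logarithm is a variable, which makes the statement linear:
  \<open>kx\<close> is \<open>k * ln x\<close>, \<open>rx\<close> is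
  \<open>(sqrt x / 3 + 1) * ln x\<close>, \<open>kl\<close> is \<open>(k + 1) * ln k\<close>,
  \<open>k2\<close> is \<open>k * ln 2\<close>, while \<open>q\<close> and \<open>t\<close> stand
  for the logarithms of the odd part and the primorial.\<close>

lemma log_bounds_contradiction:
  fixes kx :: real
  assumes "2 * kx - k2 \<le> 2 * P" "P \<le> rx + (q + t)" "t \<le> (241 / 200) * (2 * k + 3)" "k * (69 / 100) \<le> k2"
    "q \<le> kl - k + 1 - (k2 - c)" "kl + (213 / 200) * k + (533 / 100) < kx - rx" "c \<le> 7 / 10"
  shows False
  using assms by argo

text \<open>The first hypothesis is the expanded product of \<open>1357/2500 * k - 517/10\<close>
  and \<open>2l - 7/10\<close>. Here \<open>1357/2500\<close> rounds down \<open>1 - 96/210\<close>,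
  and \<open>517/10\<close> rounds up \<open>51 + 144/210\<close>: the sieve modulo 210 at
  \<open>2k + 3\<close>.\<close>

lemma log_bounds_contradiction':
  fixes kl :: real
  assumes "(1357 / 1250) * kl - (9499 / 25000) * k - (517 / 5) * l + (3619 / 100) \<le> kl + l - k + 1 - (k2 - c)"
    "k * 5 \<le> kl" "k * (69 / 100) \<le> k2" "c \<le> 7 / 10" "l \<le> k / 400 + 5" "400 \<le> k"
  shows False
  using assms by argo

text \<open>Let \<open>x\<close> be the largest term. If \<open>x \<le> k^2\<close>, only the primes
  up to \<open>sqrt x\<close> cost a term, and the others are paid for by the primorial. If
  \<open>x > k^2\<close>, the terms are so large that one may be sacrificed for every odd prime up
  to \<open>2k + 3\<close>.\<close>

lemma exists_large_prime_factor_large: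
  fixes k y :: nat
  assumes "400 \<le> k" "odd y" "2 * k + 3 \<le> y"
  shows "\<exists>p j. prime p \<and> 2 * k + 3 < p \<and> j < k \<and> p dvd y + 2 * j"
proof (rule ccontr)
  assume neg: "\<not> ?thesis"
  define x where "x = y + 2 * (k - 1)"
  define z where "z = 2 * k + 3"
  have z: "z \<le> y" unfolding z_def by (rule assms)
  have x_le: "x \<le> 2 * y" unfolding x_def using assms by simp
  have x_ge: "4 * k + 1 \<le> x" unfolding x_def using assms by simp
  have smooth: "p \<in> odd_primes_le z" if "prime p" "j \<in> {..<k}" "p dvd y + 2 * j" for p j
  proof -
    have "odd (y + 2 * j)" using assms(2) by simp
    then have "odd p" using that(3) dvd_trans by blast
    moreover have "p \<le> z" using neg that unfolding z_def by (metis lessThan_iff not_le)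
    ultimately show ?thesis using that(1) unfolding odd_primes_le_def by simp
  qed
  have k0: "0 < real k" using assms by simp
  define P where "P = (\<Prod>j<k. y + 2 * j)"
  define o' where "o' = ln (real (odd_part_fact (k - 1)))"
  define l where "l = ln (real k)"
  have o': "o' \<le> (real k + 1) * l - real k + 1 - (real k - 1) * ln 2"
    unfolding o'_def l_def using assms by (intro ln_odd_part_fact_le) simp
  have y0: "0 < y" using assms by simp
  have x0: "0 < x" unfolding x_def using y0 by simp
  have lx: "ln (real x) \<le> ln 2 + ln (real y)"
  proof -
    have "ln (real x) \<le> ln (real (2 * y))" using x_le x0 by (subst ln_le_cancel_iff) auto
    also have "\<dots> = ln 2 + ln (real y)" using y0 by (simp add: ln_mult)
    finally show ?thesis .
  qed
  show False
  proof (cases "x \<le> k ^ 2")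
    case True
    define S1 where "S1 = {p \<in> odd_primes_le z. p ^ 2 \<le> x}"
    define S2 where "S2 = {p \<in> odd_primes_le z. x < p ^ 2}"
    have S: "odd_primes_le z = S1 \<union> S2" "finite S1" "finite S2"
      unfolding S1_def S2_def by auto
    have "\<exists>U\<subseteq>{..<k}. card ({..<k} - U) \<le> card S1 \<and> (\<Prod>j\<in>U. y + 2 * j) \<le> odd_part_fact (k - 1) * \<Prod>S2"
    proof (rule exists_subset_prod_le[OF subset_refl assms(2) S(2,3)])
      show "prime p \<and> odd p" if "p \<in> S1 \<union> S2" for p
        using that unfolding S1_def S2_def odd_primes_le_def by auto
      show "p \<in> S1 \<union> S2" if "prime p" "j \<in> {..<k}" "p dvd y + 2 * j" for p j
        using smooth[OF that] unfolding S(1) .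
      show "y + 2 * j < p ^ 2" if "p \<in> S2" "j \<in> {..<k}" for p j
      proof -
        have "x < p ^ 2" using that(1) unfolding S2_def by simp
        moreover have "y + 2 * j \<le> x" unfolding x_def using that(2) by auto
        ultimately show ?thesis by linarith
      qed
    qed
    then obtain U where U: "U \<subseteq> {..<k}" "card ({..<k} - U) \<le> card S1"
      "(\<Prod>j\<in>U. y + 2 * j) \<le> odd_part_fact (k - 1) * \<Prod>S2" by metis
    have "P = (\<Prod>j\<in>{..<k} - U. y + 2 * j) * (\<Prod>j\<in>U. y + 2 * j)"
      unfolding P_def using U(1) by (intro prod.subset_diff) auto
    also have "\<dots> \<le> x ^ card S1 * (odd_part_fact (k - 1) * primorial z)"
    proof (rule mult_le_mono)
      have "(\<Prod>j\<in>{..<k} - U. y + 2 * j) \<le> (\<Prod>j\<in>{..<k} - U. x)"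
        by (intro prod_mono) (auto simp: x_def)
      also have "\<dots> = x ^ card ({..<k} - U)" by simp
      also have "\<dots> \<le> x ^ card S1" using U(2) x0 by (intro power_increasing) auto
      finally show "(\<Prod>j\<in>{..<k} - U. y + 2 * j) \<le> x ^ card S1" .
      have "\<Prod>S2 dvd primorial z" unfolding primorial_def
        by (intro prod_dvd_prod_subset) (auto simp: S2_def odd_primes_le_def)
      then have "\<Prod>S2 \<le> primorial z" using primorial_pos by (rule dvd_imp_le)
      then have "odd_part_fact (k - 1) * \<Prod>S2 \<le> odd_part_fact (k - 1) * primorial z" by (rule mult_le_mono2)
      with U(3) show "(\<Prod>j\<in>U. y + 2 * j) \<le> odd_part_fact (k - 1) * primorial z" by (rule order_trans)
    qed
    finally have Ple: "real P \<le> real (x ^ card S1 * (odd_part_fact (k - 1) * primorial z))"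
      by (rule of_nat_mono)
    have P0: "0 < P" unfolding P_def using y0 by (intro prod_pos) simp
    have "ln (real P) \<le> ln (real (x ^ card S1 * (odd_part_fact (k - 1) * primorial z)))"
      using Ple P0 by (subst ln_le_cancel_iff) auto
    also have "\<dots> = real (card S1) * ln (real x) + (o' + ln (real (primorial z)))"
      using x0 odd_part_fact_pos[of "k - 1"] primorial_pos[of z]
      by (simp add: ln_mult ln_realpow o'_def)
    finally have lnP: "ln (real P) \<le> real (card S1) * ln (real x) + (o' + ln (real (primorial z)))" .
    have "real ((y * x) ^ k) \<le> real (P ^ 2)"
      unfolding P_def x_def using assms by (intro of_nat_mono prod_terms_squared_ge) simp
    then have "ln (real ((y * x) ^ k)) \<le> ln (real (P ^ 2))"
      using y0 x0 P0 by (subst ln_le_cancel_iff) auto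
    then have "real k * (ln (real y) + ln (real x)) \<le> 2 * ln (real P)"
      using y0 x0 P0 by (simp add: ln_mult ln_realpow)
    moreover have "real k * (2 * ln (real x) - ln 2) \<le> real k * (ln (real y) + ln (real x))"
      using lx by (intro mult_left_mono) auto
    ultimately have lower: "real k * (2 * ln (real x) - ln 2) \<le> 2 * ln (real P)" by linarith
    have card: "real (card S1) \<le> sqrt (real x) / 3 + 1"
    proof (rule card_odd_primes_sieve6)
      fix p assume "p \<in> S1"
      then have p: "prime p" "odd p" "p ^ 2 \<le> x" unfolding S1_def odd_primes_le_def by auto
      then have "real p ^ 2 \<le> real x" by (metis of_nat_le_iff of_nat_power)
      then have "real p \<le> sqrt (real x)" by (rule real_le_rsqrt)
      then show "prime p \<and> odd p \<and> real p \<le> sqrt (real x)" using p by simp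
    qed simp
    have "real x \<le> real k ^ 2" using True by (metis of_nat_le_iff of_nat_power)
    then have ineq: "(real k + 1) * l + (213 / 200) * real k + (533 / 100) < (real k - 1 - sqrt (real x) / 3) * ln (real x)"
      unfolding l_def using assms x_ge by (intro sieve_inequality) auto
    have "0 \<le> ln (real x)" using x0 by simp
    then have "real (card S1) * ln (real x) \<le> (sqrt (real x) / 3 + 1) * ln (real x)"
      using card by (intro mult_right_mono)
    with lnP have f2: "ln (real P) \<le> (sqrt (real x) / 3 + 1) * ln (real x) + (o' + ln (real (primorial z)))"
      by linarith
    have f4: "ln (real (primorial z)) \<le> (241 / 200) * (2 * real k + 3)"
      using ln_primorial_le[of z] unfolding z_def by simp
    have f5: "real k * (69 / 100) \<le> real k * ln 2" using ln2_ge by (intro mult_left_mono) auto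
    define kx rx k2 kl where "kx = real k * ln (real x)" and "rx = (sqrt (real x) / 3 + 1) * ln (real x)"
      and "k2 = real k * ln 2" and "kl = (real k + 1) * l"
    have f1: "2 * kx - k2 \<le> 2 * ln (real P)"
      using lower unfolding kx_def k2_def by (simp add: algebra_simps)
    have f6: "o' \<le> kl - real k + 1 - (k2 - ln 2)"
      using o' unfolding kl_def k2_def by (simp add: algebra_simps)
    have f7: "kl + (213 / 200) * real k + (533 / 100) < kx - rx"
      using ineq unfolding kl_def kx_def rx_def by (simp add: algebra_simps)
    show False by (rule log_bounds_contradiction[OF f1 f2[folded rx_def] f4 f5[folded k2_def] f6 f7 ln2_le])
  next
    case False
    define S1 where "S1 = odd_primes_le z"
    have "y ^ (card {..<k} - card S1) \<le> odd_part_fact (k - 1)"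
      unfolding S1_def using assms(2)
    proof (rule power_le_odd_part_fact[OF subset_refl])
      show "p \<le> z" if "prime p" "j \<in> {..<k}" "p dvd y + 2 * j" for p j
        using smooth[OF that] by (simp add: odd_primes_le_def)
    qed
    then have "y ^ (k - card S1) \<le> odd_part_fact (k - 1)" by simp
    then have "real (y ^ (k - card S1)) \<le> real (odd_part_fact (k - 1))" by (rule of_nat_mono)
    then have "ln (real (y ^ (k - card S1))) \<le> o'"
      unfolding o'_def using y0 odd_part_fact_pos[of "k - 1"] by (subst ln_le_cancel_iff) auto
    then have A: "real (k - card S1) * ln (real y) \<le> o'" using y0 by (simp add: ln_realpow)
    have B: "(1357 / 2500) * real k - (517 / 10) \<le> real (k - card S1)"
      using card_odd_primes_sieve210[of z] unfolding S1_def z_def by (simp add: of_nat_diff field_simps)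
    \<comment> \<open>From \<open>k^2 \<le> x \<le> 2y\<close>, the factor 2 costing at most
      0.7.\<close>
    have ly: "2 * l - (7 / 10) \<le> ln (real y)"
    proof -
      have "real k ^ 2 \<le> real x" using False by (metis of_nat_le_iff of_nat_power nat_le_linear)
      then have "ln (real k ^ 2) \<le> ln (real x)" using k0 x0 by (subst ln_le_cancel_iff) auto
      then show ?thesis unfolding l_def using lx ln2_le k0 by (simp add: ln_realpow)
    qed
    have l5: "5 \<le> l" unfolding l_def using ln_400_ge assms(1)
      by (meson ln_mono order_trans zero_less_numeral of_nat_mono numeral_le_real_of_nat_iff)
    have l_le: "l \<le> real k / 400 + 5"
      using ln_le_tangent[of 400 "real k"] ln_400_le k0 unfolding l_def by (simp add: field_simps)
    have "((1357 / 2500) * real k - (517 / 10)) * (2 * l - (7 / 10)) \<le> real (k - card S1) * ln (real y)"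
      using B ly l5 assms(1) by (intro mult_mono) auto
    then have C: "((1357 / 2500) * real k - (517 / 10)) * (2 * l - (7 / 10)) \<le> (real k + 1) * l - real k + 1 - (real k - 1) * ln 2"
      using A o' by linarith
    have D: "real k * 5 \<le> real k * l" using l5 by (intro mult_left_mono) auto
    have E: "real k * (69 / 100) \<le> real k * ln 2" using ln2_ge by (intro mult_left_mono) auto
    have C': "(1357 / 1250) * (real k * l) - (9499 / 25000) * real k - (517 / 5) * l + (3619 / 100)
        \<le> real k * l + l - real k + 1 - (real k * ln 2 - ln 2)"
      using C by (simp add: field_simps)
    have "400 \<le> real k" using assms(1) by simp
    then show False by (rule log_bounds_contradiction'[OF C' D E ln2_le l_le])
  qed
qed

lemma odd_part_fact_le_div: "odd_part_fact n \<le> fact (n + 1) div 2 ^ n"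
proof -
  have "odd_part_fact n * 2 ^ n \<le> fact (n + 1)" using odd_part_fact_upper[of n] by (simp only: mult.commute)
  then show ?thesis by (simp add: less_eq_div_iff_mult_less_eq)
qed

text \<open>An analogue of Sylvester's theorem for odd numbers. With
  \<open>e = (d + 1) div 2\<close> it is applied to \<open>k = e - 2\<close> for even
  \<open>n\<close> and to \<open>k = e - 1\<close> for odd \<open>n\<close>; a prime above
  \<open>2k + 3\<close> is then at least \<open>d\<close>, respectively
  \<open>d + 2\<close>.\<close>

theorem exists_large_prime_factor:
  fixes k y :: nat
  assumes "6 \<le> k" "odd y" "2 * k + 3 \<le> y"
  shows "\<exists>p j. prime p \<and> 2 * k + 3 < p \<and> j < k \<and> p dvd y + 2 * j"
proof (cases "400 \<le> k")
  case True
  then show ?thesis using assms by (intro exists_large_prime_factor_large)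
next
  case False
  \<comment> \<open>A prime term is its own large prime factor, as it exceeds
    \<open>y \<ge> 2k + 3\<close>.\<close>
  have window: ?thesis if "prime p" "y < p" "p \<le> y + 2 * (k - 1)" for p
  proof -
    have "odd p" using that assms prime_odd_nat[of p] by linarith
    define j where "j = (p - y) div 2"
    have "p = y + 2 * j" unfolding j_def using \<open>odd p\<close> assms(2) that(2) by presburger
    then have "prime p \<and> 2 * k + 3 < p \<and> j < k \<and> p dvd y + 2 * j"
      using that assms by auto
    then show ?thesis by blast
  qed
  have power_less: ?thesis if "odd_part_fact (k - 1) < y ^ (k - card (odd_primes_le (2 * k + 3)))"
  proof (rule ccontr)
    assume neg: "\<not> ?thesis"
    have "y ^ (card {..<k} - card (odd_primes_le (2 * k + 3))) \<le> odd_part_fact (k - 1)"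
      using assms(2)
    proof (rule power_le_odd_part_fact[OF subset_refl])
      show "p \<le> 2 * k + 3" if "prime p" "j \<in> {..<k}" "p dvd y + 2 * j" for p j
        using neg that by (meson lessThan_iff not_le)
    qed
    then show False using that by simp
  qed
  show ?thesis
  proof (cases "y < 6 * k")
    case True
    then obtain p where p: "prime p" "y < p" "p \<le> y + 2 * (y div 6)"
      using prime_between[of y] False assms by auto
    moreover have "y div 6 \<le> k - 1" using True by linarith
    ultimately show ?thesis by (intro window[of p]) linarith+
  next
    case large: False
    show ?thesis
    proof (cases "k = 7 \<or> k = 8 \<or> k = 10")
      case False
      then show ?thesis
        using large \<open>\<not> 400 \<le> k\<close> assms(1)
        by (intro power_less odd_part_fact_less_power_medium) auto
    next
      case special: True
      show ?thesis
      proof (cases "y < 331 \<and> (k = 7 \<longrightarrow> y < 89)")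
        case True
        define g where "g = (if k = 7 then 12 else 14 :: nat)"
        have "g = 14 \<or> g = 12 \<and> y < 89" using True unfolding g_def by auto
        moreover have "15 \<le> y" using assms by linarith
        ultimately obtain p where "prime p" "y < p" "p \<le> y + g" using prime_between_small True by blast
        moreover have "g \<le> 2 * (k - 1)" using special unfolding g_def by auto
        ultimately show ?thesis by (intro window[of p]) linarith+
      next
        case False
        have count: "card (odd_primes_le (2 * k + 3)) \<le> r"
          if "length (filter (\<lambda>q. 3 \<le> q \<and> q \<le> int (2 * k + 3)) small_primes) \<le> r" for r
          using that special by (intro card_odd_primes_le_block[OF order_refl]) auto
        show ?thesis
        proof (rule power_less)
          \<comment> \<open>The numbers 78, 315 and 7087 below are \<open>k! div 2^(k - 1)\<close>;
            they explain the thresholds 89 and 331 for \<open>y\<close>.\<close>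
          consider "k = 7" "89 \<le> y" | "k = 8" "331 \<le> y" | "k = 10" "331 \<le> y"
            using special False by linarith
          then show "odd_part_fact (k - 1) < y ^ (k - card (odd_primes_le (2 * k + 3)))"
          proof cases
            case 1
            have "card (odd_primes_le (2 * k + 3)) \<le> 6"
              by (rule count) (simp add: 1 small_primes_def)
            then have "y ^ 1 \<le> y ^ (k - card (odd_primes_le (2 * k + 3)))"
              using 1 by (intro power_increasing) auto
            moreover have "odd_part_fact (k - 1) \<le> 78"
              using odd_part_fact_le_div[of 6] 1 by (simp add: fact_numeral)
            ultimately show ?thesis using 1 by simp
          next
            case 2
            have "card (odd_primes_le (2 * k + 3)) \<le> 7"
              by (rule count) (simp add: 2 small_primes_def)
            then have "y ^ 1 \<le> y ^ (k - card (odd_primes_le (2 * k + 3)))"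
              using 2 by (intro power_increasing) auto
            moreover have "odd_part_fact (k - 1) \<le> 315"
              using odd_part_fact_le_div[of 7] 2 by (simp add: fact_numeral)
            ultimately show ?thesis using 2 by simp
          next
            case 3
            have "card (odd_primes_le (2 * k + 3)) \<le> 8"
              by (rule count) (simp add: 3 small_primes_def)
            then have "y ^ 2 \<le> y ^ (k - card (odd_primes_le (2 * k + 3)))"
              using 3 by (intro power_increasing) auto
            moreover have "331 ^ 2 \<le> y ^ 2" using 3 by (intro power_mono) auto
            moreover have "odd_part_fact (k - 1) \<le> 7087"
              using odd_part_fact_le_div[of 9] 3 by (simp add: fact_numeral)
            ultimately show ?thesis by simp
          qed
        qed
      qed
    qed
  qed
qed

section \<open>Short progressions of smooth odd numbers\<close>

lemma prime_power_decomposition: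
  fixes m q :: nat
  assumes "prime q" "0 < m"
  shows "\<exists>a m'. m = q ^ a * m' \<and> \<not> q dvd m' \<and> 0 < m'"
proof -
  have "m \<noteq> 0" "\<not> is_unit q" using assms not_prime_unit by auto
  then obtain m' where "m = q ^ multiplicity q m * m'" "\<not> q dvd m'"
    by (rule multiplicity_decompose')
  moreover from this have "0 < m'" by (intro Nat.gr0I) auto
  ultimately show ?thesis by blast
qed

lemma no_prime_factor_imp_one:
  fixes m :: nat
  assumes "0 < m" "\<And>p. prime p \<Longrightarrow> \<not> p dvd m"
  shows "m = 1"
  using assms prime_factor_nat by blast

lemma pure_prime_power:
  fixes m q :: nat
  assumes "prime q" "0 < m" "\<And>p. prime p \<Longrightarrow> p dvd m \<Longrightarrow> p = q"
  shows "\<exists>a. m = q ^ a"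
proof -
  obtain a m' where m': "m = q ^ a * m'" "\<not> q dvd m'" "0 < m'"
    using prime_power_decomposition[OF assms(1,2)] by blast
  have "m' = 1"
  proof (rule no_prime_factor_imp_one[OF m'(3)])
    fix p :: nat assume "prime p"
    show "\<not> p dvd m'"
    proof
      assume "p dvd m'"
      then have "p = q" using assms(3)[OF \<open>prime p\<close>] m'(1) by simp
      then show False using \<open>p dvd m'\<close> m'(2) by simp
    qed
  qed
  then show ?thesis using m'(1) by auto
qed

lemma smooth_decomposition:
  fixes m q :: nat
  assumes "prime q" "0 < m" "\<And>p. prime p \<Longrightarrow> p dvd m \<Longrightarrow> p \<in> insert q Q" "q \<notin> Q"
  shows "\<exists>a m'. m = q ^ a * m' \<and> 0 < m' \<and> (\<forall>p. prime p \<longrightarrow> p dvd m' \<longrightarrow> p \<in> Q)"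
proof -
  obtain a m' where m': "m = q ^ a * m'" "\<not> q dvd m'" "0 < m'"
    using prime_power_decomposition[OF assms(1,2)] by blast
  have "p \<in> Q" if "prime p" "p dvd m'" for p
  proof -
    have "p dvd m" using that(2) m'(1) by simp
    moreover have "p \<noteq> q" using that(2) m'(2) by auto
    ultimately show ?thesis using assms(3)[OF that(1)] by blast
  qed
  then show ?thesis using m' by blast
qed

lemma dvd_window_diff:
  fixes q N i j :: nat
  assumes "odd q" "q dvd N - 2 * i" "q dvd N - 2 * j" "2 * j \<le> N" "i < j"
  shows "q dvd j - i"
proof -
  have "q dvd (N - 2 * i) - (N - 2 * j)" using assms(2,3) by (rule dvd_diff_nat)
  also have "(N - 2 * i) - (N - 2 * j) = 2 * (j - i)" using assms(4,5) by (simp add: diff_mult_distrib2)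
  finally show ?thesis using assms(1) by (simp add: coprime_dvd_mult_right_iff)
qed

text \<open>Indices differ by less than 5, so neither 9 nor a prime \<open>q \<ge> 5\<close> divides
  two terms. Hence at most one term is a power of 3, and every other term owns a prime of
  \<open>Q\<close>, which gives the count. In the case of equality each prime of \<open>Q\<close> is
  owned, so the terms are prime powers up to a single factor 3, and that factor can only occur at
  distance 3 from the pure power of 3.\<close>

lemma smooth_window:
  fixes N :: nat and J Q :: "nat set"
  assumes J: "J \<subseteq> {..<5}" "\<And>j. j \<in> J \<Longrightarrow> 2 * j + 9 \<le> N" and N: "odd N"
    and Q: "finite Q" "\<And>q. q \<in> Q \<Longrightarrow> prime q \<and> 5 \<le> q"
    and smooth: "\<And>p j. prime p \<Longrightarrow> j \<in> J \<Longrightarrow> p dvd N - 2 * j \<Longrightarrow> p = 3 \<or> p \<in> Q"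
  shows "card J \<le> card Q + 1"
    and "card J = card Q + 1 \<Longrightarrow> \<exists>j0\<in>J. \<exists>g. inj_on g (J - {j0}) \<and> g ` (J - {j0}) \<subseteq> Q \<and> (\<exists>a\<ge>2. N - 2 * j0 = 3 ^ a)
      \<and> (\<forall>j\<in>J - {j0}. \<exists>a b. 1 \<le> b \<and> N - 2 * j = 3 ^ a * g j ^ b \<and> (a = 0 \<or> a = 1 \<and> (j = j0 + 3 \<or> j0 = j + 3)))"
proof -
  define t where "t = (\<lambda>j. N - 2 * j)"
  have finJ: "finite J" using J(1) finite_subset by blast
  have t9: "9 \<le> t j" if "j \<in> J" for j using J(2)[OF that] unfolding t_def by simp
  have diff: "q dvd i - j \<and> j < i \<or> q dvd j - i \<and> i < j" if "odd q" "i \<in> J" "j \<in> J" "i \<noteq> j" "q dvd t i" "q dvd t j" for q i j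
    using dvd_window_diff[OF that(1), of N i j] dvd_window_diff[OF that(1), of N j i] J(2)[OF that(2)] J(2)[OF that(3)] that
    unfolding t_def by linarith
  have small: "i < 5" if "i \<in> J" for i using J(1) that by auto
  have uniq: "i = j" if "odd q" "5 \<le> q" "i \<in> J" "j \<in> J" "q dvd t i" "q dvd t j" for q i j
  proof (rule ccontr)
    assume "i \<noteq> j"
    then have "q dvd i - j \<and> j < i \<or> q dvd j - i \<and> i < j" using diff that by blast
    then have "q \<le> i - j \<and> j < i \<or> q \<le> j - i \<and> i < j" by (auto intro: dvd_imp_le)
    then show False using small[OF that(3)] small[OF that(4)] that(2) by linarith
  qed
  define Pure where "Pure = {j \<in> J. \<forall>p. prime p \<longrightarrow> p dvd t j \<longrightarrow> p = 3}"
  have pure: "\<exists>a\<ge>2. t j = 3 ^ a" if "j \<in> Pure" for j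
  proof -
    have j: "j \<in> J" using that unfolding Pure_def by blast
    have "\<exists>a. t j = 3 ^ a"
      by (rule pure_prime_power) (use that t9[OF j] in \<open>auto simp: Pure_def\<close>)
    then obtain a where a: "t j = 3 ^ a" by blast
    have "2 \<le> a"
    proof (rule ccontr)
      assume "\<not> 2 \<le> a"
      then have "a = 0 \<or> a = 1" by linarith
      then show False using a t9[OF j] by auto
    qed
    then show ?thesis using a by blast
  qed
  have nine: "9 dvd t j" if "j \<in> Pure" for j
    using pure[OF that] le_imp_power_dvd[of 2 _ "3::nat"] by auto
  have pure_uniq: "i = j" if "i \<in> Pure" "j \<in> Pure" for i j
    using uniq[of 9 i j] nine that unfolding Pure_def by auto
  define h where "h = (\<lambda>j. SOME q. q \<in> Q \<and> q dvd t j)"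
  have h: "h j \<in> Q \<and> h j dvd t j" if "j \<in> J - Pure" for j
  proof -
    have "\<exists>q. q \<in> Q \<and> q dvd t j"
      using that smooth unfolding Pure_def t_def by blast
    then show ?thesis unfolding h_def by (rule someI_ex)
  qed
  have Qodd: "odd q \<and> 5 \<le> q \<and> prime q" if "q \<in> Q" for q
    using Q(2)[OF that] prime_odd_nat[of q] by linarith
  have inj: "inj_on h (J - Pure)"
  proof (rule inj_onI)
    fix i j assume ij: "i \<in> J - Pure" "j \<in> J - Pure" "h i = h j"
    then show "i = j" using uniq[of "h i" i j] h[OF ij(1)] h[OF ij(2)] Qodd[of "h i"] by auto
  qed
  have im: "h ` (J - Pure) \<subseteq> Q" using h by blast
  have card1: "card (J - Pure) \<le> card Q"
    using card_mono[OF Q(1) im] card_image[OF inj] by simp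
  have finP: "finite Pure" using finJ unfolding Pure_def by simp
  have subP: "Pure \<subseteq> J" unfolding Pure_def by blast
  have cardP: "card Pure \<le> 1" using pure_uniq by (simp add: card_le_Suc0_iff_eq[OF finP])
  have "card J = card (J - Pure) + card Pure"
    using card_Diff_subset[OF finP subP] card_mono[OF finJ subP] by simp
  then show "card J \<le> card Q + 1" using card1 cardP by linarith
  assume eq: "card J = card Q + 1"
  then have "card Pure = 1" "card (J - Pure) = card Q"
    using \<open>card J = card (J - Pure) + card Pure\<close> card1 cardP by linarith+
  then obtain j0 where j0: "Pure = {j0}" using card_1_singletonE by blast
  \<comment> \<open>In the case of equality the choice of owned primes is onto \<open>Q\<close>; a
    second prime of \<open>Q\<close> in a term would belong to two terms.\<close>
  have surj: "h ` (J - Pure) = Q"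
    using card_subset_eq[OF Q(1) im] card_image[OF inj] \<open>card (J - Pure) = card Q\<close> by simp
  have rest: "\<exists>a b. 1 \<le> b \<and> t j = 3 ^ a * h j ^ b \<and> (a = 0 \<or> a = 1 \<and> (j = j0 + 3 \<or> j0 = j + 3))" if j: "j \<in> J - {j0}" for j
  proof -
    have jP: "j \<in> J - Pure" using j j0 by simp
    have only: "p = 3 \<or> p = h j" if p: "prime p" "p dvd t j" for p
    proof (rule ccontr)
      assume n: "\<not> (p = 3 \<or> p = h j)"
      then have "p \<in> Q" using smooth[of p j] p j unfolding t_def by blast
      then obtain i where i: "i \<in> J - Pure" "p = h i" using surj by blast
      then have "i = j" using uniq[of p i j] h[OF i(1)] Qodd[OF \<open>p \<in> Q\<close>] p(2) j by auto
      then show False using n i by simp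
    qed
    have hj: "prime (h j)" "h j \<noteq> 3" "h j dvd t j" using h[OF jP] Qodd[of "h j"] by auto
    have "0 < t j" using t9[of j] j by simp
    then obtain a m where am: "t j = 3 ^ a * m" "0 < m" "\<forall>p. prime p \<longrightarrow> p dvd m \<longrightarrow> p \<in> {h j}"
      using smooth_decomposition[of 3 "t j" "{h j}"] only hj by auto
    then obtain b where b: "m = h j ^ b" using pure_prime_power[OF hj(1) am(2)] by auto
    have "1 \<le> b"
    proof (rule ccontr)
      assume "\<not> 1 \<le> b"
      then have "t j = 3 ^ a" using am(1) b by simp
      then have "h j dvd 3" using hj prime_dvd_power by metis
      then have "h j \<le> 3" by (rule dvd_imp_le) simp
      then show False using h[OF jP] Qodd[of "h j"] by simp
    qed
    moreover have "a = 0 \<or> a = 1 \<and> (j = j0 + 3 \<or> j0 = j + 3)"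
    proof (cases "a = 0")
      case False
      have jj: "j0 \<in> J" "j \<in> J" "j \<noteq> j0" using j j0 subP by auto
      have nn: "9 dvd t j0" using nine[of j0] j0 by simp
      have "a = 1"
      proof (rule ccontr)
        assume "a \<noteq> 1"
        then have "3 ^ 2 dvd (3::nat) ^ a" using False by (intro le_imp_power_dvd) simp
        then have "9 dvd t j" using am(1) by simp
        then show False using uniq[of 9 j j0] nn jj by simp
      qed
      have "3 dvd t j" using am(1) \<open>a = 1\<close> by simp
      moreover have "3 dvd t j0" using nn by (rule dvd_trans[rotated]) simp
      ultimately have "3 dvd j - j0 \<and> j0 < j \<or> 3 dvd j0 - j \<and> j < j0"
        using diff[of 3 j j0] jj by simp
      then have "j = j0 + 3 \<or> j0 = j + 3"
        using small[OF jj(1)] small[OF jj(2)] by presburger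
      then show ?thesis using \<open>a = 1\<close> by blast
    qed simp
    ultimately show ?thesis using am(1) b by blast
  qed
  have "j0 \<in> J" "\<exists>a\<ge>2. t j0 = 3 ^ a" using j0 subP pure[of j0] by auto
  moreover have "inj_on h (J - {j0})" "h ` (J - {j0}) \<subseteq> Q" using inj im j0 by auto
  ultimately show "\<exists>j0\<in>J. \<exists>g. inj_on g (J - {j0}) \<and> g ` (J - {j0}) \<subseteq> Q \<and> (\<exists>a\<ge>2. N - 2 * j0 = 3 ^ a)
      \<and> (\<forall>j\<in>J - {j0}. \<exists>a b. 1 \<le> b \<and> N - 2 * j = 3 ^ a * g j ^ b \<and> (a = 0 \<or> a = 1 \<and> (j = j0 + 3 \<or> j0 = j + 3)))"
    using rest unfolding t_def by blast
qed

section \<open>Exponential equations solved by congruences\<close>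

lemma power_mod_cycle:
  fixes b m :: nat
  assumes "b ^ T mod m = 1 mod m"
  shows "b ^ n mod m = b ^ (n mod T) mod m"
proof -
  have "b ^ n = (b ^ T) ^ (n div T) * b ^ (n mod T)"
    by (metis power_add power_mult mult_div_mod_eq)
  moreover have "(b ^ T) ^ (n div T) mod m = 1 mod m"
    by (metis assms power_mod power_one)
  ultimately show ?thesis by (metis mod_mult_left_eq mult_1)
qed

lemma mod_add_cong:
  fixes x m :: nat
  assumes "x mod m = r"
  shows "(x + k) mod m = (r + k) mod m"
  using assms by (metis mod_add_left_eq)

lemma pow3_mod8: "(3::nat) ^ n mod 8 = (if even n then 1 else 3)"
  using power_mod_cycle[of 3 2 8 n] by (cases "even n") (simp_all add: mod_2_eq_odd)

lemma pow5_mod8: "(5::nat) ^ n mod 8 = (if even n then 1 else 5)"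
  using power_mod_cycle[of 5 2 8 n] by (cases "even n") (simp_all add: mod_2_eq_odd)

lemma pow7_mod16: "(7::nat) ^ n mod 16 = (if even n then 1 else 7)"
  using power_mod_cycle[of 7 2 16 n] by (cases "even n") (simp_all add: mod_2_eq_odd)

lemma pow7_mod8: "(7::nat) ^ n mod 8 = (if even n then 1 else 7)"
  using power_mod_cycle[of 7 2 8 n] by (cases "even n") (simp_all add: mod_2_eq_odd)

lemma pow11_mod8: "(11::nat) ^ n mod 8 = (if even n then 1 else 3)"
  using power_mod_cycle[of 11 2 8 n] by (cases "even n") (simp_all add: mod_2_eq_odd)

lemma pow13_mod8: "(13::nat) ^ n mod 8 = (if even n then 1 else 5)"
  using power_mod_cycle[of 13 2 8 n] by (cases "even n") (simp_all add: mod_2_eq_odd)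

lemma pow7_mod3: "(7::nat) ^ n mod 3 = 1"
  using power_mod_cycle[of 7 1 3 n] by simp

lemma pow5_mod3: "(5::nat) ^ n mod 3 = (if even n then 1 else 2)"
  using power_mod_cycle[of 5 2 3 n] by (cases "even n") (simp_all add: mod_2_eq_odd)

lemma mod4_cases: "(n::nat) mod 4 = 0 \<or> n mod 4 = 1 \<or> n mod 4 = 2 \<or> n mod 4 = 3"
  by presburger

lemma pow3_mod5: "(3::nat) ^ n mod 5 = (if n mod 4 = 0 then 1 else if n mod 4 = 1 then 3 else if n mod 4 = 2 then 4 else 2)"
  using power_mod_cycle[of 3 4 5 n] mod4_cases[of n] by (elim disjE) (simp_all add: power3_eq_cube power2_eq_square)

lemma pow7_mod5: "(7::nat) ^ n mod 5 = (if n mod 4 = 0 then 1 else if n mod 4 = 1 then 2 else if n mod 4 = 2 then 4 else 3)"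
  using power_mod_cycle[of 7 4 5 n] mod4_cases[of n] by (elim disjE) (simp_all add: power3_eq_cube power2_eq_square)

lemma pow7_mod25: "(7::nat) ^ n mod 25 \<noteq> 22"
  using power_mod_cycle[of 7 4 25 n] mod4_cases[of n] by (elim disjE) (simp_all add: power3_eq_cube power2_eq_square)

lemma pow7_mod32: "(7::nat) ^ n mod 32 = 23 \<Longrightarrow> n mod 4 = 3"
  using power_mod_cycle[of 7 4 32 n] mod4_cases[of n] by (elim disjE) (simp_all add: power3_eq_cube power2_eq_square)

lemma three_dvd_power: "(1::nat) \<le> a \<Longrightarrow> 3 dvd (3::nat) ^ a"
  by (intro dvd_power) simp

lemma nine_dvd_power: "(2::nat) \<le> a \<Longrightarrow> 9 dvd (3::nat) ^ a"
  using le_imp_power_dvd[of 2 a "3::nat"] by simp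

lemma eight_dvd_power: "(3::nat) \<le> m \<Longrightarrow> 8 dvd (2::nat) ^ m"
  using le_imp_power_dvd[of 3 m "2::nat"] by simp

text \<open>Powers of 3 are 1 or 3 modulo 8, so 8 never divides \<open>3^c + 1\<close>.\<close>

lemma two_power_eq_3: "(2::nat) ^ m = 3 ^ c + 1 \<Longrightarrow> (2::nat) ^ m \<le> 4"
proof -
  assume e: "(2::nat) ^ m = 3 ^ c + 1"
  have "m < 3"
  proof (rule ccontr)
    assume "\<not> m < 3"
    then have "8 dvd (2::nat) ^ m" by (intro eight_dvd_power) simp
    then have "(3 ^ c + 1) mod 8 = (0::nat)" using e by simp
    moreover have "(3::nat) ^ c mod 8 = 1 \<or> (3::nat) ^ c mod 8 = 3" using pow3_mod8[of c] by (cases "even c") simp_all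
    ultimately show False using mod_add_cong[of "3 ^ c" 8 1 1] mod_add_cong[of "3 ^ c" 8 3 1] by auto
  qed
  then have "m = 0 \<or> m = 1 \<or> m = 2" by linarith
  then show ?thesis by auto
qed

text \<open>Powers of 7 are 1 or 7 modulo 16, so 16 never divides \<open>7^c + 1\<close>.\<close>

lemma two_power_eq_7: "(2::nat) ^ m = 7 ^ c + 1 \<Longrightarrow> (2::nat) ^ m \<le> 8"
proof -
  assume e: "(2::nat) ^ m = 7 ^ c + 1"
  have "m < 4"
  proof (rule ccontr)
    assume "\<not> m < 4"
    then have "16 dvd (2::nat) ^ m" using le_imp_power_dvd[of 4 m "2::nat"] by simp
    then have "(7 ^ c + 1) mod 16 = (0::nat)" using e by simp
    moreover have "(7::nat) ^ c mod 16 = 1 \<or> (7::nat) ^ c mod 16 = 7" using pow7_mod16[of c] by (cases "even c") simp_all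
    ultimately show False using mod_add_cong[of "7 ^ c" 16 1 1] mod_add_cong[of "7 ^ c" 16 7 1] by auto
  qed
  then have "m = 0 \<or> m = 1 \<or> m = 2 \<or> m = 3" by linarith
  then show ?thesis by auto
qed

text \<open>For \<open>b \<ge> 2\<close> the equation modulo 25 forces \<open>a\<close> to be 6
  modulo 20. As 3 has order 5 modulo 11, \<open>3^a\<close> is then 3 modulo 11, a value that
  \<open>5^b + 4\<close> never takes.\<close>

lemma three_power_eq_5: "(3::nat) ^ a = 5 ^ b + 4 \<Longrightarrow> b \<le> 1"
proof (rule ccontr)
  assume e: "(3::nat) ^ a = 5 ^ b + 4" and "\<not> b \<le> 1"
  then have "25 dvd (5::nat) ^ b" using le_imp_power_dvd[of 2 b "5::nat"] by simp
  then have "(5::nat) ^ b mod 25 = 0" by simp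
  then have m: "(3::nat) ^ a mod 25 = 4" using mod_add_cong[of "5 ^ b" 25 0 4] e by simp
  then have "(3::nat) ^ a mod 5 = 4" using mod_mod_cancel[of 5 25 "(3::nat) ^ a"] by simp
  then have a4: "a mod 4 = 2" using pow3_mod5[of a] mod4_cases[of a] by auto
  define q where "q = a div 4"
  have a: "a = 4 * q + 2" using a4 unfolding q_def by presburger
  have "(3::nat) ^ a = 81 ^ q * 9" unfolding a power_add power_mult by simp
  moreover have "(81::nat) ^ q mod 25 = 81 ^ (q mod 5) mod 25" by (rule power_mod_cycle) simp
  ultimately have "(81 ^ (q mod 5) mod 25 * 9) mod 25 = (4::nat)" using m by (metis mod_mult_left_eq)
  moreover have "q mod 5 = 0 \<or> q mod 5 = 1 \<or> q mod 5 = 2 \<or> q mod 5 = 3 \<or> q mod 5 = 4" by presburger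
  ultimately have q1: "q mod 5 = 1" by (elim disjE) simp_all
  define r where "r = q div 5"
  have "a = 5 * (4 * r + 1) + 1" using a q1 unfolding r_def by presburger
  then have "a mod 5 = 1" by presburger
  then have three: "(3::nat) ^ a mod 11 = 3" using power_mod_cycle[of 3 5 11 a] by simp
  have "(5::nat) ^ b mod 11 = 5 ^ (b mod 5) mod 11" by (rule power_mod_cycle) simp
  moreover have "b mod 5 = 0 \<or> b mod 5 = 1 \<or> b mod 5 = 2 \<or> b mod 5 = 3 \<or> b mod 5 = 4" by presburger
  ultimately have "(5::nat) ^ b mod 11 \<in> {1, 5, 3, 4, 9}" by (elim disjE) simp_all
  moreover have "3 ^ a mod 11 = ((5::nat) ^ b mod 11 + 4) mod 11"
    using mod_add_cong[of "5 ^ b" 11 "5 ^ b mod 11" 4] e by simp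
  ultimately show False using three by auto
qed

text \<open>For \<open>a > 0\<close> reduction modulo 3 makes \<open>b\<close> even; then the left
  side is 1 modulo 8, while the right side is 5 or 7.\<close>

lemma five_power_eq_3: "(5::nat) ^ b = 3 ^ a + 4 \<Longrightarrow> a = 0"
proof (rule ccontr)
  assume e: "(5::nat) ^ b = 3 ^ a + 4" and "a \<noteq> 0"
  then have "3 dvd (3::nat) ^ a" by (intro three_dvd_power) simp
  then have "(3::nat) ^ a mod 3 = 0" by simp
  then have "(5::nat) ^ b mod 3 = 1" using mod_add_cong[of "3 ^ a" 3 0 4] e by simp
  then have "even b" using pow5_mod3[of b] by (cases "even b") simp_all
  then have "(5::nat) ^ b mod 8 = 1" using pow5_mod8[of b] by simp
  moreover have "((3::nat) ^ a + 4) mod 8 = 5 \<or> ((3::nat) ^ a + 4) mod 8 = 7"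
    using pow3_mod8[of a] mod_add_cong[of "3 ^ a" 8 "3 ^ a mod 8" 4] by (cases "even a") simp_all
  ultimately show False using e by simp
qed

text \<open>For \<open>b > 0\<close> the first equation modulo 5 gives \<open>a = 3\<close> modulo
  4. Then the second makes \<open>c\<close> odd when read modulo 8 and divisible by 4 when read
  modulo 5.\<close>

lemma no_powers_357: "(3::nat) ^ a = 5 ^ b + 2 \<Longrightarrow> (7::nat) ^ c = 3 ^ a + 4 \<Longrightarrow> b = 0"
proof (rule ccontr)
  assume e: "(3::nat) ^ a = 5 ^ b + 2" "(7::nat) ^ c = 3 ^ a + 4" and "b \<noteq> 0"
  then have "5 dvd (5::nat) ^ b" by (intro dvd_power) simp
  then have "(5::nat) ^ b mod 5 = 0" by simp
  then have m: "(3::nat) ^ a mod 5 = 2" using mod_add_cong[of "5 ^ b" 5 0 2] e(1) by simp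
  then have "a mod 4 = 3" using pow3_mod5[of a] mod4_cases[of a] by auto
  then have "odd a" by presburger
  then have "(3::nat) ^ a mod 8 = 3" using pow3_mod8[of a] by simp
  then have "(7::nat) ^ c mod 8 = 7" using mod_add_cong[of "3 ^ a" 8 3 4] e(2) by simp
  then have "odd c" using pow7_mod8[of c] by auto
  then have "c mod 4 \<noteq> 0" by presburger
  moreover have "(7::nat) ^ c mod 5 = 1" using mod_add_cong[of "3 ^ a" 5 2 4] e(2) m by simp
  ultimately show False using pow7_mod5[of c] mod4_cases[of c] by auto
qed

section \<open>The required prime for even n\<close>

lemma odd_prime_le_13:
  fixes p :: nat
  assumes "prime p" "odd p" "p \<le> 14"
  shows "p = 3 \<or> p = 5 \<or> p = 7 \<or> p = 11 \<or> p = 13"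
proof -
  have "p \<noteq> 9" using assms(1) by auto
  moreover have "1 < p" using assms(1) prime_gt_1_nat by blast
  moreover obtain q where q: "p = 2 * q + 1" using assms(2) by (rule oddE)
  moreover from this have "q = 0 \<or> q = 1 \<or> q = 2 \<or> q = 3 \<or> q = 4 \<or> q = 5 \<or> q = 6"
    using assms(3) by linarith
  ultimately show ?thesis by auto
qed

text \<open>Completes degrees 13 and 14, where the five lowest numbers of the window are consecutive
  odd numbers.\<close>

lemma prime_between_plus_8:
  fixes y :: nat
  assumes "13 \<le> y" "y \<le> 79"
  shows "\<exists>p. prime p \<and> 15 \<le> p \<and> y \<le> p \<and> p \<le> y + 8"
proof (rule ccontr)
  assume neg: "\<not> ?thesis"
  have step: "b < y" if "prime b" "15 \<le> b" "a < y" "b \<le> a + 9" for a b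
  proof (rule ccontr)
    assume "\<not> b < y"
    then have "prime b \<and> 15 \<le> b \<and> y \<le> b \<and> b \<le> y + 8" using that by linarith
    then show False using neg by blast
  qed
  have "12 < y" using assms by simp
  then have "17 < y" by (rule step[rotated 2]) simp_all
  then have "23 < y" by (rule step[rotated 2]) simp_all
  then have "31 < y" by (rule step[rotated 2]) simp_all
  then have "37 < y" by (rule step[rotated 2]) simp_all
  then have "43 < y" by (rule step[rotated 2]) simp_all
  then have "47 < y" by (rule step[rotated 2]) simp_all
  then have "53 < y" by (rule step[rotated 2]) simp_all
  then have "61 < y" by (rule step[rotated 2]) simp_all
  then have "67 < y" by (rule step[rotated 2]) simp_all
  then have "73 < y" by (rule step[rotated 2]) simp_all
  then have "79 < y" by (rule step[rotated 2]) simp_all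
  then show False using assms by simp
qed

text \<open>\<open>d\<close> is the degree of a hypothetical factor and \<open>s = n/2\<close>. The
  index \<open>l = s - 1\<close> is absent because \<open>n - 1\<close> cancels against the
  Vandermonde factor. In the excluded case \<open>2s + 1\<close> is the only number at disposal, and
  its prime 3 is below 4.\<close>

lemma even_case_prime_factor:
  fixes s d :: nat
  assumes s: "1 \<le> s" and d: "1 \<le> d" "d \<le> s + 1" and exc: "\<not> (d = 4 \<and> (\<exists>a. 2 * s + 1 = 3 ^ a))"
  shows "\<exists>p l. prime p \<and> odd p \<and> d \<le> p \<and> p dvd 2 * l + 1 \<and> (l = s \<or> l + 2 \<le> s \<and> s + 1 \<le> l + (d + 1) div 2)"
proof (rule ccontr)
  assume neg: "\<not> ?thesis"
  define N where "N = 2 * s + 1"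
  define e where "e = (d + 1) div 2"
  have oddN: "odd N" unfolding N_def by simp
  \<comment> \<open>The index \<open>j = s - l\<close> counts from the top: the admissible values
    are 0 and \<open>2, ..., e - 1\<close>.\<close>
  have sm: "odd p \<and> p < d" if "prime p" "p dvd N - 2 * j" "j = 0 \<or> 2 \<le> j \<and> j < e" "j \<le> s" for p j
  proof -
    have N: "N - 2 * j = 2 * (s - j) + 1" using that(4) unfolding N_def by simp
    then have odd: "odd p" using that(2) by (metis dvd_trans even_add even_mult_iff odd_one even_numeral)
    have "s - j = s \<or> (s - j) + 2 \<le> s \<and> s + 1 \<le> (s - j) + (d + 1) div 2"
      using that(3,4) unfolding e_def by linarith
    then have "\<not> d \<le> p" using neg that(1,2) odd unfolding N by blast
    then show ?thesis using odd by simp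
  qed
  have window: "p = 3 \<or> p \<in> Q" if "prime p" "p dvd N - 2 * j" "j = 0 \<or> 2 \<le> j \<and> j < e" "j \<le> s"
    "d \<le> 15" "{5,7,11,13} \<inter> {..<d} \<subseteq> Q" for p j Q
    using odd_prime_le_13[OF that(1)] sm[OF that(1-4)] that(5,6) by auto
  consider "d \<le> 3" | "d = 4" | "d = 5 \<or> d = 6" | "d = 7" | "d = 8" | "d = 9 \<or> d = 10" | "11 \<le> d \<and> d \<le> 14" | "15 \<le> d"
  proof -
    have "d \<le> 3 \<or> d = 4 \<or> (d = 5 \<or> d = 6) \<or> d = 7 \<or> d = 8 \<or> (d = 9 \<or> d = 10) \<or> (11 \<le> d \<and> d \<le> 14) \<or> 15 \<le> d"
      by presburger
    then show ?thesis using that by blast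
  qed
  then show False
  proof cases
    case 1
    have "N \<noteq> 1" using s unfolding N_def by simp
    then obtain p where p: "prime p" "p dvd N" using prime_factor_nat by blast
    then have "odd p" "p < 3" using sm[of p 0] 1 by auto
    then show False using prime_ge_2_nat[OF p(1)] by (cases "p = 2") auto
  next
    case 2
    have "\<exists>a. N = 3 ^ a"
    proof (rule pure_prime_power)
      fix p :: nat assume p: "prime p" "p dvd N"
      then have "odd p" "p < 4" using sm[of p 0] 2 by auto
      then show "p = 3" using odd_prime_le_13[OF p(1)] by auto
    qed (auto simp: N_def)
    then show False using exc 2 unfolding N_def by blast
  next
    case 3
    have e: "e = 3" using 3 unfolding e_def by auto
    \<comment> \<open>The counting lemma requires all terms to be at least 9, here
      \<open>s \<ge> 6\<close>. For \<open>s = 4\<close> and \<open>s = 5\<close> the primes 5 and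
      11 are visible directly.\<close>
    consider "s = 4" | "s = 5" | "6 \<le> s" using 3 d by linarith
    then show False
    proof cases
      case 1
      have "odd (5::nat) \<and> 5 < d" by (rule sm[of 5 2]) (simp_all add: N_def 1 e)
      then show False using 1 3 d by simp
    next
      case 2
      have "odd (11::nat) \<and> 11 < d" by (rule sm[of 11 0]) (simp_all add: N_def 2 e)
      then show False using 3 by simp
    next
      case 6: 3
      define Q where "Q = (if d = 5 then {} else {5::nat})"
      have smooth: "p = 3 \<or> p \<in> Q" if "prime p" "j \<in> {0, 2}" "p dvd N - 2 * j" for p j
        using that 3 6 e by (intro window[of p j]) (auto simp: Q_def)
      have J: "{0, 2} \<subseteq> {..<5::nat}" "\<And>j. j \<in> {0, 2} \<Longrightarrow> 2 * j + 9 \<le> N"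
        using 6 unfolding N_def by auto
      have Q: "finite Q" "\<And>q. q \<in> Q \<Longrightarrow> prime q \<and> 5 \<le> q" unfolding Q_def by (auto split: if_splits)
      have sw1: "card {0, 2::nat} \<le> card Q + 1"
        by (rule smooth_window(1)[OF J oddN _ _ smooth]) (use Q in auto)
      have sw2: "\<exists>j0\<in>{0, 2}. \<exists>g. inj_on g ({0, 2} - {j0}) \<and> g ` ({0, 2} - {j0}) \<subseteq> Q \<and> (\<exists>a\<ge>2. N - 2 * j0 = 3 ^ a)
        \<and> (\<forall>j\<in>{0, 2} - {j0}. \<exists>a b. 1 \<le> b \<and> N - 2 * j = 3 ^ a * g j ^ b \<and> (a = 0 \<or> a = 1 \<and> (j = j0 + 3 \<or> j0 = j + 3)))"
        if "card {0, 2::nat} = card Q + 1"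
        by (rule smooth_window(2)[OF J oddN _ _ smooth]) (use Q that in auto)
      show False
      proof (cases "d = 5")
        case True
        then show False using sw1 by (simp add: Q_def)
      next
        case False
        then have Q5: "Q = {5}" unfolding Q_def by simp
        obtain j0 g where j0: "j0 \<in> {0, 2}" "g ` ({0, 2} - {j0}) \<subseteq> Q" "\<exists>a\<ge>2. N - 2 * j0 = 3 ^ a"
          "\<forall>j\<in>{0, 2} - {j0}. \<exists>a b. 1 \<le> b \<and> N - 2 * j = 3 ^ a * g j ^ b \<and> (a = 0 \<or> a = 1 \<and> (j = j0 + 3 \<or> j0 = j + 3))"
        proof -
          have "card {0, 2::nat} = card Q + 1" using Q5 by simp
          from sw2[OF this] show thesis using that by blast
        qed
        obtain a where a: "2 \<le> a" "N - 2 * j0 = 3 ^ a" using j0(3) by blast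
        \<comment> \<open>\<open>N\<close> and \<open>N - 4\<close> are a power of 3 and a power of
          5 in one of the two orders, which gives \<open>3^a = 5^b + 4\<close> or
          \<open>5^b = 3^a + 4\<close>.\<close>
        have "j0 = 0 \<or> j0 = 2" using j0(1) by simp
        then show False
        proof
          assume z: "j0 = 0"
          then have "2 \<in> {0, 2} - {j0}" by simp
          then have "g 2 \<in> Q" using j0(2) by blast
          then have g2: "g 2 = 5" using Q5 by simp
          have "2 \<in> {0, 2} - {j0}" using z by simp
          from bspec[OF j0(4) this] obtain b where "N - 4 = 5 ^ b" using z g2 by auto
          then have b: "(3::nat) ^ a = 5 ^ b + 4" using a z 6 unfolding N_def by simp
          then have "b = 0 \<or> b = 1" using three_power_eq_5 by fastforce
          then have "N \<le> 9" using a z b by auto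
          then show False using 6 unfolding N_def by simp
        next
          assume z: "j0 = 2"
          then have m: "0 \<in> {0, 2} - {j0}" by simp
          then have "g 0 \<in> Q" using j0(2) by blast
          then have g0: "g 0 = 5" using Q5 by simp
          from m have "0 \<in> {0, 2} - {j0}" .
          from bspec[OF j0(4) this] obtain b where "N = 5 ^ b" using z g0 by auto
          then have b: "(5::nat) ^ b = 3 ^ a + 4" using a z 6 unfolding N_def by simp
          then show False using five_power_eq_3[OF b] a by simp
        qed
      qed
    qed
  next
    case 4
    have e: "e = 4" using 4 unfolding e_def by simp
    consider "s = 6" | "7 \<le> s" using 4 d by linarith
    then show False
    proof cases
      case 1
      have "odd (13::nat) \<and> 13 < d" by (rule sm[of 13 0]) (simp_all add: N_def 1 e)
      then show False using 4 by simp
    next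
      case 2
      have smooth: "p = 3 \<or> p \<in> {5}" if "prime p" "j \<in> {0, 2, 3}" "p dvd N - 2 * j" for p j
        using that 2 4 e by (intro window[of p j]) auto
      have J: "{0, 2, 3} \<subseteq> {..<5::nat}" "\<And>j. j \<in> {0, 2, 3} \<Longrightarrow> 2 * j + 9 \<le> N"
        using 2 unfolding N_def by auto
      \<comment> \<open>Three terms, but only the prime 5 besides 3.\<close>
      have "card {0, 2, 3::nat} \<le> card {5::nat} + 1"
        by (rule smooth_window(1)[OF J oddN _ _ smooth]) auto
      then show False by simp
    qed
  next
    case 5
    have e: "e = 4" using 5 unfolding e_def by simp
    have s7: "7 \<le> s" using 5 d by simp
    have smooth: "p = 3 \<or> p \<in> {5, 7}" if "prime p" "j \<in> {0, 2, 3}" "p dvd N - 2 * j" for p j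
      using that s7 5 e by (intro window[of p j]) auto
    have J: "{0, 2, 3} \<subseteq> {..<5::nat}" "\<And>j. j \<in> {0, 2, 3} \<Longrightarrow> 2 * j + 9 \<le> N"
      using s7 unfolding N_def by auto
    have "\<exists>j0\<in>{0, 2, 3}. \<exists>g. inj_on g ({0, 2, 3} - {j0}) \<and> g ` ({0, 2, 3} - {j0}) \<subseteq> {5, 7} \<and> (\<exists>a\<ge>2. N - 2 * j0 = 3 ^ a)
      \<and> (\<forall>j\<in>{0, 2, 3} - {j0}. \<exists>a b. 1 \<le> b \<and> N - 2 * j = 3 ^ a * g j ^ b \<and> (a = 0 \<or> a = 1 \<and> (j = j0 + 3 \<or> j0 = j + 3)))"
      by (rule smooth_window(2)[OF J oddN _ _ smooth]) auto
    then obtain j0 g where j0: "j0 \<in> {0, 2, 3}" "inj_on g ({0, 2, 3} - {j0})" "g ` ({0, 2, 3} - {j0}) \<subseteq> {5, 7}"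
      "\<exists>a\<ge>2. N - 2 * j0 = 3 ^ a"
      and rest: "\<forall>j\<in>{0, 2, 3} - {j0}. \<exists>a b. 1 \<le> b \<and> N - 2 * j = 3 ^ a * g j ^ b \<and> (a = 0 \<or> a = 1 \<and> (j = j0 + 3 \<or> j0 = j + 3))"
      by blast
    have gQ: "g j = 5 \<or> g j = 7" if "j \<in> {0, 2, 3} - {j0}" for j using j0(3) that by blast
    obtain a where a: "2 \<le> a" "N - 2 * j0 = 3 ^ a" using j0(4) by blast
    have N15: "15 \<le> N" using s7 unfolding N_def by simp
    have "(3::nat) ^ a mod 3 = 0" using three_dvd_power[of a] a(1) by simp
    note a3 = mod_add_cong[OF this]
    \<comment> \<open>Of the terms \<open>N\<close>, \<open>N - 4\<close>, \<open>N - 6\<close> one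
      is a power of 3 and the others belong to 5 and 7. Only \<open>N\<close> and
      \<open>N - 6\<close> are at index distance 3, so only there can an additional factor 3
      appear.\<close>
    consider "j0 = 0" | "j0 = 2" | "j0 = 3" using j0(1) by auto
    then show False
    proof cases
      case 1
      have "2 \<in> {0, 2, 3} - {j0}" using 1 by simp
      from bspec[OF rest this] obtain b where b: "1 \<le> b" "N - 4 = g 2 ^ b" using 1 by auto
      have "g 2 = 5 \<or> g 2 = 7" using 1 by (intro gQ) simp
      then show False
      proof
        assume "g 2 = 5"
        then have e3: "(3::nat) ^ a = 5 ^ b + 4" using a b 1 N15 by simp
        then have "b = 1" using three_power_eq_5[OF e3] b(1) by simp
        then show False using e3 a 1 N15 by simp
      next
        assume "g 2 = 7"
        then have "(3::nat) ^ a = 7 ^ b + 4" using a b 1 N15 by simp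
        then show False using mod_add_cong[OF pow7_mod3[of b], of 4] \<open>(3::nat) ^ a mod 3 = 0\<close> by simp
      qed
    next
      case 2
      have m: "0 \<in> {0, 2, 3} - {j0}" "3 \<in> {0, 2, 3} - {j0}" using 2 by simp_all
      from bspec[OF rest m(1)] obtain b where b: "1 \<le> b" "N = g 0 ^ b" using 2 by auto
      from bspec[OF rest m(2)] obtain c where c: "1 \<le> c" "N - 6 = g 3 ^ c" using 2 by auto
      have g: "g 0 = 5 \<or> g 0 = 7" "g 3 = 5 \<or> g 3 = 7" "g 0 \<noteq> g 3"
        using gQ[OF m(1)] gQ[OF m(2)] inj_onD[OF j0(2) _ m] by auto
      show False
      proof (cases "g 0 = 5")
        case True
        then have e5: "(5::nat) ^ b = 3 ^ a + 4" using a b 2 N15 by simp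
        then show False using five_power_eq_3[OF e5] a by simp
      next
        case False
        then have "g 0 = 7" "g 3 = 5" using g by auto
        then have "(3::nat) ^ a = 5 ^ c + 2" "(7::nat) ^ b = 3 ^ a + 4" using a b c 2 N15 by simp_all
        then show False using no_powers_357 c(1) by fastforce
      qed
    next
      case 3
      have m: "2 \<in> {0, 2, 3} - {j0}" "0 \<in> {0, 2, 3} - {j0}" using 3 by simp_all
      from bspec[OF rest m(1)] obtain b where b: "1 \<le> b" "N - 4 = g 2 ^ b" using 3 by auto
      from bspec[OF rest m(2)] obtain a' c where c: "1 \<le> c" "N = 3 ^ a' * g 0 ^ c" "a' = 0 \<or> a' = 1"
        using 3 by auto
      have g: "g 0 = 5 \<or> g 0 = 7" "g 2 = 5 \<or> g 2 = 7" "g 0 \<noteq> g 2"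
        using gQ[OF m(1)] gQ[OF m(2)] inj_onD[OF j0(2) _ m] by auto
      have N6: "N = 3 ^ a + 6" "N - 4 = 3 ^ a + 2" using a 3 N15 by simp_all
      show False
      proof (cases "g 2 = 7")
        case True
        then have "(7::nat) ^ b = 3 ^ a + 2" using b N6 by simp
        then show False using a3[of 2] pow7_mod3[of b] by simp
      next
        case False
        then have g0: "g 0 = 7" using g by auto
        have nine: "(3::nat) ^ a mod 9 = 0" using nine_dvd_power[OF a(1)] by simp
        from c(3) show False
        proof
          assume "a' = 0"
          then have "(7::nat) ^ c = 3 ^ a + 6" using c g0 N6 by simp
          then show False using a3[of 6] pow7_mod3[of c] by simp
        next
          assume "a' = 1"
          then have "3 * (7::nat) ^ c = 3 ^ a + 6" using c g0 N6 by simp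
          then have "3 * (7::nat) ^ c mod 9 = 6" using mod_add_cong[OF nine, of 6] by simp
          moreover have "3 * (7::nat) ^ c mod 9 = 3 * ((7::nat) ^ c mod 3)"
            using mult_mod_right[of 3 "(7::nat) ^ c" 3] by simp
          ultimately show False using pow7_mod3[of c] by simp
        qed
      qed
    qed
  next
    case 6
    have e: "e = 5" using 6 unfolding e_def by auto
    have s8: "8 \<le> s" using 6 d by auto
    have smooth: "p = 3 \<or> p \<in> {5, 7}" if "prime p" "j \<in> {0, 2, 3, 4}" "p dvd N - 2 * j" for p j
      using that s8 6 e by (intro window[of p j]) auto
    have J: "{0, 2, 3, 4} \<subseteq> {..<5::nat}" "\<And>j. j \<in> {0, 2, 3, 4} \<Longrightarrow> 2 * j + 9 \<le> N"
      using s8 unfolding N_def by auto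
    have "card {0, 2, 3, 4::nat} \<le> card {5, 7::nat} + 1"
      by (rule smooth_window(1)[OF J oddN _ _ smooth]) auto
    then show False by simp
  next
    case 7
    \<comment> \<open>For \<open>11 \<le> d \<le> 14\<close> the window has \<open>e - 1\<close>
      terms against \<open>e - 2\<close> odd primes up to \<open>2e\<close>, so the removal argument
      keeps a term and bounds \<open>y\<close> by 22 or 78; the values left are checked by
      exhibiting primes.\<close>
    define y where "y = N - 2 * (e - 1)"
    have e: "e = 6 \<or> e = 7" using 7 unfolding e_def by auto
    have se: "2 * e \<le> s + 2" using d unfolding e_def by linarith
    have y: "odd y" "2 * e - 1 \<le> y" unfolding y_def N_def using se e by auto
    have yj: "y + 2 * j = N - 2 * (e - 1 - j)" if "j < e" for j
      using that se unfolding y_def N_def by simp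
    \<comment> \<open>Counted upwards from \<open>y\<close>, the gap of the window sits at
      \<open>e - 2\<close>.\<close>
    define J where "J = {..<e} - {e - 2}"
    have sm': "odd p \<and> p < d" if "prime p" "j \<in> J" "p dvd y + 2 * j" for p j
    proof (rule sm[OF that(1)])
      have "j < e" "j \<noteq> e - 2" using that(2) unfolding J_def by auto
      then show "p dvd N - 2 * (e - 1 - j)" "e - 1 - j = 0 \<or> 2 \<le> e - 1 - j \<and> e - 1 - j < e" "e - 1 - j \<le> s"
        using that(3) yj se e by auto
    qed
    have "y ^ (card J - card (odd_primes_le (2 * e))) \<le> odd_part_fact (e - 1)"
    proof (rule power_le_odd_part_fact[OF _ y(1)])
      show "J \<subseteq> {..<e}" unfolding J_def by blast
      show "p \<le> 2 * e" if "prime p" "j \<in> J" "p dvd y + 2 * j" for p j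
        using sm'[OF that] unfolding e_def by linarith
    qed
    moreover have "card (odd_primes_le (2 * e)) \<le> e - 2"
      using e
    proof
      assume "e = 6"
      then show ?thesis using card_odd_primes_le_small[of 12] by (simp add: small_primes_def)
    next
      assume "e = 7"
      then show ?thesis using card_odd_primes_le_small[of 14] by (simp add: small_primes_def)
    qed
    moreover have "card J = e - 1" unfolding J_def using e by auto
    ultimately have "1 \<le> card J - card (odd_primes_le (2 * e))" using e by linarith
    then have "y ^ 1 \<le> y ^ (card J - card (odd_primes_le (2 * e)))"
      using y(1) by (intro power_increasing) (auto simp: Suc_le_eq odd_pos)
    with \<open>y ^ (card J - card (odd_primes_le (2 * e))) \<le> odd_part_fact (e - 1)\<close>
    have "y ^ 1 \<le> odd_part_fact (e - 1)" by linarith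
    then have y_le: "y \<le> odd_part_fact (e - 1)" by simp
    from e show False
    proof
      assume e6: "e = 6"
      then have "y \<le> 22" using y_le odd_part_fact_le_div[of 5] by (simp add: fact_numeral)
      moreover have "11 \<le> y" using y(2) e6 by simp
      ultimately have yc: "y = 11 \<or> y = 13 \<or> y = 15 \<or> y = 17 \<or> y = 19 \<or> y = 21"
        using y(1) by presburger
      have d12: "d \<le> 12" using e6 unfolding e_def by linarith
      have np: "\<not> prime (y + 2 * j)" if "j \<in> {0, 1, 2, 3}" "13 \<le> y + 2 * j" for j
        using sm'[of "y + 2 * j" j] that d12 e6 unfolding J_def by auto
      from yc show False using np[of 0] np[of 1] np[of 2] np[of 3] by (elim disjE) simp_all
    next
      assume e7: "e = 7"
      then have "y \<le> 78" using y_le odd_part_fact_le_div[of 6] by (simp add: fact_numeral)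
      moreover have "13 \<le> y" using y(2) e7 by simp
      ultimately obtain p where p: "prime p" "15 \<le> p" "y \<le> p" "p \<le> y + 8" using prime_between_plus_8[of y] by auto
      have "odd p" using prime_odd_nat[OF p(1)] p(2) by simp
      define j where "j = (p - y) div 2"
      have "p = y + 2 * j" unfolding j_def using \<open>odd p\<close> y(1) p(3) by presburger
      then have "odd p \<and> p < d" using p e7 by (intro sm'[of p j]) (auto simp: J_def)
      then show False using p(2) 7 by simp
    qed
  next
    case 8
    \<comment> \<open>The top term and the gap are dropped; what remains is an unbroken progression
      of \<open>e - 2\<close> odd numbers.\<close>
    define k where "k = e - 2"
    define y where "y = 2 * (s + 1 - e) + 1"
    have e8: "8 \<le> e" "2 * e \<le> s + 2" "d \<le> 2 * e" using 8 d unfolding e_def by linarith+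
    have "6 \<le> k" "odd y" "2 * k + 3 \<le> y" using e8 unfolding k_def y_def by auto
    then obtain p j where p: "prime p" "2 * k + 3 < p" "j < k" "p dvd y + 2 * j"
      using exists_large_prime_factor by blast
    have "y + 2 * j = N - 2 * (e - 1 - j)" using p(3) e8 unfolding y_def N_def k_def by simp
    then have "odd p \<and> p < d" using p e8 unfolding k_def by (intro sm[of p "e - 1 - j"]) auto
    moreover have "2 * e - 1 < p" using p(2) e8 unfolding k_def by linarith
    ultimately show False using e8 by linarith
  qed
qed

section \<open>The required prime for odd n\<close>

lemma dvd_half_odd:
  fixes q s j :: nat
  assumes "q dvd s" "q dvd (2 * s - 1) - 2 * j" "2 * j + 1 \<le> 2 * s"
  shows "q dvd 2 * j + 1"
proof -
  have "2 * s = ((2 * s - 1) - 2 * j) + (2 * j + 1)" using assms(3) by simp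
  moreover have "q dvd 2 * s" using assms(1) by simp
  ultimately show ?thesis using assms(2) by (metis dvd_add_right_iff)
qed

lemma power_two_3:
  fixes s :: nat
  assumes "s = 2 ^ i" "2 * s = 3 ^ a + 1"
  shows "s \<le> 2"
  using two_power_eq_3[of "Suc i" a] assms by simp

lemma power_two_7:
  fixes s :: nat
  assumes "s = 2 ^ i" "2 * s = 7 ^ a + 1"
  shows "s \<le> 4"
  using two_power_eq_7[of "Suc i" a] assms by simp

lemma odd_if_5:
  fixes s :: nat
  assumes "2 * s = 5 ^ b + 1"
  shows "odd s"
proof
  assume "even s"
  then obtain r where "s = 2 * r" by blast
  then have "5 ^ b + 1 = 4 * r" using assms by simp
  then have "(5 ^ b + 1) mod 4 = (0::nat)" by (simp only: mod_mult_self1_is_0)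
  moreover have "(5::nat) ^ b mod 4 = 1" using power_mod_cycle[of 5 1 4 b] by simp
  ultimately show False using mod_add_cong[of "5 ^ b" 4 1 1] by simp
qed

lemma power_two_5:
  fixes s :: nat
  assumes "s = 2 ^ i" "2 * s = 5 ^ b + 1"
  shows "s = 1"
  using odd_if_5[OF assms(2)] assms(1) by simp

text \<open>Degrees 5 and 6. The numbers \<open>s\<close>, \<open>2s - 1\<close>,
  \<open>2s - 3\<close> are pairwise coprime except for a possible common 3 of \<open>s\<close> and
  \<open>2s - 3\<close>. So few primes are available to each, and every branch ends in an equation
  between prime powers.\<close>

lemma odd_case_contradiction_6:
  fixes s :: nat
  assumes s: "6 \<le> s"
    and tp: "\<And>p j. prime p \<Longrightarrow> j \<le> 1 \<Longrightarrow> p dvd (2 * s - 1) - 2 * j \<Longrightarrow> p \<in> {3, 5, 7}"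
    and sp: "\<And>p. prime p \<Longrightarrow> p dvd s \<Longrightarrow> p \<in> {2, 3, 5}"
  shows False
proof -
  define u v where "u = 2 * s - 1" and "v = (2 * s - 1) - 2 * 1"
  have uv: "u = v + 2" "2 * s = u + 1" "2 * s = v + 3" "9 \<le> v" using s unfolding u_def v_def by auto
  have up: "p \<in> {3, 5, 7}" if "prime p" "p dvd u" for p using tp[of p 0] that unfolding u_def by simp
  have vp: "p \<in> {3, 5, 7}" if "prime p" "p dvd v" for p by (rule tp[OF that(1) order_refl that(2)[unfolded v_def]])
  have su: "q dvd 1" if "q dvd s" "q dvd u" for q using dvd_half_odd[of q s 0] that s unfolding u_def by simp
  have sv: "q dvd 3" if "q dvd s" "q dvd v" for q using dvd_half_odd[of q s 1] that s unfolding v_def by (simp add: numeral_3_eq_3)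
  have cop: "q dvd 2" if "q dvd u" "q dvd v" for q
    using that uv(1) by (metis dvd_add_right_iff)
  have pure_u: "\<exists>a. u = q ^ a" if "prime q" "\<And>p. p \<in> {3, 5, 7} \<Longrightarrow> p \<noteq> q \<Longrightarrow> \<not> p dvd u" for q
  proof (rule pure_prime_power[OF that(1)])
    show "0 < u" using uv by simp
    show "p = q" if "prime p" "p dvd u" for p
      using up[OF that] \<open>\<And>p. p \<in> {3, 5, 7} \<Longrightarrow> p \<noteq> q \<Longrightarrow> \<not> p dvd u\<close>[of p] that(2) by metis
  qed
  have pure_v: "\<exists>a. v = q ^ a" if "prime q" "\<And>p. p \<in> {3, 5, 7} \<Longrightarrow> p \<noteq> q \<Longrightarrow> \<not> p dvd v" for q
  proof (rule pure_prime_power[OF that(1)])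
    show "0 < v" using uv by simp
    show "p = q" if "prime p" "p dvd v" for p
      using vp[OF that] \<open>\<And>p. p \<in> {3, 5, 7} \<Longrightarrow> p \<noteq> q \<Longrightarrow> \<not> p dvd v\<close>[of p] that(2) by metis
  qed
  have s_pow2: "\<exists>i. s = 2 ^ i" if "\<not> 3 dvd s" "\<not> 5 dvd s"
  proof (rule pure_prime_power)
    show "p = 2" if "prime p" "p dvd s" for p
      using sp[OF that] that(2) \<open>\<not> 3 dvd s\<close> \<open>\<not> 5 dvd s\<close> by auto
  qed (use s in simp_all)
  have seven_odd: False if "v = 7 ^ h" "8 dvd 2 * s" for h
  proof -
    have "8 dvd 7 ^ h + (3::nat)" using that(2) unfolding uv(3) that(1) .
    then have "(7 ^ h + 3) mod 8 = (0::nat)" by simp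
    moreover have "(7::nat) ^ h mod 8 = 1 \<or> (7::nat) ^ h mod 8 = 7" using pow7_mod8[of h] by (cases "even h") simp_all
    ultimately show False using mod_add_cong[of "7 ^ h" 8 1 3] mod_add_cong[of "7 ^ h" 8 7 3] by auto
  qed
  have pow2_8: "8 dvd 2 * s" if "s = 2 ^ i" for i
  proof -
    have "3 \<le> Suc i"
    proof (rule ccontr)
      assume "\<not> 3 \<le> Suc i"
      then have "i = 0 \<or> i = 1" by linarith
      then show False using that s by auto
    qed
    then show ?thesis using eight_dvd_power[of "Suc i"] that by simp
  qed
  show False
  proof (cases "3 dvd v")
    case v3: True
    have s3: "3 dvd s"
    proof -
      have "3 dvd v + 3" using v3 by simp
      then have "3 dvd 2 * s" using uv(3) by simp
      then show ?thesis by (simp add: coprime_dvd_mult_right_iff)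
    qed
    have u3: "\<not> 3 dvd u" using su[of 3] s3 by auto
    show False
    proof (cases "7 dvd u")
      case False
      then obtain f where f: "u = 5 ^ f" using pure_u[of 5] u3 by auto
      then have odd_s: "odd s" using odd_if_5[of s f] uv by simp
      have "u \<noteq> 1" using uv by simp
      then have "f \<noteq> 0" using f by (cases f) auto
      then have u5: "5 dvd u" unfolding f by simp
      have s5: "\<not> 5 dvd s" using su[of 5] u5 by auto
      have "\<exists>b. s = 3 ^ b"
      proof (rule pure_prime_power)
        fix p :: nat assume p: "prime p" "p dvd s"
        then have "p \<noteq> 2" using odd_s by auto
        then show "p = 3" using sp[OF p] s5 p by auto
      qed (use s in auto)
      then obtain b where b: "s = 3 ^ b" by blast
      have "2 \<le> b"
      proof (rule ccontr)
        assume "\<not> 2 \<le> b"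
        then have "b = 0 \<or> b = 1" by linarith
        then show False using b s by auto
      qed
      define b' where "b' = b - 2"
      have b': "b = Suc (Suc b')" using \<open>2 \<le> b\<close> unfolding b'_def by simp
      \<comment> \<open>\<open>v = 2s - 3 = 2 * 3^b - 3\<close> equals \<open>3w\<close>, where
        \<open>w\<close> is 2 modulo 3; this is incompatible with \<open>w\<close> being a power of
        7.\<close>
      define w where "w = 6 * 3 ^ b' - (1::nat)"
      have w: "v = 3 * w" "w + 1 = 6 * 3 ^ b'" using uv(3) b b' unfolding w_def by simp_all
      have "\<exists>g. w = 7 ^ g"
      proof (rule pure_prime_power)
        show "0 < w" using w uv by simp
        fix p :: nat assume p: "prime p" "p dvd w"
        then have "p \<in> {3, 5, 7}" using vp[of p] w by simp
        moreover have "p \<noteq> 3"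
        proof
          assume "p = 3"
          then have "3 dvd w + 1" "3 dvd w" using p w by simp_all
          then have "3 dvd (1::nat)" using dvd_add_right_iff by blast
          then show False by simp
        qed
        moreover have "p \<noteq> 5" using cop[of 5] u5 p w by auto
        ultimately show "p = 7" by simp
      qed simp
      then obtain g where "w = 7 ^ g" by blast
      then have "(7 ^ g + 1) mod 3 = (0::nat)" using w by simp
      then show False using mod_add_cong[OF pow7_mod3[of g], of 1] by simp
    next
      case u7: True
      have v7: "\<not> 7 dvd v" using cop[of 7] u7 by auto
      show False
      proof (cases "5 dvd u")
        case True
        then have "\<not> 5 dvd v" "\<not> 5 dvd s" using cop[of 5] su[of 5] by auto
        then obtain c where c: "v = 3 ^ c" using pure_v[of 3] v7 by auto
        have "2 \<le> c"
        proof (rule ccontr)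
          assume "\<not> 2 \<le> c"
          then have "c = 0 \<or> c = 1" by linarith
          then show False using c uv by auto
        qed
        then have v9: "9 dvd v" using nine_dvd_power c by simp
        then have "\<not> 9 dvd s" using sv[of 9] by auto
        \<comment> \<open>Dividing \<open>2s = 3^c + 3\<close> by 3 leaves
          \<open>2r = 3^(c - 1) + 1\<close>, where \<open>r\<close> turns out to be a power of
          2.\<close>
        obtain r where r: "s = 3 * r" using s3 by blast
        have "\<not> 3 dvd r" using \<open>\<not> 9 dvd s\<close> r by auto
        have "\<exists>i. r = 2 ^ i"
        proof (rule pure_prime_power)
          show "0 < r" using r s by simp
          fix p :: nat assume p: "prime p" "p dvd r"
          then have "p \<in> {2, 3, 5}" "p \<noteq> 3" "p \<noteq> 5"
            using sp[of p] r \<open>\<not> 3 dvd r\<close> \<open>\<not> 5 dvd s\<close> by auto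
          then show "p = 2" by simp
        qed simp
        then obtain i where i: "r = 2 ^ i" by blast
        obtain c' where c': "c = Suc c'" using \<open>2 \<le> c\<close> by (cases c) auto
        have "2 * r = 3 ^ c' + 1" using uv(3) r c c' by simp
        then have "r \<le> 2" using power_two_3[OF i] by blast
        then have "s = 6" using r s by linarith
        then have "u = 11" using uv by simp
        then show False using up[of 11] by simp
      next
        case False
        then obtain g where "u = 7 ^ g" using pure_u[of 7] u3 by auto
        then have "2 * s mod 3 = 2" using uv(2) mod_add_cong[OF pow7_mod3[of g], of 1] by simp
        then show False using s3 by auto
      qed
    qed
  next
    case v3: False
    have s3: "\<not> 3 dvd s"
    proof
      assume "3 dvd s"
      then have "3 dvd 3 + v" using uv(3) by (metis add.commute dvd_mult)
      then have "3 dvd v" by simp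
      then show False using v3 by simp
    qed
    show False
    proof (cases "5 dvd u \<or> 5 dvd v")
      case True
      have "\<not> 5 dvd s" using True su[of 5] sv[of 5] by auto
      then obtain i where i: "s = 2 ^ i" using s_pow2 s3 by blast
      have s8: "8 dvd 2 * s" by (rule pow2_8[OF i])
      show False
      proof (cases "5 dvd v")
        case False
        then obtain h where "v = 7 ^ h" using pure_v[of 7] v3 by auto
        then show False using seven_odd s8 by blast
      next
        case v5: True
        have u5: "\<not> 5 dvd u" using cop[of 5] v5 by auto
        show False
        proof (cases "7 dvd u")
          case False
          then obtain c where "u = 3 ^ c" using pure_u[of 3] u5 by auto
          then show False using power_two_3[OF i, of c] uv s by simp
        next
          case u7: True
          have "\<not> 7 dvd v" using cop[of 7] u7 by auto
          then obtain f where f: "v = 5 ^ f" using pure_v[of 5] v3 by auto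
          show False
          proof (cases "3 dvd u")
            case False
            then obtain g where "u = 7 ^ g" using pure_u[of 7] u5 by auto
            then show False using power_two_7[OF i, of g] uv s by simp
          next
            case u3: True
            have "odd f"
            proof
              assume "even f"
              then have "(5::nat) ^ f mod 8 = 1" using pow5_mod8[of f] by simp
              then have "2 * s mod 8 = 4" using mod_add_cong[of "5 ^ f" 8 1 3] uv(3) f by simp
              then show False using s8 by simp
            qed
            then have "(5::nat) ^ f mod 3 = 2" using pow5_mod3[of f] by simp
            then have "u mod 3 = 1" using mod_add_cong[of "5 ^ f" 3 2 2] uv(1) f by simp
            then show False using u3 by simp
          qed
        qed
      qed
    next
      case False
      show False
      proof (cases "7 dvd v")
        case v7: True
        then obtain h where h: "v = 7 ^ h" using pure_v[of 7] v3 False by auto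
        \<comment> \<open>\<open>2s = 7^h + 3\<close> is divisible neither by 8 nor by 25, and
          \<open>s\<close> has no primes but 2 and 5, so \<open>s\<close> divides 10.\<close>
        have s8: "\<not> 8 dvd 2 * s" using seven_odd h by blast
        have s25: "\<not> 25 dvd s"
        proof
          assume "25 dvd s"
          then have "25 dvd 2 * s" by simp
          then have z: "(v + 3) mod 25 = 0" unfolding uv(3) by simp
          have "v mod 25 = 22" using mod_add_cong[OF z, of 22] by simp
          then show False using pow7_mod25[of h] h by simp
        qed
        obtain i m where im: "s = 2 ^ i * m" "0 < m" "\<forall>p. prime p \<longrightarrow> p dvd m \<longrightarrow> p \<in> {3, 5}"
          using smooth_decomposition[of 2 s "{3, 5}"] sp s by auto
        have "\<exists>k. m = 5 ^ k"
        proof (rule pure_prime_power)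
          fix p :: nat assume p: "prime p" "p dvd m"
          then have "p \<in> {3, 5}" "p \<noteq> 3" using im s3 by auto
          then show "p = 5" by simp
        qed (use im in auto)
        then obtain k where k: "m = 5 ^ k" by blast
        have "k < 2"
        proof (rule ccontr)
          assume "\<not> k < 2"
          then have "25 dvd m" using le_imp_power_dvd[of 2 k "5::nat"] k by simp
          then show False using s25 im by simp
        qed
        moreover have "i < 2"
        proof (rule ccontr)
          assume "\<not> i < 2"
          then have "8 dvd (2::nat) ^ Suc i" by (intro eight_dvd_power) simp
          then have "8 dvd 2 * s" using im(1) by simp
          then show False using s8 by simp
        qed
        ultimately have "k = 0 \<or> k = 1" "i = 0 \<or> i = 1" by linarith+
        then have "s = 10" using im(1) k s by auto
        then have "u = 19" using uv by simp
        then show False using up[of 19] by simp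
      next
        case v7: False
        then have "\<exists>a. v = 3 ^ a" using pure_v[of 3] False by auto
        then obtain a where "v = 3 ^ a" by blast
        then have "a \<noteq> 0" using uv by (cases a) auto
        then show False using v3 \<open>v = 3 ^ a\<close> by simp
      qed
    qed
  qed
qed

lemma smooth_window_full:
  fixes s n :: nat and Q :: "nat set"
  assumes n: "n \<le> 5" "2 * n + 8 \<le> 2 * s" and Q: "finite Q" "\<And>q. q \<in> Q \<Longrightarrow> prime q \<and> 5 \<le> q"
    and smooth: "\<And>p j. prime p \<Longrightarrow> j < n \<Longrightarrow> p dvd (2 * s - 1) - 2 * j \<Longrightarrow> p = 3 \<or> p \<in> Q"
  shows "n \<le> card Q + 1"
    and "n = card Q + 1 \<Longrightarrow> \<exists>j0<n. \<exists>g. inj_on g ({..<n} - {j0}) \<and> g ` ({..<n} - {j0}) \<subseteq> Q \<and> (\<exists>a\<ge>2. (2 * s - 1) - 2 * j0 = 3 ^ a)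
      \<and> (\<forall>j. j < n \<longrightarrow> j \<noteq> j0 \<longrightarrow> (\<exists>a b. 1 \<le> b \<and> (2 * s - 1) - 2 * j = 3 ^ a * g j ^ b \<and> (a = 0 \<or> a = 1 \<and> (j = j0 + 3 \<or> j0 = j + 3))))"
proof -
  have J: "{..<n} \<subseteq> {..<5}" "\<And>j. j \<in> {..<n} \<Longrightarrow> 2 * j + 9 \<le> 2 * s - 1" using n by auto
  have odd: "odd (2 * s - 1)" using n by simp
  have sm: "p = 3 \<or> p \<in> Q" if "prime p" "j \<in> {..<n}" "p dvd (2 * s - 1) - 2 * j" for p j
    using smooth[OF that(1) _ that(3)] that(2) by simp
  have "card {..<n} \<le> card Q + 1" by (rule smooth_window(1)[OF J odd Q(1) _ sm]) (use Q in auto)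
  then show "n \<le> card Q + 1" by simp
  assume "n = card Q + 1"
  then have c: "card {..<n} = card Q + 1" by simp
  have "\<exists>j0\<in>{..<n}. \<exists>g. inj_on g ({..<n} - {j0}) \<and> g ` ({..<n} - {j0}) \<subseteq> Q \<and> (\<exists>a\<ge>2. (2 * s - 1) - 2 * j0 = 3 ^ a)
      \<and> (\<forall>j\<in>{..<n} - {j0}. \<exists>a b. 1 \<le> b \<and> (2 * s - 1) - 2 * j = 3 ^ a * g j ^ b \<and> (a = 0 \<or> a = 1 \<and> (j = j0 + 3 \<or> j0 = j + 3)))"
    by (rule smooth_window(2)[OF J odd Q(1) _ sm c]) (use Q in auto)
  then obtain j0 g where j0: "j0 < n" and g: "inj_on g ({..<n} - {j0})" "g ` ({..<n} - {j0}) \<subseteq> Q"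
    and a: "\<exists>a\<ge>2. (2 * s - 1) - 2 * j0 = 3 ^ a"
    and r: "\<forall>j\<in>{..<n} - {j0}. \<exists>a b. 1 \<le> b \<and> (2 * s - 1) - 2 * j = 3 ^ a * g j ^ b \<and> (a = 0 \<or> a = 1 \<and> (j = j0 + 3 \<or> j0 = j + 3))"
    by blast
  have "\<exists>a b. 1 \<le> b \<and> (2 * s - 1) - 2 * j = 3 ^ a * g j ^ b \<and> (a = 0 \<or> a = 1 \<and> (j = j0 + 3 \<or> j0 = j + 3))"
    if "j < n" "j \<noteq> j0" for j
    using bspec[OF r, of j] that by simp
  then show "\<exists>j0<n. \<exists>g. inj_on g ({..<n} - {j0}) \<and> g ` ({..<n} - {j0}) \<subseteq> Q \<and> (\<exists>a\<ge>2. (2 * s - 1) - 2 * j0 = 3 ^ a)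
      \<and> (\<forall>j. j < n \<longrightarrow> j \<noteq> j0 \<longrightarrow> (\<exists>a b. 1 \<le> b \<and> (2 * s - 1) - 2 * j = 3 ^ a * g j ^ b \<and> (a = 0 \<or> a = 1 \<and> (j = j0 + 3 \<or> j0 = j + 3))))"
    using j0 g a by blast
qed

lemma dvd_power_ge_1:
  fixes q :: nat
  shows "1 \<le> b \<Longrightarrow> q dvd c * q ^ b"
  by (intro dvd_mult dvd_power) simp

text \<open>Degrees 7 and 8. The three terms use up 3, 5 and 7, one each, and a prime of term
  \<open>j\<close> can divide \<open>s\<close> only if it divides \<open>2j + 1\<close>. So
  \<open>s\<close> becomes a power of 2, a power of 3 or the number 10, unless a congruence modulo 3
  already fails.\<close>

lemma odd_case_contradiction_8:
  fixes s :: nat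
  assumes s: "7 \<le> s"
    and tp: "\<And>p j. prime p \<Longrightarrow> j < 3 \<Longrightarrow> p dvd (2 * s - 1) - 2 * j \<Longrightarrow> p \<in> {3, 5, 7}"
    and sp: "\<And>p. prime p \<Longrightarrow> p dvd s \<Longrightarrow> p \<in> {2, 3, 5, 7}"
  shows False
proof -
  define t where "t = (\<lambda>j. (2 * s - 1) - 2 * j)"
  have "\<exists>j0<3. \<exists>g. inj_on g ({..<3} - {j0}) \<and> g ` ({..<3} - {j0}) \<subseteq> {5, 7} \<and> (\<exists>a\<ge>2. (2 * s - 1) - 2 * j0 = 3 ^ a)
      \<and> (\<forall>j. j < 3 \<longrightarrow> j \<noteq> j0 \<longrightarrow> (\<exists>a b. 1 \<le> b \<and> (2 * s - 1) - 2 * j = 3 ^ a * g j ^ b \<and> (a = 0 \<or> a = 1 \<and> (j = j0 + 3 \<or> j0 = j + 3))))"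
    by (rule smooth_window_full(2)) (use s tp in auto)
  then obtain j0 g a where j0: "j0 < 3" and g: "inj_on g ({..<3} - {j0})" "g ` ({..<3} - {j0}) \<subseteq> {5, 7}"
    and a: "2 \<le> a" "t j0 = 3 ^ a"
    and r: "\<And>j. j < 3 \<Longrightarrow> j \<noteq> j0 \<Longrightarrow> \<exists>a b. 1 \<le> b \<and> t j = 3 ^ a * g j ^ b \<and> (a = 0 \<or> a = 1 \<and> (j = j0 + 3 \<or> j0 = j + 3))"
    unfolding t_def by blast
  have r': "\<exists>b\<ge>1. t j = g j ^ b" if "j < 3" "j \<noteq> j0" for j
    using r[OF that] that j0 by auto
  have gj: "g j = 5 \<or> g j = 7" if "j < 3" "j \<noteq> j0" for j using g(2) that by auto
  have gne: "g i \<noteq> g j" if "i < 3" "i \<noteq> j0" "j < 3" "j \<noteq> j0" "i \<noteq> j" for i j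
    using inj_onD[OF g(1), of i j] that by auto
  have t: "2 * s = t 0 + 1" "2 * s = t 1 + 3" "2 * s = t 2 + 5" using s unfolding t_def by simp_all
  have dv: "q dvd 2 * j + 1" if "q dvd s" "q dvd t j" "j < 3" for q j
    using dvd_half_odd[OF that(1), of j] that(2,3) s unfolding t_def by simp
  have nd: "\<not> q dvd s" if "t j = q ^ b" "1 \<le> b" "j < 3" "\<not> q dvd 2 * j + 1" for q j b
    using dv[of q j] that dvd_power_ge_1[of b q 1] by auto
  have pow2: "\<exists>i. s = 2 ^ i" if "\<not> 3 dvd s" "\<not> 5 dvd s" "\<not> 7 dvd s"
  proof (rule pure_prime_power)
    show "p = 2" if "prime p" "p dvd s" for p
      using sp[OF that] that(2) \<open>\<not> 3 dvd s\<close> \<open>\<not> 5 dvd s\<close> \<open>\<not> 7 dvd s\<close> by auto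
  qed (use s in simp_all)
  have a3: "3 dvd t j0" "9 dvd t j0" using a three_dvd_power[of a] nine_dvd_power[of a] by auto
  consider "j0 = 0" | "j0 = 1" | "j0 = 2" using j0 by linarith
  then show False
  proof cases
    case 1
    have s3: "\<not> 3 dvd s" using dv[of 3 0] a3 1 by auto
    obtain b where b: "1 \<le> b" "t 1 = g 1 ^ b" using r'[of 1] 1 by auto
    obtain c where c: "1 \<le> c" "t 2 = g 2 ^ c" using r'[of 2] 1 by auto
    show False
    proof (cases "g 1 = 5")
      case True
      then have g2: "g 2 = 7" using gj[of 2] gne[of 1 2] 1 by auto
      have "\<not> 5 dvd s" using nd[of 1 5 b] b True by simp
      moreover have "\<not> 7 dvd s" using nd[of 2 7 c] c g2 by simp
      ultimately obtain i where i: "s = 2 ^ i" using pow2 s3 by blast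
      show False using power_two_3[OF i, of a] t(1) a 1 s by simp
    next
      case False
      then have g1: "g 1 = 7" and g2: "g 2 = 5" using gj[of 1] gj[of 2] gne[of 1 2] 1 by auto
      have s7: "\<not> 7 dvd s" using nd[of 1 7 b] b g1 by simp
      \<comment> \<open>For \<open>c \<ge> 2\<close> the term \<open>t 2\<close> is divisible by 25;
        if \<open>s\<close> were too, then 25 would divide \<open>2 * 2 + 1\<close>.\<close>
      have "c \<noteq> 1"
      proof
        assume "c = 1"
        then have "t 2 = 5" using c g2 by simp
        then show False using t(3) s by simp
      qed
      then have "25 dvd t 2" using le_imp_power_dvd[of 2 c "5::nat"] c g2 by simp
      then have s25: "\<not> 25 dvd s" using dv[of 25 2] by auto
      obtain i m where im: "s = 2 ^ i * m" "0 < m" "\<forall>p. prime p \<longrightarrow> p dvd m \<longrightarrow> p \<in> {3, 5, 7}"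
        using smooth_decomposition[of 2 s "{3, 5, 7}"] sp s by auto
      have "\<exists>k. m = 5 ^ k"
      proof (rule pure_prime_power)
        show "p = 5" if "prime p" "p dvd m" for p
          using that im s3 s7 by auto
      qed (use im in auto)
      then obtain k where k: "m = 5 ^ k" by blast
      have "k < 2"
      proof (rule ccontr)
        assume "\<not> k < 2"
        then have "25 dvd m" using le_imp_power_dvd[of 2 k "5::nat"] k by simp
        then show False using s25 im by simp
      qed
      moreover have "i < 2"
      proof (rule ccontr)
        assume "\<not> i < 2"
        then have "8 dvd (2::nat) ^ Suc i" by (intro eight_dvd_power) simp
        then have "8 dvd 2 * s" using im(1) by simp
        then have "8 dvd 3 ^ a + (1::nat)" unfolding t(1) using a 1 by simp
        then have z: "(3 ^ a + 1) mod 8 = (0::nat)" by simp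
        have "(3::nat) ^ a mod 8 = 1 \<or> (3::nat) ^ a mod 8 = 3" using pow3_mod8[of a] by (cases "even a") simp_all
        then show False using z mod_add_cong[of "3 ^ a" 8 1 1] mod_add_cong[of "3 ^ a" 8 3 1] by auto
      qed
      ultimately have "k = 0 \<or> k = 1" "i = 0 \<or> i = 1" by linarith+
      then have "s = 10" using im(1) k s by auto
      then show False using tp[of 19 0] by simp
    qed
  next
    case 2
    have "3 dvd t 1 + 3" using a3 2 by simp
    then have "3 dvd 2 * s" unfolding t(2) .
    then have s3: "3 dvd s" by (simp add: coprime_dvd_mult_right_iff)
    have s9: "\<not> 9 dvd s" using dv[of 9 1] a3 2 by auto
    obtain b where b: "1 \<le> b" "t 0 = g 0 ^ b" using r'[of 0] 2 by auto
    obtain c where c: "1 \<le> c" "t 2 = g 2 ^ c" using r'[of 2] 2 by auto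
    show False
    proof (cases "g 0 = 5")
      case True
      then have g2: "g 2 = 7" using gj[of 2] gne[of 0 2] 2 by auto
      have s5: "\<not> 5 dvd s" using nd[of 0 5 b] b True by simp
      have s7: "\<not> 7 dvd s" using nd[of 2 7 c] c g2 by simp
      have "odd s" using odd_if_5[of s b] t(1) b True by simp
      have "\<exists>k. s = 3 ^ k"
      proof (rule pure_prime_power)
        show "p = 3" if "prime p" "p dvd s" for p
          using sp[OF that] that(2) s5 s7 \<open>odd s\<close> by auto
      qed (use s in simp_all)
      then obtain k where k: "s = 3 ^ k" by blast
      have "k < 2"
      proof (rule ccontr)
        assume "\<not> k < 2"
        then show False using s9 nine_dvd_power[of k] k by simp
      qed
      then have "k = 0 \<or> k = 1" by linarith
      then show False using k s by auto
    next
      case False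
      then have "g 0 = 7" using gj[of 0] 2 by auto
      then have "2 * s = 7 ^ b + 1" using t(1) b by simp
      then have "2 * s mod 3 = 2" using mod_add_cong[OF pow7_mod3[of b], of 1] by simp
      then show False using s3 by auto
    qed
  next
    case 3
    have s3: "\<not> 3 dvd s"
    proof
      assume "3 dvd s"
      moreover have "3 dvd t 2" using a3(1) 3 by simp
      ultimately have "3 dvd 2 * 2 + (1::nat)" by (rule dv) simp
      then show False by simp
    qed
    obtain b where b: "1 \<le> b" "t 0 = g 0 ^ b" using r'[of 0] 3 by auto
    obtain c where c: "1 \<le> c" "t 1 = g 1 ^ c" using r'[of 1] 3 by auto
    have n57: "\<not> 5 dvd s" "\<not> 7 dvd s"
      using gj[of 0] gj[of 1] gne[of 0 1] 3 nd[of 0 5 b] nd[of 1 7 c] nd[of 0 7 b] nd[of 1 5 c] b c by auto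
    then obtain i where i: "s = 2 ^ i" using pow2 s3 by blast
    have "g 0 = 5 \<or> g 0 = 7" using gj[of 0] 3 by simp
    then show False
    proof
      assume "g 0 = 5"
      then show False using power_two_5[OF i, of b] t(1) b s by simp
    next
      assume "g 0 = 7"
      then show False using power_two_7[OF i, of b] t(1) b s by simp
    qed
  qed
qed

text \<open>Modulo 8 the powers of 5 and 13 are 1 or 5, those of 7 are 1 or 7, those of 11 are 1 or
  3. So a residue other than 1 betrays the prime of a term.\<close>

lemma residue8:
  fixes q b :: nat
  assumes "q \<in> {5, 7, 11, 13}"
  shows "q ^ b mod 8 = 7 \<Longrightarrow> q = 7" and "q ^ b mod 8 = 5 \<Longrightarrow> q = 5 \<or> q = 13"
    and "q ^ b mod 8 = 3 \<Longrightarrow> q = 11" and "3 * q ^ b mod 8 = 7 \<Longrightarrow> q = 5 \<or> q = 13"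
proof -
  have c: "(q = 5 \<or> q = 13) \<and> (q ^ b mod 8 = 1 \<or> q ^ b mod 8 = 5) \<or> q = 7 \<and> (q ^ b mod 8 = 1 \<or> q ^ b mod 8 = 7)
    \<or> q = 11 \<and> (q ^ b mod 8 = 1 \<or> q ^ b mod 8 = 3)"
    using assms pow5_mod8[of b] pow7_mod8[of b] pow11_mod8[of b] pow13_mod8[of b] by (cases "even b") auto
  then show "q ^ b mod 8 = 7 \<Longrightarrow> q = 7" "q ^ b mod 8 = 5 \<Longrightarrow> q = 5 \<or> q = 13" "q ^ b mod 8 = 3 \<Longrightarrow> q = 11"
    by auto
  have "3 * q ^ b mod 8 = 3 * (q ^ b mod 8) mod 8" by (simp only: mod_mult_right_eq)
  then show "3 * q ^ b mod 8 = 7 \<Longrightarrow> q = 5 \<or> q = 13" using c by auto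
qed

lemma decomposition_2357:
  fixes s :: nat
  assumes "0 < s" "\<And>p. prime p \<Longrightarrow> p dvd s \<Longrightarrow> p \<in> {2, 3, 5, 7}"
  shows "\<exists>i \<alpha> \<beta> \<gamma>. s = 2 ^ i * (3 ^ \<alpha> * (5 ^ \<beta> * 7 ^ \<gamma>))"
proof -
  obtain i m where 1: "s = 2 ^ i * m" "0 < m" "\<forall>p. prime p \<longrightarrow> p dvd m \<longrightarrow> p \<in> {3, 5, 7}"
    using smooth_decomposition[of 2 s "{3, 5, 7}"] assms by auto
  obtain \<alpha> m' where 2: "m = 3 ^ \<alpha> * m'" "0 < m'" "\<forall>p. prime p \<longrightarrow> p dvd m' \<longrightarrow> p \<in> {5, 7}"
    using smooth_decomposition[of 3 m "{5, 7}"] 1 by auto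
  obtain \<beta> m'' where 3: "m' = 5 ^ \<beta> * m''" "0 < m''" "\<forall>p. prime p \<longrightarrow> p dvd m'' \<longrightarrow> p \<in> {7}"
    using smooth_decomposition[of 5 m' "{7}"] 2 by auto
  obtain \<gamma> where "m'' = 7 ^ \<gamma>" using pure_prime_power[of 7 m''] 3 by auto
  then show ?thesis using 1 2 3 by blast
qed

lemma exponent_le:
  fixes q :: nat
  assumes "\<not> q ^ Suc n dvd s" "q ^ k dvd s"
  shows "k \<le> n"
proof (rule ccontr)
  assume "\<not> k \<le> n"
  then have "q ^ Suc n dvd q ^ k" by (intro le_imp_power_dvd) simp
  then show False using assms dvd_trans by blast
qed

text \<open>Degrees 10 (\<open>n = 4\<close> terms) and 12 (\<open>n = 5\<close> terms), both in the
  case of equality of the counting. If 4 does not divide \<open>s\<close>, then \<open>s\<close>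
  divides 630 and finitely many values remain; otherwise the residues of the terms modulo 8 reveal
  which prime belongs to which term.\<close>

lemma odd_case_contradiction_large:
  fixes s n :: nat
  assumes c: "n = 4 \<and> Q = {5, 7, 11} \<and> 10 \<le> s \<or> n = 5 \<and> Q = {5, 7, 11, 13} \<and> 12 \<le> s"
    and tp: "\<And>p j. prime p \<Longrightarrow> j < n \<Longrightarrow> p dvd (2 * s - 1) - 2 * j \<Longrightarrow> p = 3 \<or> p \<in> Q"
    and sp: "\<And>p. prime p \<Longrightarrow> p dvd s \<Longrightarrow> p \<in> {2, 3, 5, 7} \<or> n = 5 \<and> p = 11"
  shows False
proof -
  define t where "t = (\<lambda>j. (2 * s - 1) - 2 * j)"
  have s: "10 \<le> s" and n: "4 \<le> n" "n \<le> 5" "2 * n + 8 \<le> 2 * s" "n = card Q + 1" using c by auto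
  have Q: "finite Q" "\<And>q. q \<in> Q \<Longrightarrow> prime q \<and> 5 \<le> q" using c by auto
  have Q4: "Q \<subseteq> {5, 7, 11, 13}" using c by auto
  have "\<exists>j0<n. \<exists>g. inj_on g ({..<n} - {j0}) \<and> g ` ({..<n} - {j0}) \<subseteq> Q \<and> (\<exists>a\<ge>2. (2 * s - 1) - 2 * j0 = 3 ^ a)
      \<and> (\<forall>j. j < n \<longrightarrow> j \<noteq> j0 \<longrightarrow> (\<exists>a b. 1 \<le> b \<and> (2 * s - 1) - 2 * j = 3 ^ a * g j ^ b \<and> (a = 0 \<or> a = 1 \<and> (j = j0 + 3 \<or> j0 = j + 3))))"
    by (rule smooth_window_full(2)[OF n(2,3) Q(1) _ _ n(4)]) (fact Q(2), fact tp)
  then obtain j0 g a where j0: "j0 < n" and g: "inj_on g ({..<n} - {j0})" "g ` ({..<n} - {j0}) \<subseteq> Q"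
    and a: "2 \<le> a" "t j0 = 3 ^ a"
    and r: "\<And>j. j < n \<Longrightarrow> j \<noteq> j0 \<Longrightarrow> \<exists>a b. 1 \<le> b \<and> t j = 3 ^ a * g j ^ b \<and> (a = 0 \<or> a = 1 \<and> (j = j0 + 3 \<or> j0 = j + 3))"
    unfolding t_def by blast
  have gQ: "g j \<in> Q" if "j < n" "j \<noteq> j0" for j using g(2) that by blast
  have g4: "g j \<in> {5, 7, 11, 13}" if "j < n" "j \<noteq> j0" for j using gQ[OF that] Q4 by blast
  have gne: "g i \<noteq> g j" if "i < n" "i \<noteq> j0" "j < n" "j \<noteq> j0" "i \<noteq> j" for i j
    using inj_onD[OF g(1), of i j] that by auto
  have t_ge: "2 * s = t j + (2 * j + 1)" if "j < 5" for j using s that unfolding t_def by simp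
  have dv: "q dvd 2 * j + 1" if "q dvd s" "q dvd t j" "j < 5" for q j
    using dvd_half_odd[OF that(1), of j] that(2,3) s unfolding t_def by simp
  have nd: "\<not> q dvd s" if "t j = q ^ b" "1 \<le> b" "j < 5" "\<not> q dvd 2 * j + 1" for q j b
    using dv[of q j] that dvd_power_ge_1[of b q 1] by auto
  have tn: "13 \<le> t j" if "j < n" for j using that c unfolding t_def by auto
  have "a \<noteq> 2"
  proof
    assume "a = 2"
    then show False using tn[OF j0] a by simp
  qed
  then have "3 ^ 3 dvd (3::nat) ^ a" using a(1) by (intro le_imp_power_dvd) simp
  then have a27: "27 dvd t j0" using a by simp
  have a3: "3 dvd t j0" using a27 by (rule dvd_trans[rotated]) simp
  have s3: "2 * j0 + 1 = 3 \<or> 2 * j0 + 1 = 9" if "3 dvd s"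
  proof -
    have "3 dvd 2 * j0 + 1" using dv[OF that a3] j0 n by simp
    moreover have "j0 = 0 \<or> j0 = 1 \<or> j0 = 2 \<or> j0 = 3 \<or> j0 = 4" using j0 n by linarith
    ultimately show ?thesis by auto
  qed
  have s27: "\<not> 27 dvd s"
  proof
    assume "27 dvd s"
    then have "27 dvd 2 * j0 + 1" using dv[OF _ a27] j0 n by simp
    then have "27 \<le> 2 * j0 + 1" by (rule dvd_imp_le) simp
    then show False using j0 n by linarith
  qed
  have own: "g j = q \<and> (\<exists>x b. 1 \<le> b \<and> t j = 3 ^ x * q ^ b \<and> (x = 0 \<or> x = 1 \<and> (j = j0 + 3 \<or> j0 = j + 3)))"
    if q: "prime q" "q \<noteq> 3" "q dvd t j" "j < n" for q j
  proof -
    have "j \<noteq> j0"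
    proof
      assume "j = j0"
      then have "q dvd 3" using q a prime_dvd_power[of q 3 a] by simp
      then show False using q primes_dvd_imp_eq[of q 3] by simp
    qed
    then obtain x b where xb: "1 \<le> b" "t j = 3 ^ x * g j ^ b" "x = 0 \<or> x = 1 \<and> (j = j0 + 3 \<or> j0 = j + 3)"
      using r[OF q(4)] by blast
    have "\<not> q dvd 3 ^ x" using q prime_dvd_power[of q 3 x] primes_dvd_imp_eq[of q 3] by auto
    then have "q dvd g j ^ b" using q xb(2) prime_dvd_mult_iff[of q] by auto
    then have "q dvd g j" using q prime_dvd_power by blast
    then have "g j = q" using primes_dvd_imp_eq[of q "g j"] q Q(2)[OF gQ[OF q(4) \<open>j \<noteq> j0\<close>]] by simp
    then show ?thesis using xb by blast
  qed
  have dvd_t: "q dvd t j" if "q dvd s" "2 * j + 1 = q" "j < 5" for q j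
  proof -
    have "q dvd t j + q" using t_ge[OF that(3)] that(1,2) by (metis dvd_mult)
    then show ?thesis by simp
  qed
  \<comment> \<open>If 5 divides \<open>s\<close>, term 2 is a power of 5 and, being at least 13, a
    multiple of 25; then 25 cannot divide \<open>s\<close> without dividing
    \<open>2 * 2 + 1\<close>. Term 3 plays the same part for 49.\<close>
  have s25: "\<not> 25 dvd s"
  proof
    assume s25: "25 dvd s"
    then have "5 dvd s" by (rule dvd_trans[rotated]) simp
    then have "5 dvd t 2" by (rule dvd_t) simp_all
    then obtain x b where xb: "1 \<le> b" "t 2 = 3 ^ x * 5 ^ b" "x = 0 \<or> x = 1 \<and> (2 = j0 + 3 \<or> j0 = 2 + 3)"
      using own[of 5 2] n by auto
    then have x: "x = 0" using j0 n by auto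
    have "b \<noteq> 1"
    proof
      assume "b = 1"
      then show False using tn[of 2] xb x n by simp
    qed
    then have "5 ^ 2 dvd (5::nat) ^ b" using xb(1) by (intro le_imp_power_dvd) simp
    then have "25 dvd t 2" using xb x by simp
    then have "25 dvd 2 * 2 + (1::nat)" using dv[OF s25, of 2] by simp
    then show False by simp
  qed
  have s49: "\<not> 49 dvd s"
  proof
    assume s49: "49 dvd s"
    then have "49 \<le> s" using s by (intro dvd_imp_le) simp_all
    from s49 have "7 dvd s" by (rule dvd_trans[rotated]) simp
    then have "7 dvd t 3" by (rule dvd_t) simp_all
    then obtain x b where xb: "1 \<le> b" "t 3 = 3 ^ x * 7 ^ b" "x = 0 \<or> x = 1"
      using own[of 7 3] n by auto
    have "b \<noteq> 1"
    proof
      assume "b = 1"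
      then have "t 3 \<le> 21" using xb by auto
      then show False using \<open>49 \<le> s\<close> unfolding t_def by simp
    qed
    then have "7 ^ 2 dvd (7::nat) ^ b" using xb(1) by (intro le_imp_power_dvd) simp
    then have "49 dvd t 3" using xb(2) by simp
    then have "49 dvd 2 * 3 + (1::nat)" using dv[OF s49, of 3] by simp
    then show False by simp
  qed
  have s11: "\<not> 11 dvd s"
  proof
    assume s11: "11 dvd s"
    then have n5: "n = 5" using sp[of 11] by simp
    have "card (g ` ({..<n} - {j0})) = card Q" using card_image[OF g(1)] n(4) j0 by simp
    then have "g ` ({..<n} - {j0}) = Q" using card_subset_eq[OF Q(1) g(2)] by simp
    moreover have "11 \<in> Q" using c by auto
    ultimately have "11 \<in> g ` ({..<n} - {j0})" by simp
    then obtain j where "j \<in> {..<n} - {j0}" "11 = g j" by (rule imageE)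
    then have j: "j < n" "j \<noteq> j0" "g j = 11" by simp_all
    then obtain x b where "1 \<le> b" "t j = 3 ^ x * 11 ^ b" using r[of j] by auto
    then have "11 dvd t j" using dvd_power_ge_1[of b 11 "3 ^ x"] by simp
    then have "11 dvd 2 * j + 1" using dv[OF s11, of j] j n by simp
    then have "11 \<le> 2 * j + 1" by (rule dvd_imp_le) simp
    then show False using j n by linarith
  qed
  have sp': "p \<in> {2, 3, 5, 7}" if "prime p" "p dvd s" for p using sp[OF that] that(2) s11 by auto
  show False
  proof (cases "4 dvd s")
    case False
    obtain i \<alpha> \<beta> \<gamma> where e: "s = 2 ^ i * (3 ^ \<alpha> * (5 ^ \<beta> * 7 ^ \<gamma>))"
      using decomposition_2357[of s] sp' s by auto
    have "i \<le> 1" by (rule exponent_le[of 2 1 s]) (use False e in auto)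
    moreover have "\<alpha> \<le> 2" by (rule exponent_le[of 3 2 s]) (use s27 e in auto)
    moreover have "\<beta> \<le> 1" by (rule exponent_le[of 5 1 s]) (use s25 e in auto)
    moreover have "\<gamma> \<le> 1" by (rule exponent_le[of 7 1 s]) (use s49 e in auto)
    ultimately have "i = 0 \<or> i = 1" "\<alpha> = 0 \<or> \<alpha> = 1 \<or> \<alpha> = 2" "\<beta> = 0 \<or> \<beta> = 1" "\<gamma> = 0 \<or> \<gamma> = 1"
      by linarith+
    \<comment> \<open>These are the divisors of \<open>630 = 2 * 3^2 * 5 * 7\<close>.\<close>
    then have mem: "s \<in> {1, 2, 3, 5, 6, 7, 9, 10, 14, 15, 18, 21, 30, 35, 42, 45, 63, 70, 90, 105, 126, 210, 315, 630}"
      using e by (elim disjE) simp_all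
    have p1259: "prime (1259::nat)" by (rule prime_if_no_small_factor) simp_all
    have bad: False if "prime p" "13 < p" "p dvd (2 * s - 1) - 2 * j" "j < 3" for p j
    proof -
      have "p = 3 \<or> p \<in> Q" by (rule tp[OF that(1) _ that(3)]) (use that(4) n in simp)
      then show False using that(2) Q4 by auto
    qed
    \<comment> \<open>For each remaining \<open>s \<ge> 10\<close> one of the first three terms has
      a prime factor above 13.\<close>
    have "s \<noteq> 15" by (rule notI, rule bad[where p = 29 and j = 0]) simp_all
    moreover have "s \<noteq> 21" by (rule notI, rule bad[where p = 41 and j = 0]) simp_all
    moreover have "s \<noteq> 35" by (rule notI, rule bad[where p = 67 and j = 1]) simp_all
    moreover have "s \<noteq> 45" by (rule notI, rule bad[where p = 89 and j = 0]) simp_all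
    moreover have "s \<noteq> 63" by (rule notI, rule bad[where p = 41 and j = 1]) simp_all
    moreover have "s \<noteq> 105" by (rule notI, rule bad[where p = 19 and j = 0]) simp_all
    moreover have "s \<noteq> 315" by (rule notI, rule bad[where p = 17 and j = 0]) simp_all
    moreover have "s \<noteq> 10" by (rule notI, rule bad[where p = 19 and j = 0]) simp_all
    moreover have "s \<noteq> 14" by (rule notI, rule bad[where p = 23 and j = 2]) simp_all
    moreover have "s \<noteq> 18" by (rule notI, rule bad[where p = 31 and j = 2]) simp_all
    moreover have "s \<noteq> 30" by (rule notI, rule bad[where p = 59 and j = 0]) simp_all
    moreover have "s \<noteq> 42" by (rule notI, rule bad[where p = 83 and j = 0]) simp_all
    moreover have "s \<noteq> 70" by (rule notI, rule bad[where p = 139 and j = 0]) simp_all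
    moreover have "s \<noteq> 90" by (rule notI, rule bad[where p = 179 and j = 0]) simp_all
    moreover have "s \<noteq> 126" by (rule notI, rule bad[where p = 251 and j = 0]) simp_all
    moreover have "s \<noteq> 210" by (rule notI, rule bad[where p = 419 and j = 0]) simp_all
    moreover have "s \<noteq> 630" using bad[OF p1259, of 0] by auto
    ultimately show False using mem s by auto
  next
    case four: True
    then obtain q where q: "s = 4 * q" by blast
    then have "3 \<le> q" using s by linarith
    define q' where "q' = q - 2"
    have q': "q = q' + 2" using \<open>3 \<le> q\<close> unfolding q'_def by simp
    have tm: "t 0 = 8 * (q' + 1) + 7" "t 1 = 8 * (q' + 1) + 5" "t 2 = 8 * (q' + 1) + 3" "t 4 = 8 * q' + 7"
      unfolding t_def q q' by simp_all
    \<comment> \<open>As 8 divides \<open>2s\<close>, term \<open>j\<close> is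
      \<open>-(2j + 1)\<close> modulo 8. A power of 3 is 1 or 3 modulo 8, which rules out the
      indices 0, 1 and 4 for it.\<close>
    have m0: "t 0 mod 8 = 7" and m1: "t 1 mod 8 = 5" and m2: "t 2 mod 8 = 3" and m4: "t 4 mod 8 = 7"
      unfolding tm by simp_all
    have three: "(3::nat) ^ a mod 8 = 1 \<or> (3::nat) ^ a mod 8 = 3" using pow3_mod8[of a] by (cases "even a") simp_all
    have e: "t j0 mod 8 = 1 \<or> t j0 mod 8 = 3" using three a(2) by simp
    have j01: "j0 \<noteq> 0" "j0 \<noteq> 1" "j0 \<noteq> 4"
      by (rule notI; use e m0 m1 m4 in simp)+
    obtain x1 b1 where t1: "1 \<le> b1" "t 1 = 3 ^ x1 * g 1 ^ b1" "x1 = 0" using r[of 1] j01 n by auto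
    have g1: "g 1 = 5 \<or> g 1 = 13" using residue8(2)[OF g4[of 1], of b1] m1 t1 j01 n by auto
    obtain x0 b0 where t0: "1 \<le> b0" "t 0 = 3 ^ x0 * g 0 ^ b0" "x0 = 0 \<or> x0 = 1 \<and> j0 = 3" using r[of 0] j01 n by auto
    have s3': "\<not> 3 dvd s" using s3 j01 by auto
    have pow2: "\<exists>i. s = 2 ^ i" if "\<not> 5 dvd s" "\<not> 7 dvd s"
    proof (rule pure_prime_power)
      show "p = 2" if "prime p" "p dvd s" for p
        using sp'[OF that] that(2) s3' \<open>\<not> 5 dvd s\<close> \<open>\<not> 7 dvd s\<close> by auto
    qed (use s in simp_all)
    have x0_0: "g 0 = 7" if "x0 = 0" using residue8(1)[OF g4[of 0], of b0] m0 t0 that j01 n by auto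
    have x0_1: "g 0 = 5 \<or> g 0 = 13" if "x0 = 1" using residue8(4)[OF g4[of 0], of b0] m0 t0 that j01 n by auto
    from c show False
    proof
      assume n4: "n = 4 \<and> Q = {5, 7, 11} \<and> 10 \<le> s"
      have "g 1 = 5" using g1 gQ[of 1] n4 j01 by auto
      moreover have "g 0 \<noteq> g 1" using gne[of 0 1] j01 n by auto
      moreover have "g 0 \<noteq> 13" using gQ[of 0] n4 j01 by auto
      ultimately have x: "x0 = 0" using x0_1 t0(3) by auto
      then have "t 0 = 7 ^ b0" using t0 x0_0 by simp
      then have e: "2 * s = 7 ^ b0 + 1" using t_ge[of 0] by simp
      have "\<not> 7 dvd s" using nd[of 0 7 b0] \<open>t 0 = 7 ^ b0\<close> t0 by simp
      moreover have "\<not> 5 dvd s" using nd[of 1 5 b1] t1 \<open>g 1 = 5\<close> by simp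
      ultimately obtain i where "s = 2 ^ i" using pow2 by blast
      then show False using power_two_7 e s by fastforce
    next
      assume n5: "n = 5 \<and> Q = {5, 7, 11, 13} \<and> 12 \<le> s"
      obtain b4 where t4: "1 \<le> b4" "t 4 = g 4 ^ b4" using r[of 4] j01 j0 n5 by auto
      have g4_7: "g 4 = 7" using residue8(1)[OF g4[of 4], of b4] m4 t4 j01 n5 by auto
      have "g 0 \<noteq> g 4" using gne[of 0 4] j01 j0 n5 by auto
      then have j3: "j0 = 3" using x0_0 g4_7 t0(3) by auto
      have t47: "t 4 = 7 ^ b4" using t4 g4_7 by simp
      have "\<not> 7 dvd s" using nd[of 4 7 b4] t47 t4 by simp
      moreover have "\<not> 5 dvd s"
      proof
        assume "5 dvd s"
        then have "5 dvd t 2" by (rule dvd_t) simp_all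
        then obtain x b where xb: "g 2 = 5" "t 2 = 3 ^ x * 5 ^ b" "x = 0"
          using own[of 5 2] n5 j3 by auto
        then show False using residue8(3)[of 5 b] m2 by simp
      qed
      ultimately obtain i where i: "s = 2 ^ i" using pow2 by blast
      \<comment> \<open>A power of 2 that is at least 12 is at least 16, so 32 divides
        \<open>2s = 7^b4 + 9\<close>. This fixes \<open>b4\<close> modulo 4 and would make
        \<open>3^a = 7^b4 + 2\<close> divisible by 5.\<close>
      have "4 \<le> i"
      proof (rule ccontr)
        assume "\<not> 4 \<le> i"
        then have "i = 0 \<or> i = 1 \<or> i = 2 \<or> i = 3" by linarith
        then show False using i n5 by auto
      qed
      then have "2 ^ 5 dvd (2::nat) ^ Suc i" by (intro le_imp_power_dvd) simp
      then have "32 dvd 2 * s" using i by simp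
      then have "32 dvd 7 ^ b4 + (9::nat)" using t_ge[of 4] t47 by simp
      then have "(7 ^ b4 + 9) mod 32 = (0::nat)" by simp
      then have "(7::nat) ^ b4 mod 32 = 23" using mod_add_cong[of "7 ^ b4 + 9" 32 0 23] by simp
      then have "(7::nat) ^ b4 mod 5 = 3" using pow7_mod32[of b4] pow7_mod5[of b4] by simp
      moreover have "3 ^ a = 7 ^ b4 + (2::nat)" using t_ge[of 3] t_ge[of 4] t47 a j3 by simp
      ultimately have "(3::nat) ^ a mod 5 = 0" using mod_add_cong[of "7 ^ b4" 5 3 2] by simp
      then show False using pow3_mod5[of a] by (simp split: if_splits)
    qed
  qed
qed

text \<open>If 3 does not divide \<open>s\<close>, then \<open>s\<close> is a power of 2 and,
  outside the easy cases, 15 divides \<open>2s - 1\<close>; hence \<open>2s = u^2\<close> with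
  \<open>u\<close> a power of 4, and the factors \<open>u - 1\<close> and \<open>u + 1\<close>
  separate 3 from 5. This leaves \<open>u = 4\<close>.\<close>

lemma odd_case_degree_4:
  fixes s :: nat
  assumes s: "4 \<le> s" and sp: "\<And>p. prime p \<Longrightarrow> p dvd s \<Longrightarrow> p \<in> {2, 3}"
    and tp: "\<And>p. prime p \<Longrightarrow> p dvd 2 * s - 1 \<Longrightarrow> p \<in> {3, 5}"
  shows "s = 8"
proof (cases "3 dvd s")
  case True
  have "\<not> 3 dvd 2 * s - 1"
  proof
    assume "3 dvd 2 * s - 1"
    then have "3 dvd 2 * 0 + (1::nat)" using True s by (intro dvd_half_odd[of 3 s 0]) auto
    then show False by simp
  qed
  then have "\<exists>b. 2 * s - 1 = 5 ^ b" using s tp by (intro pure_prime_power) auto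
  then obtain b where "2 * s - 1 = 5 ^ b" by blast
  then have b: "2 * s = 5 ^ b + 1" using s by linarith
  then have "odd s" by (rule odd_if_5)
  then have "\<exists>y. s = 3 ^ y" using s sp by (intro pure_prime_power) auto
  then obtain y where y: "s = 3 ^ y" by blast
  have "2 \<le> y"
  proof (rule ccontr)
    assume "\<not> 2 \<le> y"
    then have "y = 0 \<or> y = 1" by linarith
    then show False using y s by auto
  qed
  then have "9 dvd s" using y nine_dvd_power by simp
  then have "9 dvd 2 * s" by simp
  then have "(5 ^ b + 1) mod 9 = (0::nat)" using b by simp
  moreover have "b mod 6 = 0 \<or> b mod 6 = 1 \<or> b mod 6 = 2 \<or> b mod 6 = 3 \<or> b mod 6 = 4 \<or> b mod 6 = 5" by linarith
  \<comment> \<open>5 has order 6 modulo 9 and modulo 7, and its cube is -1 for both; so if 9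
    divides \<open>5^b + 1\<close>, then 7 does as well.\<close>
  moreover have 9: "(5::nat) ^ b mod 9 = 5 ^ (b mod 6) mod 9" and 7: "(5::nat) ^ b mod 7 = 5 ^ (b mod 6) mod 7"
    using power_mod_cycle[of 5 6 9 b] power_mod_cycle[of 5 6 7 b] by simp_all
  ultimately have z: "(5 ^ (b mod 6) mod 9 + 1) mod 9 = (0::nat)"
    and c6: "b mod 6 = 0 \<or> b mod 6 = 1 \<or> b mod 6 = 2 \<or> b mod 6 = 3 \<or> b mod 6 = 4 \<or> b mod 6 = 5"
    using mod_add_cong[OF 9, of 1] by (metis, blast)
  have "b mod 6 = 3" using c6 by (elim disjE) (use z in simp_all)
  then have "(5 ^ b + 1) mod 7 = (0::nat)" using mod_add_cong[OF 7, of 1] by simp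
  then have "7 dvd 2 * s" using b by (simp add: dvd_eq_mod_eq_0)
  then have "7 dvd s" by (simp add: coprime_dvd_mult_right_iff)
  then show ?thesis using sp[of 7] by simp
next
  case False
  then have "\<exists>x. s = 2 ^ x" using s sp by (intro pure_prime_power) auto
  then obtain x where x: "s = 2 ^ x" by blast
  obtain a m' where a: "2 * s - 1 = 3 ^ a * m'" "0 < m'" "\<forall>p. prime p \<longrightarrow> p dvd m' \<longrightarrow> p \<in> {5}"
    using smooth_decomposition[of 3 "2 * s - 1" "{5}"] s tp by auto
  have "\<exists>b. m' = 5 ^ b" using a by (intro pure_prime_power) auto
  then obtain b where b: "m' = 5 ^ b" by blast
  have e: "2 * s = 3 ^ a * 5 ^ b + 1" proof -
    have "2 * s - 1 = 3 ^ a * 5 ^ b" using a(1) b by simp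
    then show ?thesis using s by linarith
  qed
  have "a \<noteq> 0"
  proof
    assume "a = 0"
    then show False using power_two_5[OF x, of b] e s by simp
  qed
  moreover have "b \<noteq> 0"
  proof
    assume "b = 0"
    then show False using power_two_3[OF x, of a] e s by simp
  qed
  ultimately have "3 dvd (3::nat) ^ a" "5 dvd (5::nat) ^ b" by simp_all
  then have "3 * 5 dvd (3::nat) ^ a * 5 ^ b" by (rule mult_dvd_mono)
  then obtain c where c: "3 ^ a * 5 ^ b = 15 * (c::nat)" unfolding dvd_def by auto
  have "2 ^ Suc x mod 15 = (1::nat)" using e x c by simp
  moreover have "(2::nat) ^ Suc x mod 15 = 2 ^ (Suc x mod 4) mod 15" by (rule power_mod_cycle) simp
  ultimately have "Suc x mod 4 = 0" using mod4_cases[of "Suc x"] by (auto simp del: power_Suc)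
  then obtain m where m: "Suc x = 4 * m" by (metis dvd_def mod_0_imp_dvd)
  define u where "u = (2::nat) ^ (2 * m)"
  have m1: "1 \<le> m" using m by simp
  have u4: "u = 4 ^ m" unfolding u_def by (simp add: power_mult)
  have ul: "4 ^ 1 \<le> u" unfolding u4 using m1 by (intro power_increasing) auto
  have "2 * s = 2 ^ Suc x" using x by simp
  also have "\<dots> = u * u" unfolding m u_def by (simp flip: power_add)
  finally have su: "2 * s = u * u" .
  have "(u - 1) * (u + 1) = u * u - 1" using ul by (simp add: algebra_simps)
  then have prod: "2 * s - 1 = (u - 1) * (u + 1)" using su by simp
  have up: "p \<in> {3, 5}" if "prime p" "p dvd u + 1" for p
    using tp[OF that(1)] dvd_mult[OF that(2), of "u - 1"] unfolding prod by blast
  have um: "p \<in> {3, 5}" if "prime p" "p dvd u - 1" for p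
    using tp[OF that(1)] dvd_mult2[OF that(2), of "u + 1"] unfolding prod by blast
  have "u mod 3 = 1" using power_mod_cycle[of 4 1 3 m] unfolding u4 by simp
  then have "(u + 1) mod 3 = 2" using mod_add_cong[of u 3 1 1] by simp
  then have n3: "\<not> 3 dvd u + 1" by (simp add: dvd_eq_mod_eq_0)
  have "\<exists>c. u + 1 = 5 ^ c" using up n3 by (intro pure_prime_power) auto
  then obtain c where c: "u + 1 = 5 ^ c" by blast
  have "c \<noteq> 0" using c ul by (intro notI) simp
  then have five: "5 dvd u + 1" unfolding c by simp
  moreover have "4 \<le> u" using ul by simp
  ultimately have "\<not> 5 dvd u - 1" by presburger
  then have "\<exists>g. u - 1 = 3 ^ g" using um ul by (intro pure_prime_power) auto
  then obtain g where "u - 1 = 3 ^ g" by blast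
  then have "2 ^ (2 * m) = 3 ^ g + (1::nat)" using ul unfolding u_def by simp
  then have "u \<le> 4" unfolding u_def by (rule two_power_eq_3)
  then have "u = 4" using ul by simp
  then show ?thesis using su by simp
qed

text \<open>Here \<open>s = (n + 1)/2\<close>. For \<open>d \<le> 2\<close> no \<open>l\<close> is
  admissible, so a power of 2 offers no prime. For \<open>d = 4\<close> and \<open>s = 8\<close> the
  only odd number is 15, whose primes are below 6.\<close>

lemma odd_case_prime_factor:
  fixes s d :: nat
  assumes s: "3 \<le> s" and d: "1 \<le> d" "d \<le> s" and exc: "\<not> (d \<le> 2 \<and> (\<exists>k. s = 2 ^ k))" "\<not> (d = 4 \<and> s = 8)"
  shows "\<exists>p. prime p \<and> odd p \<and> (d + 2 \<le> p \<and> (\<exists>l. p dvd 2 * l + 1 \<and> l < s \<and> s + 1 \<le> l + (d + 1) div 2)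
      \<or> d + 1 \<le> p \<and> p dvd s)"
proof (rule ccontr)
  assume neg: "\<not> ?thesis"
  define e where "e = (d + 1) div 2"
  have sm: "odd p \<and> p \<le> d + 1" if "prime p" "p dvd (2 * s - 1) - 2 * j" "j + 2 \<le> e" "j < s" for p j
  proof -
    have N: "(2 * s - 1) - 2 * j = 2 * (s - 1 - j) + 1" using that(4) by simp
    then have odd: "odd p" using that(2) by (metis dvd_trans even_add even_mult_iff odd_one even_numeral)
    have "s - 1 - j < s \<and> s + 1 \<le> (s - 1 - j) + (d + 1) div 2"
      using that(3,4) s unfolding e_def by linarith
    then have "\<not> d + 2 \<le> p" using neg that(1,2) odd unfolding N by blast
    then show ?thesis using odd by simp
  qed
  have ss: "p = 2 \<or> odd p \<and> p \<le> d" if "prime p" "p dvd s" for p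
  proof (cases "p = 2")
    case False
    then have "odd p" using prime_odd_nat[OF that(1)] prime_ge_2_nat[OF that(1)] by simp
    moreover have "\<not> d + 1 \<le> p" using neg that \<open>odd p\<close> by blast
    ultimately show ?thesis by simp
  qed simp
  have t_in: "p = 3 \<or> p \<in> Q" if "prime p" "p dvd (2 * s - 1) - 2 * j" "j + 2 \<le> e" "j < s"
    "d \<le> 13" "{5, 7, 11, 13} \<inter> {..d + 1} \<subseteq> Q" for p j Q
    using odd_prime_le_13[OF that(1)] sm[OF that(1-4)] that(5,6) by auto
  have s_in: "p \<in> Q" if "prime p" "p dvd s" "d \<le> 13" "{3, 5, 7, 11, 13} \<inter> {..d} \<subseteq> Q" "2 \<in> Q" for p Q
    using odd_prime_le_13[OF that(1)] ss[OF that(1,2)] that(3-5) by auto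
  have "d \<le> 2 \<or> d = 3 \<or> d = 4 \<or> d = 5 \<or> d = 6 \<or> d = 7 \<or> d = 8 \<or> d = 9 \<or> d = 10 \<or> d = 11 \<or> d = 12 \<or> 13 \<le> d"
    using d(1) by presburger
  then consider "d \<le> 2" | "d = 3" | "d = 4" | "d = 5 \<or> d = 6" | "d = 7 \<or> d = 8" | "d = 9" | "d = 10" | "d = 11" | "d = 12" | "13 \<le> d"
    by blast
  then show False
  proof cases
    case 1
    then have "\<not> (\<exists>k. s = 2 ^ k)" using exc(1) by blast
    then obtain p where p: "prime p" "p dvd s" "p \<noteq> 2" using pure_prime_power[of 2 s] s by auto
    then have "odd p \<and> p \<le> d" using ss by blast
    then show False using 1 p(3) prime_ge_2_nat[OF p(1)] by auto
  next
    case 2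
    have "\<exists>a. 2 * s - 1 = 3 ^ a"
    proof (rule pure_prime_power)
      show "p = 3" if "prime p" "p dvd 2 * s - 1" for p
        using t_in[OF that(1), of 0 "{}"] that(2) 2 s unfolding e_def by auto
    qed (use s in simp_all)
    then obtain a where a: "2 * s - 1 = 3 ^ a" by blast
    then have a': "2 * s = 3 ^ a + 1" using s by linarith
    have "a \<noteq> 0" using a' s by (intro notI) simp
    then have "3 dvd 2 * s - 1" unfolding a by simp
    have "\<not> 3 dvd s"
    proof
      assume "3 dvd s"
      then have "3 dvd 2 * 0 + (1::nat)" using \<open>3 dvd 2 * s - 1\<close> s by (intro dvd_half_odd[of 3 s 0]) auto
      then show False by simp
    qed
    have "\<exists>x. s = 2 ^ x"
    proof (rule pure_prime_power)
      show "p = 2" if "prime p" "p dvd s" for p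
        using s_in[OF that, of "{2, 3}"] \<open>\<not> 3 dvd s\<close> that(2) 2 by auto
    qed (use s in simp_all)
    then obtain x where "s = 2 ^ x" by blast
    then show False using power_two_3[OF _ a'] s by simp
  next
    case 3
    have "s = 8"
    proof (rule odd_case_degree_4)
      show "p \<in> {2, 3}" if "prime p" "p dvd s" for p using 3 by (intro s_in[OF that]) auto
      show "p \<in> {3, 5}" if "prime p" "p dvd 2 * s - 1" for p
        using t_in[OF that(1), of 0 "{5}"] that(2) 3 s unfolding e_def by auto
    qed (use 3 d in simp)
    then show False using exc(2) 3 by simp
  next
    case 4
    have e: "3 \<le> e" using 4 unfolding e_def by auto
    show False
    proof (cases "6 \<le> s")
      case True
      show False
      proof (rule odd_case_contradiction_6[OF True])
        show "p \<in> {3, 5, 7}" if "prime p" "j \<le> 1" "p dvd (2 * s - 1) - 2 * j" for p j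
          using t_in[OF that(1,3), of "{5, 7}"] that(2) e 4 s by auto
        show "p \<in> {2, 3, 5}" if "prime p" "p dvd s" for p
          using 4 by (intro s_in[OF that]) auto
      qed
    next
      case False
      then have "s = 5" using 4 d by linarith
      then show False
      proof -
        assume s5: "s = 5"
        have "odd (7::nat) \<and> 7 \<le> d + 1" by (rule sm[of 7 1]) (use s5 e in auto)
        then show False using d s5 by simp
      qed
    qed
  next
    case 5
    have e: "e = 4" using 5 unfolding e_def by auto
    show False
    proof (rule odd_case_contradiction_8)
      show "7 \<le> s" using 5 d by auto
      show "p \<in> {3, 5, 7}" if "prime p" "j < 3" "p dvd (2 * s - 1) - 2 * j" for p j
        using t_in[OF that(1,3), of "{5, 7}"] that(2) e 5 s by auto
      show "p \<in> {2, 3, 5, 7}" if "prime p" "p dvd s" for p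
        using 5 by (intro s_in[OF that]) auto
    qed
  next
    case 6
    have e: "e = 5" using 6 unfolding e_def by simp
    \<comment> \<open>Four terms, but only 5 and 7 besides 3.\<close>
    have "4 \<le> card {5, 7::nat} + 1"
    proof (rule smooth_window_full(1))
      show "p = 3 \<or> p \<in> {5, 7}" if "prime p" "j < 4" "p dvd (2 * s - 1) - 2 * j" for p j
        using that(2) e 6 d by (intro t_in[OF that(1,3)]) auto
    qed (use 6 d in auto)
    then show False by simp
  next
    case 7
    have e: "e = 5" using 7 unfolding e_def by simp
    show False
    proof (rule odd_case_contradiction_large[of 4 "{5, 7, 11}" s])
      show "p = 3 \<or> p \<in> {5, 7, 11}" if "prime p" "j < 4" "p dvd (2 * s - 1) - 2 * j" for p j
        using that(2) e 7 d by (intro t_in[OF that(1,3)]) auto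
      show "p \<in> {2, 3, 5, 7} \<or> (4::nat) = 5 \<and> p = 11" if "prime p" "p dvd s" for p
        using s_in[OF that, of "{2, 3, 5, 7}"] 7 by auto
    qed (use 7 d in auto)
  next
    case 8
    have e: "e = 6" using 8 unfolding e_def by simp
    have "5 \<le> card {5, 7, 11::nat} + 1"
    proof (rule smooth_window_full(1))
      show "p = 3 \<or> p \<in> {5, 7, 11}" if "prime p" "j < 5" "p dvd (2 * s - 1) - 2 * j" for p j
        using that(2) e 8 d by (intro t_in[OF that(1,3)]) auto
    qed (use 8 d in auto)
    then show False by simp
  next
    case 9
    have e: "e = 6" using 9 unfolding e_def by simp
    show False
    proof (rule odd_case_contradiction_large[of 5 "{5, 7, 11, 13}" s])
      show "p = 3 \<or> p \<in> {5, 7, 11, 13}" if "prime p" "j < 5" "p dvd (2 * s - 1) - 2 * j" for p j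
        using that(2) e 9 d by (intro t_in[OF that(1,3)]) auto
      show "p \<in> {2, 3, 5, 7} \<or> (5::nat) = 5 \<and> p = 11" if "prime p" "p dvd s" for p
        using s_in[OF that, of "{2, 3, 5, 7, 11}"] 9 by auto
    qed (use 9 d in auto)
  next
    case 10
    \<comment> \<open>For odd \<open>n\<close> the window has no gap, so all its
      \<open>e - 1\<close> numbers are used.\<close>
    define k where "k = e - 1"
    define y where "y = 2 * (s + 1 - e) + 1"
    have e7: "7 \<le> e" "2 * e \<le> s + 1" "d \<le> 2 * e" using 10 d unfolding e_def by linarith+
    have "6 \<le> k" "odd y" "2 * k + 3 \<le> y" using e7 unfolding k_def y_def by auto
    then obtain p j where p: "prime p" "2 * k + 3 < p" "j < k" "p dvd y + 2 * j"
      using exists_large_prime_factor by blast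
    have "y + 2 * j = (2 * s - 1) - 2 * (e - 2 - j)" using p(3) e7 unfolding y_def k_def by simp
    then have "odd p \<and> p \<le> d + 1" using p e7 unfolding k_def by (intro sm[of p "e - 2 - j"]) auto
    moreover have "2 * e + 1 < p" using p(2) e7 unfolding k_def by linarith
    ultimately show False using e7 by linarith
  qed
qed

section \<open>Newton polygons and factors of integer polynomials\<close>

text \<open>Gauss's lemma for the weight \<open>\<alpha> * v + \<beta> * j\<close>: the last indices
  of minimal weight in \<open>A\<close> and \<open>B\<close> add up to an index where the product
  attains the sum of the minima. If the product has its strict minimum at 0, both indices are 0. A
  negative \<open>\<beta>\<close> is allowed, which serves for reversed polynomials.\<close>

lemma strict_min_at_0_factor:
  fixes A B :: "int poly" and p \<alpha> \<beta> :: int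
  assumes p: "prime p" and \<alpha>: "0 < \<alpha>" and R0: "coeff (A * B) 0 \<noteq> 0"
    and min: "\<And>j. 0 < j \<Longrightarrow> coeff (A * B) j \<noteq> 0 \<Longrightarrow>
      \<alpha> * int (multiplicity p (coeff (A * B) 0)) < \<alpha> * int (multiplicity p (coeff (A * B) j)) + \<beta> * int j"
    and j: "0 < j" "coeff A j \<noteq> 0"
  shows "\<alpha> * int (multiplicity p (coeff A 0)) < \<alpha> * int (multiplicity p (coeff A j)) + \<beta> * int j"
proof -
  define v where "v = (\<lambda>c. int (multiplicity p c))"
  define w where "w = (\<lambda>F k. \<alpha> * v (coeff F k) + \<beta> * int k)"
  define S where "S = (\<lambda>F. {k. coeff F k \<noteq> (0::int)})"
  have finS: "finite (S F)" for F
    unfolding S_def by (rule finite_subset[of _ "{..degree F}"]) (auto intro: le_degree)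
  have nz: "coeff A 0 \<noteq> 0" "coeff B 0 \<noteq> 0" using R0 by (auto simp: coeff_mult_0)
  define m where "m = (\<lambda>F. Min (w F ` S F))"
  \<comment> \<open>Taking the last index of minimal weight makes every other pair of indices with
    the same sum strictly heavier.\<close>
  define i where "i = (\<lambda>F. Max {k \<in> S F. w F k = m F})"
  have props: "i F \<in> S F \<and> w F (i F) = m F \<and> (\<forall>k\<in>S F. m F \<le> w F k \<and> (i F < k \<longrightarrow> m F < w F k))"
    if "coeff F 0 \<noteq> 0" for F
  proof -
    have ne: "S F \<noteq> {}" using that unfolding S_def by blast
    have "m F \<in> w F ` S F" unfolding m_def using finS ne by (intro Min_in) auto
    then have ne': "{k \<in> S F. w F k = m F} \<noteq> {}" by auto
    have fin': "finite {k \<in> S F. w F k = m F}" using finS by simp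
    have "i F \<in> {k \<in> S F. w F k = m F}" unfolding i_def by (rule Max_in[OF fin' ne'])
    moreover have le: "m F \<le> w F k" if "k \<in> S F" for k
      unfolding m_def using finS that by (intro Min_le) auto
    moreover have "m F < w F k" if k: "k \<in> S F" "i F < k" for k
    proof (rule ccontr)
      assume "\<not> m F < w F k"
      then have "k \<in> {k \<in> S F. w F k = m F}" using le[OF k(1)] k(1) by simp
      then have "k \<le> i F" unfolding i_def using fin' by (intro Max_ge) auto
      then show False using k(2) by simp
    qed
    ultimately show ?thesis by blast
  qed
  note PA = props[OF nz(1)] and PB = props[OF nz(2)]
  define V where "V = multiplicity p (coeff A (i A)) + multiplicity p (coeff B (i B))"
  have unit: "\<not> is_unit p" using p not_prime_unit by blast
  have pe: "prime_elem p" using p by (rule prime_imp_prime_elem)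
  have nzi: "coeff A (i A) \<noteq> 0" "coeff B (i B) \<noteq> 0" using PA PB unfolding S_def by auto
  have multV: "multiplicity p (coeff A (i A) * coeff B (i B)) = V"
    using pe nzi by (simp add: V_def prime_elem_multiplicity_mult_distrib)
  \<comment> \<open>For a fixed sum of indices the terms with \<open>\<beta>\<close> agree, so a
    larger weight means a larger valuation.\<close>
  have other: "p ^ Suc V dvd coeff A k * coeff B (i A + i B - k)" if k: "k \<le> i A + i B" "k \<noteq> i A" for k
  proof (cases "coeff A k = 0 \<or> coeff B (i A + i B - k) = 0")
    case False
    define k' where "k' = i A + i B - k"
    have kk: "k + k' = i A + i B" using k unfolding k'_def by simp
    have in': "k \<in> S A" "k' \<in> S B" using False unfolding S_def k'_def by auto
    have "m A + m B < w A k + w B k'"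
    proof (cases "i A < k")
      case True
      then have "m A < w A k" "m B \<le> w B k'" using PA PB in' by auto
      then show ?thesis by linarith
    next
      case False
      then have "i B < k'" using kk k(2) by linarith
      then have "m B < w B k'" "m A \<le> w A k" using PA PB in' by auto
      then show ?thesis by linarith
    qed
    moreover have "m A + m B = \<alpha> * int V + \<beta> * int (i A + i B)"
    proof -
      have "m A = w A (i A)" "m B = w B (i B)" using PA PB by auto
      then show ?thesis unfolding w_def v_def V_def by (simp add: algebra_simps)
    qed
    moreover have "w A k + w B k' = \<alpha> * (v (coeff A k) + v (coeff B k')) + \<beta> * int (i A + i B)"
      unfolding w_def kk[symmetric] by (simp add: algebra_simps)
    ultimately have "\<alpha> * int V < \<alpha> * (v (coeff A k) + v (coeff B k'))" by linarith
    then have "int V < v (coeff A k) + v (coeff B k')" using \<alpha> by simp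
    then have "Suc V \<le> multiplicity p (coeff A k) + multiplicity p (coeff B k')" unfolding v_def by linarith
    then have "Suc V \<le> multiplicity p (coeff A k * coeff B k')"
      using pe False by (simp add: prime_elem_multiplicity_mult_distrib k'_def)
    then show ?thesis unfolding k'_def by (rule multiplicity_dvd')
  qed (auto simp del: power_Suc)
  define c where "c = coeff (A * B) (i A + i B)"
  have c: "c = coeff A (i A) * coeff B (i B) + (\<Sum>k\<in>{..i A + i B} - {i A}. coeff A k * coeff B (i A + i B - k))"
    unfolding c_def coeff_mult by (subst sum.remove[of _ "i A"]) auto
  have rest: "p ^ Suc V dvd (\<Sum>k\<in>{..i A + i B} - {i A}. coeff A k * coeff B (i A + i B - k))"
    by (intro dvd_sum other) auto
  have "\<not> p ^ Suc V dvd coeff A (i A) * coeff B (i B)"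
    using multV nzi unit by (subst power_dvd_iff_le_multiplicity) auto
  then have nd: "\<not> p ^ Suc V dvd c" unfolding c using rest by (subst dvd_add_left_iff) auto
  then have c0: "c \<noteq> 0" by auto
  have cV: "multiplicity p c \<le> V"
  proof (rule ccontr)
    assume "\<not> multiplicity p c \<le> V"
    then have "p ^ Suc V dvd c" by (intro multiplicity_dvd') simp
    then show False using nd by simp
  qed
  have R0w: "\<alpha> * v (coeff (A * B) 0) = w A 0 + w B 0"
    unfolding w_def v_def coeff_mult_0 using pe nz by (simp add: prime_elem_multiplicity_mult_distrib algebra_simps)
  have zero: "i A + i B = 0"
  proof (rule ccontr)
    assume n0: "i A + i B \<noteq> 0"
    have "\<alpha> * v (coeff (A * B) 0) < \<alpha> * v c + \<beta> * int (i A + i B)"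
      using min[of "i A + i B"] n0 c0 unfolding c_def v_def by simp
    also have "\<dots> \<le> \<alpha> * int V + \<beta> * int (i A + i B)" using cV \<alpha> unfolding v_def by simp
    also have "\<dots> = w A (i A) + w B (i B)" unfolding w_def v_def V_def by (simp add: algebra_simps)
    also have "\<dots> = m A + m B" using PA PB by simp
    also have "\<dots> \<le> w A 0 + w B 0" using PA PB nz unfolding S_def by (intro add_mono) auto
    finally show False using R0w by simp
  qed
  have "m A < w A j" using PA j zero unfolding S_def by auto
  moreover have "m A = w A 0" using PA zero by simp
  ultimately show ?thesis unfolding w_def v_def by simp
qed

lemma lead_coeff_factor_unit:
  fixes A B :: "int poly"
  assumes "lead_coeff (A * B) = 1"
  shows "lead_coeff A dvd 1" "lead_coeff B dvd 1"
  using assms by (metis dvd_triv_left dvd_triv_right lead_coeff_mult)+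

lemma multiplicity_unit_eq_0:
  fixes p c :: int
  assumes "prime p" "c dvd 1"
  shows "multiplicity p c = 0"
  using assms by (intro not_dvd_imp_multiplicity_0) (meson dvd_trans not_prime_unit)

text \<open>All other points of the Newton diagram lie strictly above the line of slope
  \<open>-1/\<alpha>\<close> through the point of the constant term. This passes to
  \<open>A\<close>, whose leading coefficient is a unit and so has valuation 0.\<close>

lemma factor_low_valuation:
  fixes A B :: "int poly" and p :: int
  assumes p: "prime p" and monic: "lead_coeff (A * B) = 1" and d: "0 < degree A" and \<alpha>: "0 < \<alpha>"
    and R0: "coeff (A * B) 0 \<noteq> 0"
    and slope: "\<And>j. 0 < j \<Longrightarrow> coeff (A * B) j \<noteq> 0 \<Longrightarrow>
      \<alpha> * multiplicity p (coeff (A * B) 0) < \<alpha> * multiplicity p (coeff (A * B) j) + j"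
  shows "\<alpha> * multiplicity p (coeff A 0) < degree A"
proof -
  have lA: "lead_coeff A dvd 1" using lead_coeff_factor_unit[OF monic] by auto
  have "int \<alpha> * int (multiplicity p (coeff A 0))
      < int \<alpha> * int (multiplicity p (lead_coeff A)) + 1 * int (degree A)"
  proof (rule strict_min_at_0_factor[OF p _ R0])
    show "int \<alpha> * int (multiplicity p (coeff (A * B) 0))
        < int \<alpha> * int (multiplicity p (coeff (A * B) j)) + 1 * int j"
      if "0 < j" "coeff (A * B) j \<noteq> 0" for j
      using slope[OF that] by (simp flip: of_nat_mult of_nat_add)
    show "lead_coeff A \<noteq> 0" using lA by auto
  qed (use d \<alpha> in auto)
  then show ?thesis using multiplicity_unit_eq_0[OF p lA] by (simp flip: of_nat_mult)
qed

text \<open>Modulo \<open>p\<close> the constant term of \<open>A\<close> is invertible, so the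
  power of \<open>x\<close> dividing the product divides \<open>B\<close>.\<close>

lemma cofactor_low_coeffs:
  fixes A B :: "int poly" and p :: int
  assumes p: "prime p" and low: "\<And>j. j < m \<Longrightarrow> p dvd coeff (A * B) j" and A0: "\<not> p dvd coeff A 0"
  shows "j < m \<Longrightarrow> p dvd coeff B j"
proof (induction j rule: less_induct)
  case (less j)
  have "coeff (A * B) j = coeff A 0 * coeff B j + (\<Sum>k\<in>{..j} - {0}. coeff A k * coeff B (j - k))"
    unfolding coeff_mult by (subst sum.remove[of _ 0]) auto
  moreover have "p dvd (\<Sum>k\<in>{..j} - {0}. coeff A k * coeff B (j - k))"
    using less by (intro dvd_sum dvd_mult) auto
  ultimately have "p dvd coeff A 0 * coeff B j" using low[OF less.prems] by (metis dvd_add_left_iff)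
  then show ?case using A0 p prime_dvd_mult_iff by blast
qed

text \<open>The leading coefficient of \<open>B\<close> would be divisible by \<open>p\<close>, but
  it is a unit.\<close>

lemma no_factor_of_degree:
  fixes A B :: "int poly" and p :: int
  assumes p: "prime p" and monic: "lead_coeff (A * B) = 1"
    and low: "\<And>j. j \<le> degree B \<Longrightarrow> p dvd coeff (A * B) j" and A0: "\<not> p dvd coeff A 0"
  shows False
proof -
  have "p dvd coeff B (degree B)"
  proof (rule cofactor_low_coeffs[OF p _ A0])
    show "p dvd coeff (A * B) j" if "j < Suc (degree B)" for j using that by (intro low) simp
  qed simp
  then show False using lead_coeff_factor_unit(2)[OF monic] p by (meson dvd_trans not_prime_unit)
qed

text \<open>Modulo \<open>p\<close> the polynomial \<open>B\<close> is a multiple of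
  \<open>x^m\<close>, so only the coefficients of \<open>A\<close> up to \<open>n\<close> contribute
  in degree \<open>m + n\<close>.\<close>

lemma coeff_mult_high_part:
  fixes A B :: "int poly" and p :: int
  assumes low: "\<And>j. j < m \<Longrightarrow> p dvd coeff B j"
  shows "p dvd coeff (A * B) (m + n) - (\<Sum>k\<le>n. coeff A k * coeff B (m + n - k))"
proof -
  have "coeff (A * B) (m + n) - (\<Sum>k\<le>n. coeff A k * coeff B (m + n - k))
      = (\<Sum>k\<in>{..m + n} - {..n}. coeff A k * coeff B (m + n - k))"
    unfolding coeff_mult by (subst sum_diff) auto
  moreover have "p dvd (\<Sum>k\<in>{..m + n} - {..n}. coeff A k * coeff B (m + n - k))"
    by (intro dvd_sum dvd_mult low) auto
  ultimately show ?thesis by simp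
qed

lemma multiplicity_of_nat_int: "multiplicity (int p) (int n) = multiplicity p n"
  unfolding multiplicity_def by (simp flip: of_nat_power)

lemma irreducible_if_no_small_factor:
  fixes R :: "int poly"
  assumes monic: "lead_coeff R = 1" and deg: "0 < degree R"
    and no: "\<And>A B. R = A * B \<Longrightarrow> 0 < degree A \<Longrightarrow> degree A \<le> degree B \<Longrightarrow> False"
  shows "irreducible R"
proof (rule irreducibleI)
  have const: "A dvd 1" if "R = A * B" "degree A = 0" for A B
  proof -
    have "lead_coeff A dvd 1" using lead_coeff_factor_unit(1)[of A B] monic that by simp
    moreover have "A = [:lead_coeff A:]" using that(2) by (metis degree_eq_zeroE coeff_pCons_0 degree_pCons_0)
    ultimately show ?thesis by (metis is_unit_const_poly_iff)
  qed
  fix A B assume R: "R = A * B"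
  show "A dvd 1 \<or> B dvd 1"
  proof (cases "degree A \<le> degree B")
    case True
    then have "degree A = 0" using no[OF R] by auto
    then show ?thesis using const[OF R] by blast
  next
    case False
    have R': "R = B * A" using R by (simp add: mult.commute)
    then have "degree B = 0" using no[OF R'] False by auto
    then show ?thesis using const[OF R'] by blast
  qed
qed (use deg in \<open>auto simp: is_unit_poly_iff\<close>)

section \<open>Coefficients of the remainder polynomial\<close>

lemma odd_fact_quotient:
  assumes "i \<le> m"
  shows "\<exists>q. odd_fact m = odd_fact i * q \<and> (\<forall>l. i \<le> l \<longrightarrow> l < m \<longrightarrow> 2 * l + 1 dvd q)"
  using assms
proof (induction m rule: dec_induct)
  case base
  then show ?case by (intro exI[of _ 1]) simp
next
  case (step m)
  then obtain q where q: "odd_fact m = odd_fact i * q" "\<forall>l. i \<le> l \<longrightarrow> l < m \<longrightarrow> 2 * l + 1 dvd q" by blast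
  have "2 * l + 1 dvd (2 * m + 1) * q" if "i \<le> l" "l < Suc m" for l
  proof (cases "l = m")
    case True
    then show ?thesis by (simp only: dvd_triv_left)
  next
    case False
    then have "2 * l + 1 dvd q" using q(2) that by simp
    then show ?thesis by (rule dvd_mult)
  qed
  moreover have "odd_fact (Suc m) = odd_fact i * ((2 * m + 1) * q)"
    using q(1) by (simp only: odd_fact_Suc mult.left_commute[of "2 * m + 1" "odd_fact i" q])
  ultimately show ?case by blast
qed

lemma coeff_hermite_rec:
  "coeff (hermite (Suc (Suc k))) j
    = (if j = 0 then 0 else coeff (hermite (Suc k)) (j - 1)) - int (Suc k) * coeff (hermite k) j"
  by (cases j) simp_all

text \<open>The classical closed form with quotients of double factorials, multiplied out to stay in
  the integers. Both parities go through one induction because the recurrence alternates between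
  them.\<close>

lemma hermite_coeffs:
  "\<forall>i. coeff (hermite (2 * s)) (2 * i) * int (odd_fact i) = (-1) ^ (s + i) * int (s choose i) * int (odd_fact s)
    \<and> coeff (hermite (2 * s)) (2 * i + 1) = 0
    \<and> coeff (hermite (2 * s + 1)) (2 * i + 1) * int (odd_fact (Suc i))
        = (-1) ^ (s + i) * int (s choose i) * int (odd_fact (Suc s))
    \<and> coeff (hermite (2 * s + 1)) (2 * i) = 0"
proof (induction s)
  case 0
  have "(0 choose i) = (if i = 0 then 1 else 0)" for i :: nat by (cases i) auto
  moreover have "coeff [:0, 1::int:] (2 * i + 1) = (if i = 0 then 1 else 0)" "coeff [:0, 1::int:] (2 * i) = 0" for i
    by (auto simp: coeff_pCons split: nat.split) 
  ultimately show ?case by auto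
next
  case (Suc s)
  have rE: "coeff (hermite (2 * Suc s)) j
      = (if j = 0 then 0 else coeff (hermite (2 * s + 1)) (j - 1)) - (2 * int s + 1) * coeff (hermite (2 * s)) j" for j
    using coeff_hermite_rec[of "2 * s" j] by simp
  have rO: "coeff (hermite (2 * Suc s + 1)) j
      = (if j = 0 then 0 else coeff (hermite (2 * Suc s)) (j - 1)) - (2 * int s + 2) * coeff (hermite (2 * s + 1)) j" for j
    using coeff_hermite_rec[of "2 * s + 1" j] by simp
  note IH = Suc.IH[rule_format]
  have E: "coeff (hermite (2 * Suc s)) (2 * i) * int (odd_fact i)
      = (-1) ^ (Suc s + i) * int (Suc s choose i) * int (odd_fact (Suc s))" for i
  proof (cases i)
    case 0
    then show ?thesis using IH[of 0] by (simp add: rE algebra_simps)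
  next
    case (Suc k)
    have "coeff (hermite (2 * Suc s)) (2 * i) * int (odd_fact i)
        = coeff (hermite (2 * s + 1)) (2 * k + 1) * int (odd_fact (Suc k))
          - (2 * int s + 1) * (coeff (hermite (2 * s)) (2 * Suc k) * int (odd_fact (Suc k)))"
      unfolding Suc rE by (simp add: algebra_simps del: odd_fact_Suc)
    also have "\<dots> = (-1) ^ (s + k) * int (s choose k) * int (odd_fact (Suc s))
          - (2 * int s + 1) * ((-1) ^ (s + Suc k) * int (s choose Suc k) * int (odd_fact s))"
      using IH[of k] IH[of "Suc k"] by (simp only:)
    finally show ?thesis unfolding Suc by (simp add: algebra_simps)
  qed
  have E0: "coeff (hermite (2 * Suc s)) (2 * i + 1) = 0" for i
    using IH[of i] by (simp add: rE)
  have O: "coeff (hermite (2 * Suc s + 1)) (2 * i + 1) * int (odd_fact (Suc i))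
      = (-1) ^ (Suc s + i) * int (Suc s choose i) * int (odd_fact (Suc (Suc s)))" for i
  proof -
    have b: "(int s + 1) * int (s choose i) = (int s + 1 - int i) * int (Suc s choose i)"
    proof (cases "i \<le> Suc s")
      case True
      have "int (Suc s - i) * int (Suc s choose i) = int (Suc s) * int (s choose i)"
        using binomial_absorb_comp[of "Suc s" i] by (simp only: diff_Suc_1 flip: of_nat_mult)
      moreover have "int (Suc s - i) = int s + 1 - int i" using True by simp
      ultimately show ?thesis by simp
    qed (simp add: binomial_eq_0)
    have "coeff (hermite (2 * Suc s + 1)) (2 * i + 1) * int (odd_fact (Suc i))
        = (2 * int i + 1) * (coeff (hermite (2 * Suc s)) (2 * i) * int (odd_fact i))
          - (2 * int s + 2) * (coeff (hermite (2 * s + 1)) (2 * i + 1) * int (odd_fact (Suc i)))"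
      unfolding rO by (simp add: algebra_simps)
    also have "\<dots> = (2 * int i + 1) * ((-1) ^ (Suc s + i) * int (Suc s choose i) * int (odd_fact (Suc s)))
          - (2 * int s + 2) * ((-1) ^ (s + i) * int (s choose i) * int (odd_fact (Suc s)))"
      using IH[of i] E[of i] by (simp only:)
    also have "\<dots> = (-1) ^ (Suc s + i) * int (odd_fact (Suc s))
        * ((2 * int i + 1) * int (Suc s choose i) + 2 * ((int s + 1) * int (s choose i)))"
      by (simp add: algebra_simps del: odd_fact_Suc binomial_Suc_Suc)
    also have "\<dots> = (-1) ^ (Suc s + i) * int (odd_fact (Suc s)) * ((2 * int s + 3) * int (Suc s choose i))"
      unfolding b by (simp add: algebra_simps del: odd_fact_Suc binomial_Suc_Suc)
    finally show ?thesis by (simp add: odd_fact_Suc[of "Suc s"] algebra_simps del: odd_fact_Suc binomial_Suc_Suc)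
  qed
  have O0: "coeff (hermite (2 * Suc s + 1)) (2 * i) = 0" for i
  proof (cases i)
    case 0
    then show ?thesis using IH[of 0] by (simp add: rO)
  next
    case (Suc k)
    then show ?thesis using E0[of k] IH[of i] by (simp add: rO)
  qed
  show ?case using E E0 O O0 by blast
qed

section \<open>Wronskians with the second Hermite polynomial\<close>

lemma wronskian_pair: "wronskian [f, g] = f * pderiv g - pderiv f * g"
proof -
  define A where "A = Matrix.mat 2 2 (\<lambda>(i, j). (pderiv ^^ i) ([f, g] ! j))"
  have A: "A \<in> carrier_mat 2 2" unfolding A_def by simp
  have "Determinant.det A = (\<Sum>j<2. A $$ (0, j) * cofactor A 0 j)" by (rule laplace_expansion_row[OF A]) simp
  also have "\<dots> = A $$ (0, 0) * cofactor A 0 0 + A $$ (0, 1) * cofactor A 0 1" by (simp add: numeral_2_eq_2)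
  also have "\<dots> = f * pderiv g - g * pderiv f"
    unfolding cofactor_def A_def mat_delete_def by (subst (1 2) det_single) auto
  finally show ?thesis unfolding wronskian_def A_def by (simp add: numeral_2_eq_2 mult.commute)
qed

text \<open>Since \<open>hermite 2\<close> is \<open>x^2 - 1\<close>, the Wronskian is
  \<open>(x^2 - 1) H' - 2x H\<close>. Degrees 0 and 1 are stated apart because of the shift of
  indices.\<close>

lemma coeff_wronskian_hermite_2:
  "coeff (wronskian [hermite 2, H]) 0 = - coeff H 1"
  "coeff (wronskian [hermite 2, H]) (Suc 0) = - 2 * coeff H 2 - 2 * coeff H 0"
  "coeff (wronskian [hermite 2, H]) (Suc (Suc k)) = (int k - 1) * coeff H (k + 1) - (int k + 3) * coeff H (k + 3)"
proof -
  have "hermite 2 = [:-1, 0, 1:]" by (simp add: numeral_2_eq_2)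
  then have W: "wronskian [hermite 2, H] = [:-1, 0, 1:] * pderiv H - [:0, 2:] * H"
    by (simp add: wronskian_pair pderiv_pCons)
  show "coeff (wronskian [hermite 2, H]) 0 = - coeff H 1"
    "coeff (wronskian [hermite 2, H]) (Suc 0) = - 2 * coeff H 2 - 2 * coeff H 0"
    "coeff (wronskian [hermite 2, H]) (Suc (Suc k)) = (int k - 1) * coeff H (k + 1) - (int k + 3) * coeff H (k + 3)"
    unfolding W by (simp_all add: coeff_pderiv algebra_simps numeral_2_eq_2 numeral_3_eq_3)
qed

lemma coeff_wronskian_hermite:
  "coeff (wronskian_hermite [n, 2]) k = coeff (wronskian [hermite 2, hermite (Suc n)]) k div (int n - 1)"
proof -
  have d: "degseq [n, 2] = [2, Suc n]" unfolding degseq_def by (simp add: numeral_2_eq_2)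
  have "vandermonde [2, Suc n] = int n - 1" unfolding vandermonde_def by (simp add: lessThan_Suc)
  then show ?thesis unfolding wronskian_hermite_def d by (simp add: coeff_map_poly)
qed

section \<open>The 2-core of (n, 2)\<close>

lemma terminal_unique_even:
  assumes "remove_2hook\<^sup>*\<^sup>* {2, Suc (2 * m)} T" "\<nexists>T'. remove_2hook T T'"
  shows "T = {0, 1}"
proof -
  have "\<exists>a b. T = {a, b} \<and> even a \<and> odd b" using assms(1)
  proof (induction rule: rtranclp_induct)
    case base
    then show ?case by (intro exI[of _ 2] exI[of _ "Suc (2 * m)"]) simp
  next
    case (step S T)
    then obtain a b where ab: "S = {a, b}" "even a" "odd b" by blast
    from step(2) obtain x where x: "x \<in> S" "2 \<le> x" "T = insert (x - 2) (S - {x})" unfolding remove_2hook_def by blast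
    have "a \<noteq> b" using ab by auto
    then have "x = a \<and> T = {a - 2, b} \<or> x = b \<and> T = {a, b - 2}" using x ab by auto
    then show ?case using ab x(2) by (metis dvd_diff_nat even_numeral le_add_diff_inverse2 even_add)
  qed
  then obtain a b where ab: "T = {a, b}" "even a" "odd b" by blast
  have nr: "x < 2 \<or> x - 2 \<in> T" if "x \<in> T" for x
    using assms(2) that unfolding remove_2hook_def by (meson not_le)
  have "a < 2" using nr[of a] ab by auto
  moreover have "b < 2" using nr[of b] ab by auto
  ultimately have "a = 0" "b = 1" using ab by presburger+
  then show ?thesis using ab by simp
qed

text \<open>Removing a 2-hook preserves parities, so the set keeps two distinct even elements, and
  the only stuck position is \<open>{0, 2}\<close>. For \<open>m = 1\<close> the initial set would
  have a single element.\<close>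

lemma terminal_unique_odd:
  assumes "remove_2hook\<^sup>*\<^sup>* {2, 2 * m} T" "\<nexists>T'. remove_2hook T T'" "m \<noteq> 1"
  shows "T = {0, 2}"
proof -
  have "\<exists>a b. T = {a, b} \<and> even a \<and> even b \<and> a < b" using assms(1)
  proof (induction rule: rtranclp_induct)
    case base
    have "{2, 2 * m} = {2 * m, 2}" by auto
    moreover have "2 < 2 * m \<or> 2 * m < 2" using assms(3) by linarith
    ultimately show ?case by (metis dvd_triv_left even_numeral)
  next
    case (step S T)
    then obtain a b where ab: "S = {a, b}" "even a" "even b" "a < b" by blast
    from step(2) obtain x where x: "x \<in> S" "2 \<le> x" "x - 2 \<notin> S" "T = insert (x - 2) (S - {x})"
      unfolding remove_2hook_def by blast
    have "x = a \<and> T = {a - 2, b} \<or> x = b \<and> T = {a, b - 2}" using x ab by auto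
    then show ?case
    proof
      assume h: "x = a \<and> T = {a - 2, b}"
      then have "even (a - 2)" "a - 2 < b" using ab x by auto
      then show ?thesis using h ab by blast
    next
      assume h: "x = b \<and> T = {a, b - 2}"
      then have "even (b - 2)" "a \<noteq> b - 2" using ab x by auto
      moreover from this have "a < b - 2" using ab h x(2) by presburger
      ultimately show ?thesis using h ab by blast
    qed
  qed
  then obtain a b where ab: "T = {a, b}" "even a" "even b" "a < b" by blast
  have nr: "x < 2 \<or> x - 2 \<in> T" if "x \<in> T" for x
    using assms(2) that unfolding remove_2hook_def by (meson not_le)
  have a: "a = 0" using nr[of a] ab by auto
  have "b < 2 \<or> b - 2 = a \<or> b - 2 = b" using nr[of b] ab by auto
  then have "b = 2" using ab(3,4) a by presburger
  then show ?thesis using ab a by simp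
qed

lemma remove_2hook_path: "b \<le> 2 \<Longrightarrow> 0 < b \<Longrightarrow> remove_2hook\<^sup>*\<^sup>* {0, b + 2 * j} {0, b}"
proof (induction j)
  case (Suc j)
  have "remove_2hook {0, b + 2 * Suc j} {0, b + 2 * j}"
    unfolding remove_2hook_def using Suc.prems by (intro bexI[of _ "b + 2 * Suc j"]) auto
  then show ?case using Suc by (meson converse_rtranclp_into_rtranclp)
qed simp

lemma remove_2hook_first: "3 \<le> k \<Longrightarrow> remove_2hook {2, k} {0, k}"
  unfolding remove_2hook_def by (intro bexI[of _ 2]) auto

lemma core2_size_even:
  assumes "1 \<le> m"
  shows "core2_size [2 * m, 2] = 0"
proof -
  have d: "set (degseq [2 * m, 2]) = {2, Suc (2 * m)}" unfolding degseq_def by (simp add: numeral_2_eq_2)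
  have "Suc (2 * m) = 1 + 2 * m" by simp
  then have "remove_2hook\<^sup>*\<^sup>* {0, Suc (2 * m)} {0, 1}" using remove_2hook_path[of 1 m] by simp
  then have reach: "remove_2hook\<^sup>*\<^sup>* {2, Suc (2 * m)} {0, 1}"
    by (rule converse_rtranclp_into_rtranclp[rotated]) (use assms in \<open>intro remove_2hook_first; simp\<close>)
  have no_step: "\<nexists>T'. remove_2hook {0, 1} T'" unfolding remove_2hook_def by auto
  have size: "size_of_degset {0, 1} = 0" unfolding size_of_degset_def by simp
  show ?thesis unfolding core2_size_def d
  proof (rule the_equality)
    show "\<exists>T. remove_2hook\<^sup>*\<^sup>* {2, Suc (2 * m)} T \<and> \<not> (\<exists>T'. remove_2hook T T') \<and> 0 = size_of_degset T"
      using reach no_step size by (intro exI[of _ "{0, 1}"]) simp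
    show "k = 0" if ex: "\<exists>T. remove_2hook\<^sup>*\<^sup>* {2, Suc (2 * m)} T \<and> \<not> (\<exists>T'. remove_2hook T T') \<and> k = size_of_degset T" for k
    proof -
      obtain T where T: "remove_2hook\<^sup>*\<^sup>* {2, Suc (2 * m)} T" "\<not> (\<exists>T'. remove_2hook T T')" "k = size_of_degset T" using ex by blast
      show ?thesis using terminal_unique_even[OF T(1) T(2)] size T(3) by simp
    qed
  qed
qed

lemma core2_size_odd:
  assumes "2 \<le> m"
  shows "core2_size [2 * m - 1, 2] = 1"
proof -
  have d: "set (degseq [2 * m - 1, 2]) = {2, 2 * m}" unfolding degseq_def using assms by (simp add: numeral_2_eq_2)
  have e: "2 + 2 * (m - 1) = 2 * m" using assms by simp
  have "remove_2hook\<^sup>*\<^sup>* {0, 2 + 2 * (m - 1)} {0, 2}" by (rule remove_2hook_path) simp_all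
  then have "remove_2hook\<^sup>*\<^sup>* {0, 2 * m} {0, 2}" unfolding e .
  moreover have "remove_2hook {2, 2 * m} {0, 2 * m}" using assms by (intro remove_2hook_first) simp
  ultimately have reach: "remove_2hook\<^sup>*\<^sup>* {2, 2 * m} {0, 2}" by (rule converse_rtranclp_into_rtranclp[rotated])
  have no_step: "\<nexists>T'. remove_2hook {0, 2} T'" unfolding remove_2hook_def by auto
  have size: "size_of_degset {0, 2} = 1" unfolding size_of_degset_def by simp
  have m: "m \<noteq> 1" using assms by simp
  show ?thesis unfolding core2_size_def d
  proof (rule the_equality)
    show "\<exists>T. remove_2hook\<^sup>*\<^sup>* {2, 2 * m} T \<and> \<not> (\<exists>T'. remove_2hook T T') \<and> 1 = size_of_degset T"
      using reach no_step size by (intro exI[of _ "{0, 2}"]) simp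
    show "k = 1" if ex: "\<exists>T. remove_2hook\<^sup>*\<^sup>* {2, 2 * m} T \<and> \<not> (\<exists>T'. remove_2hook T T') \<and> k = size_of_degset T" for k
    proof -
      obtain T where T: "remove_2hook\<^sup>*\<^sup>* {2, 2 * m} T" "\<not> (\<exists>T'. remove_2hook T T')" "k = size_of_degset T" using ex by blast
      show ?thesis using terminal_unique_odd[OF T(1) T(2) m] size T(3) by simp
    qed
  qed
qed

section \<open>Even n\<close>

lemma multiplicity_le_of_mult_eq:
  fixes x y c D :: int
  assumes "prime p" "x * D = c * y" "x \<noteq> 0" "D \<noteq> 0"
  shows "multiplicity p y \<le> multiplicity p x + multiplicity p D"
proof -
  have pe: "prime_elem p" using assms(1) by (rule prime_imp_prime_elem)
  have "y dvd x * D" unfolding assms(2) by simp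
  then have "multiplicity p y \<le> multiplicity p (x * D)" using assms(3,4) by (intro dvd_imp_multiplicity_le) simp_all
  then show ?thesis using assms(3,4) pe by (simp add: prime_elem_multiplicity_mult_distrib)
qed

lemma slope_step:
  fixes a b v \<alpha> t :: nat
  assumes "a \<le> b + v" "\<alpha> * v < t"
  shows "\<alpha> * a < \<alpha> * b + t"
proof -
  have "\<alpha> * a \<le> \<alpha> * (b + v)" using assms(1) by (rule mult_le_mono2)
  also have "\<dots> = \<alpha> * b + \<alpha> * v" by (rule add_mult_distrib2)
  finally show ?thesis using assms(2) by linarith
qed

lemma not_dvd_if_multiplicity_eq_0:
  fixes p x :: int
  assumes "prime p" "x \<noteq> 0" "multiplicity p x = 0"
  shows "\<not> p dvd x"
  using assms by (metis multiplicity_eq_zero_iff not_prime_unit)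

text \<open>What is left of a Wronskian coefficient once the double factorials are split off. At
  \<open>i = 0\<close> the truncated \<open>i - 1\<close> would bring in a spurious
  binomial.\<close>

definition even_bracket :: "nat \<Rightarrow> nat \<Rightarrow> int" where
  "even_bracket s i = (if i = 0 then 1 else (2 * int i - 3) * int (s choose (i - 1)) + int (s choose i))"

lemma even_wronskian_coeffs:
  fixes s :: nat
  defines "W \<equiv> wronskian [hermite 2, hermite (Suc (2 * s))]"
  shows "coeff W (2 * i) * int (odd_fact i) = (-1) ^ (s + i + 1) * even_bracket s i * int (odd_fact (Suc s))"
    and "coeff W (2 * i + 1) = 0"
proof -
  define H where "H = hermite (Suc (2 * s))"
  have Hh: "H = hermite (2 * s + 1)" unfolding H_def by (simp only: Suc_eq_plus1)
  have H1: "coeff H (2 * i + 1) * int (odd_fact (Suc i)) = (-1) ^ (s + i) * int (s choose i) * int (odd_fact (Suc s))"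
    and H0: "coeff H (2 * i) = 0" for i
    using hermite_coeffs[of s] unfolding Hh by blast+
  have WH: "W = wronskian [hermite 2, H]" unfolding W_def H_def ..
  show "coeff W (2 * i) * int (odd_fact i) = (-1) ^ (s + i + 1) * even_bracket s i * int (odd_fact (Suc s))"
  proof (cases i)
    case 0
    have w: "coeff W 0 = - coeff H 1" unfolding WH by (rule coeff_wronskian_hermite_2)
    have "coeff H 1 = (-1) ^ s * int (odd_fact (Suc s))" using H1[of 0] odd_fact_Suc[of 0] by (simp del: odd_fact_Suc)
    then show ?thesis unfolding 0 using w by (simp add: even_bracket_def del: odd_fact_Suc)
  next
    case (Suc k)
    have x: "coeff W (Suc (Suc (2 * k))) = (int (2 * k) - 1) * coeff H (2 * k + 1) - (int (2 * k) + 3) * coeff H (2 * k + 3)"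
      unfolding WH by (rule coeff_wronskian_hermite_2)
    have a: "2 * Suc k = Suc (Suc (2 * k))" by simp
    have f: "int (odd_fact (Suc (Suc k))) = (2 * int k + 3) * int (odd_fact (Suc k))"
      unfolding odd_fact_Suc[of "Suc k"] by (simp add: algebra_simps del: odd_fact_Suc)
    have i3: "2 * Suc k + 1 = 2 * k + 3" by simp
    have h2: "coeff H (2 * k + 3) * ((2 * int k + 3) * int (odd_fact (Suc k)))
        = (-1) ^ (s + Suc k) * int (s choose Suc k) * int (odd_fact (Suc s))"
      using H1[of "Suc k"] unfolding i3 f .
    have "coeff W (2 * i) * int (odd_fact i) = (2 * int k - 1) * (coeff H (2 * k + 1) * int (odd_fact (Suc k)))
        - coeff H (2 * k + 3) * ((2 * int k + 3) * int (odd_fact (Suc k)))"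
      unfolding Suc a x by (simp add: algebra_simps del: odd_fact_Suc)
    also have "\<dots> = (2 * int k - 1) * ((-1) ^ (s + k) * int (s choose k) * int (odd_fact (Suc s)))
        - (-1) ^ (s + Suc k) * int (s choose Suc k) * int (odd_fact (Suc s))"
      by (simp only: H1 h2)
    finally show ?thesis unfolding Suc even_bracket_def by (simp add: algebra_simps del: odd_fact_Suc)
  qed
  show "coeff W (2 * i + 1) = 0"
  proof (cases i)
    case 0
    have "coeff W (Suc 0) = - 2 * coeff H 2 - 2 * coeff H 0" unfolding WH by (rule coeff_wronskian_hermite_2)
    then show ?thesis unfolding 0 using H0[of 0] H0[of 1] by simp
  next
    case (Suc k)
    have x: "coeff W (Suc (Suc (2 * k + 1))) = (int (2 * k + 1) - 1) * coeff H (2 * k + 1 + 1) - (int (2 * k + 1) + 3) * coeff H (2 * k + 1 + 3)"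
      unfolding WH by (rule coeff_wronskian_hermite_2)
    have a: "2 * Suc k + 1 = Suc (Suc (2 * k + 1))" "2 * k + 1 + 1 = 2 * Suc k" "2 * k + 1 + 3 = 2 * Suc (Suc k)" by simp_all
    show ?thesis unfolding Suc a(1) x unfolding a(2,3) H0 by simp
  qed
qed

text \<open>With \<open>s = r + 1\<close>, division by \<open>n - 1 = 2s - 1\<close> turns
  \<open>(2s + 1)!!\<close> into \<open>(2s + 1) * (2s - 3)!!\<close>; this is where one odd number
  is lost.\<close>

lemma even_remainder_coeffs:
  fixes r :: nat
  defines "R \<equiv> remainder_poly [2 * Suc r, 2]"
  shows "coeff R (2 * i) * int (odd_fact i) = (-1) ^ (r + i) * even_bracket (Suc r) i * (2 * int r + 3) * int (odd_fact r)"
    and "coeff R (2 * i + 1) = 0"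
proof -
  define W where "W = wronskian [hermite 2, hermite (Suc (2 * Suc r))]"
  have c: "core2_size [2 * Suc r, 2] = 0" by (rule core2_size_even) simp
  have "monom (1::int) 0 = 1" by (simp add: monom_0 flip: one_pCons)
  then have R: "R = wronskian_hermite [2 * Suc r, 2]" unfolding R_def remainder_poly_def c by (simp only: div_by_1)
  define K where "K = 2 * int r + 1"
  have K0: "K \<noteq> 0" unfolding K_def by linarith
  have e: "int (2 * Suc r) - 1 = K" unfolding K_def by simp
  have RW: "coeff R k = coeff W k div K" for k unfolding R coeff_wronskian_hermite e W_def ..
  have sg: "(-1::int) ^ (Suc r + i + 1) = (-1) ^ (r + i)" for i by simp
  have W: "coeff W (2 * i) * int (odd_fact i) = (-1) ^ (r + i) * even_bracket (Suc r) i * int (odd_fact (Suc (Suc r)))" for i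
    using even_wronskian_coeffs(1)[of "Suc r" i] unfolding W_def sg .
  have W0: "coeff W (2 * i + 1) = 0" for i unfolding W_def by (rule even_wronskian_coeffs(2))
  have f3: "int (odd_fact (Suc (Suc r))) = (2 * int r + 3) * int (odd_fact (Suc r))"
    unfolding odd_fact_Suc[of "Suc r"] by (simp add: algebra_simps del: odd_fact_Suc)
  have f1: "int (odd_fact (Suc r)) = K * int (odd_fact r)" unfolding K_def by (simp add: algebra_simps)
  have cancel: "x = y" if "x * int (odd_fact j) = y * int (odd_fact j)" for x y j
    using that by simp
  \<comment> \<open>The coefficientwise \<open>div\<close> says nothing before exactness is known.
    For \<open>i \<le> r\<close> the factor \<open>K\<close> remains beside the quotient of double
    factorials, for the two top indices it comes from the bracket.\<close>
  have "\<exists>z. coeff W (2 * i) = K * z" for i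
  proof -
    consider "i \<le> r" | "i = Suc r" | "i = Suc (Suc r)" | "Suc (Suc r) < i" by linarith
    then show ?thesis
    proof cases
      case 1
      then obtain q where q: "odd_fact r = odd_fact i * q" using odd_fact_quotient by blast
      have "coeff W (2 * i) * int (odd_fact i)
          = (K * ((-1) ^ (r + i) * even_bracket (Suc r) i * (2 * int r + 3) * int q)) * int (odd_fact i)"
        unfolding W f3 f1 q by (simp add: algebra_simps)
      then show ?thesis using cancel by blast
    next
      case 2
      have b: "even_bracket (Suc r) (Suc r) = K * int r" unfolding even_bracket_def K_def by (simp add: algebra_simps)
      have "coeff W (2 * i) * int (odd_fact (Suc r))
          = (K * ((-1) ^ (r + i) * int r * (2 * int r + 3))) * int (odd_fact (Suc r))"
        using W[of i] unfolding f3 2 b by (simp add: algebra_simps del: odd_fact_Suc)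
      then show ?thesis using cancel by blast
    next
      case 3
      have b: "even_bracket (Suc r) (Suc (Suc r)) = K" unfolding even_bracket_def K_def by (simp add: binomial_eq_0)
      have "coeff W (2 * i) * int (odd_fact (Suc (Suc r))) = (K * (-1) ^ (r + i)) * int (odd_fact (Suc (Suc r)))"
        using W[of i] unfolding 3 b by (simp add: algebra_simps del: odd_fact_Suc)
      then show ?thesis using cancel by blast
    next
      case 4
      then have "even_bracket (Suc r) i = 0" unfolding even_bracket_def by (simp add: binomial_eq_0)
      then have "coeff W (2 * i) = 0" using W[of i] by simp
      then show ?thesis by simp
    qed
  qed
  then have KR: "coeff W (2 * i) = K * coeff R (2 * i)" for i using RW[of "2 * i"] K0 by (metis nonzero_mult_div_cancel_left)
  have "K * (coeff R (2 * i) * int (odd_fact i))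
      = K * ((-1) ^ (r + i) * even_bracket (Suc r) i * (2 * int r + 3) * int (odd_fact r))"
    using W[of i] unfolding KR f3 f1 by (simp only: ac_simps)
  then show "coeff R (2 * i) * int (odd_fact i) = (-1) ^ (r + i) * even_bracket (Suc r) i * (2 * int r + 3) * int (odd_fact r)"
    using K0 by (simp only: mult_cancel_left simp_thms)
  show "coeff R (2 * i + 1) = 0" unfolding RW W0 by simp
qed

text \<open>Below \<open>2s + 1\<close> the odd numbers are \<open>3^a - 2l\<close> for
  \<open>l = 1, ..., M\<close>. As \<open>l < 3^a\<close>, each of them is at least as divisible by
  3 as \<open>l\<close>.\<close>

lemma multiplicity_3_odd_fact:
  assumes "2 * s + 1 = 3 ^ a" "M \<le> s"
  shows "multiplicity 3 (odd_fact (s - M)) + a + multiplicity 3 (fact M :: nat) \<le> multiplicity 3 (odd_fact (Suc s))"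
  using assms(2)
proof (induction M)
  case 0
  have "multiplicity 3 (odd_fact (Suc s)) = multiplicity 3 ((3::nat) ^ a) + multiplicity 3 (odd_fact s)"
    unfolding odd_fact_Suc assms(1) by (rule prime_elem_multiplicity_mult_distrib) simp_all
  moreover have "multiplicity 3 ((3::nat) ^ a) = a" by (simp add: multiplicity_same_power')
  ultimately show ?case by simp
next
  case (Suc M)
  define x where "x = 2 * (s - Suc M) + 1"
  obtain k where k: "s = Suc M + k" using Suc.prems le_Suc_ex by blast
  have x: "x = 3 ^ a - 2 * Suc M" unfolding x_def assms(1)[symmetric] k by simp
  have "odd_fact (s - M) = x * odd_fact (s - Suc M)"
    using Suc.prems odd_fact_Suc[of "s - Suc M"] unfolding x_def by (simp add: Suc_diff_Suc del: odd_fact_Suc)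
  moreover have "x \<noteq> 0" unfolding x_def by simp
  ultimately have 1: "multiplicity 3 (odd_fact (s - M)) = multiplicity 3 x + multiplicity 3 (odd_fact (s - Suc M))"
    by (simp add: prime_elem_multiplicity_mult_distrib)
  have 2: "multiplicity 3 (fact (Suc M) :: nat) = multiplicity 3 (Suc M) + multiplicity 3 (fact M :: nat)"
    unfolding fact_Suc of_nat_id by (rule prime_elem_multiplicity_mult_distrib) simp_all
  define h where "h = multiplicity 3 (Suc M)"
  have h: "3 ^ h dvd Suc M" unfolding h_def by (rule multiplicity_dvd)
  then have "3 ^ h \<le> Suc M" by (rule dvd_imp_le) simp
  also have "\<dots> < 3 ^ a" using Suc.prems assms(1) by linarith
  finally have "h < a" by (rule power_less_imp_less_exp[rotated]) simp
  then have "3 ^ h dvd (3::nat) ^ a" by (intro le_imp_power_dvd) simp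
  then have "3 ^ h dvd x" unfolding x by (rule dvd_diff_nat) (use h in \<open>rule dvd_mult\<close>)
  then have 3: "h \<le> multiplicity 3 x" using \<open>x \<noteq> 0\<close> by (intro multiplicity_geI) simp_all
  have "multiplicity 3 (odd_fact (s - M)) + a + multiplicity 3 (fact M :: nat) \<le> multiplicity 3 (odd_fact (Suc s))"
    using Suc.IH Suc.prems by simp
  then show ?case using 1 2 3 unfolding h_def by linarith
qed

text \<open>By Legendre \<open>2 * multiplicity 3 (fact M)\<close> is \<open>M\<close> minus the
  digit sum of \<open>M\<close> in base 3, and below \<open>3^a / 2\<close> this digit sum is at
  most \<open>2a - 2\<close>.\<close>

lemma multiplicity_3_fact_bound:
  assumes "2 \<le> a" "2 * M + 1 \<le> 3 ^ a"
  shows "M + 2 \<le> 2 * a + 2 * multiplicity 3 (fact M :: nat)"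
  using assms
proof (induction a arbitrary: M rule: dec_induct)
  case base
  have rec: "multiplicity 3 (fact M :: nat) = M div 3 + multiplicity 3 (fact (M div 3) :: nat)"
    by (rule multiplicity_fact_rec) simp
  have "M \<le> 4" using base by simp
  then have "M \<le> 2 \<or> M div 3 = 1" by linarith
  then show ?case using rec \<open>M \<le> 4\<close> by linarith
next
  case (step a)
  define q where "q = M div 3"
  have rec: "multiplicity 3 (fact M :: nat) = q + multiplicity 3 (fact q :: nat)"
    unfolding q_def by (rule multiplicity_fact_rec) simp
  have q: "M < 3 * q + 3" "3 * q \<le> M" unfolding q_def by linarith+
  have "2 * M + 1 \<le> 3 * 3 ^ a" using step.prems by simp
  then have "2 * q + 1 \<le> 3 ^ a" using q by linarith
  then have IH: "q + 2 \<le> 2 * a + 2 * multiplicity 3 (fact q :: nat)" by (rule step.IH)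
  have arith: "M + 2 \<le> 2 * Suc a + 2 * V" if "q + 2 \<le> 2 * a + 2 * v" "V = q + v" for v V :: nat
    using that q(1) by presburger
  show ?case by (rule arith[OF IH rec])
qed

text \<open>The parametrisation \<open>n = 2 * Suc r\<close> makes \<open>(n - 3)!!\<close> equal to
  \<open>odd_fact r\<close>, without subtraction.\<close>

theorem irreducible_remainder_even: "irreducible (remainder_poly [2 * Suc r, 2])"
proof -
  define R where "R = remainder_poly [2 * Suc r, 2]"
  have C: "coeff R (2 * i) * int (odd_fact i) = (-1) ^ (r + i) * even_bracket (Suc r) i * (2 * int r + 3) * int (odd_fact r)"
    and C0: "coeff R (2 * i + 1) = 0" for i
    unfolding R_def by (rule even_remainder_coeffs)+
  have odd0: "coeff R j = 0" if "odd j" for j using that C0 by (auto elim!: oddE)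
  have cancel: "x = y" if "x * int (odd_fact j) = y * int (odd_fact j)" for x y j
    using that by simp
  have f3: "int (odd_fact (Suc (Suc r))) = (2 * int r + 3) * int (odd_fact (Suc r))"
    unfolding odd_fact_Suc[of "Suc r"] by (simp add: algebra_simps del: odd_fact_Suc)
  have f1: "int (odd_fact (Suc r)) = (2 * int r + 1) * int (odd_fact r)" by (simp add: algebra_simps)
  have high: "coeff R j = 0" if j: "2 * r + 4 < j" for j
  proof (cases "even j")
    case True
    then obtain i where i: "j = 2 * i" by blast
    then have "even_bracket (Suc r) i = 0" using j unfolding even_bracket_def by (simp add: binomial_eq_0)
    then show ?thesis using C[of i] i by simp
  qed (rule odd0)
  have top: "coeff R (2 * r + 4) = 1"
  proof -
    have b: "even_bracket (Suc r) (Suc (Suc r)) = 2 * int r + 1" unfolding even_bracket_def by (simp add: binomial_eq_0)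
    have sg: "(-1::int) ^ (r + Suc (Suc r)) = 1" by (rule neg_one_even_power) simp
    have "coeff R (2 * Suc (Suc r)) * int (odd_fact (Suc (Suc r))) = 1 * int (odd_fact (Suc (Suc r)))"
      using C[of "Suc (Suc r)"] unfolding b sg f3 f1 by (simp only: ac_simps)
    then have "coeff R (2 * Suc (Suc r)) = 1" by (rule cancel)
    moreover have "2 * Suc (Suc r) = 2 * r + 4" by simp
    ultimately show ?thesis by metis
  qed
  have deg: "degree R = 2 * r + 4"
    by (rule antisym) (use high top in \<open>auto intro!: degree_le le_degree\<close>)
  have R0: "coeff R 0 = (-1) ^ r * ((2 * int r + 3) * int (odd_fact r))"
    using C[of 0] by (simp add: even_bracket_def)
  have "2 * int r + 3 \<noteq> 0" by linarith
  then have R0n: "coeff R 0 \<noteq> 0" unfolding R0 by simp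
  have Rel: "coeff R (2 * i) * int (odd_fact i) = ((-1) ^ i * even_bracket (Suc r) i) * coeff R 0" for i
    unfolding C R0 power_add by (simp only: ac_simps)
  have "irreducible R"
  proof (rule irreducible_if_no_small_factor)
    show "lead_coeff R = 1" "0 < degree R" using top unfolding deg by simp_all
    fix A B assume RAB: "R = A * B" and d0: "0 < degree A" and dle: "degree A \<le> degree B"
    have AB0: "A \<noteq> 0" "B \<noteq> 0" using R0n unfolding RAB by auto
    have dsum: "degree A + degree B = 2 * r + 4" using deg AB0 unfolding RAB by (simp add: degree_mult_eq)
    have monic: "lead_coeff (A * B) = 1" using top deg unfolding RAB by simp
    have R0n': "coeff (A * B) 0 \<noteq> 0" using R0n unfolding RAB .
    have A0: "coeff A 0 \<noteq> 0" using R0n unfolding RAB by (auto simp: coeff_mult_0)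
    \<comment> \<open>The constant term times an integer equals the coefficient of
      \<open>x^(2i)\<close> times \<open>odd_fact i\<close>, so the bound for
      \<open>odd_fact i\<close> becomes a bound for the slopes.\<close>
    have val: "p * multiplicity (int p) (coeff A 0) < degree A" if p: "prime p" "odd p" for p :: nat
    proof (rule factor_low_valuation[OF _ monic d0 _ R0n'])
      show "prime (int p)" "0 < p" using p(1) prime_gt_0_nat by auto
      show "p * multiplicity (int p) (coeff (A * B) 0) < p * multiplicity (int p) (coeff (A * B) j) + j"
        if j: "0 < j" "coeff (A * B) j \<noteq> 0" for j
      proof -
        have "even j" using odd0[of j] j(2) unfolding RAB by blast
        then obtain i where i: "j = 2 * i" by blast
        have "multiplicity (int p) (coeff R 0) \<le> multiplicity (int p) (coeff R j) + multiplicity (int p) (int (odd_fact i))"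
          by (rule multiplicity_le_of_mult_eq[OF _ Rel[of i, folded i]]) (use p j in \<open>simp_all add: RAB\<close>)
        moreover have "p * multiplicity p (odd_fact i) < j" using multiplicity_odd_fact_less[OF p, of i] i j(1) by simp
        ultimately show ?thesis unfolding multiplicity_of_nat_int RAB[symmetric] by (rule slope_step)
      qed
    qed
    show False
    proof (cases "degree A = 4 \<and> (\<exists>a. 2 * Suc r + 1 = (3::nat) ^ a)")
      case False
      have "\<exists>p l. prime p \<and> odd p \<and> degree A \<le> p \<and> p dvd 2 * l + 1
          \<and> (l = Suc r \<or> l + 2 \<le> Suc r \<and> Suc r + 1 \<le> l + (degree A + 1) div 2)"
        by (rule even_case_prime_factor) (use d0 dle dsum False in auto)
      then obtain p l where p: "prime p" "odd p" "degree A \<le> p" "p dvd 2 * l + 1"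
        and l: "l = Suc r \<or> l + 2 \<le> Suc r \<and> Suc r + 1 \<le> l + (degree A + 1) div 2" by blast
      have "multiplicity (int p) (coeff A 0) = 0"
      proof (rule ccontr)
        assume "multiplicity (int p) (coeff A 0) \<noteq> 0"
        then have "p * 1 \<le> p * multiplicity (int p) (coeff A 0)" by (intro mult_le_mono2) simp
        then show False using val[OF p(1,2)] p(3) by linarith
      qed
      then have nd: "\<not> int p dvd coeff A 0" using p(1) A0 by (intro not_dvd_if_multiplicity_eq_0) simp_all
      have pl: "int p dvd int (2 * l + 1)" using p(4) by (simp only: int_dvd_int_iff)
      show False
      proof (rule no_factor_of_degree[OF _ monic _ nd])
        show "prime (int p)" using p(1) by simp
        fix j assume jB: "j \<le> degree B"
        have "int p dvd coeff R j"
        proof (cases "even j")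
          case True
          then obtain i where i: "j = 2 * i" by blast
          have ij: "2 * i + degree A \<le> 2 * r + 4" using jB i dsum by linarith
          have half: "2 * ((degree A + 1) div 2) \<le> degree A + 1" by simp
          show ?thesis
          proof (cases "i \<le> r")
            case True
            then obtain q where q: "odd_fact r = odd_fact i * q" "\<forall>l. i \<le> l \<longrightarrow> l < r \<longrightarrow> 2 * l + 1 dvd q"
              using odd_fact_quotient by blast
            have "coeff R (2 * i) * int (odd_fact i)
                = ((-1) ^ (r + i) * even_bracket (Suc r) i * (2 * int r + 3) * int q) * int (odd_fact i)"
              unfolding C q(1) by (simp add: algebra_simps)
            then have F: "coeff R j = (-1) ^ (r + i) * even_bracket (Suc r) i * (2 * int r + 3) * int q"
              unfolding i by (rule cancel)
            from l show ?thesis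
            proof
              assume "l = Suc r"
              then have "int (2 * l + 1) = 2 * int r + 3" by simp
              then have "int p dvd 2 * int r + 3" using pl by metis
              then show ?thesis unfolding F by (intro dvd_mult2 dvd_mult)
            next
              assume l': "l + 2 \<le> Suc r \<and> Suc r + 1 \<le> l + (degree A + 1) div 2"
              then have "i \<le> l" "l < r" using ij half by linarith+
              then have "2 * l + 1 dvd q" using q(2) by blast
              then have "p dvd q" using p(4) dvd_trans by blast
              then show ?thesis unfolding F by (intro dvd_mult) simp
            qed
          next
            case False
            \<comment> \<open>This index is reached only if \<open>degree A \<le> 2\<close>. The
              window then consists of \<open>2r + 3\<close> alone, which is still a factor of the
              coefficient.\<close>
            then have ir: "i = Suc r" using ij d0 by linarith
            have lr: "l = Suc r"
            proof (rule ccontr)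
              assume "l \<noteq> Suc r"
              then have "l + 2 \<le> Suc r \<and> Suc r + 1 \<le> l + (degree A + 1) div 2" using l by blast
              then show False using ij half ir by linarith
            qed
            have b: "even_bracket (Suc r) (Suc r) = (2 * int r + 1) * int r" unfolding even_bracket_def by (simp add: algebra_simps)
            have "coeff R (2 * i) * int (odd_fact (Suc r)) = ((-1) ^ (r + i) * int r * (2 * int r + 3)) * int (odd_fact (Suc r))"
              using C[of i] unfolding ir b f1 by (simp only: ac_simps)
            then have F: "coeff R j = (-1) ^ (r + i) * int r * (2 * int r + 3)" unfolding i by (rule cancel)
            have "int (2 * l + 1) = 2 * int r + 3" unfolding lr by simp
            then have "int p dvd 2 * int r + 3" using pl by metis
            then show ?thesis unfolding F by (intro dvd_mult)
          qed
        next
          case False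
          then show ?thesis using odd0 by simp
        qed
        then show "int p dvd coeff (A * B) j" unfolding RAB .
      qed
    next
      case True
      then obtain a where d4: "degree A = 4" and a: "2 * Suc r + 1 = (3::nat) ^ a" by blast
      have r2: "2 \<le> r" using d4 dle dsum by linarith
      have a2: "2 \<le> a"
      proof (rule ccontr)
        assume "\<not> 2 \<le> a"
        then have "a = 0 \<or> a = 1" by linarith
        then show False using a r2 by auto
      qed
      have "3 dvd (3::nat) ^ a" using a2 by simp
      have three: "prime (3::int)" by simp
      have v1: "3 * multiplicity 3 (coeff A 0) < 4" using val[of 3] d4 by simp
      \<comment> \<open>Reversal exchanges the two ends of the Newton polygon. The bound
        \<open>v1\<close> allows at most one factor 3 in the constant term of \<open>A\<close>; the
        reversed estimate, with weight \<open>4 * v - j\<close>, demands two.\<close>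
      have rA: "coeff (reflect_poly A) 4 = coeff A 0" "coeff (reflect_poly A) 0 = lead_coeff A"
        using d4 by (simp_all add: coeff_reflect_poly)
      have rAB: "reflect_poly A * reflect_poly B = reflect_poly R" unfolding RAB by (rule reflect_poly_mult[symmetric])
      have rR0: "coeff (reflect_poly R) 0 = 1" using top deg by (simp add: coeff_reflect_poly)
      have "4 * int (multiplicity 3 (coeff (reflect_poly A) 0)) < 4 * int (multiplicity 3 (coeff (reflect_poly A) 4)) + (-1) * int 4"
      proof (rule strict_min_at_0_factor[OF three])
        show "coeff (reflect_poly A * reflect_poly B) 0 \<noteq> 0" unfolding rAB rR0 by simp
        show "coeff (reflect_poly A) 4 \<noteq> 0" unfolding rA by (rule A0)
        fix j :: nat assume j: "0 < j" "coeff (reflect_poly A * reflect_poly B) j \<noteq> 0"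
        have jd: "j \<le> 2 * r + 4" and cj: "coeff (reflect_poly R) j = coeff R (2 * r + 4 - j)"
          using j(2) unfolding rAB by (auto simp: coeff_reflect_poly deg split: if_splits)
        have nz: "coeff R (2 * r + 4 - j) \<noteq> 0" using j(2) unfolding rAB cj .
        then have "even (2 * r + 4 - j)" using odd0 by blast
        then obtain i where i: "2 * r + 4 - j = 2 * i" by blast
        have ir: "i \<le> Suc r" using i j(1) jd by linarith
        have jm: "j = 2 * (Suc r - i) + 2" using i jd ir by linarith
        define M where "M = Suc r - i"
        have iM: "Suc r - M = i" "M \<le> Suc r" using ir unfolding M_def by simp_all
        have "3 * int (multiplicity 3 (coeff R 0)) \<ge> 0" by simp
        have "\<not> (3::int) dvd 2 * int r + 1"
        proof
          assume "(3::int) dvd 2 * int r + 1"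
          then have "(3::int) dvd int (2 * r + 1)" by (simp add: add.commute)
          then have "3 dvd 2 * r + 1" by presburger
          moreover have "3 dvd 2 * Suc r + 1" unfolding a by (rule \<open>3 dvd 3 ^ a\<close>)
          ultimately show False by presburger
        qed
        then have v0: "multiplicity 3 (2 * int r + 1) = 0" by (rule not_dvd_imp_multiplicity_0)
        have "(coeff R (2 * i) * (2 * int r + 1)) * int (odd_fact i) = (coeff R (2 * i) * int (odd_fact i)) * (2 * int r + 1)"
          by (simp only: ac_simps)
        also have "\<dots> = ((-1) ^ (r + i) * even_bracket (Suc r) i) * int (odd_fact (Suc (Suc r)))"
          unfolding C f3 f1 by (simp only: ac_simps)
        finally have "multiplicity 3 (int (odd_fact (Suc (Suc r)))) \<le> multiplicity 3 (coeff R (2 * i) * (2 * int r + 1)) + multiplicity 3 (int (odd_fact i))"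
        proof (rule multiplicity_le_of_mult_eq[OF three])
          have "2 * int r + 1 \<noteq> 0" by linarith
          then show "coeff R (2 * i) * (2 * int r + 1) \<noteq> 0" using nz unfolding i by simp
        qed simp
        moreover have "multiplicity 3 (coeff R (2 * i) * (2 * int r + 1)) = multiplicity 3 (coeff R (2 * i)) + multiplicity 3 (2 * int r + 1)"
          by (rule prime_elem_multiplicity_mult_distrib) (use nz i in \<open>simp_all, linarith?\<close>)
        ultimately have "multiplicity 3 (odd_fact (Suc (Suc r))) \<le> multiplicity 3 (coeff R (2 * i)) + multiplicity 3 (odd_fact i)"
          unfolding v0 using multiplicity_of_nat_int[of 3 "odd_fact (Suc (Suc r))"] multiplicity_of_nat_int[of 3 "odd_fact i"]
          by (simp del: odd_fact_Suc)
        moreover have "multiplicity 3 (odd_fact i) + a + multiplicity 3 (fact M :: nat) \<le> multiplicity 3 (odd_fact (Suc (Suc r)))"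
          using multiplicity_3_odd_fact[OF a iM(2)] unfolding iM(1) .
        moreover have "M + 2 \<le> 2 * a + 2 * multiplicity 3 (fact M :: nat)"
          by (rule multiplicity_3_fact_bound[OF a2]) (use iM(2) in \<open>simp flip: a\<close>)
        ultimately have "M + 2 \<le> 2 * multiplicity 3 (coeff R (2 * i))" by linarith
        then have "j < 4 * multiplicity 3 (coeff R (2 * i))" using jm unfolding M_def by linarith
        then show "4 * int (multiplicity 3 (coeff (reflect_poly A * reflect_poly B) 0))
            < 4 * int (multiplicity 3 (coeff (reflect_poly A * reflect_poly B) j)) + (-1) * int j"
          unfolding rAB rR0 cj i by simp
      qed simp_all
      moreover have "multiplicity 3 (lead_coeff A) = 0"
        by (rule multiplicity_unit_eq_0[OF three]) (rule lead_coeff_factor_unit(1)[OF monic])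
      ultimately show False using v1 unfolding rA by linarith
    qed
  qed
  then show ?thesis unfolding R_def .
qed

section \<open>Odd n\<close>

text \<open>What is left of a Wronskian coefficient after the double factorials and the factor
  \<open>2s - 2 = n - 1\<close>. Written this way, the second summand is visibly divisible by
  \<open>s\<close>.\<close>

definition odd_bracket :: "nat \<Rightarrow> nat \<Rightarrow> int" where
  "odd_bracket s i = int (s choose i) + 2 * int s * (if i < 2 then 0 else int ((s - 2) choose (i - 2)))"

text \<open>The variables stand for \<open>c = C(s, i)\<close>, \<open>c' = C(s, i + 1)\<close> and
  \<open>y = C(s - 2, i - 2)\<close>. Stating it over the integers keeps the ring computation apart
  from truncated subtraction.\<close>

lemma odd_bracket_identity:
  fixes s i c c' y :: int
  assumes "(i + 1) * c' = (s - i) * c" "i * (i - 1) * c = s * (s - 1) * y"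
  shows "(2 * i - 2) * (2 * i + 1) * c + (2 * i + 2) * c' = (2 * s - 2) * (c + 2 * s * y)"
proof -
  have "(2 * i - 2) * (2 * i + 1) * c + (2 * i + 2) * c' = (2 * i - 2) * (2 * i + 1) * c + 2 * ((i + 1) * c')"
    by (simp add: algebra_simps)
  also have "\<dots> = 4 * (i * (i - 1) * c) + (2 * s - 2) * c" unfolding assms(1) by (simp add: algebra_simps)
  also have "\<dots> = (2 * s - 2) * (c + 2 * s * y)" unfolding assms(2) by (simp add: algebra_simps)
  finally show ?thesis .
qed

lemma odd_bracket_eq:
  assumes "2 \<le> s"
  shows "(2 * int i - 2) * (2 * int i + 1) * int (s choose i) + (2 * int i + 2) * int (s choose Suc i)
    = (2 * int s - 2) * odd_bracket s i"
  unfolding odd_bracket_def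
proof (rule odd_bracket_identity)
  show "(int i + 1) * int (s choose Suc i) = (int s - int i) * int (s choose i)"
  proof (cases "i \<le> s")
    case True
    have "int (Suc i) * int (s choose Suc i) = int (s - i) * int (s choose i)"
      by (simp only: binomial_absorption binomial_absorb_comp flip: of_nat_mult)
    moreover have "int (Suc i) = int i + 1" "int (s - i) = int s - int i" using True by simp_all
    ultimately show ?thesis by metis
  qed (simp add: binomial_eq_0)
  show "int i * (int i - 1) * int (s choose i) = int s * (int s - 1) * (if i < 2 then 0 else int ((s - 2) choose (i - 2)))"
  proof (cases "i < 2")
    case True
    then have "i = 0 \<or> i = 1" by linarith
    then show ?thesis by auto
  next
    case False
    obtain k where k: "i = Suc (Suc k)" using False by (metis add_2_eq_Suc le_Suc_ex not_le)
    obtain t where t: "s = Suc (Suc t)" using assms by (metis add_2_eq_Suc le_Suc_ex)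
    have 1: "int (Suc (Suc k)) * int (Suc (Suc t) choose Suc (Suc k)) = int (Suc (Suc t)) * int (Suc t choose Suc k)"
      by (simp only: Suc_times_binomial flip: of_nat_mult)
    have 2: "int (Suc k) * int (Suc t choose Suc k) = int (Suc t) * int (t choose k)"
      by (simp only: Suc_times_binomial flip: of_nat_mult)
    have "int i * (int i - 1) * int (s choose i) = int (Suc k) * (int (Suc (Suc k)) * int (Suc (Suc t) choose Suc (Suc k)))"
      unfolding k t by (simp add: algebra_simps del: binomial_Suc_Suc)
    also have "\<dots> = int (Suc (Suc t)) * (int (Suc k) * int (Suc t choose Suc k))" unfolding 1 by (simp only: ac_simps)
    also have "\<dots> = int s * (int s - 1) * int (t choose k)" unfolding 2 t by (simp add: algebra_simps)
    finally show ?thesis using False k t by simp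
  qed
qed

lemma odd_wronskian_coeffs:
  fixes s :: nat
  defines "W \<equiv> wronskian [hermite 2, hermite (2 * s)]"
  assumes s: "2 \<le> s"
  shows "coeff W (2 * i + 1) * int (odd_fact (Suc i)) = (-1) ^ (s + i) * int (odd_fact s) * ((2 * int s - 2) * odd_bracket s i)"
    and "coeff W (2 * i) = 0"
proof -
  define H where "H = hermite (2 * s)"
  have H1: "coeff H (2 * i) * int (odd_fact i) = (-1) ^ (s + i) * int (s choose i) * int (odd_fact s)"
    and H0: "coeff H (2 * i + 1) = 0" for i
    using hermite_coeffs[of s] unfolding H_def by blast+
  have WH: "W = wronskian [hermite 2, H]" unfolding W_def H_def ..
  have w: "coeff W (2 * i + 1) = (2 * int i - 2) * coeff H (2 * i) - (2 * int i + 2) * coeff H (2 * Suc i)"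
  proof (cases i)
    case 0
    have "coeff W (Suc 0) = - 2 * coeff H 2 - 2 * coeff H 0" unfolding WH by (rule coeff_wronskian_hermite_2)
    moreover have "2 * 0 + 1 = Suc 0" "2 * 0 = (0::nat)" "2 * Suc 0 = (2::nat)" by simp_all
    ultimately show ?thesis unfolding 0 by simp
  next
    case (Suc k)
    have x: "coeff W (Suc (Suc (2 * k + 1))) = (int (2 * k + 1) - 1) * coeff H (2 * k + 1 + 1) - (int (2 * k + 1) + 3) * coeff H (2 * k + 1 + 3)"
      unfolding WH by (rule coeff_wronskian_hermite_2)
    have a: "2 * Suc k + 1 = Suc (Suc (2 * k + 1))" "2 * k + 1 + 1 = 2 * Suc k" "2 * k + 1 + 3 = 2 * Suc (Suc k)" by simp_all
    have n: "int (2 * k + 1) - 1 = 2 * int (Suc k) - 2" "int (2 * k + 1) + 3 = 2 * int (Suc k) + 2" by simp_all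
    show ?thesis unfolding Suc a(1) x n unfolding a(2,3) ..
  qed
  have f: "int (odd_fact (Suc i)) = (2 * int i + 1) * int (odd_fact i)" by (simp add: algebra_simps)
  have "coeff W (2 * i + 1) * int (odd_fact (Suc i)) = (2 * int i - 2) * (2 * int i + 1) * (coeff H (2 * i) * int (odd_fact i))
      - (2 * int i + 2) * (coeff H (2 * Suc i) * int (odd_fact (Suc i)))"
    unfolding w f by (simp add: algebra_simps)
  also have "\<dots> = (2 * int i - 2) * (2 * int i + 1) * ((-1) ^ (s + i) * int (s choose i) * int (odd_fact s))
      - (2 * int i + 2) * ((-1) ^ (s + Suc i) * int (s choose Suc i) * int (odd_fact s))"
    by (simp only: H1)
  also have "\<dots> = (-1) ^ (s + i) * int (odd_fact s)
      * ((2 * int i - 2) * (2 * int i + 1) * int (s choose i) + (2 * int i + 2) * int (s choose Suc i))"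
    by (simp add: algebra_simps)
  finally show "coeff W (2 * i + 1) * int (odd_fact (Suc i)) = (-1) ^ (s + i) * int (odd_fact s) * ((2 * int s - 2) * odd_bracket s i)"
    unfolding odd_bracket_eq[OF s] .
  show "coeff W (2 * i) = 0"
  proof (cases i)
    case 0
    have "coeff W 0 = - coeff H 1" unfolding WH by (rule coeff_wronskian_hermite_2)
    then show ?thesis unfolding 0 using H0[of 0] by simp
  next
    case (Suc k)
    have x: "coeff W (Suc (Suc (2 * k))) = (int (2 * k) - 1) * coeff H (2 * k + 1) - (int (2 * k) + 3) * coeff H (2 * k + 3)"
      unfolding WH by (rule coeff_wronskian_hermite_2)
    have a: "2 * Suc k = Suc (Suc (2 * k))" "2 * k + 3 = 2 * Suc k + 1" by simp_all
    have "coeff H (2 * k + 3) = 0" unfolding a(2) by (rule H0)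
    then show ?thesis unfolding Suc a(1) x H0 by simp
  qed
qed

lemma odd_bracket_self: "2 \<le> s \<Longrightarrow> odd_bracket s s = 1 + 2 * int s"
  unfolding odd_bracket_def by simp

lemma odd_bracket_eq_0: "s < i \<Longrightarrow> 2 \<le> s \<Longrightarrow> odd_bracket s i = 0"
  unfolding odd_bracket_def by (simp add: binomial_eq_0)

lemma odd_remainder_coeffs:
  fixes s :: nat
  defines "R \<equiv> remainder_poly [2 * s - 1, 2]"
  assumes s: "2 \<le> s"
  shows "coeff R (2 * i) * int (odd_fact (Suc i)) = (-1) ^ (s + i) * int (odd_fact s) * odd_bracket s i"
    and "coeff R (2 * i + 1) = 0"
proof -
  define W where "W = wronskian [hermite 2, hermite (2 * s)]"
  define V where "V = wronskian_hermite [2 * s - 1, 2]"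
  define K where "K = 2 * int s - 2"
  have K0: "K \<noteq> 0" using s unfolding K_def by linarith
  have e: "int (2 * s - 1) - 1 = K" "Suc (2 * s - 1) = 2 * s" using s unfolding K_def by linarith+
  have VW: "coeff V k = coeff W k div K" for k unfolding V_def coeff_wronskian_hermite e W_def ..
  have W: "coeff W (2 * i + 1) * int (odd_fact (Suc i)) = (-1) ^ (s + i) * int (odd_fact s) * (K * odd_bracket s i)"
    and W0: "coeff W (2 * i) = 0" for i
    unfolding W_def K_def by (rule odd_wronskian_coeffs[OF s])+
  have c: "core2_size [2 * s - 1, 2] = 1" by (rule core2_size_odd[OF s])
  have "coeff V 0 = 0" using VW[of 0] W0[of 0] by simp
  then obtain Q where Q: "V = pCons 0 Q" by (cases V) auto
  have m: "monom (1::int) 1 = [:0, 1:]" by (simp add: monom_Suc monom_0)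
  have "V = monom 1 1 * Q" unfolding Q m by simp
  moreover have "monom (1::int) 1 \<noteq> 0" unfolding m by simp
  ultimately have "V div monom 1 1 = Q" by simp
  then have "R = Q" unfolding R_def remainder_poly_def c V_def by simp
  then have RW: "coeff R k = coeff W (Suc k) div K" for k using VW[of "Suc k"] Q by simp
  have cancel: "x = y" if "x * int (odd_fact j) = y * int (odd_fact j)" for x y j
    using that by simp
  \<comment> \<open>Exactness again: here \<open>K\<close> is an explicit factor, and at the top
    index the double factorials cancel against the bracket \<open>1 + 2s\<close>.\<close>
  have "\<exists>z. coeff W (2 * i + 1) = K * z" for i
  proof -
    consider "i < s" | "i = s" | "s < i" by linarith
    then show ?thesis
    proof cases
      case 1
      then obtain q where q: "odd_fact s = odd_fact (Suc i) * q" using odd_fact_quotient[of "Suc i" s] by auto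
      have "coeff W (2 * i + 1) * int (odd_fact (Suc i)) = (K * ((-1) ^ (s + i) * odd_bracket s i * int q)) * int (odd_fact (Suc i))"
        unfolding W q of_nat_mult by (simp only: ac_simps)
      then show ?thesis using cancel by blast
    next
      case 2
      have f: "int (odd_fact (Suc s)) = (1 + 2 * int s) * int (odd_fact s)" by (simp add: algebra_simps)
      have "coeff W (2 * i + 1) * int (odd_fact (Suc s)) = (K * (-1) ^ (s + i)) * int (odd_fact (Suc s))"
        using W[of i] unfolding 2 odd_bracket_self[OF s] f by (simp only: ac_simps)
      then show ?thesis using cancel by blast
    next
      case 3
      have "coeff W (2 * i + 1) * int (odd_fact (Suc i)) = (K * 0) * int (odd_fact (Suc i))"
        unfolding W odd_bracket_eq_0[OF 3 s] by simp
      then show ?thesis using cancel by blast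
    qed
  qed
  then have KR: "coeff W (2 * i + 1) = K * coeff R (2 * i)" for i
    using RW[of "2 * i"] K0 by (metis Suc_eq_plus1 nonzero_mult_div_cancel_left)
  have "K * (coeff R (2 * i) * int (odd_fact (Suc i))) = K * ((-1) ^ (s + i) * int (odd_fact s) * odd_bracket s i)"
    using W[of i] unfolding KR by (simp only: ac_simps)
  then show "coeff R (2 * i) * int (odd_fact (Suc i)) = (-1) ^ (s + i) * int (odd_fact s) * odd_bracket s i"
    using K0 by (simp only: mult_cancel_left simp_thms)
  have "coeff W (Suc (2 * i + 1)) = 0" using W0[of "Suc i"] by simp
  then show "coeff R (2 * i + 1) = 0" unfolding RW by simp
qed

text \<open>The slope bound for odd \<open>n\<close>. Equality does occur, as for
  \<open>p = 3\<close> and \<open>i = 1\<close>; if \<open>p\<close> divides \<open>i\<close>, the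
  valuation of \<open>i!\<close> that is subtracted makes it strict.\<close>

lemma multiplicity_odd_fact_bound:
  fixes p :: nat
  assumes p: "prime p" "odd p"
  shows "(p - 1) * multiplicity p (odd_fact (Suc i)) \<le> 2 * i"
    and "p dvd i \<Longrightarrow> 0 < i \<Longrightarrow> (p - 1) * multiplicity p (odd_fact (Suc i)) < 2 * i"
proof -
  define m where "m = multiplicity p (fact (2 * i + 1) :: nat)"
  define w where "w = multiplicity p (fact i :: nat)"
  define v where "v = multiplicity p (odd_fact (Suc i))"
  have m: "(p - 1) * m \<le> 2 * i" using multiplicity_fact_le[OF p(1), of "2 * i + 1"] unfolding m_def by simp
  have v: "v \<le> m - w" unfolding v_def m_def w_def by (rule multiplicity_odd_fact_le_fact[OF p])
  have "(p - 1) * v \<le> (p - 1) * m" using v by (intro mult_le_mono2) simp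
  then show "(p - 1) * multiplicity p (odd_fact (Suc i)) \<le> 2 * i" using m unfolding v_def by linarith
  assume i: "p dvd i" "0 < i"
  have "p \<le> i" using i by (rule dvd_imp_le)
  then have "p dvd fact i" using prime_gt_0_nat[OF p(1)] by (intro dvd_fact) simp_all
  then have w1: "1 \<le> w" unfolding w_def using prime_gt_1_nat[OF p(1)] by (intro multiplicity_geI) simp_all
  have "w \<le> m" unfolding w_def m_def by (intro dvd_imp_multiplicity_le fact_dvd) simp_all
  then have "v + 1 \<le> m" using v w1 by linarith
  then have "(p - 1) * (v + 1) \<le> (p - 1) * m" by (rule mult_le_mono2)
  moreover have "(p - 1) * (v + 1) = (p - 1) * v + (p - 1)" by simp
  moreover have "1 < p" using p(1) by (rule prime_gt_1_nat)
  ultimately show "(p - 1) * multiplicity p (odd_fact (Suc i)) < 2 * i" using m unfolding v_def by linarith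
qed

text \<open>\<open>p\<close> divides \<open>i * C(s, i) = s * C(s - 1, i - 1)\<close> but not
  \<open>i\<close>.\<close>

lemma prime_dvd_odd_bracket:
  fixes p :: nat
  assumes "prime p" "p dvd s" "\<not> p dvd i"
  shows "int p dvd odd_bracket s i"
proof -
  obtain k where k: "i = Suc k" using assms(3) by (cases i) auto
  have "p dvd Suc k * (s choose Suc k)" unfolding binomial_absorption using assms(2) by simp
  then have "p dvd s choose i" using assms(1,3) unfolding k prime_dvd_mult_iff[OF assms(1)] by blast
  then have "int p dvd int (s choose i)" by simp
  moreover have "int p dvd int s" using assms(2) by simp
  ultimately show ?thesis unfolding odd_bracket_def by (intro dvd_add dvd_mult2 dvd_mult) simp_all
qed

lemma odd_odd_fact: "odd (odd_fact n)"
  by (induction n) simp_all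

text \<open>For factors of degree at most 2 the numbers that \<open>p\<close> would have to divide
  are divisors of 12, apart from one check modulo 5.\<close>

lemma prime_not_dvd_12:
  fixes p :: nat and x :: int
  assumes "prime p" "5 \<le> p" "x dvd 12"
  shows "\<not> int p dvd x"
proof
  assume "int p dvd x"
  then have "int p dvd int 12" using assms(3) by (metis dvd_trans of_nat_numeral)
  then have "p dvd 2 * (2 * 3)" by (simp only: int_dvd_int_iff) simp
  then have "p dvd 2 \<or> p dvd 3" using assms(1) by (simp only: prime_dvd_mult_iff) blast
  then have "p \<le> 3" by (auto dest: dvd_imp_le)
  then show False using assms(2) by simp
qed

text \<open>Compare \<open>x^4 + \<rho> x^2 + 3\<close> with
  \<open>(e x^2 + a1 x + a) (e x^2 + b1 x + b0)\<close> modulo \<open>p\<close>. The odd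
  coefficients give \<open>a1 = -b1\<close> and \<open>a1 (b0 - a) = 0\<close>; so either
  \<open>b0 = a\<close> and \<open>a^2 = 3\<close>, or both factors are even and
  \<open>a + b0 = e \<rho>\<close>.\<close>

lemma quadratic_factor_top:
  fixes p a a1 e b0 b1 \<rho> :: int
  assumes p: "prime p" and e: "e * e = 1" and h0: "p dvd 3 - a * b0" and h1: "p dvd a * b1 + a1 * b0"
    and h2: "p dvd \<rho> - (a * e + a1 * b1 + e * b0)" and h3: "p dvd a1 * e + e * b1"
  shows "p dvd a * a - 3 \<or> p dvd a * a + 3 - e * \<rho> * a"
proof -
  have "e * (a1 * e + e * b1) = (e * e) * (a1 + b1)" by (simp add: algebra_simps)
  then have "a1 + b1 = e * (a1 * e + e * b1)" unfolding e by simp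
  then have s1: "p dvd a1 + b1" using h3 by simp
  have "a1 * (b0 - a) = (a * b1 + a1 * b0) - a * (a1 + b1)" by (simp add: algebra_simps)
  then have "p dvd a1 * (b0 - a)" using h1 s1 by simp
  then consider "p dvd a1" | "p dvd b0 - a" using p prime_dvd_mult_iff by blast
  then show ?thesis
  proof cases
    case 1
    have "(3 - a * b0) - a * e * (\<rho> - (a * e + a1 * b1 + e * b0)) - a1 * (a * e * b1)
        = 3 - a * b0 - a * e * \<rho> + (e * e) * (a * a) + (e * e) * (a * b0)"
      by (simp add: algebra_simps)
    also have "\<dots> = a * a + 3 - e * \<rho> * a" unfolding e by (simp add: algebra_simps)
    finally have id: "a * a + 3 - e * \<rho> * a = (3 - a * b0) - a * e * (\<rho> - (a * e + a1 * b1 + e * b0)) - a1 * (a * e * b1)" ..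
    have "p dvd a * a + 3 - e * \<rho> * a" unfolding id
      by (rule dvd_diff[OF dvd_diff[OF h0 dvd_mult[OF h2]] dvd_mult2[OF 1]])
    then show ?thesis ..
  next
    case 2
    have id: "a * a - 3 = - (3 - a * b0) - a * (b0 - a)" by (simp add: algebra_simps)
    have "p dvd - (3 - a * b0)" unfolding dvd_minus_iff by (rule h0)
    then have "p dvd a * a - 3" unfolding id using dvd_mult[OF 2] by (rule dvd_diff)
    then show ?thesis ..
  qed
qed

text \<open>The factor \<open>a + e x\<close> has the root \<open>-e a\<close>; the combination of
  the hypotheses evaluates \<open>x^4 + \<rho> x^2 + 3\<close> there.\<close>

lemma linear_factor_top:
  fixes p a e b0 b1 b2 \<rho> :: int
  assumes e: "e * e = 1" and h0: "p dvd 3 - a * b0" and h1: "p dvd a * b1 + e * b0"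
    and h2: "p dvd \<rho> - (a * b2 + e * b1)" and h3: "p dvd a * e + e * b2"
  shows "p dvd (a * a) * (a * a) + \<rho> * (a * a) + 3"
proof -
  have "(3 - a * b0) + a * e * (a * b1 + e * b0) + a * a * (\<rho> - (a * b2 + e * b1)) + a * a * a * e * (a * e + e * b2)
      = 3 - a * b0 + (e * e) * (a * b0) + a * a * \<rho> - a * a * a * b2 + (e * e) * (a * a * (a * a)) + (e * e) * (a * a * a * b2)"
    by (simp add: algebra_simps)
  also have "\<dots> = (a * a) * (a * a) + \<rho> * (a * a) + 3" unfolding e by (simp add: algebra_simps)
  finally have "(a * a) * (a * a) + \<rho> * (a * a) + 3
      = (3 - a * b0) + a * e * (a * b1 + e * b0) + a * a * (\<rho> - (a * b2 + e * b1)) + a * a * a * e * (a * e + e * b2)" ..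
  moreover have "p dvd (3 - a * b0) + a * e * (a * b1 + e * b0) + a * a * (\<rho> - (a * b2 + e * b1)) + a * a * a * e * (a * e + e * b2)"
    by (intro dvd_add dvd_mult h0 h1 h2 h3)
  ultimately show ?thesis by metis
qed

text \<open>With \<open>s = t + 2\<close> these are the brackets of \<open>x^(2s - 4)\<close> and
  \<open>x^(2s - 2)\<close>; doubling avoids the halves in the binomials.\<close>

lemma odd_bracket_top:
  "2 * odd_bracket (Suc (Suc t)) t = (int t + 2) * (int t + 1) + 2 * (int t + 2) * int t * (int t - 1)"
  "odd_bracket (Suc (Suc t)) (Suc t) = (int t + 2) * (2 * int t + 1)"
proof -
  have two_choose: "2 * int (Suc (Suc u) choose u) = (int u + 2) * (int u + 1)" for u
  proof -
    have "int (Suc (Suc u) - u) * int (Suc (Suc u) choose u) = int (Suc (Suc u)) * int (Suc u choose u)"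
      by (simp only: binomial_absorb_comp diff_Suc_1 flip: of_nat_mult)
    then show ?thesis by (simp add: algebra_simps Suc_diff_le del: binomial_Suc_Suc)
  qed
  show "2 * odd_bracket (Suc (Suc t)) t = (int t + 2) * (int t + 1) + 2 * (int t + 2) * int t * (int t - 1)"
  proof (cases "t < 2")
    case True
    then have "t = 0 \<or> t = 1" by linarith
    then show ?thesis using two_choose[of t] True unfolding odd_bracket_def by auto
  next
    case False
    then obtain u where u: "t = Suc (Suc u)" by (metis add_2_eq_Suc le_Suc_ex not_le)
    have "2 * odd_bracket (Suc (Suc t)) t = 2 * int (Suc (Suc t) choose t) + 2 * (int t + 2) * (2 * int (t choose u))"
      unfolding odd_bracket_def using False u by (simp add: algebra_simps del: binomial_Suc_Suc)
    also have "2 * int (t choose u) = int t * (int t - 1)" using two_choose[of u] unfolding u by (simp add: algebra_simps del: binomial_Suc_Suc)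
    finally show ?thesis unfolding two_choose by (simp add: algebra_simps)
  qed
  show "odd_bracket (Suc (Suc t)) (Suc t) = (int t + 2) * (2 * int t + 1)"
  proof (cases t)
    case (Suc u)
    have "(Suc (Suc t) choose Suc t) = Suc (Suc t)" "(t choose u) = t" unfolding Suc by (rule binomial_Suc_n)+
    then show ?thesis unfolding odd_bracket_def using Suc by (simp add: algebra_simps del: binomial_Suc_Suc)
  qed (simp add: odd_bracket_def)
qed

theorem irreducible_remainder_odd:
  assumes s: "2 \<le> s"
  shows "irreducible (remainder_poly [2 * s - 1, 2])"
proof -
  define R where "R = remainder_poly [2 * s - 1, 2]"
  have C: "coeff R (2 * i) * int (odd_fact (Suc i)) = (-1) ^ (s + i) * int (odd_fact s) * odd_bracket s i"
    and C0: "coeff R (2 * i + 1) = 0" for i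
    unfolding R_def by (rule odd_remainder_coeffs[OF s])+
  have odd0: "coeff R j = 0" if "odd j" for j using that C0 by (auto elim!: oddE)
  have cancel: "x = y" if "x * int (odd_fact j) = y * int (odd_fact j)" for x y j
    using that by simp
  have high: "coeff R j = 0" if j: "2 * s < j" for j
  proof (cases "even j")
    case True
    then obtain i where i: "j = 2 * i" by blast
    then have "odd_bracket s i = 0" using j s by (intro odd_bracket_eq_0) simp_all
    then have "coeff R (2 * i) * int (odd_fact (Suc i)) = 0 * int (odd_fact (Suc i))" unfolding C by simp
    then show ?thesis unfolding i by (rule cancel)
  qed (rule odd0)
  have top: "coeff R (2 * s) = 1"
  proof -
    have sg: "(-1::int) ^ (s + s) = 1" by (rule neg_one_even_power) simp
    have f: "int (odd_fact (Suc s)) = (1 + 2 * int s) * int (odd_fact s)" by (simp add: algebra_simps)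
    have "coeff R (2 * s) * int (odd_fact (Suc s)) = (-1) ^ (s + s) * int (odd_fact s) * odd_bracket s s" by (rule C)
    also have "\<dots> = 1 * int (odd_fact (Suc s))" unfolding sg odd_bracket_self[OF s] f by (simp only: ac_simps)
    finally show ?thesis by (rule cancel)
  qed
  have deg: "degree R = 2 * s"
    by (rule antisym) (use high top in \<open>auto intro!: degree_le le_degree\<close>)
  have R0: "coeff R 0 = (-1) ^ s * int (odd_fact s)"
    using C[of 0] by (simp add: odd_bracket_def)
  have R0n: "coeff R 0 \<noteq> 0" unfolding R0 by simp
  have Rel: "coeff R (2 * i) * int (odd_fact (Suc i)) = ((-1) ^ i * odd_bracket s i) * coeff R 0" for i
    unfolding C R0 power_add by (simp only: ac_simps)
  have F: "\<exists>q. coeff R (2 * i) = (-1) ^ (s + i) * odd_bracket s i * int q \<and> (\<forall>l. i < l \<longrightarrow> l < s \<longrightarrow> 2 * l + 1 dvd q)"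
    if i: "i < s" for i
  proof -
    obtain q where q: "odd_fact s = odd_fact (Suc i) * q" "\<forall>l. Suc i \<le> l \<longrightarrow> l < s \<longrightarrow> 2 * l + 1 dvd q"
      using odd_fact_quotient[of "Suc i" s] i by auto
    have "coeff R (2 * i) * int (odd_fact (Suc i)) = ((-1) ^ (s + i) * odd_bracket s i * int q) * int (odd_fact (Suc i))"
      unfolding C q(1) of_nat_mult by (simp only: ac_simps)
    then have "coeff R (2 * i) = (-1) ^ (s + i) * odd_bracket s i * int q" by (rule cancel)
    then show ?thesis using q(2) by auto
  qed
  have low_prime: "int p dvd coeff R j" if "p dvd 2 * l + 1" "l < s" "j < 2 * l" for p l j
  proof (cases "even j")
    case True
    then obtain i where i: "j = 2 * i" by blast
    then have il: "i < l" using that(3) by simp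
    then have "i < s" using that(2) by simp
    then obtain q where q: "coeff R (2 * i) = (-1) ^ (s + i) * odd_bracket s i * int q" "\<forall>l. i < l \<longrightarrow> l < s \<longrightarrow> 2 * l + 1 dvd q"
      using F by blast
    have "p dvd q" using q(2) il that(1,2) dvd_trans by blast
    then have "int p dvd int q" by simp
    then show ?thesis unfolding i q(1) by (rule dvd_mult)
  qed (use odd0 in simp)
  have "irreducible R"
  proof (rule irreducible_if_no_small_factor)
    show "lead_coeff R = 1" "0 < degree R" using top s unfolding deg by simp_all
    fix A B assume RAB: "R = A * B" and d0: "0 < degree A" and dle: "degree A \<le> degree B"
    define d where "d = degree A"
    have AB0: "A \<noteq> 0" "B \<noteq> 0" using R0n unfolding RAB by auto
    have dsum: "d + degree B = 2 * s" using deg AB0 unfolding RAB d_def by (simp add: degree_mult_eq)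
    have ds: "1 \<le> d" "d \<le> s" using d0 dle dsum unfolding d_def by linarith+
    have monic: "lead_coeff (A * B) = 1" using top deg unfolding RAB by simp
    have R0n': "coeff (A * B) 0 \<noteq> 0" using R0n unfolding RAB .
    have A0: "coeff A 0 \<noteq> 0" using R0n unfolding RAB by (auto simp: coeff_mult_0)
    \<comment> \<open>The bound with \<open>p - 1\<close> is not strict, hence the requirement that
      \<open>\<alpha>\<close> be at most \<open>p - 2\<close>.\<close>
    have val: "\<alpha> * multiplicity (int p) (coeff A 0) < d" if p: "prime p" "odd p" and \<alpha>: "0 < \<alpha>" "\<alpha> + 2 \<le> p" for p \<alpha> :: nat
      unfolding d_def
    proof (rule factor_low_valuation[OF _ monic d0 \<alpha>(1) R0n'])
      show "prime (int p)" using p(1) by simp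
      show "\<alpha> * multiplicity (int p) (coeff (A * B) 0) < \<alpha> * multiplicity (int p) (coeff (A * B) j) + j"
        if j: "0 < j" "coeff (A * B) j \<noteq> 0" for j
      proof -
        have "even j" using odd0[of j] j(2) unfolding RAB by blast
        then obtain i where i: "j = 2 * i" by blast
        define v where "v = multiplicity p (odd_fact (Suc i))"
        have "multiplicity (int p) (coeff R 0) \<le> multiplicity (int p) (coeff R j) + multiplicity (int p) (int (odd_fact (Suc i)))"
          by (rule multiplicity_le_of_mult_eq[OF _ Rel[of i, folded i]]) (use p j in \<open>simp_all add: RAB del: odd_fact_Suc\<close>)
        moreover have "\<alpha> * v < j"
        proof (cases "v = 0")
          case True
          then show ?thesis using j(1) by simp
        next
          case False
          have "\<alpha> * v < (p - 1) * v" using False \<alpha>(2) by (intro mult_strict_right_mono) auto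
          also have "\<dots> \<le> 2 * i" unfolding v_def by (rule multiplicity_odd_fact_bound(1)[OF p])
          finally show ?thesis unfolding i .
        qed
        ultimately show ?thesis unfolding multiplicity_of_nat_int RAB[symmetric] v_def by (rule slope_step)
      qed
    qed
    have nd: "\<not> int p dvd coeff A 0" if p: "prime p" and v: "\<alpha> * multiplicity (int p) (coeff A 0) < d" "d \<le> \<alpha>" for p \<alpha> :: nat
    proof -
      have "multiplicity (int p) (coeff A 0) = 0"
      proof (rule ccontr)
        assume "multiplicity (int p) (coeff A 0) \<noteq> 0"
        then have "\<alpha> * 1 \<le> \<alpha> * multiplicity (int p) (coeff A 0)" by (intro mult_le_mono2) simp
        then show False using v by linarith
      qed
      then show ?thesis using p A0 by (intro not_dvd_if_multiplicity_eq_0) simp_all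
    qed
    obtain t where t: "s = Suc (Suc t)" using s by (metis add_2_eq_Suc le_Suc_ex)
    have top2: "coeff R (2 * Suc t) = - ((int t + 2) * (2 * int t + 1))"
    proof -
      have sg: "(-1::int) ^ (s + Suc t) = - 1" unfolding t by (rule neg_one_odd_power) simp
      have "coeff R (2 * Suc t) * int (odd_fact s) = (- odd_bracket s (Suc t)) * int (odd_fact s)"
        using C[of "Suc t"] unfolding sg t[symmetric] by (simp add: ac_simps)
      then have "coeff R (2 * Suc t) = - odd_bracket s (Suc t)" by (rule cancel)
      then show ?thesis unfolding t odd_bracket_top .
    qed
    \<comment> \<open>The identity behind the constant 3 modulo \<open>2t + 1 = n - 2\<close>: the
      cubic in \<open>2t + 4 = 2s\<close> is the cofactor, and 8 clears the halves, which is
      harmless modulo an odd prime.\<close>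
    have top4: "8 * (coeff R (2 * t) - 3) = (2 * int t + 1) * ((2 * int t + 4) ^ 3 - 7 * (2 * int t + 4) ^ 2 + 10 * (2 * int t + 4) + 8)"
    proof -
      have sg: "(-1::int) ^ (s + t) = 1" unfolding t by (rule neg_one_even_power) simp
      have f: "int (odd_fact s) = (2 * int t + 3) * int (odd_fact (Suc t))"
        unfolding t odd_fact_Suc[of "Suc t"] by (simp add: algebra_simps del: odd_fact_Suc)
      have "coeff R (2 * t) * int (odd_fact (Suc t)) = ((2 * int t + 3) * odd_bracket s t) * int (odd_fact (Suc t))"
        unfolding C sg f by (simp only: ac_simps mult_1)
      then have "coeff R (2 * t) = (2 * int t + 3) * odd_bracket s t" by (rule cancel)
      then have "8 * (coeff R (2 * t) - 3) = 4 * (2 * int t + 3) * (2 * odd_bracket s t) - 24" by simp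
      moreover have "4 * (2 * x + 3) * ((x + 2) * (x + 1) + 2 * (x + 2) * x * (x - 1)) - 24
          = (2 * x + 1) * ((2 * x + 4) ^ 3 - 7 * (2 * x + 4) ^ 2 + 10 * (2 * x + 4) + 8)" for x :: int
        by (simp add: algebra_simps power2_eq_square power3_eq_cube)
      ultimately show ?thesis unfolding t odd_bracket_top by (simp only:)
    qed
    have top_mod: "int p dvd coeff R (2 * t) - 3 \<and> int p dvd coeff R (2 * Suc t)" if p: "prime p" "odd p" "p dvd 2 * t + 1" for p
    proof -
      have "int p dvd int (2 * t + 1)" using p(3) by (simp only: int_dvd_int_iff)
      moreover have "int (2 * t + 1) = 2 * int t + 1" by simp
      ultimately have pt: "int p dvd 2 * int t + 1" by metis
      have "int p dvd 8 * (coeff R (2 * t) - 3)" unfolding top4 using pt by (rule dvd_mult2)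
      moreover have "\<not> int p dvd 8"
      proof
        assume "int p dvd 8"
        then have "int p dvd 2 ^ 3" by simp
        then have "int p dvd 2" using p(1) prime_dvd_power[of "int p" 2 3] by simp
        then have "p dvd 2" by presburger
        then show False using p(1,2) primes_dvd_imp_eq[of p 2] by simp
      qed
      ultimately have "int p dvd coeff R (2 * t) - 3" using p(1) by (metis prime_dvd_mult_iff prime_nat_int_transfer)
      moreover have "int p dvd coeff R (2 * Suc t)" unfolding top2 using pt by (simp only: dvd_minus_iff dvd_mult)
      ultimately show ?thesis by blast
    qed
    show False
    proof (cases "d \<le> 2 \<and> (\<exists>k. s = 2 ^ k)")
      case True
      then obtain k where d2: "d \<le> 2" and k: "s = 2 ^ k" by blast
      \<comment> \<open>For \<open>s = 2\<close> the number \<open>2t + 1\<close> is 1 and offers no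
        prime. There \<open>R = x^4 - 2x^2 + 3\<close> itself, and \<open>p = 5\<close> with
        \<open>\<rho> = -2\<close> brings it into the common form.\<close>
      obtain p \<rho> where p: "prime p" "5 \<le> p" and c4: "int p dvd coeff R (2 * t) - 3" and c2: "int p dvd coeff R (2 * Suc t) - \<rho>"
        and lowR: "\<forall>j<2 * t. int p dvd coeff R j" and \<rho>: "\<rho> = 0 \<or> \<rho> = -2 \<and> p = 5"
      proof (cases "t = 0")
        case True
        have p5: "prime (5::nat)" by simp
        show ?thesis by (rule that[of 5 "-2"]) (use True top4 top2 p5 in simp_all)
      next
        case False
        then have "2 * t + 1 \<noteq> 1" by simp
        then obtain p where p: "prime p" "p dvd 2 * t + 1" using prime_factor_nat by blast
        have "odd p" using p(2) by (metis dvd_trans even_add even_mult_iff odd_one even_numeral)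
        \<comment> \<open>3 divides \<open>2t + 1 = 2s - 3\<close> only if it divides
          \<open>s\<close>, which is a power of 2.\<close>
        have "p \<noteq> 3"
        proof
          assume "p = 3"
          then have "3 dvd s" using p(2) unfolding t by presburger
          then have "3 dvd (2::nat)" unfolding k by (rule prime_dvd_power[rotated]) simp
          then show False by simp
        qed
        moreover have "p \<noteq> 2" "p \<noteq> 4" using \<open>odd p\<close> by auto
        ultimately have "5 \<le> p" using prime_ge_2_nat[OF p(1)] by linarith
        show ?thesis
        proof (rule that[of p 0])
          show "\<forall>j<2 * t. int p dvd coeff R j" using low_prime[OF p(2)] unfolding t by simp
        qed (use p \<open>5 \<le> p\<close> top_mod[OF p(1) \<open>odd p\<close> p(2)] in simp_all)
      qed
      define a where "a = coeff A 0"
      have aR: "a dvd coeff R 0" unfolding RAB a_def coeff_mult_0 by simp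
      then have a_of: "nat \<bar>a\<bar> dvd odd_fact s" unfolding R0 by (cases "even s") (simp_all add: nat_abs_dvd_iff)
      have a_pos: "0 < nat \<bar>a\<bar>" using A0 unfolding a_def by simp
      \<comment> \<open>Primes \<open>q \<ge> 5\<close> are excluded by the slope bound with
        \<open>\<alpha> = 2 \<ge> d\<close>. For 3 only \<open>\<alpha> = 1\<close> is available, so
        up to sign \<open>a\<close> is \<open>3^m\<close> with \<open>m < d\<close>.\<close>
      have only3: "q = 3" if q: "prime q" "q dvd nat \<bar>a\<bar>" for q :: nat
      proof (rule ccontr)
        assume "q \<noteq> 3"
        have "q dvd odd_fact s" using q(2) a_of dvd_trans by blast
        then have "odd q" using odd_odd_fact dvd_trans by blast
        then have "q \<noteq> 2" "q \<noteq> 4" by auto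
        then have q5: "5 \<le> q" using \<open>q \<noteq> 3\<close> prime_ge_2_nat[OF q(1)] by linarith
        then have "2 * multiplicity (int q) (coeff A 0) < d" using q(1) \<open>odd q\<close> by (intro val) simp_all
        then have "\<not> int q dvd a" unfolding a_def by (rule nd[OF q(1)]) (rule d2)
        then show False using q(2) by (simp add: dvd_nat_abs_iff)
      qed
      obtain m where m: "nat \<bar>a\<bar> = 3 ^ m" using pure_prime_power[of 3 "nat \<bar>a\<bar>"] only3 a_pos by auto
      have "1 * multiplicity (int 3) (coeff A 0) < d" by (rule val) simp_all
      moreover have "m \<le> multiplicity (int 3) (coeff A 0)"
      proof (rule multiplicity_geI)
        have "int 3 ^ m = \<bar>a\<bar>" using m A0 unfolding a_def by (metis abs_of_nat nat_abs_int_diff of_nat_power int_nat_eq abs_ge_zero)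
        then show "int 3 ^ m dvd coeff A 0" unfolding a_def by simp
      qed (use A0 in simp_all)
      ultimately have md: "m < d" by simp
      have abs_a: "\<bar>a\<bar> = 3 ^ m" using m by (metis abs_ge_zero int_nat_eq of_nat_numeral of_nat_power)
      have a_nd: "\<not> int p dvd coeff A 0"
      proof (rule nd[OF p(1)])
        show "2 * multiplicity (int p) (coeff A 0) < d"
          using p prime_odd_nat[OF p(1)] by (intro val) simp_all
      qed (rule d2)
      have lowB: "int p dvd coeff B j" if "j < 2 * t" for j
      proof (rule cofactor_low_coeffs[OF _ _ a_nd that])
        show "prime (int p)" using p(1) by simp
        show "int p dvd coeff (A * B) j" if "j < 2 * t" for j using lowR that unfolding RAB by blast
      qed
      \<comment> \<open>Modulo \<open>p\<close> the top coefficients of \<open>R\<close> are 3, 0,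
        \<open>\<rho>\<close>, 0, 1; the cases \<open>n = 0, 1, 2, 3\<close> compare them with those
        of the product.\<close>
      have T: "int p dvd coeff R (2 * t + n) - (\<Sum>k\<le>n. coeff A k * coeff B (2 * t + n - k))" for n
        unfolding RAB by (rule coeff_mult_high_part[OF lowB])
      have R1: "coeff R (2 * t + Suc 0) = 0" "coeff R (2 * t + Suc (Suc (Suc 0))) = 0" by (rule odd0, simp)+
      have R2: "coeff R (2 * t + Suc (Suc 0)) = coeff R (2 * Suc t)" by simp
      have lead: "lead_coeff A * lead_coeff B = 1" using monic by (simp only: lead_coeff_mult)
      have T0: "int p dvd coeff R (2 * t) - coeff A 0 * coeff B (2 * t)" using T[of 0] by simp
      have h0: "int p dvd 3 - a * coeff B (2 * t)"
      proof -
        have "3 - a * coeff B (2 * t) = (coeff R (2 * t) - coeff A 0 * coeff B (2 * t)) - (coeff R (2 * t) - 3)" unfolding a_def by simp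
        then show ?thesis using dvd_diff[OF T0 c4] by metis
      qed
      have T1: "int p dvd 0 - (coeff A 0 * coeff B (2 * t + 1) + coeff A 1 * coeff B (2 * t))"
        using T[of "Suc 0"] unfolding R1 by simp
      have h1: "int p dvd a * coeff B (2 * t + 1) + coeff A 1 * coeff B (2 * t)"
        using T1 unfolding a_def diff_0 dvd_minus_iff .
      have T2: "int p dvd coeff R (2 * Suc t) - (coeff A 0 * coeff B (2 * t + 2) + coeff A 1 * coeff B (2 * t + 1) + coeff A 2 * coeff B (2 * t))"
        using T[of "Suc (Suc 0)"] unfolding R2 by (simp add: numeral_2_eq_2)
      have h2: "int p dvd \<rho> - (a * coeff B (2 * t + 2) + coeff A 1 * coeff B (2 * t + 1) + coeff A 2 * coeff B (2 * t))"
      proof -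
        have "\<rho> - (a * coeff B (2 * t + 2) + coeff A 1 * coeff B (2 * t + 1) + coeff A 2 * coeff B (2 * t))
          = (coeff R (2 * Suc t) - (coeff A 0 * coeff B (2 * t + 2) + coeff A 1 * coeff B (2 * t + 1) + coeff A 2 * coeff B (2 * t)))
            - (coeff R (2 * Suc t) - \<rho>)" unfolding a_def by simp
        then show ?thesis using dvd_diff[OF T2 c2] by metis
      qed
      have A3: "coeff A 3 = 0" using d2 unfolding d_def by (intro coeff_eq_0) simp
      have "int p dvd 0 - (coeff A 0 * coeff B (2 * t + 3) + coeff A 1 * coeff B (2 * t + 2) + coeff A 2 * coeff B (2 * t + 1) + coeff A 3 * coeff B (2 * t))"
        using T[of "Suc (Suc (Suc 0))"] unfolding R1 by (simp add: numeral_2_eq_2 numeral_3_eq_3)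
      then have h3: "int p dvd a * coeff B (2 * t + 3) + coeff A 1 * coeff B (2 * t + 2) + coeff A 2 * coeff B (2 * t + 1)"
        unfolding a_def diff_0 dvd_minus_iff A3 by simp
      have d12: "d = 1 \<or> d = 2" using d2 ds by linarith
      then show False
      proof
        assume d1: "d = 1"
        have dA: "degree A = 1" and dB: "degree B = 2 * t + 3" using d1 dsum unfolding d_def t by simp_all
        have A2: "coeff A 2 = 0" using dA by (intro coeff_eq_0) simp
        define e where "e = coeff A 1"
        have "(e = 1 \<and> coeff B (2 * t + 3) = 1) \<or> (e = -1 \<and> coeff B (2 * t + 3) = -1)"
          using lead unfolding dA dB e_def by (simp only: zmult_eq_1_iff)
        then have e: "e * e = 1" "coeff B (2 * t + 3) = e" by auto
        have "int p dvd (a * a) * (a * a) + \<rho> * (a * a) + 3"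
        proof (rule linear_factor_top[OF e(1) h0])
          show "int p dvd a * coeff B (2 * t + 1) + e * coeff B (2 * t)" using h1 unfolding e_def .
          show "int p dvd \<rho> - (a * coeff B (2 * t + 2) + e * coeff B (2 * t + 1))" using h2 unfolding A2 e_def by simp
          show "int p dvd a * e + e * coeff B (2 * t + 2)" using h3 unfolding A2 e(2) e_def[symmetric] by simp
        qed
        moreover have "\<bar>a\<bar> = 1" using abs_a md d1 by simp
        then have "a * a = 1" by (metis abs_mult_self_eq mult_1)
        ultimately have "int p dvd 4 + \<rho>" by (simp add: add.commute)
        moreover have "4 + \<rho> dvd 12" using \<rho> by auto
        ultimately show False using prime_not_dvd_12[OF p] by blast
      next
        assume d2: "d = 2"
        have dA: "degree A = 2" and dB: "degree B = 2 * t + 2" using d2 dsum unfolding d_def t by simp_all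
        have B3: "coeff B (2 * t + 3) = 0" using dB by (intro coeff_eq_0) simp
        define e where "e = coeff A 2"
        have ee: "(e = 1 \<and> coeff B (2 * t + 2) = 1) \<or> (e = -1 \<and> coeff B (2 * t + 2) = -1)"
          using lead unfolding dA dB e_def by (simp only: zmult_eq_1_iff)
        then have e: "e * e = 1" "coeff B (2 * t + 2) = e" by auto
        have "int p dvd a * a - 3 \<or> int p dvd a * a + 3 - e * \<rho> * a"
        proof (rule quadratic_factor_top[OF _ e(1) h0 h1])
          show "prime (int p)" using p(1) by simp
          show "int p dvd \<rho> - (a * e + coeff A 1 * coeff B (2 * t + 1) + e * coeff B (2 * t))" using h2 unfolding e(2) e_def[symmetric] .
          show "int p dvd coeff A 1 * e + e * coeff B (2 * t + 1)" using h3 unfolding B3 e(2) e_def[symmetric] by simp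
        qed
        moreover have "m = 0 \<or> m = 1" using md d2 by linarith
        then have "\<bar>a\<bar> = 1 \<or> \<bar>a\<bar> = 3" using abs_a by auto
        then have a4: "a = 1 \<or> a = -1 \<or> a = 3 \<or> a = -3" by linarith
        ultimately consider "int p dvd a * a - 3" | "int p dvd a * a + 3 - e * \<rho> * a" by blast
        then show False
        proof cases
          case 1
          have "a * a - 3 = -2 \<or> a * a - 3 = 6" using a4 by auto
          then have "a * a - 3 dvd 12" by auto
          then show False using prime_not_dvd_12[OF p] 1 by blast
        next
          case 2
          from \<rho> show False
          proof
            assume "\<rho> = 0"
            then have "a * a + 3 - e * \<rho> * a = 4 \<or> a * a + 3 - e * \<rho> * a = 12" using a4 by auto
            moreover have "(4::int) dvd 12" by simp
            ultimately have "a * a + 3 - e * \<rho> * a dvd 12" by (metis dvd_refl)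
            then show False using prime_not_dvd_12[OF p] 2 by blast
          next
            assume r: "\<rho> = -2 \<and> p = 5"
            have "e = 1 \<or> e = -1" using ee by blast
            then have "a * a + 3 - e * (-2) * a \<in> {2, 6, 18}" using a4 by auto
            moreover have "int 5 dvd a * a + 3 - e * (-2) * a" using 2 unfolding conjunct1[OF r] conjunct2[OF r] .
            ultimately obtain x where "int 5 dvd x" "x \<in> {2, 6, 18}" by blast
            then show False by auto
          qed
        qed
      qed
    next
      case no_exc1: False
      have s3: "3 \<le> s"
      proof (rule ccontr)
        assume "\<not> 3 \<le> s"
        then have "s = 2" using s by linarith
        then have "s = 2 ^ 1" by simp
        moreover have "d \<le> 2" using ds \<open>s = 2\<close> by simp
        ultimately show False using no_exc1 by blast
      qed
      show False
      proof (cases "d = 4 \<and> s = 8")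
        case False
        have "\<exists>p. prime p \<and> odd p \<and> (d + 2 \<le> p \<and> (\<exists>l. p dvd 2 * l + 1 \<and> l < s \<and> s + 1 \<le> l + (d + 1) div 2) \<or> d + 1 \<le> p \<and> p dvd s)"
          by (rule odd_case_prime_factor[OF s3 ds no_exc1 False])
        then obtain p where p: "prime p" "odd p"
          and c: "d + 2 \<le> p \<and> (\<exists>l. p dvd 2 * l + 1 \<and> l < s \<and> s + 1 \<le> l + (d + 1) div 2) \<or> d + 1 \<le> p \<and> p dvd s" by blast
        have pi: "prime (int p)" using p(1) by simp
        have half: "2 * ((d + 1) div 2) \<le> d + 1" by simp
        from c show False
        proof
          assume "d + 2 \<le> p \<and> (\<exists>l. p dvd 2 * l + 1 \<and> l < s \<and> s + 1 \<le> l + (d + 1) div 2)"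
          then obtain l where dp: "d + 2 \<le> p" and l: "p dvd 2 * l + 1" "l < s" "s + 1 \<le> l + (d + 1) div 2" by blast
          have "d * multiplicity (int p) (coeff A 0) < d" using ds dp by (intro val[OF p]) simp_all
          then have np: "\<not> int p dvd coeff A 0" by (rule nd[OF p(1)]) simp
          show False
          proof (rule no_factor_of_degree[OF pi monic _ np])
            fix j assume "j \<le> degree B"
            then have "j < 2 * l" using dsum l half by linarith
            then show "int p dvd coeff (A * B) j" using low_prime[OF l(1,2)] unfolding RAB by blast
          qed
        next
          assume "d + 1 \<le> p \<and> p dvd s"
          then have dp: "d + 1 \<le> p" and ps: "p dvd s" by blast+
          \<comment> \<open>For \<open>p = d + 1\<close> the general slope bound just misses
            strictness. If \<open>p\<close> divides \<open>i\<close>, its strict variant applies;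
            otherwise \<open>p\<close> divides the bracket, which raises the valuation of the
            coefficient by one.\<close>
          have "d * multiplicity (int p) (coeff A 0) < degree A"
          proof (rule factor_low_valuation[OF pi monic d0 _ R0n'])
            show "0 < d" using ds by simp
            fix j assume j: "0 < j" "coeff (A * B) j \<noteq> 0"
            have "even j" using odd0[of j] j(2) unfolding RAB by blast
            then obtain i where i: "j = 2 * i" by blast
            define v where "v = multiplicity p (odd_fact (Suc i))"
            have dv: "d * v \<le> (p - 1) * v" using dp by (intro mult_le_mono1) simp
            show "d * multiplicity (int p) (coeff (A * B) 0) < d * multiplicity (int p) (coeff (A * B) j) + j"
            proof (cases "p dvd i")
              case True
              have "multiplicity (int p) (coeff R 0) \<le> multiplicity (int p) (coeff R j) + multiplicity (int p) (int (odd_fact (Suc i)))"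
                by (rule multiplicity_le_of_mult_eq[OF pi Rel[of i, folded i]]) (use j in \<open>simp_all add: RAB del: odd_fact_Suc\<close>)
              moreover have "d * v < j"
              proof -
                have "0 < i" using j(1) i by simp
                then have "(p - 1) * v < 2 * i" unfolding v_def by (rule multiplicity_odd_fact_bound(2)[OF p True])
                then show ?thesis using dv unfolding i by linarith
              qed
              ultimately show ?thesis unfolding multiplicity_of_nat_int RAB[symmetric] v_def by (rule slope_step)
            next
              case False
              then obtain c where c: "odd_bracket s i = int p * c" using prime_dvd_odd_bracket[OF p(1) ps] by (metis dvdE)
              have "coeff R j * int (odd_fact (Suc i)) = ((-1) ^ i * c) * (int p * coeff R 0)"
                using Rel[of i] unfolding i c by (simp only: ac_simps)
              then have "multiplicity (int p) (int p * coeff R 0) \<le> multiplicity (int p) (coeff R j) + multiplicity (int p) (int (odd_fact (Suc i)))"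
                by (rule multiplicity_le_of_mult_eq[OF pi]) (use j in \<open>simp_all add: RAB del: odd_fact_Suc\<close>)
              moreover have "multiplicity (int p) (int p * coeff R 0) = Suc (multiplicity (int p) (coeff R 0))"
                using R0n prime_gt_1_nat[OF p(1)] by (intro multiplicity_times_same) simp_all
              ultimately have "multiplicity (int p) (coeff R 0) + 1 \<le> multiplicity (int p) (coeff R j) + v"
                unfolding v_def multiplicity_of_nat_int by simp
              then have "d * (multiplicity (int p) (coeff R 0) + 1) \<le> d * (multiplicity (int p) (coeff R j) + v)" by (rule mult_le_mono2)
              moreover have "d * v \<le> j"
                using dv multiplicity_odd_fact_bound(1)[OF p, of i] unfolding v_def i by linarith
              ultimately show ?thesis using ds unfolding add_mult_distrib2 RAB[symmetric] by linarith
            qed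
          qed
          then have np: "\<not> int p dvd coeff A 0" unfolding d_def by (rule nd[OF p(1), unfolded d_def]) simp
          show False
          proof (rule no_factor_of_degree[OF pi monic _ np])
            fix j assume jB: "j \<le> degree B"
            have "int p dvd coeff R j"
            proof (cases "even j")
              case True
              then obtain i where i: "j = 2 * i" by blast
              have lt: "i < s" using jB i dsum ds by linarith
              show ?thesis
              proof (cases "p dvd i")
                case True
                \<comment> \<open>The bracket is of no help when \<open>p\<close> divides
                  \<open>i\<close>, but \<open>2i + p\<close> is an odd multiple of \<open>p\<close>
                  and still of the form \<open>2l + 1\<close> with \<open>i < l < s\<close>.\<close>
                define h where "h = (p - 1) div 2"
                have h: "p = 2 * h + 1" using p(2) unfolding h_def by (auto elim!: oddE)
                have "p \<noteq> 1" using p(1) by auto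
                then have h0: "0 < h" using h by (cases h) simp_all
                have "p dvd s - i" using ps True by (rule dvd_diff_nat)
                then have "p \<le> s - i" using lt by (intro dvd_imp_le) simp_all
                then have lh: "i + h < s" using h h0 by linarith
                have e: "2 * (i + h) + 1 = 2 * i + p" using h by simp
                have "p dvd 2 * i + p" using True by simp
                then have "p dvd 2 * (i + h) + 1" unfolding e .
                then show ?thesis by (rule low_prime[OF _ lh]) (use i h0 in simp)
              next
                case False
                obtain q where q: "coeff R (2 * i) = (-1) ^ (s + i) * odd_bracket s i * int q" using F[OF lt] by blast
                show ?thesis unfolding i q using prime_dvd_odd_bracket[OF p(1) ps False] by (intro dvd_mult2 dvd_mult)
              qed
            qed (use odd0 in simp)
            then show "int p dvd coeff (A * B) j" unfolding RAB .
          qed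
        qed
      next
        case True
        then have d4: "d = 4" and s8: "s = 8" by blast+
        have t6: "t = 6" using t s8 by simp
        have o: "odd_fact 8 = 2027025"
        proof -
          have "odd_fact 1 = 1" using odd_fact_Suc[of 0] by simp
          then have "odd_fact 2 = 3" by (simp add: numeral_2_eq_2)
          then have "odd_fact 3 = 15" using odd_fact_Suc[of 2] by (simp del: odd_fact_Suc)
          then have "odd_fact 4 = 105" using odd_fact_Suc[of 3] by (simp del: odd_fact_Suc)
          then have "odd_fact 5 = 945" using odd_fact_Suc[of 4] by (simp del: odd_fact_Suc)
          then have "odd_fact 6 = 10395" using odd_fact_Suc[of 5] by (simp del: odd_fact_Suc)
          then have "odd_fact 7 = 135135" using odd_fact_Suc[of 6] by (simp del: odd_fact_Suc)
          then show ?thesis using odd_fact_Suc[of 7] by (simp del: odd_fact_Suc)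
        qed
        \<comment> \<open>\<open>a\<close> divides \<open>15!! = 3^4 * 5^2 * 7 * 11 * 13\<close>.
          The slopes exclude 7, 11, 13 and 25, while 5 must occur, as otherwise 15 would annihilate
          the cofactor modulo 5. So up to sign \<open>a\<close> is \<open>5 * 3^i\<close>, to be
          confronted with the constant 3 modulo \<open>13 = n - 2\<close>.\<close>
        define a where "a = coeff A 0"
        define n where "n = nat \<bar>a\<bar>"
        have an: "\<bar>a\<bar> = int n" unfolding n_def by simp
        have dvd_n: "q dvd n \<longleftrightarrow> int q dvd a" for q unfolding n_def by (simp add: dvd_nat_abs_iff)
        have "a dvd coeff R 0" unfolding RAB a_def coeff_mult_0 by simp
        then have "n dvd odd_fact 8" unfolding R0 s8 n_def by (simp add: nat_abs_dvd_iff)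
        then have n: "n dvd 2027025" unfolding o .
        have pr: "prime (5::nat)" "prime (7::nat)" "prime (11::nat)" "prime (13::nat)" by simp_all
        have large: "\<not> q dvd n" if q: "prime q" "odd q" "6 \<le> q" for q
        proof -
          have "4 * multiplicity (int q) (coeff A 0) < d" using q by (intro val) simp_all
          then have "\<not> int q dvd coeff A 0" by (rule nd[OF q(1)]) (simp add: d4)
          then show ?thesis unfolding dvd_n a_def .
        qed
        have cop: "coprime n q" if "prime q" "\<not> q dvd n" for q
          using prime_imp_coprime[OF that] by (simp add: coprime_commute)
        have l: "\<not> 13 dvd n" "\<not> 11 dvd n" "\<not> 7 dvd n" by (rule large; simp)+
        have "n dvd 13 * 155925" using n by simp
        then have "n dvd 155925" by (rule iffD1[OF coprime_dvd_mult_right_iff[OF cop[OF pr(4) l(1)]]])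
        then have "n dvd 11 * 14175" by simp
        then have "n dvd 14175" by (rule iffD1[OF coprime_dvd_mult_right_iff[OF cop[OF pr(3) l(2)]]])
        then have "n dvd 7 * 2025" by simp
        then have "n dvd 2025" by (rule iffD1[OF coprime_dvd_mult_right_iff[OF cop[OF pr(2) l(3)]]])
        then have n2025: "n dvd 5 * 405" by simp
        have n5: "5 dvd n"
        proof (rule ccontr)
          assume "\<not> 5 dvd n"
          then have np: "\<not> int 5 dvd coeff A 0" unfolding dvd_n a_def .
          show False
          proof (rule no_factor_of_degree[OF _ monic _ np])
            show "prime (int 5)" by simp
            fix j assume "j \<le> degree B"
            then have j: "j < 2 * 7" using dsum d4 s8 by linarith
            have "int 5 dvd coeff R j" by (rule low_prime[OF _ _ j]) (simp_all add: s8)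
            then show "int 5 dvd coeff (A * B) j" unfolding RAB .
          qed
        qed
        then obtain u where u: "n = 5 * u" by blast
        have n25: "\<not> 25 dvd n"
        proof
          assume "25 dvd n"
          then have "int 5 ^ 2 dvd coeff A 0" unfolding dvd_n a_def by simp
          then have "2 \<le> multiplicity (int 5) (coeff A 0)" using A0 by (intro multiplicity_geI) simp_all
          moreover have "3 * multiplicity (int 5) (coeff A 0) < d" by (rule val) simp_all
          ultimately show False using d4 by linarith
        qed
        have "\<not> 5 dvd u"
        proof
          assume "5 dvd u"
          then obtain w where "u = 5 * w" by blast
          then show False using n25 u by simp
        qed
        then have "coprime u 5" using prime_imp_coprime[OF pr(1)] by (simp add: coprime_commute)
        moreover have "u dvd 5 * 81" using n2025 u by simp
        ultimately have "u dvd 81" using coprime_dvd_mult_right_iff[of u 5 81] by blast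
        then have "u dvd 3 ^ 4" by simp
        then obtain i where i: "i \<le> 4" "u = 3 ^ i" using divides_primepow_nat[of 3 u 4] by auto
        have dA: "degree A = 4" and dB: "degree B = 12" using d4 dsum s8 unfolding d_def by simp_all
        have p13: "prime (13::nat)" "odd (13::nat)" "13 dvd 2 * t + 1" unfolding t6 by simp_all
        have nd13: "\<not> int 13 dvd coeff A 0" using large[of 13] unfolding dvd_n a_def by simp
        have lowB: "int 13 dvd coeff B j" if "j < 2 * t" for j
        proof (rule cofactor_low_coeffs[OF _ _ nd13 that])
          show "prime (int 13)" using p13(1) by (simp only: prime_nat_int_transfer)
          show "int 13 dvd coeff (A * B) j" if "j < 2 * t" for j
            using low_prime[OF p13(3) _ that] unfolding t RAB by simp
        qed
        have "int 13 dvd coeff R (2 * t + 0) - (\<Sum>k\<le>0. coeff A k * coeff B (2 * t + 0 - k))"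
          unfolding RAB by (rule coeff_mult_high_part[OF lowB])
        then have T0: "int 13 dvd coeff R (2 * t) - a * coeff B 12" unfolding t6 a_def by simp
        have "int 13 dvd (coeff R (2 * t) - a * coeff B 12) - (coeff R (2 * t) - 3)"
          by (rule dvd_diff[OF T0 conjunct1[OF top_mod[OF p13]]])
        then have fin: "13 dvd 3 - a * coeff B 12" by simp
        have "lead_coeff A * lead_coeff B = 1" using monic by (simp only: lead_coeff_mult)
        then have "coeff B 12 = 1 \<or> coeff B 12 = -1" unfolding dA dB zmult_eq_1_iff by blast
        moreover have "a = int n \<or> a = - int n" using an by linarith
        ultimately have "13 dvd 3 - int n \<or> 13 dvd 3 + int n" using fin by auto
        moreover have "i = 0 \<or> i = 1 \<or> i = 2 \<or> i = 3 \<or> i = 4" using i(1) by linarith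
        then have "n = 5 \<or> n = 15 \<or> n = 45 \<or> n = 135 \<or> n = 405" unfolding u i(2) by auto
        \<comment> \<open>Modulo 13 the candidates are 5, 2, 6, 5, 2, never 3 or 10.\<close>
        ultimately show False by auto
      qed
    qed
  qed
  then show ?thesis unfolding R_def .
qed

theorem mainTheorem3:
  fixes n :: nat
  assumes "n \<ge> 2"
  shows "irreducible (remainder_poly [n, 2])"
proof (cases "even n")
  case True
  then obtain m where m: "n = 2 * m" by blast
  then obtain r where "m = Suc r" using assms by (cases m) auto
  then show ?thesis using irreducible_remainder_even[of r] m by simp
next
  case False
  then obtain m where m: "n = 2 * m + 1" by (rule oddE)
  then have "n = 2 * Suc m - 1" "2 \<le> Suc m" using assms by simp_all
  then show ?thesis using irreducible_remainder_odd[of "Suc m"] by metis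
qed

end
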